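(* Each of MR-DP, MR-AP and MR-SP is fixed-parameter tractable when parameterized by $b+k$, where $b$ is the budget and $k$ the number of base-paths, and can be solved in $\mathcal O\big(b^{6k}\cdot k^{2k}\cdot|\mathcal G|^{\mathcal O(1)}\big)$ time, where $|\mathcal G|$ is the size of the input temporal $k$-path graph.
   Context: A temporal multigraph $\mathcal G=(V,E,\lambda)$ consists of a directed multigraph $(V,E)$ and a labeling $\lambda$ assigning integer time labels to edges; a pair $(e,t)$ with $t\in\lambda(e)$ is a temporal edge. A temporal path is a sequence of temporal edges $((e_1,t_1),\dots,(e_m,t_m))$ such that $e_1,\dots,e_m$ form a directed path and $t_1<\dots<t_m$. A vertex $u$ reaches $v$ if there is a temporal path from $u$ to $v$; $R^{\mathcal G}(u)$ is the set of vertices reached by $u$. A temporal $k$-path graph is a temporal multigraph $\mathcal G$ together with a collection $\mathcal P=\{P_1,\dots,P_k\}$ of temporal paths (base-paths) whose multiset union of temporal edges is exactly the multiset of temporal edges of $\mathcal G$. A shifting operation is a pair $((e,t),\delta)$ where $(e,t)$ is a temporal edge lying on base-path $P_i$ and $\delta\in\mathbb Z$. Applying it sets the label of $(e,t)$ to $t+\delta$; every edge $e'$ that is the $d$-th edge after $e$ on $P_i$ gets label $\max(\lambda(e'),t+\delta+d)$; every edge $e'$ that is the $d$-th edge before $e$ on $P_i$ gets label $\min(\lambda(e'),t+\delta-d)$; edges of other base-paths are unchanged. It is delaying if $\delta>0$, advancing if $\delta<0$; its cost is $|\delta|$; a sequence is applied one after another and its cost is the sum of costs. MR-SP: given a temporal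 $k$-path graph $\mathcal G$, a budget $b\in\mathbb N$ and a vertex $s$, find a sequence of shifting operations of total cost at most $b$ maximizing $|R^{\mathcal G'}(s)|$, where $\mathcal G'$ is the resulting graph. MR-DP (resp. MR-AP) is the same with only delaying (resp. only advancing) operations allowed.
   Formalization: The factor b^{6k} is replaced by max(1,b)^{6k}, since for budget b=0 and k≥1 the stated time bound would be zero; for every b≥1 the bound is as stated. *)

theory Defs
  imports Main "HOL-Library.Multiset"
begin

section \<open>Temporal multigraphs and temporal k-path graphs\<close>

text \<open>Labels form a multiset per edge, since shifting can make two occurrences of the same
  edge (on different base-paths) carry the same label.\<close>

record ('v, 'e) tmultigraph =
  verts :: "'v set"
  edges :: "'e set"
  tail :: "'e \<Rightarrow> 'v"
  head :: "'e \<Rightarrow> 'v"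
  lab :: "'e \<Rightarrow> int multiset"

record ('v, 'e) kpath_graph = "('v, 'e) tmultigraph" +
  bpaths :: "('e \<times> int) list list"

definition wf_tmultigraph :: "('v, 'e, 'z) tmultigraph_scheme \<Rightarrow> bool" where
  "wf_tmultigraph G \<longleftrightarrow> finite (verts G) \<and> finite (edges G) \<and>
     (\<forall>e \<in> edges G. tail G e \<in> verts G \<and> head G e \<in> verts G)"

definition temporal_edges :: "('v, 'e, 'z) tmultigraph_scheme \<Rightarrow> ('e \<times> int) multiset" where
  "temporal_edges G = (\<Sum>e\<in>edges G. image_mset (Pair e) (lab G e))"

definition directed_path :: "('v, 'e, 'z) tmultigraph_scheme \<Rightarrow> 'e list \<Rightarrow> bool" where
  "directed_path G es \<longleftrightarrow> es \<noteq> [] \<and> set es \<subseteq> edges G \<and>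
     (\<forall>i. Suc i < length es \<longrightarrow> head G (es ! i) = tail G (es ! Suc i)) \<and>
     distinct (tail G (hd es) # map (head G) es)"

definition temporal_path :: "('v, 'e, 'z) tmultigraph_scheme \<Rightarrow> ('e \<times> int) list \<Rightarrow> bool" where
  "temporal_path G p \<longleftrightarrow> set p \<subseteq> set_mset (temporal_edges G) \<and>
     directed_path G (map fst p) \<and> sorted_wrt (<) (map snd p)"

text \<open>The case \<open>u = v\<close> is the empty temporal path.\<close>

definition reaches :: "('v, 'e, 'z) tmultigraph_scheme \<Rightarrow> 'v \<Rightarrow> 'v \<Rightarrow> bool" where
  "reaches G u v \<longleftrightarrow> u = v \<or>
     (\<exists>p. temporal_path G p \<and> tail G (fst (hd p)) = u \<and> head G (fst (last p)) = v)"

definition reach_set :: "('v, 'e, 'z) tmultigraph_scheme \<Rightarrow> 'v \<Rightarrow> 'v set" where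
  "reach_set G u = {v \<in> verts G. reaches G u v}"

definition temporal_kpath_graph :: "nat \<Rightarrow> ('v, 'e) kpath_graph \<Rightarrow> bool" where
  "temporal_kpath_graph k G \<longleftrightarrow> wf_tmultigraph G \<and> length (bpaths G) = k \<and>
     (\<forall>p \<in> set (bpaths G). temporal_path G p) \<and>
     temporal_edges G = sum_list (map mset (bpaths G))"

definition graph_size :: "('v, 'e, 'z) tmultigraph_scheme \<Rightarrow> nat" where
  "graph_size G = card (verts G) + card (edges G) + size (temporal_edges G)"


section \<open>Shifting operations\<close>

text \<open>The operation \<open>(i, j, \<delta>)\<close> acts on the temporal edge at position \<open>j\<close> of the base-path with
  index \<open>i\<close> (both counted from 0). The index \<open>i\<close> is needed because the same pair \<open>(e, t)\<close> may lie on
  several base-paths.\<close>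

type_synonym shift_op = "nat \<times> nat \<times> int"

definition shift_path :: "nat \<Rightarrow> int \<Rightarrow> ('e \<times> int) list \<Rightarrow> ('e \<times> int) list" where
  "shift_path j \<delta> p =
     (let t' = snd (p ! j) + \<delta> in
      map (\<lambda>l. (fst (p ! l),
                if l = j then t'
                else if j < l then max (snd (p ! l)) (t' + int (l - j))
                else min (snd (p ! l)) (t' - int (j - l))))
          [0..<length p])"

definition labels_of_paths :: "('e \<times> int) list list \<Rightarrow> 'e \<Rightarrow> int multiset" where
  "labels_of_paths Ps e = image_mset snd {# x \<in># sum_list (map mset Ps). fst x = e #}"

fun valid_shift :: "('v, 'e) kpath_graph \<Rightarrow> shift_op \<Rightarrow> bool" where
  "valid_shift G (i, j, \<delta>) \<longleftrightarrow> i < length (bpaths G) \<and> j < length (bpaths G ! i)"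

fun apply_shift :: "('v, 'e) kpath_graph \<Rightarrow> shift_op \<Rightarrow> ('v, 'e) kpath_graph" where
  "apply_shift G (i, j, \<delta>) =
     (let Ps = (bpaths G)[i := shift_path j \<delta> (bpaths G ! i)]
      in G\<lparr>lab := labels_of_paths Ps, bpaths := Ps\<rparr>)"

fun valid_shifts :: "('v, 'e) kpath_graph \<Rightarrow> shift_op list \<Rightarrow> bool" where
  "valid_shifts G [] \<longleftrightarrow> True"
| "valid_shifts G (x # xs) \<longleftrightarrow> valid_shift G x \<and> valid_shifts (apply_shift G x) xs"

definition apply_shifts :: "('v, 'e) kpath_graph \<Rightarrow> shift_op list \<Rightarrow> ('v, 'e) kpath_graph" where
  "apply_shifts G xs = foldl apply_shift G xs"

definition shifts_cost :: "shift_op list \<Rightarrow> nat" where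
  "shifts_cost xs = (\<Sum>(i, j, \<delta>)\<leftarrow>xs. nat \<bar>\<delta>\<bar>)"


section \<open>The problems MR-DP, MR-AP and MR-SP\<close>

datatype mr_variant = MR_DP | MR_AP | MR_SP

fun allowed_op :: "mr_variant \<Rightarrow> shift_op \<Rightarrow> bool" where
  "allowed_op MR_DP (i, j, \<delta>) \<longleftrightarrow> \<delta> > 0"
| "allowed_op MR_AP (i, j, \<delta>) \<longleftrightarrow> \<delta> < 0"
| "allowed_op MR_SP (i, j, \<delta>) \<longleftrightarrow> True"

definition mr_feasible :: "mr_variant \<Rightarrow> ('v, 'e) kpath_graph \<Rightarrow> nat \<Rightarrow> shift_op list \<Rightarrow> bool" where
  "mr_feasible X G b xs \<longleftrightarrow>
     valid_shifts G xs \<and> (\<forall>x \<in> set xs. allowed_op X x) \<and> shifts_cost xs \<le> b"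

definition mr_optimal ::
  "mr_variant \<Rightarrow> ('v, 'e) kpath_graph \<Rightarrow> nat \<Rightarrow> 'v \<Rightarrow> shift_op list \<Rightarrow> bool" where
  "mr_optimal X G b s xs \<longleftrightarrow> mr_feasible X G b xs \<and>
     (\<forall>ys. mr_feasible X G b ys \<longrightarrow>
        card (reach_set (apply_shifts G ys) s) \<le> card (reach_set (apply_shifts G xs) s))"


section \<open>Random access machines\<close>

text \<open>Structured random access programs under the uniform cost measure. The arithmetic is restricted
  to addition and subtraction; with multiplication at unit cost the model would no longer be
  polynomially related to Turing machines. A state consists of registers and an addressable memory,
  all holding integers.\<close>

datatype ram_exp =
    Const int
  | Reg nat
  | Load ram_exp
  | Add ram_exp ram_exp
  | Sub ram_exp ram_exp

datatype ram_com =
    Skip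
  | Assign nat ram_exp
  | Store ram_exp ram_exp
  | Seq ram_com ram_com
  | IfPos ram_exp ram_com ram_com
  | WhilePos ram_exp ram_com

type_synonym ram_state = "(nat \<Rightarrow> int) \<times> (int \<Rightarrow> int)"

fun ram_eval :: "ram_exp \<Rightarrow> ram_state \<Rightarrow> int" where
  "ram_eval (Const z) \<sigma> = z"
| "ram_eval (Reg r) \<sigma> = fst \<sigma> r"
| "ram_eval (Load a) \<sigma> = snd \<sigma> (ram_eval a \<sigma>)"
| "ram_eval (Add a b) \<sigma> = ram_eval a \<sigma> + ram_eval b \<sigma>"
| "ram_eval (Sub a b) \<sigma> = ram_eval a \<sigma> - ram_eval b \<sigma>"

fun exp_cost :: "ram_exp \<Rightarrow> nat" where
  "exp_cost (Const z) = 1"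
| "exp_cost (Reg r) = 1"
| "exp_cost (Load a) = 1 + exp_cost a"
| "exp_cost (Add a b) = 1 + exp_cost a + exp_cost b"
| "exp_cost (Sub a b) = 1 + exp_cost a + exp_cost b"

text \<open>\<open>ram_exec c \<sigma> t \<tau>\<close>: started in \<open>\<sigma>\<close>, the program \<open>c\<close> halts in \<open>\<tau>\<close> after \<open>t\<close> time units.\<close>

inductive ram_exec :: "ram_com \<Rightarrow> ram_state \<Rightarrow> nat \<Rightarrow> ram_state \<Rightarrow> bool" where
  Skip: "ram_exec Skip \<sigma> 1 \<sigma>"
| Assign: "ram_exec (Assign r a) \<sigma> (1 + exp_cost a) ((fst \<sigma>)(r := ram_eval a \<sigma>), snd \<sigma>)"
| Store: "ram_exec (Store a v) \<sigma> (1 + exp_cost a + exp_cost v)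
            (fst \<sigma>, (snd \<sigma>)(ram_eval a \<sigma> := ram_eval v \<sigma>))"
| Seq: "ram_exec c \<sigma> t \<rho> \<Longrightarrow> ram_exec d \<rho> u \<tau> \<Longrightarrow> ram_exec (Seq c d) \<sigma> (t + u) \<tau>"
| IfTrue: "ram_eval a \<sigma> > 0 \<Longrightarrow> ram_exec c \<sigma> t \<tau> \<Longrightarrow>
            ram_exec (IfPos a c d) \<sigma> (1 + exp_cost a + t) \<tau>"
| IfFalse: "\<not> ram_eval a \<sigma> > 0 \<Longrightarrow> ram_exec d \<sigma> t \<tau> \<Longrightarrow>
            ram_exec (IfPos a c d) \<sigma> (1 + exp_cost a + t) \<tau>"
| WhileFalse: "\<not> ram_eval a \<sigma> > 0 \<Longrightarrow> ram_exec (WhilePos a c) \<sigma> (1 + exp_cost a) \<sigma>"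
| WhileTrue: "ram_eval a \<sigma> > 0 \<Longrightarrow> ram_exec c \<sigma> t \<rho> \<Longrightarrow> ram_exec (WhilePos a c) \<rho> u \<tau> \<Longrightarrow>
            ram_exec (WhilePos a c) \<sigma> (1 + exp_cost a + t + u) \<tau>"

inductive_cases ram_exec_elims:
  "ram_exec Skip \<sigma> t \<tau>"
  "ram_exec (Assign r a) \<sigma> t \<tau>"
  "ram_exec (Store a v) \<sigma> t \<tau>"
  "ram_exec (Seq c d) \<sigma> t \<tau>"
  "ram_exec (IfPos a c d) \<sigma> t \<tau>"
  "ram_exec (WhilePos a c) \<sigma> t \<tau>"

lemma ram_exec_deterministic:
  "ram_exec c \<sigma> t \<tau> \<Longrightarrow> ram_exec c \<sigma> t' \<tau>' \<Longrightarrow> t' = t \<and> \<tau>' = \<tau>"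
proof (induction arbitrary: t' \<tau>' rule: ram_exec.induct)
  case (Seq c \<sigma> t \<rho> d u \<tau>)
  from Seq.prems obtain t1 \<rho>1 u1 where
    "ram_exec c \<sigma> t1 \<rho>1" "ram_exec d \<rho>1 u1 \<tau>'" "t' = t1 + u1"
    by (rule ram_exec_elims(4))
  then show ?case using Seq.IH by metis
next
  case (WhileTrue a \<sigma> c t \<rho> u \<tau>)
  from WhileTrue.prems obtain t1 \<rho>1 u1 where
    "ram_exec c \<sigma> t1 \<rho>1" "ram_exec (WhilePos a c) \<rho>1 u1 \<tau>'" "t' = 1 + exp_cost a + t1 + u1"
    by (rule ram_exec_elims(6)) (use WhileTrue.hyps in simp_all)
  then show ?case using WhileTrue.IH by metis
next
  case (IfTrue a \<sigma> c t \<tau> d)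
  from IfTrue.prems obtain t1 where
    "ram_exec c \<sigma> t1 \<tau>'" "t' = 1 + exp_cost a + t1"
    by (rule ram_exec_elims(5)) (use IfTrue.hyps in simp_all)
  then show ?case using IfTrue.IH by metis
next
  case (IfFalse a \<sigma> d t \<tau> c)
  from IfFalse.prems obtain t1 where
    "ram_exec d \<sigma> t1 \<tau>'" "t' = 1 + exp_cost a + t1"
    by (rule ram_exec_elims(5)) (use IfFalse.hyps in simp_all)
  then show ?case using IfFalse.IH by metis
next
  case (WhileFalse a \<sigma> c)
  from WhileFalse.prems show ?case
    by (rule ram_exec_elims(6)) (use WhileFalse.hyps in simp_all)
qed (erule ram_exec_elims; simp)+

text \<open>The input occupies the memory cells from address 0 on and its length is in register 0; all
  other registers and cells are 0. The output is left in the same format.\<close>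

definition ram_init :: "int list \<Rightarrow> ram_state" where
  "ram_init xs = ((\<lambda>r. 0)(0 := int (length xs)),
     \<lambda>a. if 0 \<le> a \<and> a < int (length xs) then xs ! nat a else 0)"

definition ram_output :: "ram_state \<Rightarrow> int list" where
  "ram_output \<sigma> = map (\<lambda>l. snd \<sigma> (int l)) [0..<nat (fst \<sigma> 0)]"

definition ram_run :: "ram_com \<Rightarrow> int list \<Rightarrow> nat \<Rightarrow> int list \<Rightarrow> bool" where
  "ram_run c xs t ys \<longleftrightarrow> (\<exists>\<tau>. ram_exec c (ram_init xs) t \<tau> \<and> ys = ram_output \<tau>)"

definition computable_fun :: "(nat \<Rightarrow> nat) \<Rightarrow> bool" where
  "computable_fun f \<longleftrightarrow> (\<exists>c. \<forall>n. \<exists>t. ram_run c [int n] t [int (f n)])"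

text \<open>A problem is given by its set of inputs \<open>I\<close>, their encoding \<open>enc\<close>, and the relation \<open>sol\<close>
  of correct outputs.\<close>

definition solves_in_time ::
  "ram_com \<Rightarrow> 'i set \<Rightarrow> ('i \<Rightarrow> int list) \<Rightarrow> ('i \<Rightarrow> int list \<Rightarrow> bool) \<Rightarrow> ('i \<Rightarrow> nat) \<Rightarrow> bool" where
  "solves_in_time c I enc sol T \<longleftrightarrow>
     (\<forall>x \<in> I. \<exists>t ys. ram_run c (enc x) t ys \<and> sol x ys \<and> t \<le> T x)"

definition fixed_parameter_tractable ::
  "'i set \<Rightarrow> ('i \<Rightarrow> int list) \<Rightarrow> ('i \<Rightarrow> int list \<Rightarrow> bool) \<Rightarrow> ('i \<Rightarrow> nat) \<Rightarrow> bool" where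
  "fixed_parameter_tractable I enc sol \<kappa> \<longleftrightarrow>
     (\<exists>c f d. computable_fun f \<and>
        solves_in_time c I enc sol (\<lambda>x. f (\<kappa> x) * length (enc x) ^ d))"


section \<open>Encoding of instances and solutions\<close>

type_synonym mr_input = "(nat, nat) kpath_graph \<times> nat \<times> nat"

definition mr_inputs :: "mr_input set" where
  "mr_inputs = {(G, b, s). (\<exists>k. temporal_kpath_graph k G) \<and>
     (\<exists>n. verts G = {..<n}) \<and> (\<exists>m. edges G = {..<m}) \<and> s \<in> verts G}"

text \<open>The labelling is determined by the base-paths and is not encoded separately.\<close>

fun enc_input :: "mr_input \<Rightarrow> int list" where
  "enc_input (G, b, s) =
     [int b, int s, int (card (verts G)), int (card (edges G)), int (length (bpaths G))]
     @ concat (map (\<lambda>e. [int (tail G e), int (head G e)]) [0..<card (edges G)])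
     @ concat (map (\<lambda>p. int (length p) # concat (map (\<lambda>(e, t). [int e, t]) p)) (bpaths G))"

definition enc_shifts :: "shift_op list \<Rightarrow> int list" where
  "enc_shifts xs = concat (map (\<lambda>(i, j, \<delta>). [int i, int j, \<delta>]) xs)"

fun mr_solution :: "mr_variant \<Rightarrow> mr_input \<Rightarrow> int list \<Rightarrow> bool" where
  "mr_solution X (G, b, s) ys \<longleftrightarrow> (\<exists>xs. ys = enc_shifts xs \<and> mr_optimal X G b s xs)"

fun mr_budget :: "mr_input \<Rightarrow> nat" where
  "mr_budget (G, b, s) = b"

fun mr_paths :: "mr_input \<Rightarrow> nat" where
  "mr_paths (G, b, s) = length (bpaths G)"

fun mr_graph_size :: "mr_input \<Rightarrow> nat" where
  "mr_graph_size (G, b, s) = graph_size G"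

text \<open>The budget enters as \<open>max 1 b\<close>: read literally, the bound vanishes for \<open>b = 0 < k\<close>. For
  \<open>k = 0\<close> the factor \<open>k ^ (2 * k)\<close> is 1.\<close>

definition mr_time_bound :: "nat \<Rightarrow> nat \<Rightarrow> mr_input \<Rightarrow> nat" where
  "mr_time_bound C d x =
     C * (max 1 (mr_budget x) ^ (6 * mr_paths x) * mr_paths x ^ (2 * mr_paths x)
          * mr_graph_size x ^ d)"

end

theory Submission
  imports Defs
begin

text \<open>
  A solution is determined by where each base-path is first entered: from that edge on all its
  vertices are reached, so the entered paths form a tree rooted in the source. Measuring labels
  by their levels (label minus position), an advance of a path collapses an interval of levels to
  its lower end, a delay of the entry edge raises the later levels to a common minimum, and the cost
  of a solution is at least the number of levels it changes. Hence on each path one delay at the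
  entry edge and one advance per maximal run of changed levels suffice, at no higher cost.

  The algorithm guesses for each path its parent, the change of the label at its entry edge and
  the run used to enter it, and for each run its length. Entry positions are then computed greedily
  from the source: entering a path earlier never hurts later choices. The only place where earliest is
  not best is a run shared by several children. But an exit that needs the advance of an early run
  cannot lead to a later entry than an exit in a run beyond its reach, since otherwise it would not
  need the advance. So the optimal run starts within \<open>b\<close> levels of the first possible one, or the
  first one is as good, and guessing an offset of at most \<open>b\<close> suffices. This makes
  \<open>((k + 1) (min b k + 1) (2 b + 1) (b + 1)\<^sup>2)\<^sup>k\<close> guesses, and each is evaluated exactly in
  polynomial time on the random access machine.
\<close>

section \<open>Maximal runs in finite sets of integers\<close>

text \<open>Early entry is harmless because the guess stores the change of the label at the entry
  edge and not the label itself: original levels ascend along a path, so the same change at an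
  earlier edge gives a base level that is no higher, and the levels after the delay are no higher
  either. The base level is also the floor of all advances on the path; so the label at the entry
  edge never falls below the value on which the transfer into the path relies. Cost is not counted
  twice because entry delays are paid by changed levels below the level that the entry edge has in
  the given solution, and advances by those from it upwards. Two circularities remain: offsets
  depend on entry positions and positions on offsets, and parents are processed in no particular
  order. Both are resolved by one rank, the number of entered paths with a smaller entry label,
  which drops strictly towards the parent. The number of guesses fits the bound because only one
  factor \<open>k + 1\<close> per path is spent on the parent: the remaining \<open>k ^ k\<close> of
  \<open>k ^ (2 * k)\<close> absorbs the constant factor per path.\<close>

definition is_run :: "int set \<Rightarrow> int \<Rightarrow> int \<Rightarrow> bool" where
  "is_run S l h \<longleftrightarrow> l < h \<and> {l..<h} \<subseteq> S \<and> l - 1 \<notin> S \<and> h \<notin> S"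

lemma ex_run_end:
  fixes S :: "int set"
  assumes "finite S" "x \<in> S"
  shows "\<exists>h>x. {x..<h} \<subseteq> S \<and> h \<notin> S"
  using assms
proof (induction "card {y \<in> S. y \<ge> x}" arbitrary: x rule: less_induct)
  case less
  show ?case
  proof (cases "x + 1 \<in> S")
    case True
    have "x \<in> {y \<in> S. y \<ge> x}" "x \<notin> {y \<in> S. y \<ge> x + 1}" using less.prems by auto
    then have "{y \<in> S. y \<ge> x + 1} \<subset> {y \<in> S. y \<ge> x}" by fastforce
    then have "card {y \<in> S. y \<ge> x + 1} < card {y \<in> S. y \<ge> x}"
      using less.prems(1) by (intro psubset_card_mono) auto
    from less.hyps[OF this less.prems(1) True] obtain h where
      h: "h > x + 1" "{x+1..<h} \<subseteq> S" "h \<notin> S" by blast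
    have "{x..<h} \<subseteq> insert x {x+1..<h}" by auto
    with h less.prems(2) show ?thesis by (intro exI[of _ h]) auto
  next
    case False
    have "{x..<x+1} \<subseteq> S" using less.prems(2) by auto
    with False show ?thesis by (intro exI[of _ "x + 1"]) auto
  qed
qed

lemma ex_run:
  assumes "finite S" "x \<in> S"
  shows "\<exists>l h. is_run S l h \<and> l \<le> x \<and> x < h"
proof -
  from ex_run_end[OF assms] obtain h where h: "h > x" "{x..<h} \<subseteq> S" "h \<notin> S" by blast
  \<comment> \<open>Negation turns the lower end of the run into an upper end, so
    \<open>ex_run_end\<close> serves twice. The last point of the half-open interval ending at
    \<open>g\<close> is \<open>g - 1\<close>, hence the lower end \<open>1 - g\<close>.\<close>
  have "finite (uminus ` S)" "- x \<in> uminus ` S" using assms by auto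
  from ex_run_end[OF this] obtain g where
    g: "g > - x" "{- x..<g} \<subseteq> uminus ` S" "g \<notin> uminus ` S" by blast
  define l where "l = 1 - g"
  have sub: "{l..x} \<subseteq> S"
  proof
    fix y assume "y \<in> {l..x}"
    then have "- y \<in> {- x..<g}" by (auto simp: l_def)
    with g(2) have "- y \<in> uminus ` S" by blast
    then show "y \<in> S" by auto
  qed
  have "l - 1 \<notin> S"
  proof
    assume "l - 1 \<in> S"
    then have "- (l - 1) \<in> uminus ` S" by blast
    then show False using g(3) by (simp add: l_def)
  qed
  moreover have "{l..<h} \<subseteq> {l..x} \<union> {x..<h}" by auto
  ultimately have "is_run S l h" using h sub g(1) by (auto simp: is_run_def l_def)
  then show ?thesis using h g(1) by (intro exI[of _ l] exI[of _ h]) (auto simp: l_def)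
qed

text \<open>Serves to put the whole interval of levels crossed by an exit edge into the run that
  contains its lowest point.\<close>

lemma run_covers:
  assumes "is_run S l h" "{e..<f} \<subseteq> S" "l \<le> e" "e < h"
  shows "f \<le> h"
proof (rule ccontr)
  assume "\<not> f \<le> h"
  then have "h \<in> {e..<f}" using assms(4) by auto
  then show False using assms(1,2) unfolding is_run_def by blast
qed

lemma run_unique:
  assumes "is_run S l h" "is_run S l' h'" "x \<in> {l..<h}" "x \<in> {l'..<h'}"
  shows "l = l' \<and> h = h'"
proof -
  have "{x..<h'} \<subseteq> {l'..<h'}" "{x..<h} \<subseteq> {l..<h}" using assms(3,4) by auto
  then have sub: "{x..<h'} \<subseteq> S" "{x..<h} \<subseteq> S"
    using assms(1,2) unfolding is_run_def by blast+
  have "h' \<le> h" using run_covers[OF assms(1) sub(1)] assms(3) by simp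
  moreover have "h \<le> h'" using run_covers[OF assms(2) sub(2)] assms(4) by simp
  moreover have "l \<le> l'"
  proof (rule ccontr)
    assume "\<not> l \<le> l'"
    then have "l - 1 \<in> {l'..<h'}" using assms(3,4) by auto
    then show False using assms(1,2) unfolding is_run_def by blast
  qed
  moreover have "l' \<le> l"
  proof (rule ccontr)
    assume "\<not> l' \<le> l"
    then have "l' - 1 \<in> {l..<h}" using assms(3,4) by auto
    then show False using assms(1,2) unfolding is_run_def by blast
  qed
  ultimately show ?thesis by simp
qed

lemma shifts_cost_append: "shifts_cost (xs @ ys) = shifts_cost xs + shifts_cost ys"
  by (simp add: shifts_cost_def)

lemma shifts_cost_single: "shifts_cost [(c, j, d)] = nat \<bar>d\<bar>"
  by (simp add: shifts_cost_def)

lemma shifts_cost_Nil: "shifts_cost [] = 0"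
  by (simp add: shifts_cost_def)

section \<open>The flat view of an instance\<close>

text \<open>The temporal edges of all base-paths are numbered consecutively; path \<open>c\<close> occupies
  \<open>PS c, ..., PS (Suc c) - 1\<close>. The edge \<open>PS k\<close> forms a virtual path number \<open>k\<close> that ends in the
  source and whose label stays below all others whatever is done within the budget.\<close>

locale flat_instance =
  fixes k b :: nat and PS :: "nat \<Rightarrow> nat" and TV HV LB :: "nat \<Rightarrow> int" and s :: int
  assumes PS_less: "c < k \<Longrightarrow> PS c < PS (Suc c)"
    and PS_Suc_k: "PS (Suc k) = Suc (PS k)"
    and PS_0: "PS 0 = 0"
    and consec: "c < k \<Longrightarrow> PS c \<le> x \<Longrightarrow> Suc x < PS (Suc c) \<Longrightarrow> HV x = TV (Suc x)"
    and LB_Suc: "c < k \<Longrightarrow> PS c \<le> x \<Longrightarrow> Suc x < PS (Suc c) \<Longrightarrow> LB x < LB (Suc x)"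
    and HV_src: "HV (PS k) = s"
    and LB_src: "x < PS k \<Longrightarrow> LB (PS k) + int b < LB x"
begin

abbreviation seg :: "nat \<Rightarrow> nat set" where "seg c \<equiv> {PS c..<PS (Suc c)}"

lemma PS_mono: "c \<le> d \<Longrightarrow> d \<le> Suc k \<Longrightarrow> PS c \<le> PS d"
proof (induction d rule: nat_induct)
  case (Suc d)
  have "PS d \<le> PS (Suc d)"
    using PS_less[of d] PS_Suc_k Suc.prems by (cases "d = k") auto
  with Suc show ?case by (cases "c = Suc d") auto
qed simp

lemma seg_unique: "x \<in> seg c \<Longrightarrow> x \<in> seg d \<Longrightarrow> c \<le> k \<Longrightarrow> d \<le> k \<Longrightarrow> c = d"
  using PS_mono[of "Suc c" d] PS_mono[of "Suc d" c] by (cases c d rule: linorder_cases) auto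

lemma seg_le: "c < k \<Longrightarrow> x \<in> seg c \<Longrightarrow> x < PS k"
  using PS_mono[of "Suc c" k] by auto

lemma seg_ex: "x < PS d \<Longrightarrow> d \<le> k \<Longrightarrow> \<exists>c<d. x \<in> seg c"
proof (induction d)
  case 0 then show ?case by (simp add: PS_0)
next
  case (Suc d)
  show ?case
  proof (cases "x < PS d")
    case True with Suc show ?thesis by (meson Suc_leD less_SucI)
  next
    case False with Suc.prems show ?thesis by (intro exI[of _ d]) auto
  qed
qed

text \<open>The level \<open>W y - int y\<close> of an edge is nondecreasing along a path exactly if the labels
  increase strictly, and it turns the propagation of a shift into a truncation at a constant.\<close>

definition ascending :: "(nat \<Rightarrow> int) \<Rightarrow> bool" where
  "ascending W \<longleftrightarrow> (\<forall>c<k. \<forall>x\<in>seg c. \<forall>y\<in>seg c. x \<le> y \<longrightarrow> W x - int x \<le> W y - int y)"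

lemma ascendingD: "ascending W \<Longrightarrow> c < k \<Longrightarrow> x \<in> seg c \<Longrightarrow> y \<in> seg c \<Longrightarrow> x \<le> y \<Longrightarrow>
    W x - int x \<le> W y - int y"
  unfolding ascending_def by blast

lemma ascending_LB: "ascending LB"
  unfolding ascending_def
proof (intro allI impI ballI)
  fix c x y assume c: "c < k" and x: "x \<in> seg c" and y: "y \<in> seg c" and "x \<le> y"
  from this(4) y show "LB x - int x \<le> LB y - int y"
  proof (induction y rule: dec_induct)
    case (step n)
    then show ?case using LB_Suc[OF c, of n] x by auto
  qed simp
qed

section \<open>Shifts on the flat numbering\<close>

definition fshift :: "nat \<Rightarrow> nat \<Rightarrow> int \<Rightarrow> (nat \<Rightarrow> int) \<Rightarrow> nat \<Rightarrow> int" where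
  "fshift c x v W y = (if y \<in> seg c then
     (if y = x then v else if x < y then max (W y) (v + (int y - int x))
      else min (W y) (v - (int x - int y))) else W y)"

fun fop :: "(nat \<Rightarrow> int) \<Rightarrow> shift_op \<Rightarrow> nat \<Rightarrow> int" where
  "fop W (c, j, d) = fshift c (PS c + j) (W (PS c + j) + d) W"

definition fapply :: "shift_op list \<Rightarrow> nat \<Rightarrow> int" where
  "fapply ops = foldl fop LB ops"

definition ops_ok :: "shift_op list \<Rightarrow> bool" where
  "ops_ok ops \<longleftrightarrow> (\<forall>(c, j, d)\<in>set ops. c < k \<and> PS c + j < PS (Suc c))"

lemma fapply_Nil: "fapply [] = LB" by (simp add: fapply_def)

lemma fapply_snoc: "fapply (ops @ [x]) = fop (fapply ops) x"
  by (simp add: fapply_def)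

lemma fshift_other: "y \<notin> seg c \<Longrightarrow> fshift c x v W y = W y"
  unfolding fshift_def by presburger

text \<open>On levels a shift truncates at one constant, from above before \<open>x\<close> and from
  below after it; both truncations are monotone and they meet in that constant at
  \<open>x\<close>.\<close>

lemma ascending_fshift:
  assumes "ascending W" "c < k" "x \<in> seg c"
  shows "ascending (fshift c x v W)"
  unfolding ascending_def
proof (intro allI impI ballI)
  fix d y z assume d: "d < k" and y: "y \<in> seg d" and z: "z \<in> seg d" and "y \<le> z"
  have W: "W y - int y \<le> W z - int z" using ascendingD[OF assms(1) d y z \<open>y \<le> z\<close>] .
  show "fshift c x v W y - int y \<le> fshift c x v W z - int z"
  proof (cases "c = d")
    case True
    then show ?thesis using W y z \<open>y \<le> z\<close> unfolding fshift_def by auto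
  next
    case False
    then have "y \<notin> seg c" "z \<notin> seg c" using seg_unique[of _ c d] y z d assms(2) by auto
    then show ?thesis using W by (simp add: fshift_other)
  qed
qed

text \<open>A shift by one unit moves the threshold of a single level on a single path, hence the
  number of changed levels is a lower bound for the cost of any sequence of shifts.\<close>

definition changed :: "(nat \<Rightarrow> int) \<Rightarrow> (nat \<Rightarrow> int) \<Rightarrow> (nat \<times> int) set" where
  "changed W W' = {(c, l). c < k \<and> (\<exists>y\<in>seg c. (l < W y - int y) \<noteq> (l < W' y - int y))}"

lemma changed_trans: "changed W W'' \<subseteq> changed W W' \<union> changed W' W''"
  unfolding changed_def by blast

text \<open>Before \<open>x\<close> levels are at most the old level of \<open>x\<close>, after it
  at least that. Truncation at the new level can therefore flip only thresholds between the old and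
  the new level of \<open>x\<close>.\<close>

lemma changed_fshift:
  assumes "ascending W" "c < k" "x \<in> seg c"
  shows "changed W (fshift c x v W)
    \<subseteq> {c} \<times> {min (W x - int x) (v - int x)..<max (W x - int x) (v - int x)}"
proof
  fix p assume "p \<in> changed W (fshift c x v W)"
  then obtain d l y where p: "p = (d, l)" "d < k" "y \<in> seg d"
    "(l < W y - int y) \<noteq> (l < fshift c x v W y - int y)"
    unfolding changed_def by blast
  have dc: "d = c"
  proof (rule ccontr)
    assume "d \<noteq> c"
    then have "y \<notin> seg c" using seg_unique[of y c d] p assms(2) by auto
    then show False using p(4) by (simp add: fshift_other)
  qed
  have y: "y \<in> seg c" using p dc by simp
  have "W y - int y \<le> W x - int x" if "y < x"
    using ascendingD[OF assms(1,2) y assms(3)] that by simp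
  moreover have "W x - int x \<le> W y - int y" if "x < y"
    using ascendingD[OF assms(1,2) assms(3) y] that by simp
  ultimately show "p \<in> {c} \<times> {min (W x - int x) (v - int x)..<max (W x - int x) (v - int x)}"
    using p(1,4) y dc unfolding fshift_def
    by (cases x y rule: linorder_cases) (auto simp: min_def max_def split: if_splits)
qed

text \<open>By the triangle inequality \<open>changed_trans\<close> each operation adds at most as
  many thresholds as it costs. These three facts are all that is kept of a solution later
  on.\<close>

lemma fapply_props:
  assumes "ops_ok ops"
  shows "ascending (fapply ops) \<and> finite (changed LB (fapply ops))
     \<and> card (changed LB (fapply ops)) \<le> shifts_cost ops"
  using assms
proof (induction ops rule: rev_induct)
  case Nil
  have "changed LB LB = {}" by (auto simp: changed_def)
  then show ?case by (simp add: fapply_Nil ascending_LB shifts_cost_Nil)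
next
  case (snoc a ops)
  obtain c j d where a: "a = (c, j, d)" by (cases a)
  let ?W = "fapply ops" and ?x = "PS c + j"
  have ok: "ops_ok ops" "c < k" "?x \<in> seg c" using snoc.prems a by (auto simp: ops_ok_def)
  note IH = snoc.IH[OF ok(1)]
  let ?W' = "fshift c ?x (?W ?x + d) ?W"
  have W': "fapply (ops @ [a]) = ?W'" by (simp add: fapply_snoc a)
  let ?I = "{c} \<times> {min (?W ?x - int ?x) (?W ?x + d - int ?x)..<max (?W ?x - int ?x) (?W ?x + d - int ?x)}"
  have sub: "changed LB ?W' \<subseteq> changed LB ?W \<union> ?I"
    using changed_trans[of LB ?W' ?W] changed_fshift[of ?W c ?x "?W ?x + d"] IH ok by blast
  have fin: "finite (changed LB ?W \<union> ?I)" using IH by auto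
  have "card ?I = nat \<bar>d\<bar>" by (simp add: card_cartesian_product_singleton)
  then have "card (changed LB ?W') \<le> shifts_cost ops + nat \<bar>d\<bar>"
    using card_mono[OF fin sub] card_Un_le[of "changed LB ?W" ?I] IH by linarith
  then show ?case
    using W' ascending_fshift[of ?W c ?x "?W ?x + d"] IH ok finite_subset[OF sub fin]
    by (simp add: a shifts_cost_append shifts_cost_single)
qed

section \<open>One-sided shifts and usable edges\<close>

lemma fshift_delay_ge:
  assumes "ascending W" "c < k" "x \<in> seg c" "v \<ge> W x"
  shows "fshift c x v W y \<ge> W y"
  using ascendingD[OF assms(1,2), of y x] assms(3,4) unfolding fshift_def
  by (cases x y rule: linorder_cases) (auto simp: min_def)

lemma fshift_advance_le:
  assumes "ascending W" "c < k" "x \<in> seg c" "v \<le> W x"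
  shows "fshift c x v W y \<le> W y"
  using ascendingD[OF assms(1,2), of x y] assms(3,4) unfolding fshift_def
  by (cases x y rule: linorder_cases) (auto simp: max_def)

lemma fapply_delay:
  assumes "ops_ok ops" "\<forall>x\<in>set ops. allowed_op MR_DP x"
  shows "LB y \<le> fapply ops y"
  using assms
proof (induction ops rule: rev_induct)
  case (snoc a ops)
  obtain c j d where a: "a = (c, j, d)" by (cases a)
  have ok: "ops_ok ops" "c < k" "PS c + j \<in> seg c" "d > 0" "\<forall>x\<in>set ops. allowed_op MR_DP x"
    using snoc.prems a by (auto simp: ops_ok_def)
  have "fapply ops y \<le> fapply (ops @ [a]) y"
    using fshift_delay_ge[of "fapply ops" c "PS c + j"] fapply_props[OF ok(1)] ok
    by (simp add: fapply_snoc a)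
  with snoc.IH ok show ?case by fastforce
qed (simp add: fapply_Nil)

text \<open>If no label rises, no entry change is positive. This makes the delay stage empty for
  \<open>MR_AP\<close>.\<close>

lemma fapply_advance:
  assumes "ops_ok ops" "\<forall>x\<in>set ops. allowed_op MR_AP x"
  shows "fapply ops y \<le> LB y"
  using assms
proof (induction ops rule: rev_induct)
  case (snoc a ops)
  obtain c j d where a: "a = (c, j, d)" by (cases a)
  have ok: "ops_ok ops" "c < k" "PS c + j \<in> seg c" "d < 0" "\<forall>x\<in>set ops. allowed_op MR_AP x"
    using snoc.prems a by (auto simp: ops_ok_def)
  have "fapply (ops @ [a]) y \<le> fapply ops y"
    using fshift_advance_le[of "fapply ops" c "PS c + j"] fapply_props[OF ok(1)] ok
    by (simp add: fapply_snoc a)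
  with snoc.IH ok show ?case by fastforce
qed (simp add: fapply_Nil)

text \<open>Edges on walks with increasing labels, where vertices may repeat, so that the notion is
  closed under single steps. \<open>path_usable\<close> and \<open>usable_path\<close> relate it to
  temporal paths, which are simple.\<close>

inductive usable :: "(nat \<Rightarrow> int) \<Rightarrow> nat \<Rightarrow> bool" for W where
  usable_start: "x < PS k \<Longrightarrow> TV x = s \<Longrightarrow> usable W x"
| usable_step: "usable W y \<Longrightarrow> x < PS k \<Longrightarrow> HV y = TV x \<Longrightarrow> W y < W x \<Longrightarrow> usable W x"

lemma usable_less: "usable W x \<Longrightarrow> x < PS k"
  by (cases rule: usable.cases) auto

text \<open>A path once entered can be followed to its end, since labels increase strictly along it.
  Hence only the first usable edge of each path matters.\<close>

lemma usable_later:
  assumes "ascending W" "c < k" "usable W x" "x \<in> seg c" "y \<in> seg c" "x \<le> y"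
  shows "usable W y"
  using assms(6,5)
proof (induction y rule: dec_induct)
  case base then show ?case using assms by simp
next
  case (step n)
  have n: "n \<in> seg c" "Suc n \<in> seg c" using step assms(4) by auto
  then have "usable W n" using step by simp
  moreover have "W n < W (Suc n)" using ascendingD[OF assms(1,2) n] by simp
  moreover have "HV n = TV (Suc n)" using consec[OF assms(2), of n] n by auto
  moreover have "Suc n < PS k" using seg_le[OF assms(2) n(2)] .
  ultimately show ?case by (blast intro: usable_step)
qed

text \<open>A guess consists of functions \<open>par, cl, del, am, ofs\<close>. Path \<open>c\<close> is entered from path \<open>par c\<close>
  (\<open>k\<close> stands for the source), and the label of its entry edge has to change by \<open>del c\<close>. Paths with
  the same \<open>cl c = r > 0\<close> share one advance of their common parent, which lowers all levels in
  \<open>[hi - am r, hi]\<close> to \<open>hi - am r\<close>. The level \<open>hi\<close> lies \<open>ofs r\<close> above the least one that lets all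
  these paths use the advance. With \<open>cl c = 0\<close> no advance is needed.\<close>

definition blev :: "(nat \<Rightarrow> int) \<Rightarrow> nat \<Rightarrow> nat \<Rightarrow> int" where
  "blev del p j = LB p - int p + del j"

text \<open>The level of an edge at or behind the entry after the entry delay. If the change at the
  entry is not positive, \<open>B\<close> is at most the original level there and nothing is
  raised.\<close>

definition lvl :: "int \<Rightarrow> nat \<Rightarrow> int" where
  "lvl B y = max (LB y - int y) B"

text \<open>A transfer from \<open>z\<close> to \<open>x\<close> that fails without the advance and
  succeeds with it. The departure on the new path is taken to be \<open>LB x + del d\<close>, a
  value below which the final label of the entry edge never falls.\<close>

definition paid :: "(nat \<Rightarrow> int) \<Rightarrow> int \<Rightarrow> int \<Rightarrow> int \<Rightarrow> nat \<Rightarrow> nat \<Rightarrow> nat \<Rightarrow> bool" where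
  "paid del B a hi d x z \<longleftrightarrow> HV z = TV x \<and> lvl B z \<le> hi \<and> LB x + del d \<le> lvl B z + int z \<and>
     max (hi - a) B + int z < LB x + del d"

definition feas ::
  "(nat \<Rightarrow> nat) \<Rightarrow> (nat \<Rightarrow> nat) \<Rightarrow> (nat \<Rightarrow> int) \<Rightarrow> (nat \<Rightarrow> int) \<Rightarrow> nat \<Rightarrow> nat \<Rightarrow> nat \<Rightarrow> int \<Rightarrow> bool" where
  "feas par cl del am p j r hi \<longleftrightarrow> (\<forall>d<k. par d = j \<and> cl d = r \<longrightarrow>
     (\<exists>x\<in>seg d. \<exists>z\<in>{p..<PS (Suc j)}. paid del (blev del p j) (am r) hi d x z))"

definition first_feas ::
  "(nat \<Rightarrow> nat) \<Rightarrow> (nat \<Rightarrow> nat) \<Rightarrow> (nat \<Rightarrow> int) \<Rightarrow> (nat \<Rightarrow> int) \<Rightarrow> nat \<Rightarrow> nat \<Rightarrow> nat \<Rightarrow> int" where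
  "first_feas par cl del am p j r = (let B = blev del p j;
       Q = (\<lambda>y. y \<in> {p..<PS (Suc j)} \<and> feas par cl del am p j r (lvl B y))
     in if \<exists>y. Q y then lvl B (LEAST y. Q y) else B)"

text \<open>Used as an upper bound and not as the final level of \<open>z\<close>: further advances
  on the same path may lower it more.\<close>

definition elev :: "int \<Rightarrow> int \<Rightarrow> int \<Rightarrow> nat \<Rightarrow> int" where
  "elev B a hi z = (if lvl B z \<le> hi then min (lvl B z) (max (hi - a) B) else lvl B z)"

definition boards :: "(nat \<Rightarrow> nat) \<Rightarrow> (nat \<Rightarrow> int) \<Rightarrow> int \<Rightarrow> nat \<Rightarrow> nat \<Rightarrow> int \<Rightarrow> nat \<Rightarrow> bool" where
  "boards par del a p c hi x \<longleftrightarrow> x \<in> seg c \<and> (\<exists>z\<in>{p..<PS (Suc (par c))}.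
     HV z = TV x \<and> elev (blev del p (par c)) a hi z + int z < LB x + del c)"

text \<open>The value \<open>PS (Suc c)\<close>, one past the end, stands for a path that is not
  entered; the range of exits starting there is empty.\<close>

definition entry :: "(nat \<Rightarrow> nat) \<Rightarrow> (nat \<Rightarrow> int) \<Rightarrow> int \<Rightarrow> nat \<Rightarrow> nat \<Rightarrow> int \<Rightarrow> nat" where
  "entry par del a p c hi = (if \<exists>x. boards par del a p c hi x
     then LEAST x. boards par del a p c hi x else PS (Suc c))"

definition hi_of where
  "hi_of par cl del am ofs p c = first_feas par cl del am p (par c) (cl c) + ofs (cl c)"

definition newp where
  "newp par cl del am ofs p c = entry par del (am (cl c)) p c (hi_of par cl del am ofs p c)"

definition proc where
  "proc par cl del am ofs P c = P(c := newp par cl del am ofs (P (par c)) c)"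

definition P0 :: "nat \<Rightarrow> nat" where
  "P0 c = (if c = k then PS k else PS (Suc c))"

definition round where
  "round par cl del am ofs P = foldl (proc par cl del am ofs) P [0..<k]"

text \<open>For the guesses that matter \<open>k\<close> rounds suffice, as the rank of an entered
  path is below \<open>k\<close> and a path is final one round after its parent at the
  latest.\<close>

definition positions where
  "positions par cl del am ofs = (round par cl del am ofs ^^ k) P0"

fun push :: "nat \<Rightarrow> nat \<Rightarrow> int \<Rightarrow> (nat \<Rightarrow> int) \<times> shift_op list \<Rightarrow> (nat \<Rightarrow> int) \<times> shift_op list" where
  "push c x v (W, ops) = (fshift c x v W, ops @ [(c, x - PS c, v - W x)])"

definition dstep where
  "dstep del P st c = (let v = LB (P c) + del c in
     if P c < PS (Suc c) \<and> fst st (P c) < v then push c (P c) v st else st)"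

definition low_edges where
  "low_edges B hi p j = {y \<in> {p..<PS (Suc j)}. lvl B y \<le> hi}"

text \<open>The last low edge \<open>y\<close> is pulled down and propagation lowers the edges
  before it. Those behind \<open>y\<close> keep their labels, because their levels are at least the
  current level of \<open>y\<close>, which exceeds the new one. The test against the current label
  makes the advance idle for a class that has been served already.\<close>

definition astep where
  "astep par cl del am ofs P st c = (let j = par c; B = blev del (P j) j;
     hi = hi_of par cl del am ofs (P j) c; S = low_edges B hi (P j) j; y = Max S;
     v = max (hi - am (cl c)) B + int y
     in if j < k \<and> S \<noteq> {} \<and> v < fst st y then push j y v st else st)"

definition dstage where
  "dstage del P = foldl (dstep del P) (LB, []) [0..<k]"

definition gen where
  "gen X par cl del am ofs = (let P = positions par cl del am ofs;
     st = (if X = MR_AP then (LB, []) else dstage del P)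
     in if X = MR_DP then st else foldl (astep par cl del am ofs P) st [0..<k])"

end

section \<open>Shifts generated from a guess\<close>

context flat_instance
begin

lemma lvl_mono: "c < k \<Longrightarrow> y \<in> seg c \<Longrightarrow> z \<in> seg c \<Longrightarrow> y \<le> z \<Longrightarrow> lvl B y \<le> lvl B z"
  using ascendingD[OF ascending_LB, of c y z] by (auto simp: lvl_def)

lemma entry_le: "boards par del a p c hi x \<Longrightarrow> entry par del a p c hi \<le> x"
  by (auto simp: entry_def intro: Least_le)

lemma entry_boards:
  assumes "boards par del a p c hi x"
  shows "boards par del a p c hi (entry par del a p c hi)"
  using assms LeastI_ex[of "boards par del a p c hi"] by (auto simp: entry_def)

lemma entry_range: "c < k \<Longrightarrow> PS c \<le> entry par del a p c hi \<and> entry par del a p c hi \<le> PS (Suc c)"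
proof (cases "\<exists>x. boards par del a p c hi x")
  case True
  then have "boards par del a p c hi (entry par del a p c hi)" using entry_boards by blast
  then show ?thesis unfolding boards_def by simp
next
  case False
  then show "c < k \<Longrightarrow> ?thesis" using PS_less[of c] by (auto simp: entry_def)
qed

text \<open>With amount 0 a transfer cannot both need the advance and profit from it. Together with
  \<open>ofs 0 = 0\<close> class 0 gets the base level as top level, and truncation there leaves
  every \<open>lvl\<close> as it is.\<close>

lemma first_feas_trivial:
  assumes "c < k" "par c = j" "cl c = r" "am r = 0"
  shows "first_feas par cl del am p j r = blev del p j"
proof -
  have "\<not> feas par cl del am p j r h" for h
    using assms by (fastforce simp: feas_def paid_def)
  then show ?thesis by (simp add: first_feas_def)
qed

text \<open>Replace \<open>hi\<close> by the largest level among the chosen exits of the class: all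
  exits remain low enough, and the advance now ends no higher. So feasibility anywhere implies
  feasibility at the level of some edge, and as levels ascend the first such edge has the least
  level.\<close>

lemma first_feas_le:
  assumes j: "j < k" "PS j \<le> p" and c: "c < k" "par c = j" "cl c = r"
    and f: "feas par cl del am p j r hi"
  shows "feas par cl del am p j r (first_feas par cl del am p j r) \<and>
    first_feas par cl del am p j r \<le> hi"
proof -
  let ?B = "blev del p j"
  let ?D = "{d. d < k \<and> par d = j \<and> cl d = r}"
  have "\<forall>d\<in>?D. \<exists>xz. fst xz \<in> seg d \<and> snd xz \<in> {p..<PS (Suc j)} \<and>
      paid del ?B (am r) hi d (fst xz) (snd xz)"
    using f unfolding feas_def by fastforce
  then obtain xz where xz: "\<And>d. d \<in> ?D \<Longrightarrow> fst (xz d) \<in> seg d \<and> snd (xz d) \<in> {p..<PS (Suc j)} \<and>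
      paid del ?B (am r) hi d (fst (xz d)) (snd (xz d))"
    by metis
  let ?I = "(\<lambda>d. lvl ?B (snd (xz d))) ` ?D"
  have fin: "finite ?I" "?I \<noteq> {}" using c by auto
  define h0 where "h0 = Max ?I"
  have "h0 \<in> ?I" unfolding h0_def using Max_in[OF fin] .
  then obtain d0 where d0: "d0 \<in> ?D" "h0 = lvl ?B (snd (xz d0))" by blast
  have le: "lvl ?B (snd (xz d)) \<le> h0" if "d \<in> ?D" for d
    unfolding h0_def using fin that by (intro Max_ge) auto
  have h0: "h0 \<le> hi" using d0 xz[OF d0(1)] by (auto simp: paid_def)
  have feas0: "feas par cl del am p j r h0"
    unfolding feas_def
  proof (intro allI impI)
    fix d assume "d < k" "par d = j \<and> cl d = r"
    then have d: "d \<in> ?D" by simp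
    have "paid del ?B (am r) h0 d (fst (xz d)) (snd (xz d))"
      using xz[OF d] le[OF d] h0 by (auto simp: paid_def)
    then show "\<exists>x\<in>seg d. \<exists>z\<in>{p..<PS (Suc j)}. paid del ?B (am r) h0 d x z"
      using xz[OF d] by blast
  qed
  let ?Q = "\<lambda>y. y \<in> {p..<PS (Suc j)} \<and> feas par cl del am p j r (lvl ?B y)"
  have Q0: "?Q (snd (xz d0))" using feas0 d0 xz[OF d0(1)] by simp
  have ff: "first_feas par cl del am p j r = lvl ?B (LEAST y. ?Q y)"
    using Q0 by (auto simp: first_feas_def Let_def)
  have L: "?Q (LEAST y. ?Q y)" "(LEAST y. ?Q y) \<le> snd (xz d0)"
    using LeastI[of ?Q, OF Q0] Least_le[of ?Q, OF Q0] by blast+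
  have "lvl ?B (LEAST y. ?Q y) \<le> lvl ?B (snd (xz d0))"
    using L Q0 j by (intro lvl_mono[of j]) auto
  then show ?thesis using ff L(1) d0(2) h0 by simp
qed

section \<open>Legality of the shifts generated from an arbitrary guess\<close>

definition sound :: "(nat \<Rightarrow> int) \<times> shift_op list \<Rightarrow> bool" where
  "sound st \<longleftrightarrow> fst st = fapply (snd st) \<and> ops_ok (snd st)"

lemma sound_init: "sound (LB, [])"
  by (simp add: sound_def fapply_Nil ops_ok_def)

lemma sound_push:
  assumes "sound st" "c < k" "x \<in> seg c"
  shows "sound (push c x v st)"
  using assms by (cases st) (auto simp: sound_def fapply_snoc ops_ok_def)

lemma sound_ascending: "sound st \<Longrightarrow> ascending (fst st)"
  using fapply_props by (auto simp: sound_def)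

definition ranged :: "(nat \<Rightarrow> nat) \<Rightarrow> bool" where
  "ranged P \<longleftrightarrow> P k = PS k \<and> (\<forall>c<k. PS c \<le> P c \<and> P c \<le> PS (Suc c))"

lemma ranged_P0: "ranged P0"
  using PS_less by (auto simp: ranged_def P0_def less_imp_le)

lemma ranged_proc: "ranged P \<Longrightarrow> c < k \<Longrightarrow> ranged (proc par cl del am ofs P c)"
  using entry_range by (auto simp: ranged_def proc_def newp_def)

lemma ranged_fold: "ranged P \<Longrightarrow> i \<le> k \<Longrightarrow> ranged (foldl (proc par cl del am ofs) P [0..<i])"
  by (induction i) (auto simp: ranged_proc)

lemma ranged_rounds: "ranged ((round par cl del am ofs ^^ n) P0)"
  by (induction n) (auto simp: ranged_P0 round_def ranged_fold)

lemma ranged_positions: "ranged (positions par cl del am ofs)"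
  unfolding positions_def by (rule ranged_rounds)

lemma dstep_sound:
  assumes "ranged P" "c < k" "sound st" "\<forall>x\<in>set (snd st). allowed_op MR_DP x"
  shows "sound (dstep del P st c) \<and> (\<forall>x\<in>set (snd (dstep del P st c)). allowed_op MR_DP x) \<and>
    length (snd (dstep del P st c)) \<le> Suc (length (snd st))"
proof (cases "P c < PS (Suc c) \<and> fst st (P c) < LB (P c) + del c")
  case True
  then have "P c \<in> seg c" using assms by (auto simp: ranged_def)
  then show ?thesis using sound_push[OF assms(3,2)] True assms(4)
    by (cases st) (auto simp: dstep_def Let_def)
next
  case False
  then show ?thesis using assms by (auto simp: dstep_def Let_def)
qed

lemma dfold_sound:
  assumes "ranged P" "i \<le> k"
  shows "sound (foldl (dstep del P) (LB, []) [0..<i]) \<and>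
    (\<forall>x\<in>set (snd (foldl (dstep del P) (LB, []) [0..<i])). allowed_op MR_DP x) \<and>
    length (snd (foldl (dstep del P) (LB, []) [0..<i])) \<le> i"
  using assms(2)
proof (induction i)
  case (Suc i)
  then show ?case using dstep_sound[OF assms(1), of i "foldl (dstep del P) (LB, []) [0..<i]" del] by force
qed (simp add: sound_init)

lemma low_edges_Max:
  assumes "low_edges B hi p j \<noteq> {}"
  shows "Max (low_edges B hi p j) \<in> low_edges B hi p j"
  using Max_in[of "low_edges B hi p j"] assms by (auto simp: low_edges_def)

text \<open>The free predicate \<open>Q\<close> lets one lemma serve two problems: it is false for
  \<open>MR_AP\<close>, where only advances may occur, and true for \<open>MR_SP\<close>.\<close>

lemma astep_sound:
  assumes "ranged P" "c < k" "sound st" "\<forall>x\<in>set (snd st). allowed_op MR_AP x \<or> Q x"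
  shows "sound (astep par cl del am ofs P st c) \<and>
    (\<forall>x\<in>set (snd (astep par cl del am ofs P st c)). allowed_op MR_AP x \<or> Q x) \<and>
    length (snd (astep par cl del am ofs P st c)) \<le> Suc (length (snd st))"
proof -
  define j B hi S y v where "j = par c" and "B = blev del (P j) j"
    and "hi = hi_of par cl del am ofs (P j) c" and "S = low_edges B hi (P j) j" and "y = Max S"
    and "v = max (hi - am (cl c)) B + int y"
  have eq: "astep par cl del am ofs P st c =
      (if j < k \<and> S \<noteq> {} \<and> v < fst st y then push j y v st else st)"
    by (simp add: astep_def Let_def j_def B_def hi_def S_def y_def v_def)
  show ?thesis
  proof (cases "j < k \<and> S \<noteq> {} \<and> v < fst st y")
    case True
    then have "y \<in> S" using low_edges_Max unfolding y_def S_def by blast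
    then have "y \<in> seg j" using True assms(1) by (auto simp: S_def low_edges_def ranged_def)
    then show ?thesis using sound_push[OF assms(3), of j y v] True assms(4) eq
      by (cases st) auto
  next
    case False
    then have "astep par cl del am ofs P st c = st" using eq by metis
    then show ?thesis using assms by simp
  qed
qed

lemma afold_sound:
  assumes "ranged P" "i \<le> k" "sound st" "\<forall>x\<in>set (snd st). allowed_op MR_AP x \<or> Q x"
  shows "sound (foldl (astep par cl del am ofs P) st [0..<i]) \<and>
    (\<forall>x\<in>set (snd (foldl (astep par cl del am ofs P) st [0..<i])). allowed_op MR_AP x \<or> Q x) \<and>
    length (snd (foldl (astep par cl del am ofs P) st [0..<i])) \<le> i + length (snd st)"
  using assms(2)
proof (induction i)
  case (Suc i)
  then show ?case
    using astep_sound[OF assms(1), of i "foldl (astep par cl del am ofs P) st [0..<i]" Q par cl del am ofs]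
    by force
qed (use assms in simp)

text \<open>Every path contributes at most one operation to each of the two stages. The resulting
  length bound \<open>2 * k\<close> later limits the size of the output.\<close>

lemma gen_sound:
  shows "sound (gen X par cl del am ofs) \<and>
    (\<forall>x\<in>set (snd (gen X par cl del am ofs)). allowed_op X x) \<and>
    length (snd (gen X par cl del am ofs)) \<le> 2 * k"
proof -
  define P where "P = positions par cl del am ofs"
  have r: "ranged P" unfolding P_def by (rule ranged_positions)
  note d = dfold_sound[OF r order_refl, of del, folded dstage_def]
  show ?thesis
  proof (cases X)
    case MR_DP
    then show ?thesis using d by (simp add: gen_def P_def Let_def)
  next
    case MR_AP
    show ?thesis using afold_sound[OF r order_refl sound_init, of "\<lambda>_. False" par cl del am ofs] MR_AP
      by (simp add: gen_def P_def Let_def)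
  next
    case MR_SP
    have "allowed_op MR_SP x" for x by (cases x) simp
    moreover have "\<forall>x\<in>set (snd (dstage del P)). allowed_op MR_AP x \<or> True" by simp
    ultimately show ?thesis
      using afold_sound[OF r order_refl, of "dstage del P" "\<lambda>_. True" par cl del am ofs] d MR_SP
      by (simp add: gen_def P_def[symmetric] Let_def)
  qed
qed

text \<open>Delays on different paths do not interact, so each path carries a single shift of its
  original labels. Negative changes cost nothing at this stage, which \<open>nat\<close>
  expresses.\<close>

lemma foldl_dstep:
  fixes del :: "nat \<Rightarrow> int"
  assumes r: "ranged P" and i: "i \<le> k"
  defines "st \<equiv> foldl (dstep del P) (LB, []) [0..<i]"
  shows "(\<forall>c<k. \<forall>y\<in>seg c. fst st y = (if c < i \<and> P c < PS (Suc c) \<and> del c > 0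
            then fshift c (P c) (LB (P c) + del c) LB y else LB y)) \<and>
         shifts_cost (snd st) \<le> (\<Sum>c<i. nat (del c))"
  using i unfolding st_def
proof (induction i)
  case 0
  then show ?case by (simp add: shifts_cost_Nil)
next
  case (Suc i)
  let ?st = "foldl (dstep del P) (LB, []) [0..<i]"
  let ?st' = "dstep del P ?st i"
  have ik: "i < k" using Suc.prems by simp
  note IH = Suc.IH[OF less_imp_le[OF ik]]
  have Pi: "fst ?st (P i) = LB (P i)" if "P i < PS (Suc i)"
    using IH ik r that by (auto simp: ranged_def)
  show ?case
  proof (cases "P i < PS (Suc i) \<and> del i > 0")
    case True
    obtain W ops where st: "?st = (W, ops)" by fastforce
    have st': "?st' = (fshift i (P i) (LB (P i) + del i) W, ops @ [(i, P i - PS i, del i)])"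
      using True Pi st by (simp add: dstep_def Let_def)
    have "fst ?st' y = (if c < Suc i \<and> P c < PS (Suc c) \<and> del c > 0
            then fshift c (P c) (LB (P c) + del c) LB y else LB y)" if "c < k" "y \<in> seg c" for c y
    proof (cases "c = i")
      case True
      then have "W y = LB y" using IH st that by simp
      then have "fshift i (P i) (LB (P i) + del i) W y = fshift i (P i) (LB (P i) + del i) LB y"
        by (simp add: fshift_def)
      then show ?thesis using st' True \<open>P i < PS (Suc i) \<and> del i > 0\<close> by simp
    next
      case False
      then have "y \<notin> seg i" using seg_unique[of y i c] that ik by auto
      then have "fst ?st' y = fst ?st y" using st' st fshift_other by simp
      then show ?thesis using IH that False by (auto simp: less_Suc_eq)
    qed
    moreover have "shifts_cost (snd ?st') \<le> (\<Sum>c<Suc i. nat (del c))"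
      using IH st st' True by (simp add: shifts_cost_append shifts_cost_single)
    ultimately show ?thesis by simp
  next
    case False
    have "?st' = ?st"
    proof (cases "P i < PS (Suc i)")
      case True
      then show ?thesis using Pi False by (simp add: dstep_def Let_def)
    qed (simp add: dstep_def Let_def)
    then have "foldl (dstep del P) (LB, []) [0..<Suc i] = ?st" by simp
    moreover have "(c < Suc i \<and> P c < PS (Suc c) \<and> 0 < del c) \<longleftrightarrow>
        (c < i \<and> P c < PS (Suc c) \<and> 0 < del c)" for c
      using False by (auto simp: less_Suc_eq)
    ultimately show ?thesis using IH by auto
  qed
qed

lemma dstage_level:
  assumes r: "ranged P" and c: "c < k" and y: "y \<in> {P c..<PS (Suc c)}"
  shows "fst (dstage del P) y - int y = lvl (blev del (P c) c) y"
proof -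
  have yc: "y \<in> seg c" and pc: "P c \<in> seg c" using y r c by (auto simp: ranged_def)
  have "fst (dstage del P) y = (if del c > 0 then fshift c (P c) (LB (P c) + del c) LB y else LB y)"
    using foldl_dstep[OF r order_refl, of del] c yc y unfolding dstage_def by auto
  moreover have "LB (P c) - int (P c) \<le> LB y - int y"
    using ascendingD[OF ascending_LB c pc yc] y by simp
  ultimately show ?thesis using y yc by (auto simp: lvl_def blev_def fshift_def)
qed

text \<open>Advances only lower labels, so a ceiling \<open>elev c\<close> once reached persists
  whatever else happens on that path, while the floor \<open>blev\<close> is respected by every
  target. A further member of a class finds its ceiling reached and pushes nothing; hence each class
  is paid only once.\<close>

lemma foldl_astep:
  fixes del :: "nat \<Rightarrow> int"
  assumes r: "ranged P"
    and cl: "\<And>c d. c < k \<Longrightarrow> d < k \<Longrightarrow> cl c = cl d \<Longrightarrow> cl c \<noteq> 0 \<Longrightarrow> par c = par d"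
    and z: "am 0 = 0" "ofs 0 = 0" and a: "\<And>r. am r \<ge> 0"
    and i: "i \<le> k"
  defines "elv \<equiv> (\<lambda>c. elev (blev del (P (par c)) (par c)) (am (cl c)) (hi_of par cl del am ofs (P (par c)) c))"
  defines "st \<equiv> foldl (astep par cl del am ofs P) (dstage del P) [0..<i]"
  shows "(\<forall>c<k. \<forall>y\<in>{P c..<PS (Suc c)}. blev del (P c) c \<le> fst st y - int y \<and>
            fst st y - int y \<le> lvl (blev del (P c) c) y) \<and>
         (\<forall>c<i. par c < k \<longrightarrow> (\<forall>y\<in>{P (par c)..<PS (Suc (par c))}. fst st y - int y \<le> elv c y)) \<and>
         shifts_cost (snd st) \<le> shifts_cost (snd (dstage del P)) + (\<Sum>r\<in>cl ` {..<i} - {0}. nat (am r)) \<and>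
         ((\<forall>c<i. cl c = 0) \<longrightarrow> st = dstage del P) \<and> sound st"
  using i unfolding st_def
proof (induction i)
  case 0
  then show ?case using dstage_level[OF r] dfold_sound[OF r order_refl, of del]
    by (auto simp: lvl_def dstage_def[symmetric])
next
  case (Suc i)
  let ?st = "foldl (astep par cl del am ofs P) (dstage del P) [0..<i]"
  have ik: "i < k" using Suc.prems by simp
  note IH = Suc.IH[OF less_imp_le[OF ik]]
  define j B hi S y v where "j = par i" and "B = blev del (P j) j"
    and "hi = hi_of par cl del am ofs (P j) i" and "S = low_edges B hi (P j) j" and "y = Max S"
    and "v = max (hi - am (cl i)) B + int y"
  let ?st' = "astep par cl del am ofs P ?st i"
  have eq: "?st' = (if j < k \<and> S \<noteq> {} \<and> v < fst ?st y then push j y v ?st else ?st)"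
    by (simp add: astep_def Let_def j_def B_def hi_def S_def y_def v_def)
  have elvi: "elv i = elev B (am (cl i)) hi" by (simp add: elv_def j_def B_def hi_def)
  have finS: "finite S" by (simp add: S_def low_edges_def)
  show ?case
  proof (cases "j < k \<and> S \<noteq> {} \<and> v < fst ?st y")
    case False
    have st': "?st' = ?st" using False eq by metis
    \<comment> \<open>If nothing is pushed although low edges exist, the last of them is at the
      target level already, and by monotonicity so are the low edges before it.\<close>
    have "fst ?st z - int z \<le> elv i z" if "par i < k" "z \<in> {P (par i)..<PS (Suc (par i))}" for z
    proof (cases "lvl B z \<le> hi")
      case True
      then have zS: "z \<in> S" using that by (auto simp: S_def low_edges_def j_def)
      then have "y \<in> S" "z \<le> y" using Max_in[OF finS] Max_ge[OF finS] unfolding y_def by blast+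
      then have "y \<in> seg j" "z \<in> seg j" using zS r that by (auto simp: S_def low_edges_def ranged_def j_def)
      then have "fst ?st z - int z \<le> fst ?st y - int y"
        using ascendingD[OF sound_ascending[of ?st]] IH that \<open>z \<le> y\<close> j_def by blast
      also have "\<dots> \<le> max (hi - am (cl i)) B" using False zS that v_def j_def by auto
      finally show ?thesis using IH that True unfolding elvi elev_def
        by (auto simp: B_def j_def)
    next
      case F: False
      then show ?thesis using IH that unfolding elvi elev_def by (auto simp: B_def j_def)
    qed
    moreover have "(\<Sum>r\<in>cl ` {..<i} - {0}. nat (am r)) \<le> (\<Sum>r\<in>cl ` {..<Suc i} - {0}. nat (am r))"
      by (intro sum_mono2) auto
    ultimately show ?thesis using IH st' by (auto simp: less_Suc_eq intro: order_trans)
  next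
    case True
    have yS: "y \<in> S" using Max_in[OF finS] True unfolding y_def by blast
    then have y: "y \<in> {P j..<PS (Suc j)}" "lvl B y \<le> hi" by (auto simp: S_def low_edges_def)
    have yj: "y \<in> seg j" using y(1) r True by (auto simp: ranged_def)
    obtain W ops where st: "?st = (W, ops)" by fastforce
    have st': "?st' = (fshift j y v W, ops @ [(j, y - PS j, v - W y)])" using True eq st by simp
    have vW: "v < W y" using True st by simp
    have Wy: "W y - int y \<le> lvl B y" using IH True y(1) st unfolding B_def by auto
    \<comment> \<open>For class 0 the target level is the base level, and the low edges are not
      above it, so nothing would be pushed.\<close>
    have nz: "cl i \<noteq> 0"
    proof
      assume 0: "cl i = 0"
      have "first_feas par cl del am (P j) j (cl i) = B"
        unfolding B_def by (rule first_feas_trivial[of i]) (auto simp: ik j_def 0 z)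
      then have "hi = B" unfolding hi_def hi_of_def using 0 z by (simp add: j_def)
      then show False using y Wy vW v_def 0 z by simp
    qed
    \<comment> \<open>An earlier member of the same class shares parent, amount and top level, and
      its advance would have brought \<open>y\<close> down to the target.\<close>
    have new: "cl i \<notin> cl ` {..<i}"
    proof
      assume "cl i \<in> cl ` {..<i}"
      then obtain c where c: "c < i" "cl c = cl i" by auto
      then have pc: "par c = j" using cl[of c i] ik nz j_def by simp
      then have "elv c = elv i" using c by (simp add: elv_def j_def hi_of_def)
      then have "W y - int y \<le> elv i y" using IH c pc True y st by (auto simp: j_def)
      then show False using y vW by (simp add: elvi elev_def v_def)
    qed
    have asc: "ascending W" using sound_ascending[of ?st] IH st by simp
    have le: "fshift j y v W z \<le> W z" for z
      using fshift_advance_le[OF asc _ yj] True vW by simp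
    have 1: "blev del (P c) c \<le> fshift j y v W z - int z" if "c < k" "z \<in> {P c..<PS (Suc c)}" for c z
    proof (cases "c = j")
      case cj: True
      then have "z \<in> seg j" using that r by (auto simp: ranged_def)
      moreover have "B \<le> W z - int z" using IH that st cj by (auto simp: B_def)
      moreover have "B \<le> v - int y" by (simp add: v_def)
      ultimately show ?thesis using cj B_def unfolding fshift_def by auto
    next
      case False
      have "z \<in> seg c" using that r by (auto simp: ranged_def)
      then have "z \<notin> seg j" using seg_unique[of z j c] that True False by auto
      then have "fshift j y v W z = W z" by (rule fshift_other)
      then show ?thesis using IH that st by auto
    qed
    have 2: "fshift j y v W z - int z \<le> elv i z" if "par i < k" "z \<in> {P (par i)..<PS (Suc (par i))}" for z
    proof (cases "lvl B z \<le> hi")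
      case lz: True
      then have zS: "z \<in> S" using that by (auto simp: S_def low_edges_def j_def)
      then have "z \<le> y" using Max_ge[OF finS] unfolding y_def by blast
      moreover have "z \<in> seg j" using zS r that by (auto simp: S_def low_edges_def ranged_def j_def)
      ultimately have "fshift j y v W z - int z \<le> v - int y" unfolding fshift_def by auto
      moreover have "fshift j y v W z - int z \<le> lvl B z"
        using le[of z] IH that st by (fastforce simp: B_def j_def)
      ultimately show ?thesis using lz by (simp add: elvi elev_def v_def)
    next
      case F: False
      have "fshift j y v W z - int z \<le> lvl B z"
        using le[of z] IH that st by (fastforce simp: B_def j_def)
      then show ?thesis using F by (simp add: elvi elev_def)
    qed
    \<comment> \<open>The edge \<open>y\<close> starts at level at most \<open>hi\<close> and stops
      at level at least \<open>hi - am (cl i)\<close>.\<close>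
    have "nat \<bar>v - W y\<bar> \<le> nat (am (cl i))" using vW Wy y a[of "cl i"] by (simp add: v_def)
    moreover have "(\<Sum>r\<in>cl ` {..<Suc i} - {0}. nat (am r)) = nat (am (cl i)) + (\<Sum>r\<in>cl ` {..<i} - {0}. nat (am r))"
    proof -
      have "cl ` {..<Suc i} - {0} = insert (cl i) (cl ` {..<i} - {0})"
        using nz by (auto simp: less_Suc_eq)
      then show ?thesis using new by simp
    qed
    ultimately have 3: "shifts_cost (ops @ [(j, y - PS j, v - W y)]) \<le>
        shifts_cost (snd (dstage del P)) + (\<Sum>r\<in>cl ` {..<Suc i} - {0}. nat (am r))"
      using IH st by (simp add: shifts_cost_append shifts_cost_single)
    have 4: "sound ?st'" using sound_push[of ?st j y v] IH True yj eq by simp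
    have 5: "\<forall>c<k. \<forall>z\<in>{P c..<PS (Suc c)}. fshift j y v W z - int z \<le> lvl (blev del (P c) c) z"
    proof (intro allI impI ballI)
      fix c z assume "c < k" "z \<in> {P c..<PS (Suc c)}"
      then have "W z - int z \<le> lvl (blev del (P c) c) z" using IH st by auto
      with le[of z] show "fshift j y v W z - int z \<le> lvl (blev del (P c) c) z" by linarith
    qed
    have 6: "\<forall>c<i. par c < k \<longrightarrow> (\<forall>z\<in>{P (par c)..<PS (Suc (par c))}. fshift j y v W z - int z \<le> elv c z)"
    proof (intro allI impI ballI)
      fix c z assume "c < i" "par c < k" "z \<in> {P (par c)..<PS (Suc (par c))}"
      then have "W z - int z \<le> elv c z" using IH st by auto
      with le[of z] show "fshift j y v W z - int z \<le> elv c z" by linarith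
    qed
    show ?thesis using 1 2 3 4 5 6 nz st' by (auto simp: less_Suc_eq)
  qed
qed

end

section \<open>A guess for every labelling within the budget\<close>

text \<open>A solution enters only through its final labels; number, kind and order of its
  operations are forgotten except for the count of changed thresholds.\<close>

locale target_labels = flat_instance +
  fixes L :: "nat \<Rightarrow> int"
  assumes asc: "ascending L" and fin: "finite (changed LB L)" and few: "card (changed LB L) \<le> b"
begin

lemma changedI: "c < k \<Longrightarrow> y \<in> seg c \<Longrightarrow> (l < LB y - int y) \<noteq> (l < L y - int y) \<Longrightarrow>
    (c, l) \<in> changed LB L"
  unfolding changed_def by blast

section \<open>The tree of entries in a given solution\<close>

definition boarded :: "nat \<Rightarrow> bool" where
  "boarded c \<longleftrightarrow> c < k \<and> (\<exists>x\<in>seg c. usable L x)"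

definition ps :: "nat \<Rightarrow> nat" where
  "ps c = (LEAST x. x \<in> seg c \<and> usable L x)"

lemma boardedD:
  assumes "boarded c"
  shows "c < k" "ps c \<in> seg c" "usable L (ps c)"
proof -
  obtain x where "x \<in> seg c \<and> usable L x" using assms by (auto simp: boarded_def)
  then have "ps c \<in> seg c \<and> usable L (ps c)" unfolding ps_def by (rule LeastI)
  then show "ps c \<in> seg c" "usable L (ps c)" by auto
  show "c < k" using assms by (simp add: boarded_def)
qed

lemma ps_le: "x \<in> seg c \<Longrightarrow> usable L x \<Longrightarrow> ps c \<le> x"
  unfolding ps_def by (rule Least_le) simp

definition link :: "nat \<Rightarrow> nat \<Rightarrow> nat \<Rightarrow> bool" where
  "link c j z \<longleftrightarrow> (j = k \<and> z = PS k \<and> TV (ps c) = s) \<or>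
     (boarded j \<and> z \<in> seg j \<and> ps j \<le> z \<and> HV z = TV (ps c) \<and> L z < L (ps c))"

lemma ex_link:
  assumes "boarded c"
  shows "\<exists>j z. link c j z"
  using boardedD(3)[OF assms]
proof (cases rule: usable.cases)
  case usable_start
  then show ?thesis by (auto simp: link_def)
next
  case (usable_step y)
  then obtain j where j: "j < k" "y \<in> seg j" using seg_ex[of y k] usable_less by auto
  then have "boarded j" "ps j \<le> y" using usable_step ps_le by (auto simp: boarded_def)
  then show ?thesis using usable_step j unfolding link_def by blast
qed

definition le :: "nat \<Rightarrow> nat \<times> nat" where
  "le c = (SOME jz. link c (fst jz) (snd jz))"

text \<open>A path that is not entered gets the source as parent, which is harmless; beyond the last
  path the value 0 is the one that decoding of the digits yields there.\<close>

definition par :: "nat \<Rightarrow> nat" where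
  "par c = (if boarded c then fst (le c) else if c < k then k else 0)"

definition ex :: "nat \<Rightarrow> nat" where
  "ex c = snd (le c)"

lemma link: "boarded c \<Longrightarrow> link c (par c) (ex c)"
proof -
  assume c: "boarded c"
  then obtain j z where "link c j z" using ex_link by blast
  then have "link c (fst (le c)) (snd (le c))"
    unfolding le_def by (intro someI[of "\<lambda>jz. link c (fst jz) (snd jz)" "(j, z)"]) simp
  then show ?thesis using c by (simp add: par_def ex_def)
qed

lemma par_le: "c < k \<Longrightarrow> par c \<le> k"
  using link[of c] boardedD(1) by (cases "boarded c") (auto simp: link_def par_def less_imp_le)

lemma par_boarded: "boarded c \<Longrightarrow> par c < k \<Longrightarrow> boarded (par c) \<and> ex c \<in> seg (par c) \<and>
    ps (par c) \<le> ex c \<and> HV (ex c) = TV (ps c) \<and> L (ex c) < L (ps c)"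
  using link[of c] by (auto simp: link_def)

lemma par_src: "boarded c \<Longrightarrow> par c = k \<Longrightarrow> ex c = PS k \<and> TV (ps c) = s"
  using link[of c] boardedD(1)[of k] by (auto simp: link_def)

text \<open>Labels at the entries decrease strictly towards the parent. Counting the smaller ones
  turns this into a natural number below \<open>k\<close>, which bounds both a recursion depth and a
  number of rounds.\<close>

definition dep :: "nat \<Rightarrow> nat" where
  "dep c = card {j. boarded j \<and> L (ps j) < L (ps c)}"

lemma fin_boarded: "finite {j. boarded j \<and> Q j}"
  by (rule finite_subset[of _ "{..<k}"]) (auto simp: boarded_def)

lemma dep_less: "boarded c \<Longrightarrow> dep c < k"
proof -
  assume c: "boarded c"
  have "{j. boarded j \<and> L (ps j) < L (ps c)} \<subseteq> {..<k} - {c}"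
    by (auto simp: boarded_def)
  then have "dep c \<le> card ({..<k} - {c})" unfolding dep_def by (intro card_mono) auto
  then show ?thesis using boardedD(1)[OF c] by simp
qed

lemma ps_mono: "boarded j \<Longrightarrow> z \<in> seg j \<Longrightarrow> ps j \<le> z \<Longrightarrow> L (ps j) - int (ps j) \<le> L z - int z"
  using ascendingD[OF asc, of j "ps j" z] boardedD[of j] by simp

lemma dep_par: "boarded c \<Longrightarrow> par c < k \<Longrightarrow> dep (par c) < dep c"
proof -
  assume c: "boarded c" "par c < k"
  note p = par_boarded[OF c]
  have lt: "L (ps (par c)) < L (ps c)" using ps_mono[of "par c" "ex c"] p by auto
  have "par c \<in> {j. boarded j \<and> L (ps j) < L (ps c)}"
    "par c \<notin> {j. boarded j \<and> L (ps j) < L (ps (par c))}" using lt p by auto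
  moreover have "{j. boarded j \<and> L (ps j) < L (ps (par c))} \<subseteq> {j. boarded j \<and> L (ps j) < L (ps c)}"
    using lt by auto
  ultimately have "{j. boarded j \<and> L (ps j) < L (ps (par c))} \<subset> {j. boarded j \<and> L (ps j) < L (ps c)}"
    by blast
  then show ?thesis unfolding dep_def by (intro psubset_card_mono fin_boarded)
qed

section \<open>Changed thresholds, runs and classes of children\<close>

definition del :: "nat \<Rightarrow> int" where
  "del c = (if boarded c then L (ps c) - LB (ps c) else 0)"

definition bs :: "nat \<Rightarrow> int" where
  "bs j = L (ps j) - int (ps j)"

text \<open>Changed thresholds from the level of the entry upwards will pay for advances; those
  below it are left to pay for the entry delay.\<close>

definition hot :: "nat \<Rightarrow> int set" where
  "hot j = {l. (j, l) \<in> changed LB L \<and> bs j \<le> l}"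

lemma finite_hot: "finite (hot j)"
proof -
  have "hot j \<subseteq> snd ` changed LB L" unfolding hot_def by force
  then show ?thesis using fin finite_subset by blast
qed

text \<open>The exit is too late if only the delay at the entry of the parent is applied, so the
  solution must have advanced it.\<close>

definition member :: "nat \<Rightarrow> bool" where
  "member c \<longleftrightarrow> boarded c \<and> par c < k \<and> L (ps c) \<le> lvl (bs (par c)) (ex c) + int (ex c)"

text \<open>In the solution the exit precedes \<open>L (ps c)\<close>, and its level is at least
  that of the parent's entry. So it is not the delay but its original level that makes it too late,
  and it crosses all thresholds from its final up to its original level.\<close>

lemma member_interval:
  assumes "member c"
  shows "bs (par c) \<le> L (ex c) - int (ex c)" "L (ex c) < LB (ex c)"
    "{L (ex c) - int (ex c)..<LB (ex c) - int (ex c)} \<subseteq> hot (par c)"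
proof -
  have m: "boarded c" "par c < k" "L (ps c) \<le> lvl (bs (par c)) (ex c) + int (ex c)"
    using assms by (auto simp: member_def)
  note p = par_boarded[OF m(1,2)]
  show 1: "bs (par c) \<le> L (ex c) - int (ex c)" using ps_mono[of "par c" "ex c"] p by (simp add: bs_def)
  then show 2: "L (ex c) < LB (ex c)" using m(3) p by (auto simp: lvl_def)
  show "{L (ex c) - int (ex c)..<LB (ex c) - int (ex c)} \<subseteq> hot (par c)"
  proof
    fix l assume l: "l \<in> {L (ex c) - int (ex c)..<LB (ex c) - int (ex c)}"
    then have "(l < LB (ex c) - int (ex c)) \<noteq> (l < L (ex c) - int (ex c))" by auto
    then have "(par c, l) \<in> changed LB L" using p m(2) changedI by blast
    then show "l \<in> hot (par c)" using 1 l by (auto simp: hot_def)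
  qed
qed

definition run :: "nat \<Rightarrow> int \<times> int" where
  "run c = (SOME lh. is_run (hot (par c)) (fst lh) (snd lh) \<and>
     fst lh \<le> L (ex c) - int (ex c) \<and> LB (ex c) - int (ex c) \<le> snd lh)"

lemma run:
  assumes "member c"
  shows "is_run (hot (par c)) (fst (run c)) (snd (run c)) \<and>
     fst (run c) \<le> L (ex c) - int (ex c) \<and> LB (ex c) - int (ex c) \<le> snd (run c)"
proof -
  note m = member_interval[OF assms]
  let ?e = "L (ex c) - int (ex c)" and ?f = "LB (ex c) - int (ex c)"
  have "?e \<in> hot (par c)" using m by auto
  from ex_run[OF finite_hot this] obtain l h where
    lh: "is_run (hot (par c)) l h" "l \<le> ?e" "?e < h" by blast
  have "?f \<le> h" using run_covers[OF lh(1) m(3) lh(2,3)] .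
  then show ?thesis unfolding run_def
    using someI[of "\<lambda>lh. is_run (hot (par c)) (fst lh) (snd lh) \<and> fst lh \<le> ?e \<and> ?f \<le> snd lh" "(l, h)"] lh
    by simp
qed

lemma run_ge: "member c \<Longrightarrow> bs (par c) \<le> fst (run c)"
  using run[of c] by (auto simp: is_run_def hot_def subset_iff)

definition clusters :: "(nat \<times> int \<times> int) set" where
  "clusters = (\<lambda>c. (par c, run c)) ` {c. member c}"

text \<open>An arbitrary numbering of the runs in use. It is moved up by one in \<open>cl\<close>,
  which keeps 0 free for paths without an advance.\<close>

definition idx :: "nat \<times> int \<times> int \<Rightarrow> nat" where
  "idx = (SOME f. bij_betw f clusters {0..<card clusters})"

lemma finite_clusters: "finite clusters" and card_clusters: "card clusters \<le> k"
proof -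
  have sub: "{c. member c} \<subseteq> {..<k}" by (auto simp: member_def boarded_def)
  then have "finite {c. member c}" using finite_subset by blast
  then show "finite clusters" "card clusters \<le> k"
    using card_image_le[of "{c. member c}" "\<lambda>c. (par c, run c)"] card_mono[OF _ sub]
    by (auto simp: clusters_def)
qed

lemma idx: "bij_betw idx clusters {0..<card clusters}"
  unfolding idx_def using ex_bij_betw_finite_nat[OF finite_clusters] by (rule someI_ex)

definition cl :: "nat \<Rightarrow> nat" where
  "cl c = (if member c then Suc (idx (par c, run c)) else 0)"

definition dat :: "nat \<Rightarrow> nat \<times> int \<times> int" where
  "dat r = inv_into clusters idx (r - 1)"

definition am :: "nat \<Rightarrow> int" where
  "am r = (if 0 < r \<and> r \<le> card clusters then snd (snd (dat r)) - fst (snd (dat r)) else 0)"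

lemma member_cluster:
  assumes "member c"
  shows "(par c, run c) \<in> clusters" "dat (cl c) = (par c, run c)" "0 < cl c" "cl c \<le> card clusters"
    "am (cl c) = snd (run c) - fst (run c)"
proof -
  show 1: "(par c, run c) \<in> clusters" using assms by (auto simp: clusters_def)
  show 2: "dat (cl c) = (par c, run c)" using 1 idx assms
    by (simp add: dat_def cl_def bij_betw_def)
  have "idx (par c, run c) < card clusters" using bij_betwE[OF idx] 1 by auto
  then show 3: "0 < cl c" "cl c \<le> card clusters" using assms by (auto simp: cl_def)
  show "am (cl c) = snd (run c) - fst (run c)" using 2 3 by (simp add: am_def)
qed

lemma cl_nonmember: "\<not> member c \<Longrightarrow> cl c = 0"
  by (simp add: cl_def)

lemma cl_eq: "cl c = cl d \<Longrightarrow> cl c \<noteq> 0 \<Longrightarrow> par c = par d \<and> run c = run d"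
proof -
  assume e: "cl c = cl d" "cl c \<noteq> 0"
  then have "member c" "member d" by (auto simp: cl_def split: if_splits)
  then have "(par c, run c) = (par d, run d)"
    using member_cluster(2)[of c] member_cluster(2)[of d] e by simp
  then show ?thesis by simp
qed

lemma cluster_run: "(j, l, h) \<in> clusters \<Longrightarrow> is_run (hot j) l h"
proof -
  assume "(j, l, h) \<in> clusters"
  then obtain c where "member c" "j = par c" "run c = (l, h)" by (auto simp: clusters_def)
  then show ?thesis using run[of c] by simp
qed

text \<open>Two disjoint families of changed thresholds: on each entered path those from the
  original level of the entry edge up to \<open>bs\<close>, and the runs, which lie at or above
  \<open>bs\<close>. Different runs of one path are disjoint by maximality. A negative
  \<open>del\<close> yields an empty interval, in accordance with its cost 0 in the delay
  stage.\<close>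

lemma cost_bound:
  "(\<Sum>c<k. nat (del c)) + (\<Sum>r\<in>{1..card clusters}. nat (am r)) \<le> card (changed LB L)"
proof -
  let ?A = "SIGMA c:{..<k}. (if boarded c then {LB (ps c) - int (ps c)..<bs c} else {})"
  let ?C = "\<lambda>(j, l, h). {j :: nat} \<times> {l :: int..<h}"
  let ?B = "\<Union> (?C ` clusters)"
  have "card ?A = (\<Sum>c<k. card (if boarded c then {LB (ps c) - int (ps c)..<bs c} else {}))"
    by (rule card_SigmaI) auto
  also have "\<dots> = (\<Sum>c<k. nat (del c))"
    by (intro sum.cong) (auto simp: del_def bs_def)
  finally have A: "card ?A = (\<Sum>c<k. nat (del c))" .
  have "card ?B = (\<Sum>t\<in>clusters. card (?C t))"
  proof (rule card_UN_disjoint[OF finite_clusters])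
    show "\<forall>i\<in>clusters. finite (?C i)" by auto
    show "\<forall>i\<in>clusters. \<forall>j\<in>clusters. i \<noteq> j \<longrightarrow> ?C i \<inter> ?C j = {}"
    proof (intro ballI impI)
      fix t u assume t: "t \<in> clusters" "u \<in> clusters" "t \<noteq> u"
      obtain j l h j' l' h' where tu: "t = (j, l, h)" "u = (j', l', h')" by (cases t, cases u)
      show "?C t \<inter> ?C u = {}"
      proof (rule ccontr)
        assume "?C t \<inter> ?C u \<noteq> {}"
        then obtain i x where "(i, x) \<in> ?C t" "(i, x) \<in> ?C u" by auto
        then have "j = j'" "x \<in> {l..<h}" "x \<in> {l'..<h'}" using tu by simp_all
        then show False using run_unique[of "hot j" l h l' h' x] cluster_run[of j l h]
            cluster_run[of j' l' h'] t tu by simp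
      qed
    qed
  qed
  also have "\<dots> = (\<Sum>t\<in>clusters. nat (snd (snd t) - fst (snd t)))"
    by (intro sum.cong) (auto simp: card_cartesian_product_singleton)
  also have "\<dots> = (\<Sum>i\<in>{0..<card clusters}. nat (am (Suc i)))"
  proof -
    have "(\<Sum>i\<in>{0..<card clusters}. nat (am (Suc i))) = (\<Sum>t\<in>clusters. nat (am (Suc (idx t))))"
      by (rule sum.reindex_bij_betw[OF idx, symmetric])
    also have "\<dots> = (\<Sum>t\<in>clusters. nat (snd (snd t) - fst (snd t)))"
    proof (intro sum.cong refl)
      fix t assume t: "t \<in> clusters"
      then have "idx t < card clusters" using bij_betwE[OF idx] by auto
      moreover have "dat (Suc (idx t)) = t" using t idx by (simp add: dat_def bij_betw_def)
      ultimately show "nat (am (Suc (idx t))) = nat (snd (snd t) - fst (snd t))" by (simp add: am_def)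
    qed
    finally show ?thesis by simp
  qed
  also have "\<dots> = (\<Sum>r\<in>{1..card clusters}. nat (am r))"
    by (rule sum.reindex_bij_witness[of _ "\<lambda>r. r - 1" Suc]) auto
  finally have B: "card ?B = (\<Sum>r\<in>{1..card clusters}. nat (am r))" .
  have subA: "?A \<subseteq> changed LB L"
  proof
    fix q assume "q \<in> ?A"
    then obtain c l where q: "q = (c, l)" "c < k" "boarded c" "l \<in> {LB (ps c) - int (ps c)..<bs c}"
      by (auto split: if_splits)
    have "(l < LB (ps c) - int (ps c)) \<noteq> (l < L (ps c) - int (ps c))" using q(4) by (auto simp: bs_def)
    then show "q \<in> changed LB L" using q(1,2) boardedD(2)[OF q(3)] changedI by blast
  qed
  have subB: "l \<in> hot j" if jl: "(j, l) \<in> ?B" for j l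
  proof -
    obtain e f where "(j, e, f) \<in> clusters" "l \<in> {e..<f}" using jl by auto
    then show ?thesis using cluster_run[of j e f] unfolding is_run_def by blast
  qed
  have disj: "?A \<inter> ?B = {}"
  proof (rule ccontr)
    assume "?A \<inter> ?B \<noteq> {}"
    then obtain q where "q \<in> ?A" "q \<in> ?B" by blast
    moreover obtain j l where "q = (j, l)" by (cases q)
    ultimately have "(j, l) \<in> ?A" "(j, l) \<in> ?B" by simp_all
    then have "l < bs j" "l \<in> hot j" using subB by (auto split: if_splits)
    then show False by (simp add: hot_def)
  qed
  have "?B \<subseteq> changed LB L"
  proof
    fix q assume q: "q \<in> ?B"
    obtain j l where "q = (j, l)" by (cases q)
    then show "q \<in> changed LB L" using subB[of j l] q by (simp add: hot_def)
  qed
  then have "card (?A \<union> ?B) \<le> card (changed LB L)" using subA fin by (intro card_mono) auto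
  moreover have "card (?A \<union> ?B) = card ?A + card ?B"
    by (rule card_Un_disjoint) (use disj finite_clusters in auto)
  ultimately show ?thesis using A B by simp
qed

lemma am_ge: "am r \<ge> 0"
proof (cases "0 < r \<and> r \<le> card clusters")
  case True
  then have "r - 1 \<in> idx ` clusters" using idx by (auto simp: bij_betw_def)
  then have "dat r \<in> clusters" unfolding dat_def by (rule inv_into_into)
  then show ?thesis using cluster_run[of "fst (dat r)" "fst (snd (dat r))" "snd (snd (dat r))"]
    by (auto simp: am_def is_run_def)
qed (auto simp: am_def)

lemma am_pos: "0 < r \<Longrightarrow> r \<le> card clusters \<Longrightarrow> am r \<ge> 1"
proof -
  assume r: "0 < r" "r \<le> card clusters"
  then have "r - 1 \<in> idx ` clusters" using idx by (auto simp: bij_betw_def)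
  then have "dat r \<in> clusters" unfolding dat_def by (rule inv_into_into)
  then show ?thesis using cluster_run[of "fst (dat r)" "fst (snd (dat r))" "snd (snd (dat r))"] r
    by (auto simp: am_def is_run_def)
qed

lemma am_le: "am r \<le> int b"
proof (cases "0 < r \<and> r \<le> card clusters")
  case True
  then have "nat (am r) \<le> (\<Sum>r\<in>{1..card clusters}. nat (am r))" by (intro member_le_sum) auto
  then show ?thesis using cost_bound few by linarith
qed (auto simp: am_def)

text \<open>Runs are not empty, so each class uses up at least one unit of the budget. With
  \<open>card_clusters\<close> this is the origin of the digit bound \<open>min b k\<close>.\<close>

lemma clusters_le: "card clusters \<le> b"
proof -
  have "card clusters = (\<Sum>r\<in>{1..card clusters}. 1)" by simp
  also have "\<dots> \<le> (\<Sum>r\<in>{1..card clusters}. nat (am r))"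
  proof (rule sum_mono)
    fix r assume "r \<in> {1..card clusters}"
    then show "1 \<le> nat (am r)" using am_pos[of r] by simp
  qed
  finally show ?thesis using cost_bound few by linarith
qed

lemma cl_le: "cl c \<le> b \<and> cl c \<le> k"
proof (cases "member c")
  case True
  then show ?thesis using member_cluster(4)[OF True] clusters_le card_clusters by linarith
qed (simp add: cl_nonmember)

text \<open>The entry edge alone crosses this many thresholds. Other than in
  \<open>cost_bound\<close> both directions count here, as the guess must also represent lowered
  entries.\<close>

lemma del_abs: "\<bar>del c\<bar> \<le> int b"
proof (cases "boarded c")
  case True
  let ?lo = "min (L (ps c)) (LB (ps c)) - int (ps c)" and ?hi = "max (L (ps c)) (LB (ps c)) - int (ps c)"
  have "{c} \<times> {?lo..<?hi} \<subseteq> changed LB L"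
  proof
    fix q assume "q \<in> {c} \<times> {?lo..<?hi}"
    then obtain l where q: "q = (c, l)" "l \<in> {?lo..<?hi}" by auto
    then have "(l < LB (ps c) - int (ps c)) \<noteq> (l < L (ps c) - int (ps c))" by auto
    then show "q \<in> changed LB L" using boardedD[OF True] q(1) changedI by blast
  qed
  then have "card ({c} \<times> {?lo..<?hi}) \<le> b" using card_mono[OF fin] few le_trans by blast
  then have "nat (?hi - ?lo) \<le> b" by (simp add: card_cartesian_product_singleton)
  then show ?thesis using True by (auto simp: del_def)
qed (simp add: del_def)

section \<open>Earlier entry into the parent keeps the classes feasible\<close>

lemma bl_eq: "boarded c \<Longrightarrow> LB (ps c) + del c = L (ps c)"
  by (simp add: del_def)

lemma bs_ge:
  assumes "boarded j" "PS j \<le> p" "p \<le> ps j"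
  shows "blev del p j \<le> bs j"
proof -
  have "p \<in> seg j" using assms boardedD[of j] by auto
  then have "LB p - int p \<le> LB (ps j) - int (ps j)"
    using ascendingD[OF ascending_LB, of j p "ps j"] boardedD[of j] assms by simp
  then show ?thesis using assms(1) by (simp add: blev_def bs_def del_def)
qed

text \<open>The top level to be used if the parent is entered at \<open>p\<close>: the one of the
  solution where an offset of at most \<open>b\<close> reaches it, and otherwise the first feasible
  one.\<close>

definition hsel :: "nat \<Rightarrow> nat \<Rightarrow> int" where
  "hsel c p = (if cl c = 0 then blev del p (par c)
     else let h = first_feas par cl del am p (par c) (cl c); H = snd (run c)
       in if H \<le> h + int b then H else h)"

text \<open>Entry, exit and run of the solution remain a witness for every earlier \<open>p\<close>:
  only the base level depends on \<open>p\<close>, and it stays at or below the bottom of the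
  run.\<close>

lemma member_feas:
  assumes m: "member c" and p: "PS (par c) \<le> p" "p \<le> ps (par c)"
  defines "j \<equiv> par c"
  shows "paid del (blev del p j) (am (cl c)) (snd (run c)) c (ps c) (ex c)"
    "blev del p j \<le> fst (run c)" "lvl (blev del p j) (ex c) = LB (ex c) - int (ex c)"
proof -
  have c: "boarded c" "j < k" "L (ps c) \<le> lvl (bs j) (ex c) + int (ex c)"
    using m by (auto simp: member_def j_def)
  note pb = par_boarded[OF c(1) c(2)[unfolded j_def], folded j_def]
  note mi = member_interval[OF m, folded j_def]
  have B: "blev del p j \<le> bs j" using bs_ge[of j p] pb p by (simp add: j_def)
  show B2: "blev del p j \<le> fst (run c)" using B run_ge[OF m] j_def by simp
  have lv: "lvl (bs j) (ex c) = LB (ex c) - int (ex c)" using mi by (auto simp: lvl_def)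
  show lv2: "lvl (blev del p j) (ex c) = LB (ex c) - int (ex c)" using mi B by (auto simp: lvl_def)
  show "paid del (blev del p j) (am (cl c)) (snd (run c)) c (ps c) (ex c)"
    unfolding paid_def lv2
    using pb run[OF m] c(3) lv B2 bl_eq[OF c(1)] member_cluster(5)[OF m] by auto
qed

lemma cluster_feas:
  assumes m: "member c" and p: "PS (par c) \<le> p" "p \<le> ps (par c)"
  shows "feas par cl del am p (par c) (cl c) (snd (run c))"
  unfolding feas_def
proof (intro allI impI)
  fix d assume d: "d < k" "par d = par c \<and> cl d = cl c"
  have md: "member d" using member_cluster(3)[OF m] d cl_nonmember[of d] by fastforce
  have rd: "run d = run c" using cl_eq[of d c] d member_cluster(3)[OF m] by simp
  have bd: "boarded d" "par d < k" using md by (auto simp: member_def)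
  have 1: "ps d \<in> seg d" using boardedD[OF bd(1)] by simp
  have 2: "ex d \<in> {p..<PS (Suc (par c))}" using par_boarded[OF bd] p d by auto
  show "\<exists>x\<in>seg d. \<exists>z\<in>{p..<PS (Suc (par c))}. paid del (blev del p (par c)) (am (cl c)) (snd (run c)) d x z"
    using member_feas(1)[OF md] p d rd 1 2 by metis
qed

lemma first_feas_member:
  assumes m: "member c" and p: "PS (par c) \<le> p" "p \<le> ps (par c)"
  defines "h \<equiv> first_feas par cl del am p (par c) (cl c)"
  shows "feas par cl del am p (par c) (cl c) h" "h \<le> snd (run c)"
  using first_feas_le[OF _ p(1) _ refl refl cluster_feas[OF m p]] m
  by (auto simp: h_def member_def boarded_def)

text \<open>The early exit of \<open>c\<close> at level at most \<open>h\<close> needs the advance, so it cannot lead to a later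
  position on \<open>c\<close> than an exit at a level above \<open>h\<close>: otherwise it would be free.\<close>

lemma ex_boarding:
  assumes c: "boarded c" and p: "if par c = k then p = PS k else PS (par c) \<le> p \<and> p \<le> ps (par c)"
  shows "\<exists>x\<le>ps c. boards par del (am (cl c)) p c (hsel c p) x"
proof (cases "par c = k")
  case True
  then have nm: "\<not> member c" by (auto simp: member_def)
  have nb: "\<not> boarded k" by (simp add: boarded_def)
  have psk: "ps c < PS k" using usable_less boardedD(3)[OF c] by blast
  have "p = PS k" using p True by simp
  then have "elev (blev del p (par c)) (am (cl c)) (hsel c p) p = LB p - int p"
    using nm nb True by (auto simp: elev_def lvl_def hsel_def cl_def blev_def del_def am_def)
  \<comment> \<open>The gap of more than \<open>b\<close> below all labels outweighs an entry
    change, which is at least \<open>- int b\<close>.\<close>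
  moreover have "LB p < LB (ps c) + del c"
    using LB_src[OF psk] del_abs[of c] \<open>p = PS k\<close> by auto
  ultimately have "boards par del (am (cl c)) p c (hsel c p) (ps c)"
    unfolding boards_def using \<open>p = PS k\<close> True par_src[OF c True] HV_src PS_Suc_k boardedD[OF c]
    by (intro conjI bexI[of _ p]) auto
  then show ?thesis by blast
next
  case False
  define j where "j = par c"
  have jk: "j < k" using False par_le boardedD(1)[OF c] by (auto simp: j_def le_less)
  have p': "PS j \<le> p" "p \<le> ps j" using p False by (auto simp: j_def)
  define B where "B = blev del p j"
  note pb = par_boarded[OF c, folded j_def, OF jk]
  have z: "ex c \<in> {p..<PS (Suc j)}" using pb p' by auto
  have Bb: "B \<le> bs j" using bs_ge[of j p] pb p' by (simp add: B_def)
  show ?thesis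
  proof (cases "member c")
    case nm: False
    \<comment> \<open>Here the exit is early enough after the delay alone, and an earlier entry into
      the parent can only lower its delayed level.\<close>
    then have "lvl (bs j) (ex c) + int (ex c) < L (ps c)" using c jk by (auto simp: member_def j_def)
    moreover have "lvl B (ex c) \<le> lvl (bs j) (ex c)" using Bb by (auto simp: lvl_def)
    moreover have "elev B a h y \<le> lvl B y" for a h y by (auto simp: elev_def)
    ultimately have "elev B (am (cl c)) (hsel c p) (ex c) + int (ex c) < LB (ps c) + del c"
      using bl_eq[OF c] by (smt (verit))
    then have "boards par del (am (cl c)) p c (hsel c p) (ps c)"
      unfolding boards_def using z pb boardedD[OF c] by (auto simp: B_def j_def)
    then show ?thesis by blast
  next
    case m: True
    let ?h = "first_feas par cl del am p j (cl c)"
    have mp: "PS (par c) \<le> p" "p \<le> ps (par c)" using p' by (auto simp: j_def)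
    note mf = member_feas[OF m mp, folded j_def B_def]
    note ff = first_feas_member[OF m mp, folded j_def]
    have lo: "am (cl c) = snd (run c) - fst (run c)" using member_cluster(5)[OF m] .
    have nz: "cl c \<noteq> 0" using member_cluster(3)[OF m] by simp
    show ?thesis
    proof (cases "snd (run c) \<le> ?h + int b")
      case True
      then have hs: "hsel c p = snd (run c)" using nz by (simp add: hsel_def j_def Let_def)
      have "boards par del (am (cl c)) p c (hsel c p) (ps c)"
        unfolding boards_def hs using mf z pb boardedD[OF c]
        by (auto simp: paid_def elev_def B_def j_def)
      then show ?thesis by blast
    next
      case F: False
      then have hs: "hsel c p = ?h" using nz by (simp add: hsel_def j_def Let_def)
      obtain x y where xy: "x \<in> seg c" "y \<in> {p..<PS (Suc j)}" "paid del B (am (cl c)) ?h c x y"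
        using ff(1) boardedD(1)[OF c] unfolding feas_def B_def[symmetric] by (auto simp: j_def)
      have "boards par del (am (cl c)) p c (hsel c p) x"
        unfolding boards_def hs using xy by (auto simp: paid_def elev_def B_def j_def)
      moreover have "x \<le> ps c"
      proof (rule ccontr)
        assume "\<not> x \<le> ps c"
        then have "LB (ps c) \<le> LB x - (int x - int (ps c))" 
          using ascendingD[OF ascending_LB, of c "ps c" x] boardedD[OF c] xy(1) by simp
        then have 1: "L (ps c) < LB x + del c" using bl_eq[OF c] \<open>\<not> x \<le> ps c\<close> by linarith
        \<comment> \<open>A run has length at most \<open>b\<close>. If its top is more than
          \<open>b\<close> above \<open>?h\<close>, its bottom is above \<open>?h\<close> as
          well.\<close>
        have hlo: "?h < fst (run c)" using F lo am_le[of "cl c"] by linarith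
        have 2: "LB x + del c \<le> ?h + int y" using xy(3) by (auto simp: paid_def)
        have 3: "fst (run c) + int (ex c) < L (ps c)" using run[OF m] pb by linarith
        \<comment> \<open>So \<open>y\<close> lies behind \<open>ex c\<close> on the same path and
          has level at most \<open>?h\<close>. But the original level of \<open>ex c\<close> exceeds
          the bottom of the run, hence \<open>?h\<close>, and levels ascend.\<close>
        have "ex c < y" using 1 2 3 hlo by linarith
        then have "lvl B (ex c) \<le> lvl B y" using xy(2) pb z p' jk by (intro lvl_mono[of j]) auto
        then show False using xy(3) hlo mf(3) run[OF m] member_interval(2)[OF m]
          by (auto simp: paid_def B_def)
      qed
      ultimately show ?thesis by blast
    qed
  qed
qed

text \<open>The offsets depend on the positions, which depend on the offsets of the clusters closer to the
  source. The positions are therefore first defined with the offsets replaced by their effect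
  \<open>hsel\<close>.\<close>

fun gpos :: "nat \<Rightarrow> nat \<Rightarrow> nat" where
  "gpos 0 c = P0 c"
| "gpos (Suc n) c = (if c = k then PS k else
     entry par del (am (cl c)) (gpos n (par c)) c (hsel c (gpos n (par c))))"

lemma gpos_k: "gpos n k = PS k"
  by (cases n) (auto simp: P0_def)

text \<open>Recursion beyond the rank of \<open>c\<close> changes nothing. As ranks are below
  \<open>k\<close>, depth \<open>k\<close> turns the recursion into the fixed point equation
  \<open>gp_eq\<close>.\<close>

lemma gpos_stable: "boarded c \<Longrightarrow> dep c < n \<Longrightarrow> gpos (Suc n) c = gpos n c"
proof (induction n arbitrary: c)
  case (Suc n)
  have "gpos (Suc n) (par c) = gpos n (par c)"
  proof (cases "par c < k")
    case True
    have "dep (par c) < n" using dep_par[OF Suc.prems(1) True] Suc.prems(2) by simp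
    then show ?thesis using Suc.IH par_boarded[OF Suc.prems(1) True] by blast
  next
    case False
    then have "par c = k" using par_le boardedD(1)[OF Suc.prems(1)] by (simp add: le_antisym not_less)
    then show ?thesis by (simp only: gpos_k)
  qed
  then show ?case by (metis gpos.simps(2))
qed simp

definition gp :: "nat \<Rightarrow> nat" where "gp = gpos k"

lemma gp_eq:
  assumes "boarded c"
  shows "gp c = entry par del (am (cl c)) (gp (par c)) c (hsel c (gp (par c)))"
proof -
  have "gp c = gpos (Suc k) c" unfolding gp_def using gpos_stable[OF assms dep_less[OF assms]] by simp
  then show ?thesis using boardedD(1)[OF assms] by (simp add: gp_def)
qed

text \<open>Induction on the rank: the bound for the parent is the hypothesis of
  \<open>ex_boarding\<close>, whose result bounds the greedy entry because that is the least
  possible one.\<close>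

lemma gp_le: "boarded c \<Longrightarrow> PS c \<le> gp c \<and> gp c \<le> ps c \<and>
   boards par del (am (cl c)) (gp (par c)) c (hsel c (gp (par c))) (gp c)"
proof (induction "dep c" arbitrary: c rule: less_induct)
  case less
  have "if par c = k then gp (par c) = PS k else PS (par c) \<le> gp (par c) \<and> gp (par c) \<le> ps (par c)"
  proof (cases "par c = k")
    case True
    then show ?thesis using gpos_k by (simp add: gp_def)
  next
    case False
    then have lt: "par c < k" using par_le[OF boardedD(1)[OF less.prems]] by simp
    then show ?thesis using less.hyps[OF dep_par[OF less.prems lt]] par_boarded[OF less.prems lt] False
      by simp
  qed
  from ex_boarding[OF less.prems this] obtain x where
    x: "x \<le> ps c" "boards par del (am (cl c)) (gp (par c)) c (hsel c (gp (par c))) x" by blast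
  have "gp c \<le> x" unfolding gp_eq[OF less.prems] by (rule entry_le[OF x(2)])
  moreover have "boards par del (am (cl c)) (gp (par c)) c (hsel c (gp (par c))) (gp c)"
    using entry_boards[OF x(2)] gp_eq[OF less.prems] by simp
  moreover from this have "PS c \<le> gp c" by (simp add: boards_def)
  ultimately show ?case using x(1) by simp
qed

text \<open>All members of a class share parent and run, so the offset can be read off
  \<open>dat r\<close> without choosing a member. It reproduces the choice made in
  \<open>hsel\<close>.\<close>

definition ofs :: "nat \<Rightarrow> int" where
  "ofs r = (if 0 < r \<and> r \<le> card clusters then
     (let j = fst (dat r); h = first_feas par cl del am (gp j) j r; H = snd (snd (dat r))
      in if h \<le> H \<and> H \<le> h + int b then H - h else 0) else 0)"

lemma ofs_range: "0 \<le> ofs r \<and> ofs r \<le> int b"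
  by (auto simp: ofs_def Let_def)

lemma hi_of_gp:
  assumes "boarded c"
  shows "hi_of par cl del am ofs (gp (par c)) c = hsel c (gp (par c))"
proof (cases "member c")
  case True
  have lt: "par c < k" using True by (simp add: member_def)
  have "PS (par c) \<le> gp (par c)" "gp (par c) \<le> ps (par c)"
    using gp_le par_boarded[OF assms lt] by auto
  note ff = first_feas_member(2)[OF True this]
  note mc = member_cluster[OF True]
  show ?thesis using ff mc(2-4) by (auto simp: hi_of_def hsel_def ofs_def Let_def)
next
  case False
  then have "first_feas par cl del am (gp (par c)) (par c) (cl c) = blev del (gp (par c)) (par c)"
    using boardedD(1)[OF assms] by (intro first_feas_trivial[of c]) (auto simp: cl_nonmember am_def)
  then show ?thesis using False by (simp add: hi_of_def hsel_def cl_nonmember ofs_def)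
qed

lemma newp_gp: "boarded c \<Longrightarrow> newp par cl del am ofs (gp (par c)) c = gp c"
  unfolding newp_def hi_of_gp using gp_eq by simp

text \<open>Updates are made in place, so some paths see the new and others the old entry of their
  parent. For rank at most \<open>n\<close> both agree, since the parent has rank below
  \<open>n\<close> and is final already.\<close>

lemma fold_proc_gp:
  assumes P: "\<And>c. boarded c \<Longrightarrow> dep c < n \<Longrightarrow> P c = gp c" "P k = PS k" and i: "i \<le> k"
  defines "Q \<equiv> foldl (proc par cl del am ofs) P [0..<i]"
  shows "Q k = PS k \<and> (\<forall>c. boarded c \<longrightarrow> dep c < n \<or> c < i \<and> dep c \<le> n \<longrightarrow> Q c = gp c)"
  using i unfolding Q_def
proof (induction i)
  case (Suc i)
  let ?Q = "foldl (proc par cl del am ofs) P [0..<i]"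
  have IH: "?Q k = PS k" "\<And>c. boarded c \<Longrightarrow> dep c < n \<or> c < i \<and> dep c \<le> n \<Longrightarrow> ?Q c = gp c"
    using Suc by auto
  have "newp par cl del am ofs (?Q (par i)) i = gp i" if "boarded i" "dep i \<le> n"
  proof (cases "par i < k")
    case True
    then have "?Q (par i) = gp (par i)" using IH(2) dep_par[OF that(1) True] par_boarded[OF that(1) True] that(2)
      by simp
    then show ?thesis using newp_gp[OF that(1)] by simp
  next
    case False
    then have "par i = k" using par_le Suc.prems by (simp add: le_antisym not_less)
    then have "?Q (par i) = gp (par i)" using IH(1) gpos_k by (simp add: gp_def)
    then show ?thesis using newp_gp[OF that(1)] by simp
  qed
  then show ?case using IH Suc.prems by (auto simp: proc_def[of par cl del am ofs ?Q i] less_Suc_eq)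
qed (use P in auto)

lemma rounds_gp:
  "((round par cl del am ofs ^^ n) P0) k = PS k \<and>
   (\<forall>c. boarded c \<longrightarrow> dep c < n \<longrightarrow> ((round par cl del am ofs ^^ n) P0) c = gp c)"
proof (induction n)
  case (Suc n)
  then show ?case
    using fold_proc_gp[of n "(round par cl del am ofs ^^ n) P0" k] boardedD(1)
    by (auto simp: round_def[of par cl del am ofs "(round par cl del am ofs ^^ n) P0"] less_Suc_eq_le)
qed (simp add: P0_def)

lemma positions_gp: "boarded c \<Longrightarrow> positions par cl del am ofs c = gp c"
  using rounds_gp[of k] dep_less unfolding positions_def by blast

section \<open>Comparison of the generated labels with the given ones\<close>

definition out :: "(nat \<Rightarrow> int) \<times> shift_op list" where
  "out = foldl (astep par cl del am ofs (positions par cl del am ofs))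
     (dstage del (positions par cl del am ofs)) [0..<k]"

lemma out_facts:
  defines "P \<equiv> positions par cl del am ofs"
  shows "\<And>c y. c < k \<Longrightarrow> y \<in> {P c..<PS (Suc c)} \<Longrightarrow> blev del (P c) c \<le> fst out y - int y"
    and "\<And>c y. c < k \<Longrightarrow> par c < k \<Longrightarrow> y \<in> {P (par c)..<PS (Suc (par c))} \<Longrightarrow> fst out y - int y \<le>
       elev (blev del (P (par c)) (par c)) (am (cl c)) (hi_of par cl del am ofs (P (par c)) c) y"
    and "shifts_cost (snd out) \<le> b"
    and "(\<forall>c<k. cl c = 0) \<Longrightarrow> out = dstage del P"
    and "ascending (fst out)"
proof -
  have "(\<Sum>r\<in>cl ` {..<k} - {0}. nat (am r)) \<le> (\<Sum>r\<in>{1..card clusters}. nat (am r))"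
  proof (rule sum_mono2)
    show "cl ` {..<k} - {0} \<subseteq> {1..card clusters}"
          proof
      fix r assume "r \<in> cl ` {..<k} - {0}"
      then obtain c where "r = cl c" "r \<noteq> 0" by blast
      then show "r \<in> {1..card clusters}" using member_cluster(4)[of c] cl_nonmember[of c]
        by (cases "member c") auto
    qed
  qed auto
  moreover have "shifts_cost (snd (dstage del P)) \<le> (\<Sum>c<k. nat (del c))"
    using foldl_dstep[OF ranged_positions order_refl] unfolding dstage_def P_def by blast
  moreover have inj: "\<And>c d. c < k \<Longrightarrow> d < k \<Longrightarrow> cl c = cl d \<Longrightarrow> cl c \<noteq> 0 \<Longrightarrow> par c = par d"
    using cl_eq by blast
  have z: "am 0 = 0" "ofs 0 = 0" by (auto simp: am_def ofs_def)
  have rP: "ranged P" unfolding P_def by (rule ranged_positions)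
  note op = foldl_astep[where P = P and par = par and cl = cl and am = am and ofs = ofs and i = k
      and del = del, OF rP inj z am_ge order_refl]
  have out: "out = foldl (astep par cl del am ofs P) (dstage del P) [0..<k]"
    by (simp add: out_def P_def)
  show "\<And>c y. c < k \<Longrightarrow> y \<in> {P c..<PS (Suc c)} \<Longrightarrow> blev del (P c) c \<le> fst out y - int y"
    and "\<And>c y. c < k \<Longrightarrow> par c < k \<Longrightarrow> y \<in> {P (par c)..<PS (Suc (par c))} \<Longrightarrow> fst out y - int y \<le>
       elev (blev del (P (par c)) (par c)) (am (cl c)) (hi_of par cl del am ofs (P (par c)) c) y"
    and "(\<forall>c<k. cl c = 0) \<Longrightarrow> out = dstage del P"
    and "ascending (fst out)"
    using op sound_ascending unfolding out[symmetric] by blast+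
  have "shifts_cost (snd out) \<le> shifts_cost (snd (dstage del P)) + (\<Sum>r\<in>cl ` {..<k} - {0}. nat (am r))"
    using op unfolding out[symmetric] by blast
  with calculation show "shifts_cost (snd out) \<le> b" using cost_bound few by linarith
qed

text \<open>The exit has the ceiling \<open>elev\<close> and the entry edge the floor
  \<open>blev\<close>; \<open>boards\<close> compares exactly these two, so the transfer works
  whatever the other shifts do.\<close>

lemma out_usable_gp: "boarded c \<Longrightarrow> usable (fst out) (gp c)"
proof (induction "dep c" arbitrary: c rule: less_induct)
  case less
  note c = less.prems
  have ck: "c < k" using boardedD(1)[OF c] .
  note g = gp_le[OF c]
  have gc: "gp c \<in> seg c" using g by (auto simp: boards_def)
  have gk: "gp c < PS k" using seg_le[OF ck gc] .
  obtain z where z: "z \<in> {gp (par c)..<PS (Suc (par c))}" "HV z = TV (gp c)"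
    "elev (blev del (gp (par c)) (par c)) (am (cl c)) (hsel c (gp (par c))) z + int z < LB (gp c) + del c"
    using g by (auto simp: boards_def)
  show ?case
  proof (cases "par c < k")
    case True
    note pb = par_boarded[OF c True]
    have pos: "positions par cl del am ofs (par c) = gp (par c)" "positions par cl del am ofs c = gp c"
      using positions_gp pb c by auto
    have "fst out z - int z \<le> elev (blev del (gp (par c)) (par c)) (am (cl c)) (hsel c (gp (par c))) z"
      using out_facts(2)[OF ck True] z(1) pos(1) hi_of_gp[OF c] by simp
    moreover have "blev del (gp c) c \<le> fst out (gp c) - int (gp c)"
      using out_facts(1)[OF ck, of "gp c"] gc pos by simp
    ultimately have lt: "fst out z < fst out (gp c)" using z(3) by (simp add: blev_def)
    have "usable (fst out) (gp (par c))" using less.hyps[OF dep_par[OF c True]] pb by simp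
    moreover have "gp (par c) \<in> seg (par c)" using gp_le pb z(1) by fastforce
    moreover have "z \<in> seg (par c)" using gp_le pb z(1) by fastforce
    ultimately have "usable (fst out) z"
      using usable_later[OF out_facts(5) True] z(1) by auto
    then show ?thesis using usable_step gk z(2) lt by blast
  next
    case False
    then have pk: "par c = k" using par_le[OF ck] by simp
    then have "z = PS k" using z(1) gpos_k PS_Suc_k by (simp add: gp_def)
    then show ?thesis using usable_start[OF gk] z(2) HV_src by simp
  qed
qed

lemma out_usable: "usable L x \<Longrightarrow> usable (fst out) x"
proof -
  assume x: "usable L x"
  then obtain c where c: "c < k" "x \<in> seg c" using seg_ex[of x k] usable_less by auto
  then have b: "boarded c" "ps c \<le> x" using x ps_le by (auto simp: boarded_def)
  have "gp c \<in> seg c" using gp_le[OF b(1)] by (auto simp: boards_def)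
  then show ?thesis using usable_later[OF out_facts(5) c(1) out_usable_gp[OF b(1)] _ c(2)] gp_le[OF b(1)] b(2)
    by simp
qed

lemma dstage_trivial: "(\<And>c. del c \<le> 0) \<Longrightarrow> dstage del P = (LB, [])"
proof -
  assume d: "\<And>c. del c \<le> 0"
  have "foldl (dstep del P) (LB, []) [0..<i] = (LB, [])" for i
    using d by (induction i) (auto simp: dstep_def Let_def not_less)
  then show ?thesis by (simp add: dstage_def)
qed

text \<open>In the one-sided problems the omitted stage would be idle: with delays only there is no
  member and every class is 0, with advances only no entry change is positive.\<close>

lemma gen_out:
  assumes "X = MR_DP \<Longrightarrow> \<forall>y. LB y \<le> L y" "X = MR_AP \<Longrightarrow> \<forall>y. L y \<le> LB y"
  shows "gen X par cl del am ofs = out"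
proof (cases X)
  case MR_DP
  have "\<not> member c" for c using member_interval(2)[of c] assms(1)[OF MR_DP] by (metis not_less)
  then have "out = dstage del (positions par cl del am ofs)" using out_facts(4) cl_nonmember by blast
  then show ?thesis using MR_DP by (simp add: gen_def Let_def)
next
  case MR_AP
  have "del c \<le> 0" for c using assms(2)[OF MR_AP] by (simp add: del_def)
  then show ?thesis using MR_AP dstage_trivial by (simp add: gen_def Let_def out_def)
next
  case MR_SP
  then show ?thesis by (simp add: gen_def Let_def out_def)
qed

end

context flat_instance
begin

text \<open>The ranges, and the zeros outside the index range, are those of the digits enumerated by
  the program, so that decoding recovers this very guess.\<close>

theorem ex_guess:
  assumes "ops_ok ys" "\<forall>x\<in>set ys. allowed_op X x" "shifts_cost ys \<le> b"
  shows "\<exists>par cl del am ofs.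
    (\<forall>c<k. par c \<le> k \<and> cl c \<le> min b k \<and> \<bar>del c\<bar> \<le> int b) \<and>
    (\<forall>c\<ge>k. par c = 0 \<and> cl c = 0 \<and> del c = 0) \<and>
    (\<forall>r. 0 \<le> am r \<and> am r \<le> int b \<and> 0 \<le> ofs r \<and> ofs r \<le> int b) \<and>
    (\<forall>r. r = 0 \<or> r > k \<longrightarrow> am r = 0 \<and> ofs r = 0) \<and>
    shifts_cost (snd (gen X par cl del am ofs)) \<le> b \<and>
    (\<forall>x. usable (fapply ys) x \<longrightarrow> usable (fst (gen X par cl del am ofs)) x)"
proof -
  interpret target_labels k b PS TV HV LB s "fapply ys"
    using fapply_props[OF assms(1)] assms(3) by unfold_locales auto
  have g: "gen X par cl del am ofs = out"
    by (rule gen_out) (use fapply_delay fapply_advance assms in auto)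
  have nb: "\<not> boarded c" "\<not> member c" if "c \<ge> k" for c using that by (auto simp: boarded_def member_def)
  have 1: "\<forall>c<k. par c \<le> k \<and> cl c \<le> min b k \<and> \<bar>del c\<bar> \<le> int b"
    using par_le cl_le del_abs by simp
  have 2: "\<forall>c\<ge>k. par c = 0 \<and> cl c = 0 \<and> del c = 0"
    using nb by (simp add: par_def cl_def del_def)
  have 3: "\<forall>r. 0 \<le> am r \<and> am r \<le> int b \<and> 0 \<le> ofs r \<and> ofs r \<le> int b"
    using am_ge am_le ofs_range by simp
  have 4: "\<forall>r. r = 0 \<or> r > k \<longrightarrow> am r = 0 \<and> ofs r = 0"
    using card_clusters by (simp add: am_def ofs_def)
  have 5: "shifts_cost (snd (gen X par cl del am ofs)) \<le> b" using g out_facts(3) by simp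
  have 6: "\<forall>x. usable (fapply ys) x \<longrightarrow> usable (fst (gen X par cl del am ofs)) x"
    using g out_usable by simp
  show ?thesis using 1 2 3 4 5 6 by blast
qed

end

section \<open>Programs with counted loops\<close>

text \<open>In \<open>tb\<close> and \<open>wp\<close> the number \<open>n\<close> bounds the iterations of every loop. A proof of \<open>wp c n Q \<sigma>\<close>
  thus yields total correctness together with a running time polynomial in \<open>n\<close>.\<close>

primrec tb :: "nat \<Rightarrow> ram_com \<Rightarrow> nat" where
  "tb n Skip = 1"
| "tb n (Assign r a) = 1 + exp_cost a"
| "tb n (Store a v) = 1 + exp_cost a + exp_cost v"
| "tb n (Seq c d) = tb n c + tb n d"
| "tb n (IfPos a c d) = 1 + exp_cost a + tb n c + tb n d"
| "tb n (WhilePos a c) = (n + 1) * (1 + exp_cost a + tb n c)"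

primrec wp :: "ram_com \<Rightarrow> nat \<Rightarrow> (ram_state \<Rightarrow> bool) \<Rightarrow> ram_state \<Rightarrow> bool" where
  "wp Skip n Q \<sigma> = Q \<sigma>"
| "wp (Assign r a) n Q \<sigma> = Q ((fst \<sigma>)(r := ram_eval a \<sigma>), snd \<sigma>)"
| "wp (Store a v) n Q \<sigma> = Q (fst \<sigma>, (snd \<sigma>)(ram_eval a \<sigma> := ram_eval v \<sigma>))"
| "wp (Seq c d) n Q \<sigma> = wp c n (wp d n Q) \<sigma>"
| "wp (IfPos a c d) n Q \<sigma> = (if ram_eval a \<sigma> > 0 then wp c n Q \<sigma> else wp d n Q \<sigma>)"
| "wp (WhilePos a c) n Q \<sigma> =
     (\<exists>l\<le>n. ((\<lambda>R \<sigma>. ram_eval a \<sigma> > 0 \<and> wp c n R \<sigma>) ^^ l) (\<lambda>\<sigma>. \<not> ram_eval a \<sigma> > 0 \<and> Q \<sigma>) \<sigma>)"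

lemma wp_mono: "wp c n Q \<sigma> \<Longrightarrow> (\<And>\<tau>. Q \<tau> \<Longrightarrow> Q' \<tau>) \<Longrightarrow> wp c n Q' \<sigma>"
proof (induction c arbitrary: Q Q' \<sigma>)
  case (Seq c d)
  have "wp c n (wp d n Q) \<sigma>" using Seq.prems(1) by simp
  then have "wp c n (wp d n Q') \<sigma>"
    by (rule Seq.IH(1)) (rule Seq.IH(2), assumption, rule Seq.prems(2))
  then show ?case by simp
next
  case (WhilePos a c)
  let ?F = "\<lambda>R \<sigma>. ram_eval a \<sigma> > 0 \<and> wp c n R \<sigma>"
  have mono: "(?F ^^ l) R \<sigma> \<Longrightarrow> (\<And>\<tau>. R \<tau> \<Longrightarrow> R' \<tau>) \<Longrightarrow> (?F ^^ l) R' \<sigma>" for l R R' \<sigma>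
  proof (induction l arbitrary: \<sigma>)
    case (Suc l)
    then show ?case using WhilePos.IH[of "(?F ^^ l) R" \<sigma> "(?F ^^ l) R'"] by simp
  qed simp
  from WhilePos.prems(1) obtain l where "l \<le> n"
    "(?F ^^ l) (\<lambda>\<sigma>. \<not> ram_eval a \<sigma> > 0 \<and> Q \<sigma>) \<sigma>" by auto
  moreover from this(2) have "(?F ^^ l) (\<lambda>\<sigma>. \<not> ram_eval a \<sigma> > 0 \<and> Q' \<sigma>) \<sigma>"
    by (rule mono) (use WhilePos.prems(2) in blast)
  ultimately show ?case by auto
qed (auto split: if_splits)

lemma wp_exec: "wp c n Q \<sigma> \<Longrightarrow> \<exists>t \<tau>. ram_exec c \<sigma> t \<tau> \<and> t \<le> tb n c \<and> Q \<tau>"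
proof (induction c arbitrary: Q \<sigma>)
  case Skip
  then have "ram_exec Skip \<sigma> 1 \<sigma> \<and> 1 \<le> tb n Skip \<and> Q \<sigma>"
    using ram_exec.Skip[of \<sigma>] by simp
  then show ?case by blast
next
  case (Assign r a)
  then show ?case unfolding wp.simps tb.simps using ram_exec.Assign[of r a \<sigma>] by blast
next
  case (Store a v)
  then show ?case unfolding wp.simps tb.simps using ram_exec.Store[of a v \<sigma>] by blast
next
  case (Seq c d)
  from Seq.prems have "wp c n (wp d n Q) \<sigma>" by simp
  from Seq.IH(1)[OF this] obtain t \<rho> where 1: "ram_exec c \<sigma> t \<rho>" "t \<le> tb n c" "wp d n Q \<rho>" by blast
  from Seq.IH(2)[OF this(3)] obtain u \<tau> where 2: "ram_exec d \<rho> u \<tau>" "u \<le> tb n d" "Q \<tau>" by blast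
  have "ram_exec (Seq c d) \<sigma> (t + u) \<tau>" using 1 2 by (blast intro: ram_exec.Seq)
  moreover have "t + u \<le> tb n (Seq c d)" using 1 2 by simp
  ultimately show ?case using 2 by blast
next
  case (IfPos a c d)
  show ?case
  proof (cases "ram_eval a \<sigma> > 0")
    case True
    then have "wp c n Q \<sigma>" using IfPos.prems by simp
    from IfPos.IH(1)[OF this] obtain t \<tau> where "ram_exec c \<sigma> t \<tau>" "t \<le> tb n c" "Q \<tau>" by blast
    moreover have "ram_exec (IfPos a c d) \<sigma> (1 + exp_cost a + t) \<tau>"
      using ram_exec.IfTrue[OF True] calculation by blast
    moreover have "1 + exp_cost a + t \<le> tb n (IfPos a c d)" using calculation by simp
    ultimately show ?thesis by blast
  next
    case False
    then have "wp d n Q \<sigma>" using IfPos.prems by simp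
    from IfPos.IH(2)[OF this] obtain t \<tau> where "ram_exec d \<sigma> t \<tau>" "t \<le> tb n d" "Q \<tau>" by blast
    moreover have "ram_exec (IfPos a c d) \<sigma> (1 + exp_cost a + t) \<tau>"
      using ram_exec.IfFalse[OF False] calculation by blast
    moreover have "1 + exp_cost a + t \<le> tb n (IfPos a c d)" using calculation by simp
    ultimately show ?thesis by blast
  qed
next
  case (WhilePos a c)
  let ?F = "\<lambda>R \<sigma>. ram_eval a \<sigma> > 0 \<and> wp c n R \<sigma>"
  have "(?F ^^ l) (\<lambda>\<sigma>. \<not> ram_eval a \<sigma> > 0 \<and> Q \<sigma>) \<sigma> \<Longrightarrow>
      \<exists>t \<tau>. ram_exec (WhilePos a c) \<sigma> t \<tau> \<and> t \<le> (l + 1) * (1 + exp_cost a + tb n c) \<and> Q \<tau>" for l \<sigma>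
  proof (induction l arbitrary: \<sigma>)
    case 0
    then have "ram_exec (WhilePos a c) \<sigma> (1 + exp_cost a) \<sigma>" "Q \<sigma>"
      using ram_exec.WhileFalse[of a \<sigma> c] by simp_all
    then show ?case by (intro exI[of _ "1 + exp_cost a"] exI[of _ \<sigma>]) simp
  next
    case (Suc l)
    then have pos: "ram_eval a \<sigma> > 0"
      and "wp c n ((?F ^^ l) (\<lambda>\<sigma>. \<not> ram_eval a \<sigma> > 0 \<and> Q \<sigma>)) \<sigma>" by auto
    from WhilePos.IH[OF this(2)] obtain t \<rho> where 1: "ram_exec c \<sigma> t \<rho>" "t \<le> tb n c"
      "(?F ^^ l) (\<lambda>\<sigma>. \<not> ram_eval a \<sigma> > 0 \<and> Q \<sigma>) \<rho>" by blast
    from Suc.IH[OF 1(3)] obtain u \<tau> where 2: "ram_exec (WhilePos a c) \<rho> u \<tau>"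
      "u \<le> (l + 1) * (1 + exp_cost a + tb n c)" "Q \<tau>" by blast
    have "ram_exec (WhilePos a c) \<sigma> (1 + exp_cost a + t + u) \<tau>"
      using ram_exec.WhileTrue[OF pos 1(1) 2(1)] .
    moreover have "1 + exp_cost a + t + u \<le> (Suc l + 1) * (1 + exp_cost a + tb n c)"
      using 1 2 by simp
    ultimately show ?case using 2 by blast
  qed
  moreover obtain l where "l \<le> n" "(?F ^^ l) (\<lambda>\<sigma>. \<not> ram_eval a \<sigma> > 0 \<and> Q \<sigma>) \<sigma>"
    using WhilePos.prems by auto
  ultimately obtain t \<tau> where "ram_exec (WhilePos a c) \<sigma> t \<tau>"
    "t \<le> (l + 1) * (1 + exp_cost a + tb n c)" "Q \<tau>" by blast
  moreover have "(l + 1) * (1 + exp_cost a + tb n c) \<le> tb n (WhilePos a c)"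
    using \<open>l \<le> n\<close> unfolding tb.simps by (intro mult_right_mono) auto
  ultimately show ?case using le_trans by blast
qed

text \<open>The nesting of loops is fixed by the program text, and each loop raises the degree by
  one.\<close>

lemma tb_poly: "\<exists>C d. \<forall>n. tb n c \<le> C * (n + 1) ^ d"
proof (induction c)
  case (Seq c d)
  then obtain C d1 D d2 where 1: "\<And>n. tb n c \<le> C * (n + 1) ^ d1" "\<And>n. tb n d \<le> D * (n + 1) ^ d2"
    by blast
  have "tb n (Seq c d) \<le> (C + D) * (n + 1) ^ (d1 + d2)" for n
  proof -
    have "(n + 1) ^ d1 \<le> (n + 1) ^ (d1 + d2)" "(n + 1) ^ d2 \<le> (n + 1) ^ (d1 + d2)"
      by (rule power_increasing; simp)+
    then have "C * (n + 1) ^ d1 \<le> C * (n + 1) ^ (d1 + d2)" "D * (n + 1) ^ d2 \<le> D * (n + 1) ^ (d1 + d2)"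
      by (auto intro: mult_left_mono)
    then show ?thesis using 1(1)[of n] 1(2)[of n] unfolding tb.simps add_mult_distrib by linarith
  qed
  then show ?case by blast
next
  case (IfPos a c d)
  then obtain C d1 D d2 where 1: "\<And>n. tb n c \<le> C * (n + 1) ^ d1" "\<And>n. tb n d \<le> D * (n + 1) ^ d2"
    by blast
  have "tb n (IfPos a c d) \<le> (1 + exp_cost a + C + D) * (n + 1) ^ (d1 + d2)" for n
  proof -
    have "(n + 1) ^ d1 \<le> (n + 1) ^ (d1 + d2)" "(n + 1) ^ d2 \<le> (n + 1) ^ (d1 + d2)"
      by (rule power_increasing; simp)+
    then have "C * (n + 1) ^ d1 \<le> C * (n + 1) ^ (d1 + d2)" "D * (n + 1) ^ d2 \<le> D * (n + 1) ^ (d1 + d2)"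
      by (auto intro: mult_left_mono)
    moreover have "(1 + exp_cost a) * 1 \<le> (1 + exp_cost a) * (n + 1) ^ (d1 + d2)"
      by (intro mult_left_mono) auto
    ultimately show ?thesis using 1(1)[of n] 1(2)[of n] unfolding tb.simps add_mult_distrib by linarith
  qed
  then show ?case by blast
next
  case (WhilePos a c)
  then obtain C d1 where 1: "\<And>n. tb n c \<le> C * (n + 1) ^ d1" by blast
  have "tb n (WhilePos a c) \<le> (1 + exp_cost a + C) * (n + 1) ^ (Suc d1)" for n
  proof -
    have "(1 + exp_cost a) * 1 \<le> (1 + exp_cost a) * (n + 1) ^ d1"
      by (intro mult_left_mono) auto
    then have "1 + exp_cost a + tb n c \<le> (1 + exp_cost a + C) * (n + 1) ^ d1"
      using 1[of n] unfolding add_mult_distrib by linarith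
    then have "(n + 1) * (1 + exp_cost a + tb n c) \<le> (n + 1) * ((1 + exp_cost a + C) * (n + 1) ^ d1)"
      by (intro mult_left_mono) auto
    then show ?thesis by (simp add: algebra_simps)
  qed
  then show ?case by blast
qed (rule exI, rule exI[of _ 0], simp, rule order_refl)+

section \<open>Frame conditions read off the program text\<close>

primrec writes :: "ram_com \<Rightarrow> nat set" where
  "writes Skip = {}"
| "writes (Assign r a) = {r}"
| "writes (Store a v) = {}"
| "writes (Seq c d) = writes c \<union> writes d"
| "writes (IfPos a c d) = writes c \<union> writes d"
| "writes (WhilePos a c) = writes c"

primrec nostore :: "ram_com \<Rightarrow> bool" where
  "nostore Skip = True"
| "nostore (Assign r a) = True"
| "nostore (Store a v) = False"
| "nostore (Seq c d) = (nostore c \<and> nostore d)"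
| "nostore (IfPos a c d) = (nostore c \<and> nostore d)"
| "nostore (WhilePos a c) = nostore c"

definition agree :: "ram_com \<Rightarrow> ram_state \<Rightarrow> ram_state \<Rightarrow> bool" where
  "agree c \<sigma> \<tau> \<longleftrightarrow> (\<forall>r. r \<notin> writes c \<longrightarrow> fst \<tau> r = fst \<sigma> r) \<and> (nostore c \<longrightarrow> snd \<tau> = snd \<sigma>)"

text \<open>The frame rule: any postcondition may be strengthened by the syntactic frame, so
  specifications need not mention registers or memory that the program text leaves alone.\<close>

lemma wp_agree: "wp c n Q \<sigma> \<Longrightarrow> wp c n (\<lambda>\<tau>. Q \<tau> \<and> agree c \<sigma> \<tau>) \<sigma>"
proof (induction c arbitrary: Q \<sigma>)
  case (Seq c d)
  from Seq.prems have "wp c n (wp d n Q) \<sigma>" by simp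
  from Seq.IH(1)[OF this] show ?case unfolding wp.simps
  proof (rule wp_mono)
    fix \<rho> assume \<rho>: "wp d n Q \<rho> \<and> agree c \<sigma> \<rho>"
    then have "wp d n (\<lambda>\<tau>. Q \<tau> \<and> agree d \<rho> \<tau>) \<rho>" using Seq.IH(2) by blast
    then show "wp d n (\<lambda>\<tau>. Q \<tau> \<and> agree (Seq c d) \<sigma> \<tau>) \<rho>"
      by (rule wp_mono) (use \<rho> in \<open>auto simp: agree_def\<close>)
  qed
next
  case (IfPos a c d)
  show ?case
  proof (cases "ram_eval a \<sigma> > 0")
    case True
    then have "wp c n (\<lambda>\<tau>. Q \<tau> \<and> agree c \<sigma> \<tau>) \<sigma>" using IfPos by simp
    then have "wp c n (\<lambda>\<tau>. Q \<tau> \<and> agree (IfPos a c d) \<sigma> \<tau>) \<sigma>"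
      by (rule wp_mono) (auto simp: agree_def)
    then show ?thesis using True by simp
  next
    case False
    then have "wp d n (\<lambda>\<tau>. Q \<tau> \<and> agree d \<sigma> \<tau>) \<sigma>" using IfPos by simp
    then have "wp d n (\<lambda>\<tau>. Q \<tau> \<and> agree (IfPos a c d) \<sigma> \<tau>) \<sigma>"
      by (rule wp_mono) (auto simp: agree_def)
    then show ?thesis using False by simp
  qed
next
  case (WhilePos a c)
  let ?F = "\<lambda>R \<sigma>. ram_eval a \<sigma> > 0 \<and> wp c n R \<sigma>"
  let ?A = "agree (WhilePos a c)"
  have "(?F ^^ l) (\<lambda>\<sigma>. \<not> ram_eval a \<sigma> > 0 \<and> Q \<sigma>) \<rho> \<Longrightarrow> ?A \<sigma> \<rho> \<Longrightarrow>
     (?F ^^ l) (\<lambda>\<tau>. \<not> ram_eval a \<tau> > 0 \<and> Q \<tau> \<and> ?A \<sigma> \<tau>) \<rho>" for l \<rho>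
  proof (induction l arbitrary: \<rho>)
    case (Suc l)
    then have pos: "ram_eval a \<rho> > 0"
      and "wp c n ((?F ^^ l) (\<lambda>\<sigma>. \<not> ram_eval a \<sigma> > 0 \<and> Q \<sigma>)) \<rho>" by auto
    from WhilePos.IH[OF this(2)]
    have "wp c n ((?F ^^ l) (\<lambda>\<tau>. \<not> ram_eval a \<tau> > 0 \<and> Q \<tau> \<and> ?A \<sigma> \<tau>)) \<rho>"
    proof (rule wp_mono)
      fix \<tau> assume t: "(?F ^^ l) (\<lambda>\<sigma>. \<not> ram_eval a \<sigma> > 0 \<and> Q \<sigma>) \<tau> \<and> agree c \<rho> \<tau>"
      then have "?A \<sigma> \<tau>" using Suc.prems(2) by (auto simp: agree_def)
      then show "(?F ^^ l) (\<lambda>\<tau>. \<not> ram_eval a \<tau> > 0 \<and> Q \<tau> \<and> ?A \<sigma> \<tau>) \<tau>" using t Suc.IH by blast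
    qed
    then show ?case using pos by simp
  qed simp
  moreover obtain l where "l \<le> n" "(?F ^^ l) (\<lambda>\<sigma>. \<not> ram_eval a \<sigma> > 0 \<and> Q \<sigma>) \<sigma>"
    using WhilePos.prems by auto
  moreover have "?A \<sigma> \<sigma>" by (simp add: agree_def)
  ultimately show ?case unfolding wp.simps by blast
qed (auto simp: agree_def)

lemma wp_conseq:
  assumes "wp c n Q' (R, m)"
    and "\<And>R' m'. Q' (R', m') \<Longrightarrow> (\<And>r. r \<notin> writes c \<Longrightarrow> R' r = R r) \<Longrightarrow> (nostore c \<Longrightarrow> m' = m) \<Longrightarrow> Q (R', m')"
  shows "wp c n Q (R, m)"
  using wp_agree[OF assms(1)]
proof (rule wp_mono)
  fix \<tau> assume t: "Q' \<tau> \<and> agree c (R, m) \<tau>"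
  obtain R' m' where "\<tau> = (R', m')" by (cases \<tau>)
  with t show "Q \<tau>" using assms(2)[of R' m'] unfolding agree_def by simp
qed

definition For :: "nat \<Rightarrow> ram_exp \<Rightarrow> nat \<Rightarrow> ram_com \<Rightarrow> ram_com" where
  "For i a h c = Seq (Assign i a) (WhilePos (Sub (Reg h) (Reg i)) (Seq c (Assign i (Add (Reg i) (Const 1)))))"

lemma For_simps [simp]: "writes (For i a h c) = insert i (writes c)" "nostore (For i a h c) = nostore c"
  by (auto simp: For_def)

text \<open>The frame relative to the state before the loop is supplied in \<open>step\<close> and
  \<open>fin\<close>; the invariant only has to speak of what the body changes. Each loop limit
  \<open>h\<close> must survive the body because it is read again in every test.\<close>

lemma wp_For:
  assumes f: "i \<notin> writes c" "h \<notin> writes c" "i \<noteq> h"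
    and b: "ram_eval a (R, m) = int l" "R h = int u" "l \<le> u" "u - l \<le> n"
    and init: "I l (R(i := int l)) m"
    and step: "\<And>x R' m'. l \<le> x \<Longrightarrow> x < u \<Longrightarrow> I x R' m' \<Longrightarrow> R' i = int x \<Longrightarrow>
       (\<And>r. r \<noteq> i \<Longrightarrow> r \<notin> writes c \<Longrightarrow> R' r = R r) \<Longrightarrow> (nostore c \<Longrightarrow> m' = m) \<Longrightarrow>
       wp c n (\<lambda>\<tau>. I (Suc x) ((fst \<tau>)(i := int (Suc x))) (snd \<tau>)) (R', m')"
    and fin: "\<And>R' m'. I u R' m' \<Longrightarrow> R' i = int u \<Longrightarrow>
       (\<And>r. r \<noteq> i \<Longrightarrow> r \<notin> writes c \<Longrightarrow> R' r = R r) \<Longrightarrow> (nostore c \<Longrightarrow> m' = m) \<Longrightarrow> Q (R', m')"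
  shows "wp (For i a h c) n Q (R, m)"
proof -
  let ?a = "Sub (Reg h) (Reg i)" and ?c = "Seq c (Assign i (Add (Reg i) (Const 1)))"
  let ?F = "\<lambda>R \<sigma>. ram_eval ?a \<sigma> > 0 \<and> wp ?c n R \<sigma>"
  have "(?F ^^ d) (\<lambda>\<sigma>. \<not> ram_eval ?a \<sigma> > 0 \<and> Q \<sigma>) (R', m')"
    if "u - x = d" "l \<le> x" "x \<le> u" "I x R' m'" "R' i = int x"
      "\<And>r. r \<noteq> i \<Longrightarrow> r \<notin> writes c \<Longrightarrow> R' r = R r" "nostore c \<Longrightarrow> m' = m" for x d R' m'
    using that
  proof (induction d arbitrary: x R' m')
    case 0
    then have "x = u" by simp
    then have "Q (R', m')" using fin 0 by blast
    moreover have "R' h = int u" using 0(6)[of h] f b(2) by simp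
    ultimately show ?case using 0 \<open>x = u\<close> by simp
  next
    case (Suc d)
    have xu: "x < u" using Suc.prems(1) by simp
    have h: "R' h = int u" using Suc.prems(6)[of h] f b(2) by simp
    have "wp c n (\<lambda>\<tau>. I (Suc x) ((fst \<tau>)(i := int (Suc x))) (snd \<tau>)) (R', m')"
      using step[OF Suc.prems(2) xu Suc.prems(4-7)] by blast
    then have "wp c n (wp (Assign i (Add (Reg i) (Const 1))) n
        ((?F ^^ d) (\<lambda>\<sigma>. \<not> ram_eval ?a \<sigma> > 0 \<and> Q \<sigma>))) (R', m')"
    proof (rule wp_conseq)
      fix R'' m''
      assume I: "I (Suc x) ((fst (R'', m''))(i := int (Suc x))) (snd (R'', m''))"
        and fr: "\<And>r. r \<notin> writes c \<Longrightarrow> R'' r = R' r" "nostore c \<Longrightarrow> m'' = m'"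
      have i: "R'' i + 1 = int (Suc x)" using fr(1)[OF f(1)] Suc.prems(5) by simp
      have "(?F ^^ d) (\<lambda>\<sigma>. \<not> ram_eval ?a \<sigma> > 0 \<and> Q \<sigma>) (R''(i := int (Suc x)), m'')"
      proof (rule Suc.IH[of "Suc x"])
        show "(R''(i := int (Suc x))) r = R r" if "r \<noteq> i" "r \<notin> writes c" for r
          using that fr(1)[of r] Suc.prems(6)[of r] by simp
        show "I (Suc x) (R''(i := int (Suc x))) m''" using I unfolding fst_conv snd_conv .
      qed (use Suc.prems(1,2,7) fr(2) xu in auto)
      then show "wp (Assign i (Add (Reg i) (Const 1))) n
          ((?F ^^ d) (\<lambda>\<sigma>. \<not> ram_eval ?a \<sigma> > 0 \<and> Q \<sigma>)) (R'', m'')"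
        unfolding wp.simps ram_eval.simps fst_conv snd_conv i by simp
    qed
    then show ?case using h Suc.prems(5) xu by simp
  qed
  from this[of l "u - l" "R(i := int l)" m] b(3) init
  have "(?F ^^ (u - l)) (\<lambda>\<sigma>. \<not> ram_eval ?a \<sigma> > 0 \<and> Q \<sigma>) (R(i := int l), m)" by simp
  then have "wp (WhilePos ?a ?c) n Q (R(i := int l), m)"
    using b(4) unfolding wp.simps(6) by blast
  then show ?thesis unfolding For_def using b(1) by simp
qed

section \<open>Derived commands and addressing\<close>

definition IfEq :: "ram_exp \<Rightarrow> ram_exp \<Rightarrow> ram_com \<Rightarrow> ram_com" where
  "IfEq a b c = IfPos (Sub a b) Skip (IfPos (Sub b a) Skip c)"

definition IfLt :: "ram_exp \<Rightarrow> ram_exp \<Rightarrow> ram_com \<Rightarrow> ram_com" where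
  "IfLt a b c = IfPos (Sub b a) c Skip"

definition IfLe :: "ram_exp \<Rightarrow> ram_exp \<Rightarrow> ram_com \<Rightarrow> ram_com" where
  "IfLe a b c = IfPos (Sub a b) Skip c"

lemma IfEq_simps [simp]:
  "wp (IfEq a b c) n Q \<sigma> = (if ram_eval a \<sigma> = ram_eval b \<sigma> then wp c n Q \<sigma> else Q \<sigma>)"
  "writes (IfEq a b c) = writes c" "nostore (IfEq a b c) = nostore c"
  by (auto simp: IfEq_def)

lemma IfLt_simps [simp]:
  "wp (IfLt a b c) n Q \<sigma> = (if ram_eval a \<sigma> < ram_eval b \<sigma> then wp c n Q \<sigma> else Q \<sigma>)"
  "writes (IfLt a b c) = writes c" "nostore (IfLt a b c) = nostore c"
  by (auto simp: IfLt_def)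

lemma IfLe_simps [simp]:
  "wp (IfLe a b c) n Q \<sigma> = (if ram_eval a \<sigma> \<le> ram_eval b \<sigma> then wp c n Q \<sigma> else Q \<sigma>)"
  "writes (IfLe a b c) = writes c" "nostore (IfLe a b c) = nostore c"
  by (auto simp: IfLe_def)

text \<open>Sixteen interleaved arrays in the negative addresses, disjoint from the input.\<close>

definition adr :: "int \<Rightarrow> int \<Rightarrow> int" where
  "adr t i = - 1 - t - 16 * i"

lemma adr_eq [simp]:
  "0 \<le> t \<Longrightarrow> t < 16 \<Longrightarrow> 0 \<le> t' \<Longrightarrow> t' < 16 \<Longrightarrow> adr t i = adr t' i' \<longleftrightarrow> t = t' \<and> i = i'"
proof -
  assume t: "0 \<le> t" "t < 16" "0 \<le> t'" "t' < 16"
  have "t = t'" if "t + 16 * i = t' + 16 * i'"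
  proof -
    have "(t + 16 * i) mod 16 = t" "(t' + 16 * i') mod 16 = t'" using t by simp_all
    then show ?thesis using that by simp
  qed
  then show ?thesis unfolding adr_def by auto
qed

lemma adr_neg: "0 \<le> t \<Longrightarrow> 0 \<le> i \<Longrightarrow> adr t i < 0"
  by (simp add: adr_def)

text \<open>The factor 16 is obtained by four doublings, as the machine cannot multiply. The
  duplicated subexpression costs a constant factor only.\<close>

definition adr_exp :: "int \<Rightarrow> ram_exp \<Rightarrow> ram_exp" where
  "adr_exp t e = (let two = (\<lambda>x. Add x x) in Sub (Const (- 1 - t)) (two (two (two (two e)))))"

lemma adr_exp_eval [simp]: "ram_eval (adr_exp t e) \<sigma> = adr t (ram_eval e \<sigma>)"
  by (simp add: adr_exp_def adr_def)

definition At :: "int \<Rightarrow> ram_exp \<Rightarrow> ram_exp" where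
  "At t e = Load (adr_exp t e)"

definition SetAt :: "int \<Rightarrow> ram_exp \<Rightarrow> ram_exp \<Rightarrow> ram_com" where
  "SetAt t e v = Store (adr_exp t e) v"

lemma At_eval [simp]: "ram_eval (At t e) \<sigma> = snd \<sigma> (adr t (ram_eval e \<sigma>))"
  by (simp add: At_def)

lemma SetAt_simps [simp]:
  "wp (SetAt t e v) n Q \<sigma> = Q (fst \<sigma>, (snd \<sigma>)(adr t (ram_eval e \<sigma>) := ram_eval v \<sigma>))"
  "writes (SetAt t e v) = {}" "nostore (SetAt t e v) = False"
  by (auto simp: SetAt_def)

definition Five :: "ram_exp \<Rightarrow> int \<Rightarrow> ram_exp" where
  "Five e z = Add (Add e (Add e (Add e (Add e e)))) (Const z)"

lemma Five_eval [simp]: "ram_eval (Five e z) \<sigma> = 5 * ram_eval e \<sigma> + z"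
  by (simp add: Five_def)

definition Block :: "ram_com list \<Rightarrow> ram_com" where
  "Block cs = foldr Seq cs Skip"

lemma Block_simps [simp]:
  "wp (Block []) n Q = Q" "wp (Block (c # cs)) n Q = wp c n (wp (Block cs) n Q)"
  "writes (Block []) = {}" "writes (Block (c # cs)) = writes c \<union> writes (Block cs)"
  "nostore (Block []) = True" "nostore (Block (c # cs)) = (nostore c \<and> nostore (Block cs))"
  by (auto simp: Block_def)

section \<open>Computing the entry positions\<close>

text \<open>Scalars live in registers and arrays are distinguished by tags. Array \<open>tD\<close> holds the guess:
  \<open>par c, cl c, del c + b\<close> are in the cells \<open>5 * c + 5, 5 * c + 6, 5 * c + 7\<close> and \<open>am r, ofs r\<close> in
  \<open>5 * r + 3, 5 * r + 4\<close>, so that \<open>r = 0\<close> reads cells that are always 0.\<close>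

abbreviation (input) "rK \<equiv> 2 :: nat"
abbreviation (input) "rM \<equiv> 3 :: nat"
abbreviation (input) "rB \<equiv> 4 :: nat"
abbreviation (input) "rS \<equiv> 5 :: nat"
abbreviation (input) "rJ \<equiv> 6 :: nat"
abbreviation (input) "rR \<equiv> 7 :: nat"
abbreviation (input) "rP \<equiv> 8 :: nat"
abbreviation (input) "rE \<equiv> 9 :: nat"
abbreviation (input) "rL \<equiv> 10 :: nat"
abbreviation (input) "rA \<equiv> 11 :: nat"
abbreviation (input) "rH \<equiv> 12 :: nat"
abbreviation (input) "rLo \<equiv> 13 :: nat"
abbreviation (input) "rD \<equiv> 14 :: nat"
abbreviation (input) "rX \<equiv> 15 :: nat"
abbreviation (input) "rXe \<equiv> 16 :: nat"
abbreviation (input) "rZ \<equiv> 17 :: nat"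
abbreviation (input) "rHit \<equiv> 18 :: nat"
abbreviation (input) "rOk \<equiv> 19 :: nat"
abbreviation (input) "rY \<equiv> 20 :: nat"
abbreviation (input) "rHm \<equiv> 21 :: nat"
abbreviation (input) "rFn \<equiv> 22 :: nat"
abbreviation (input) "rC \<equiv> 23 :: nat"
abbreviation (input) "rRd \<equiv> 24 :: nat"
abbreviation (input) "rV \<equiv> 25 :: nat"
abbreviation (input) "rNp \<equiv> 26 :: nat"

abbreviation (input) "tPS \<equiv> 2 :: int"
abbreviation (input) "tTV \<equiv> 3 :: int"
abbreviation (input) "tHV \<equiv> 4 :: int"
abbreviation (input) "tLB \<equiv> 5 :: int"
abbreviation (input) "tD \<equiv> 6 :: int"
abbreviation (input) "tP \<equiv> 8 :: int"

abbreviation (input) "level_exp r \<equiv> Sub (At tLB (Reg r)) (Reg r)"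
abbreviation (input) "bl_exp d \<equiv> Sub (Add (At tLB (Reg rX)) (At tD (Five (Reg d) 7))) (Reg rB)"

definition Pair_test :: ram_com where
  "Pair_test = Block [Assign rV (level_exp rZ), IfLt (Reg rV) (Reg rL) (Assign rV (Reg rL)),
     IfEq (At tHV (Reg rZ)) (At tTV (Reg rX)) (IfLe (Reg rV) (Reg rH)
       (IfLe (bl_exp rD) (Add (Reg rV) (Reg rZ))
         (IfLt (Add (Reg rLo) (Reg rZ)) (bl_exp rD) (Assign rHit (Const 1)))))]"

definition Member_test :: ram_com where
  "Member_test = Block [Assign rHit (Const 0), Assign rXe (At tPS (Add (Reg rD) (Const 1))),
     For rX (At tPS (Reg rD)) rXe (For rZ (Reg rP) rE Pair_test)]"

definition Set_low :: ram_com where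
  "Set_low = Block [Assign rLo (Sub (Reg rH) (Reg rA)), IfLt (Reg rLo) (Reg rL) (Assign rLo (Reg rL))]"

definition Feasible :: ram_com where
  "Feasible = Block [Set_low, Assign rOk (Const 1),
     For rD (Const 0) rK (IfEq (At tD (Five (Reg rD) 5)) (Reg rJ) (IfEq (At tD (Five (Reg rD) 6)) (Reg rR)
       (Block [Member_test, IfEq (Reg rHit) (Const 0) (Assign rOk (Const 0))])))]"

text \<open>A counted loop cannot be left early; the flag \<open>rFn\<close> freezes the first hit
  instead.\<close>

definition Feas_search :: ram_com where
  "Feas_search = Block [Assign rHm (Reg rL), Assign rFn (Const 0),
     For rY (Reg rP) rE (Block [Assign rH (level_exp rY), IfLt (Reg rH) (Reg rL) (Assign rH (Reg rL)),
       Feasible,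
       IfEq (Reg rFn) (Const 0) (IfEq (Reg rOk) (Const 1) (Block [Assign rHm (Reg rH), Assign rFn (Const 1)]))])]"

definition Load_ctx :: ram_com where
  "Load_ctx = Block [Assign rJ (At tD (Five (Reg rC) 5)), Assign rR (At tD (Five (Reg rC) 6)),
     Assign rP (At tP (Reg rJ)), Assign rE (At tPS (Add (Reg rJ) (Const 1))),
     Assign rL (Sub (Add (level_exp rP) (At tD (Five (Reg rJ) 7))) (Reg rB)),
     Assign rA (At tD (Five (Reg rR) 3))]"

definition High :: ram_com where
  "High = Block [Load_ctx, Feas_search, Assign rH (Add (Reg rHm) (At tD (Five (Reg rR) 4))), Set_low]"

definition Board_test :: ram_com where
  "Board_test = Block [Assign rV (level_exp rZ), IfLt (Reg rV) (Reg rL) (Assign rV (Reg rL)),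
     IfLe (Reg rV) (Reg rH) (IfLt (Reg rLo) (Reg rV) (Assign rV (Reg rLo))),
     IfEq (Reg rFn) (Const 0) (IfEq (At tHV (Reg rZ)) (At tTV (Reg rX))
       (IfLt (Add (Reg rV) (Reg rZ)) (bl_exp rC) (Block [Assign rNp (Reg rX), Assign rFn (Const 1)])))]"

definition New_pos :: ram_com where
  "New_pos = Block [Assign rNp (At tPS (Add (Reg rC) (Const 1))), Assign rXe (Reg rNp), Assign rFn (Const 0),
     For rX (At tPS (Reg rC)) rXe (For rZ (Reg rP) rE Board_test),
     SetAt tP (Reg rC) (Reg rNp)]"

definition Rounds :: ram_com where
  "Rounds = For rRd (Const 0) rK (For rC (Const 0) rK (Block [High, New_pos]))"

lemma writes_search [simp]:
  "writes Pair_test = {rV, rHit}" "nostore Pair_test"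
  "writes Member_test = {rV, rHit, rXe, rX, rZ}" "nostore Member_test"
  "writes Set_low = {rLo}" "nostore Set_low"
  "writes Feasible = {rLo, rOk, rD, rV, rHit, rXe, rX, rZ}" "nostore Feasible"
  "writes Feas_search = {rHm, rFn, rY, rH, rLo, rOk, rD, rV, rHit, rXe, rX, rZ}" "nostore Feas_search"
  "writes Load_ctx = {rJ, rR, rP, rE, rL, rA}" "nostore Load_ctx"
  "writes High = {rJ, rR, rP, rE, rL, rA, rHm, rFn, rY, rH, rLo, rOk, rD, rV, rHit, rXe, rX, rZ}" "nostore High"
  "writes Board_test = {rV, rNp, rFn}" "nostore Board_test"
  "writes New_pos = {rNp, rXe, rFn, rX, rZ, rV}"
  unfolding Pair_test_def Member_test_def Set_low_def Feasible_def Feas_search_def Load_ctx_def High_def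
    Board_test_def New_pos_def
  by auto

lemma wp_Set_low [simp]: "wp Set_low n Q (R, m) = Q (R(rLo := max (R rH - R rA) (R rL)), m)"
  by (simp add: Set_low_def max_def)

section \<open>Correctness of the search for entry positions\<close>

definition same :: "int set \<Rightarrow> (int \<Rightarrow> int) \<Rightarrow> (int \<Rightarrow> int) \<Rightarrow> bool" where
  "same T m m' \<longleftrightarrow> (\<forall>t i. 0 \<le> t \<longrightarrow> t < 16 \<longrightarrow> t \<notin> T \<longrightarrow> m' (adr t i) = m (adr t i))"

lemma same_refl: "same T m m" by (simp add: same_def)

lemma same_trans: "same T m m' \<Longrightarrow> same T m' m'' \<Longrightarrow> same T m m''" by (simp add: same_def)

lemma same_mono: "same T m m' \<Longrightarrow> T \<subseteq> T' \<Longrightarrow> same T' m m'" by (auto simp: same_def)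

lemma same_upd: "same T m m' \<Longrightarrow> t \<in> T \<Longrightarrow> 0 \<le> t \<Longrightarrow> t < 16 \<Longrightarrow> same T m (m'(adr t i := v))"
  by (auto simp: same_def)

lemma sameD: "same T m m' \<Longrightarrow> 0 \<le> t \<Longrightarrow> t < 16 \<Longrightarrow> t \<notin> T \<Longrightarrow> m' (adr t i) = m (adr t i)"
  by (simp add: same_def)

text \<open>The index \<open>k\<close> is included for \<open>del\<close> because the source may be
  a parent, and for \<open>am\<close> and \<open>ofs\<close> because class numbers run from 0 to
  \<open>k\<close>. The number \<open>n\<close> is the common bound for loop iterations.\<close>

locale guess = flat_instance +
  fixes D :: "nat \<Rightarrow> int" and par cl :: "nat \<Rightarrow> nat" and del am ofs :: "nat \<Rightarrow> int" and n :: nat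
  assumes D_par: "c < k \<Longrightarrow> D (5 * c + 5) = int (par c)"
    and D_cl: "c < k \<Longrightarrow> D (5 * c + 6) = int (cl c)"
    and D_del: "c \<le> k \<Longrightarrow> D (5 * c + 7) = del c + int b"
    and D_am: "r \<le> k \<Longrightarrow> D (5 * r + 3) = am r"
    and D_ofs: "r \<le> k \<Longrightarrow> D (5 * r + 4) = ofs r"
    and par_le: "c < k \<Longrightarrow> par c \<le> k" and cl_le: "c < k \<Longrightarrow> cl c \<le> k"
    and n: "k \<le> n" "Suc (PS k) \<le> n"
begin

definition minst :: "(int \<Rightarrow> int) \<Rightarrow> bool" where
  "minst m \<longleftrightarrow> (\<forall>c\<le>Suc k. m (adr tPS (int c)) = int (PS c)) \<and> (\<forall>x<PS k. m (adr tTV (int x)) = TV x) \<and>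
     (\<forall>x\<le>PS k. m (adr tHV (int x)) = HV x \<and> m (adr tLB (int x)) = LB x) \<and>
     (\<forall>i. m (adr tD (int i)) = D i)"

definition base :: "(nat \<Rightarrow> int) \<Rightarrow> bool" where
  "base R \<longleftrightarrow> R rK = int k \<and> R rM = int (PS k) \<and> R rB = int b \<and> R rS = s"

lemma minst_same: "minst m \<Longrightarrow> same T m m' \<Longrightarrow> T \<inter> {2..6} = {} \<Longrightarrow> minst m'"
proof -
  assume a: "minst m" "same T m m'" "T \<inter> {2..6} = {}"
  have "m' (adr t i) = m (adr t i)" if "t \<in> {2..6}" for t i
  proof -
    have "t \<notin> T" using a(3) that by blast
    then show ?thesis using sameD[OF a(2), of t i] that by simp
  qed
  then show ?thesis using a(1) by (simp add: minst_def)
qed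

lemma minstD:
  assumes "minst m"
  shows "c \<le> Suc k \<Longrightarrow> m (adr tPS (int c)) = int (PS c)"
    "x < PS k \<Longrightarrow> m (adr tTV (int x)) = TV x"
    "x \<le> PS k \<Longrightarrow> m (adr tHV (int x)) = HV x"
    "x \<le> PS k \<Longrightarrow> m (adr tLB (int x)) = LB x"
    "c \<le> k \<Longrightarrow> m (adr tPS (1 + int c)) = int (PS (Suc c))"
    "c \<le> k \<Longrightarrow> m (adr tPS (int c + 1)) = int (PS (Suc c))"
    "c < k \<Longrightarrow> m (adr tD (5 * int c + 5)) = int (par c)"
    "c < k \<Longrightarrow> m (adr tD (5 * int c + 6)) = int (cl c)"
    "c \<le> k \<Longrightarrow> m (adr tD (5 * int c + 7)) = del c + int b"
    "r \<le> k \<Longrightarrow> m (adr tD (5 * int r + 3)) = am r"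
    "r \<le> k \<Longrightarrow> m (adr tD (5 * int r + 4)) = ofs r"
proof -
  have d: "m (adr tD (5 * int c + int z)) = D (5 * c + z)" for c z
    using assms unfolding minst_def by (metis of_nat_add of_nat_mult of_nat_numeral)
  show "c < k \<Longrightarrow> m (adr tD (5 * int c + 5)) = int (par c)" using d[of c 5] D_par by simp
  show "c < k \<Longrightarrow> m (adr tD (5 * int c + 6)) = int (cl c)" using d[of c 6] D_cl by simp
  show "c \<le> k \<Longrightarrow> m (adr tD (5 * int c + 7)) = del c + int b" using d[of c 7] D_del by simp
  show "r \<le> k \<Longrightarrow> m (adr tD (5 * int r + 3)) = am r" using d[of r 3] D_am by simp
  show "r \<le> k \<Longrightarrow> m (adr tD (5 * int r + 4)) = ofs r" using d[of r 4] D_ofs by simp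
  have p: "c \<le> Suc k \<Longrightarrow> m (adr tPS (int c)) = int (PS c)" for c using assms by (simp add: minst_def)
  show "c \<le> Suc k \<Longrightarrow> m (adr tPS (int c)) = int (PS c)" by (rule p)
  show "c \<le> k \<Longrightarrow> m (adr tPS (1 + int c)) = int (PS (Suc c))" using p[of "Suc c"] by simp
  show "c \<le> k \<Longrightarrow> m (adr tPS (int c + 1)) = int (PS (Suc c))" using p[of "Suc c"] by (simp add: add.commute)
qed (use assms in \<open>auto simp: minst_def\<close>)

lemma wp_Pair_test:
  assumes "minst m" "R rB = int b" "d < k" "x < PS k" "z \<le> PS k" "R rD = int d" "R rX = int x" "R rZ = int z"
    "R rL = B" "R rH = hi" "R rLo = max (hi - a) B"
  shows "wp Pair_test n (\<lambda>\<tau>. fst \<tau> rHit = (if paid del B a hi d x z then 1 else R rHit)) (R, m)"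
  using assms(2-) by (auto simp: Pair_test_def minstD[OF assms(1)] paid_def lvl_def max_def)

lemma seg_bounds: "c \<le> k \<Longrightarrow> x \<in> seg c \<Longrightarrow> x \<le> PS k" "c < k \<Longrightarrow> PS (Suc c) \<le> PS k" "c \<le> k \<Longrightarrow> PS c \<le> PS (Suc c)"
  "c \<le> k \<Longrightarrow> PS (Suc c) \<le> n"
  using PS_mono[of "Suc c" "Suc k"] PS_mono[of "Suc c" k] PS_mono[of c "Suc c"] PS_Suc_k n by auto

lemma wp_Member_test:
  assumes "minst m" "R rB = int b" "d < k" "R rD = int d" "R rP = int p" "R rE = int e" "p \<le> e" "e \<le> Suc (PS k)"
    "R rL = B" "R rH = hi" "R rLo = max (hi - a) B"
  shows "wp Member_test n (\<lambda>\<tau>. fst \<tau> rHit =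
     (if \<exists>x\<in>seg d. \<exists>z\<in>{p..<e}. paid del B a hi d x z then 1 else 0)) (R, m)"
proof -
  define R1 where "R1 = R(rHit := 0, rXe := int (PS (Suc d)))"
  have "wp (For rX (At tPS (Reg rD)) rXe (For rZ (Reg rP) rE Pair_test)) n (\<lambda>\<tau>. fst \<tau> rHit =
     (if \<exists>x\<in>seg d. \<exists>z\<in>{p..<e}. paid del B a hi d x z then 1 else 0)) (R1, m)"
  proof (rule wp_For[where l = "PS d" and u = "PS (Suc d)" and
        I = "\<lambda>x R m. R rHit = (if \<exists>x\<in>{PS d..<x}. \<exists>z\<in>{p..<e}. paid del B a hi d x z then 1 else 0)"])
    show "ram_eval (At tPS (Reg rD)) (R1, m) = int (PS d)" using assms minstD[OF assms(1)] by (simp add: R1_def)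
    show "PS d \<le> PS (Suc d)" "PS (Suc d) - PS d \<le> n" using seg_bounds[of d] assms by auto
    fix x R' m' assume x: "PS d \<le> x" "x < PS (Suc d)"
      and I: "R' rHit = (if \<exists>x\<in>{PS d..<x}. \<exists>z\<in>{p..<e}. paid del B a hi d x z then 1 else 0)"
      and rx: "R' rX = int x"
      and fr: "\<And>r. r \<noteq> rX \<Longrightarrow> r \<notin> writes (For rZ (Reg rP) rE Pair_test) \<Longrightarrow> R' r = R1 r"
      and m: "nostore (For rZ (Reg rP) rE Pair_test) \<Longrightarrow> m' = m"
    have m': "m' = m" using m by simp
    have xk: "x < PS k" using x seg_bounds(2)[OF assms(3)] by simp
    have regs: "R' rB = int b" "R' rD = int d" "R' rP = int p" "R' rE = int e" "R' rL = B" "R' rH = hi"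
      "R' rLo = max (hi - a) B" using fr assms by (simp_all add: R1_def)
    show "wp (For rZ (Reg rP) rE Pair_test) n (\<lambda>\<tau>. ((fst \<tau>)(rX := int (Suc x))) rHit =
      (if \<exists>x\<in>{PS d..<Suc x}. \<exists>z\<in>{p..<e}. paid del B a hi d x z then 1 else 0)) (R', m')"
    \<comment> \<open>A hit from an earlier row \<open>x\<close> is never cleared, which is recorded
      by \<open>R' rHit = 1\<close> in the inner invariant.\<close>
    proof (rule wp_For[where l = p and u = e and
          I = "\<lambda>z R m. R rHit = (if R' rHit = 1 \<or> (\<exists>z\<in>{p..<z}. paid del B a hi d x z) then 1 else 0)"])
      fix z R'' m'' assume z: "p \<le> z" "z < e"
        and I': "R'' rHit = (if R' rHit = 1 \<or> (\<exists>z\<in>{p..<z}. paid del B a hi d x z) then 1 else 0)"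
        and rz: "R'' rZ = int z"
        and fr': "\<And>r. r \<noteq> rZ \<Longrightarrow> r \<notin> writes Pair_test \<Longrightarrow> R'' r = R' r" and m'': "nostore Pair_test \<Longrightarrow> m'' = m'"
      have "wp Pair_test n (\<lambda>\<tau>. fst \<tau> rHit = (if paid del B a hi d x z then 1 else R'' rHit)) (R'', m'')"
        by (rule wp_Pair_test) (use assms(1,3,8) m' m'' regs fr' xk z rz rx in auto)
      then show "wp Pair_test n (\<lambda>\<tau>. ((fst \<tau>)(rZ := int (Suc z))) rHit =
         (if R' rHit = 1 \<or> (\<exists>z\<in>{p..<Suc z}. paid del B a hi d x z) then 1 else 0)) (R'', m'')"
        by (rule wp_mono) (use I' z in \<open>auto simp: less_Suc_eq\<close>)
    next
      fix R'' :: "nat \<Rightarrow> int" and m'' :: "int \<Rightarrow> int"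
      assume "R'' rHit = (if R' rHit = 1 \<or> (\<exists>z\<in>{p..<e}. paid del B a hi d x z) then 1 else 0)"
      then show "((fst (R'', m''))(rX := int (Suc x))) rHit =
        (if \<exists>x\<in>{PS d..<Suc x}. \<exists>z\<in>{p..<e}. paid del B a hi d x z then 1 else 0)"
        using I x by (auto simp: less_Suc_eq)
    qed (use regs I n assms(7,8) in auto)
  qed (auto simp: R1_def)
  then show ?thesis using assms by (simp add: Member_test_def R1_def minstD[OF assms(1)] split del: if_split)
qed

lemma wp_Feasible:
  assumes "minst m" "R rK = int k" "R rB = int b" "R rJ = int j" "R rR = int r" "j \<le> k" "r \<le> k" "R rP = int p"
    "R rE = int (PS (Suc j))" "p \<le> PS (Suc j)"
    "R rL = blev del p j" "R rA = am r" "R rH = hi"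
  shows "wp Feasible n (\<lambda>\<tau>. fst \<tau> rOk = (if feas par cl del am p j r hi then 1 else 0)) (R, m)"
proof -
  define R1 where "R1 = R(rLo := max (hi - am r) (blev del p j), rOk := 1)"
  let ?C = "\<lambda>d. par d = j \<and> cl d = r \<longrightarrow>
     (\<exists>x\<in>seg d. \<exists>z\<in>{p..<PS (Suc j)}. paid del (blev del p j) (am r) hi d x z)"
  let ?body = "IfEq (At tD (Five (Reg rD) 5)) (Reg rJ) (IfEq (At tD (Five (Reg rD) 6)) (Reg rR)
       (Block [Member_test, IfEq (Reg rHit) (Const 0) (Assign rOk (Const 0))]))"
  have e: "PS (Suc j) \<le> Suc (PS k)" using PS_mono[of "Suc j" "Suc k"] PS_Suc_k assms(6) by simp
  have "wp (For rD (Const 0) rK ?body) n (\<lambda>\<tau>. fst \<tau> rOk = (if feas par cl del am p j r hi then 1 else 0)) (R1, m)"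
  proof (rule wp_For[where l = 0 and u = k and I = "\<lambda>d R m. R rOk = (if \<forall>d'<d. ?C d' then 1 else 0)"])
    fix d R' m' assume d: "d < k" and I: "R' rOk = (if \<forall>d'<d. ?C d' then 1 else 0)" and rd: "R' rD = int d"
      and fr: "\<And>r. r \<noteq> rD \<Longrightarrow> r \<notin> writes ?body \<Longrightarrow> R' r = R1 r" and m: "nostore ?body \<Longrightarrow> m' = m"
    have m': "m' = m" using m by simp
    have regs: "R' rB = int b" "R' rJ = int j" "R' rR = int r" "R' rP = int p" "R' rE = int (PS (Suc j))"
      "R' rL = blev del p j" "R' rH = hi" "R' rLo = max (hi - am r) (blev del p j)"
      using fr assms by (simp_all add: R1_def)
    have "wp Member_test n (\<lambda>\<tau>. fst \<tau> rHit =
     (if \<exists>x\<in>seg d. \<exists>z\<in>{p..<PS (Suc j)}. paid del (blev del p j) (am r) hi d x z then 1 else 0)) (R', m')"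
      by (rule wp_Member_test) (use assms(1,10) m' regs d rd e in auto)
    then have "wp Member_test n (wp (Block [IfEq (Reg rHit) (Const 0) (Assign rOk (Const 0))]) n
       (\<lambda>\<tau>. fst \<tau> rOk = (if (\<forall>d'<d. ?C d') \<and>
         (\<exists>x\<in>seg d. \<exists>z\<in>{p..<PS (Suc j)}. paid del (blev del p j) (am r) hi d x z) then 1 else 0))) (R', m')"
      by (rule wp_conseq) (use I in auto)
    moreover have "(\<forall>d'<Suc d. ?C d') \<longleftrightarrow> (\<forall>d'<d. ?C d') \<and> ?C d" by (auto simp: less_Suc_eq)
    ultimately show "wp ?body n (\<lambda>\<tau>. ((fst \<tau>)(rD := int (Suc d))) rOk = (if \<forall>d'<Suc d. ?C d' then 1 else 0)) (R', m')"
      using I d rd regs m' minstD(7,8)[OF assms(1) d] by (simp split del: if_split) auto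
  qed (use assms n in \<open>auto simp: R1_def feas_def\<close>)
  then show ?thesis using assms by (simp add: Feasible_def R1_def split del: if_split)
qed


lemma wp_Feas_search:
  assumes "minst m" "R rK = int k" "R rB = int b" "R rJ = int j" "R rR = int r" "j \<le> k" "r \<le> k" "R rP = int p"
    "R rE = int (PS (Suc j))" "p \<le> PS (Suc j)" "R rL = blev del p j" "R rA = am r"
  shows "wp Feas_search n (\<lambda>\<tau>. fst \<tau> rHm = first_feas par cl del am p j r) (R, m)"
proof -
  let ?B = "blev del p j"
  let ?Q = "\<lambda>y. y \<in> {p..<PS (Suc j)} \<and> feas par cl del am p j r (lvl ?B y)"
  let ?I = "\<lambda>y R m. (R rFn = 0 \<and> R rHm = ?B \<and> (\<forall>y'<y. \<not> ?Q y')) \<or>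
     (R rFn = 1 \<and> (\<exists>y'<y. R rHm = lvl ?B y' \<and> ?Q y' \<and> (\<forall>y''<y'. \<not> ?Q y'')))"
  let ?body = "Block [Assign rH (level_exp rY), IfLt (Reg rH) (Reg rL) (Assign rH (Reg rL)),
       Feasible,
       IfEq (Reg rFn) (Const 0) (IfEq (Reg rOk) (Const 1) (Block [Assign rHm (Reg rH), Assign rFn (Const 1)]))]"
  define R1 where "R1 = R(rHm := ?B, rFn := 0)"
  have e: "PS (Suc j) \<le> Suc (PS k)" using PS_mono[of "Suc j" "Suc k"] PS_Suc_k assms(6) by simp
  have "wp (For rY (Reg rP) rE ?body) n (\<lambda>\<tau>. fst \<tau> rHm = first_feas par cl del am p j r) (R1, m)"
  proof (rule wp_For[where l = p and u = "PS (Suc j)" and I = ?I])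
    fix y R' m' assume y: "p \<le> y" "y < PS (Suc j)" and I: "?I y R' m'" and ry: "R' rY = int y"
      and fr: "\<And>r. r \<noteq> rY \<Longrightarrow> r \<notin> writes ?body \<Longrightarrow> R' r = R1 r" and m: "nostore ?body \<Longrightarrow> m' = m"
    have m': "m' = m" using m by simp
    have yk: "y \<le> PS k" using y e by simp
    have regs: "R' rK = int k" "R' rB = int b" "R' rJ = int j" "R' rR = int r" "R' rP = int p"
      "R' rE = int (PS (Suc j))" "R' rL = ?B" "R' rA = am r"
      using fr assms by (simp_all add: R1_def)
    let ?R = "R'(rH := lvl ?B y)"
    have "wp Feasible n (\<lambda>\<tau>. fst \<tau> rOk = (if feas par cl del am p j r (lvl ?B y) then 1 else 0)) (?R, m)"
      by (rule wp_Feasible) (use assms regs in auto)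
    then have "wp Feasible n (wp (Block [IfEq (Reg rFn) (Const 0) (IfEq (Reg rOk) (Const 1)
        (Block [Assign rHm (Reg rH), Assign rFn (Const 1)]))]) n
        (\<lambda>\<tau>. ?I (Suc y) ((fst \<tau>)(rY := int (Suc y))) (snd \<tau>))) (?R, m)"
    proof (rule wp_conseq)
      fix R'' :: "nat \<Rightarrow> int" and m'' :: "int \<Rightarrow> int"
      assume ok: "fst (R'', m'') rOk = (if feas par cl del am p j r (lvl ?B y) then 1 else 0)"
        and fr': "\<And>r. r \<notin> writes Feasible \<Longrightarrow> R'' r = ?R r"
      have r: "R'' rFn = R' rFn" "R'' rHm = R' rHm" "R'' rH = lvl ?B y" using fr' by simp_all
      have Qy: "?Q y \<longleftrightarrow> feas par cl del am p j r (lvl ?B y)" using y by simp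
      from I show "wp (Block [IfEq (Reg rFn) (Const 0) (IfEq (Reg rOk) (Const 1)
        (Block [Assign rHm (Reg rH), Assign rFn (Const 1)]))]) n
        (\<lambda>\<tau>. ?I (Suc y) ((fst \<tau>)(rY := int (Suc y))) (snd \<tau>)) (R'', m'')"
      proof
        assume "R' rFn = 0 \<and> R' rHm = ?B \<and> (\<forall>y'<y. \<not> ?Q y')"
        then show ?thesis using ok r Qy by (auto simp: less_Suc_eq)
      next
        assume "R' rFn = 1 \<and> (\<exists>y'<y. R' rHm = lvl ?B y' \<and> ?Q y' \<and> (\<forall>y''<y'. \<not> ?Q y''))"
        then show ?thesis using ok r by (simp) (blast intro: less_SucI)
      qed
    qed
    moreover have "(if LB y - int y < ?B then R'(rH := ?B) else R'(rH := LB y - int y)) = ?R"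
      by (auto simp: lvl_def max_def)
    ultimately show "wp ?body n (\<lambda>\<tau>. ?I (Suc y) ((fst \<tau>)(rY := int (Suc y))) (snd \<tau>)) (R', m')"
      using ry regs m' minstD(4)[OF assms(1) yk] by (simp split: if_splits)
  next
    fix R' m' assume I: "?I (PS (Suc j)) R' m'"
    show "fst (R', m') rHm = first_feas par cl del am p j r"
      using I
    proof
      assume "R' rFn = 0 \<and> R' rHm = ?B \<and> (\<forall>y'<PS (Suc j). \<not> ?Q y')"
      then show ?thesis by (auto simp: first_feas_def Let_def)
    next
      assume "R' rFn = 1 \<and> (\<exists>y'<PS (Suc j). R' rHm = lvl ?B y' \<and> ?Q y' \<and> (\<forall>y''<y'. \<not> ?Q y''))"
      then obtain y where y: "R' rHm = lvl ?B y" "?Q y" "\<forall>y''<y. \<not> ?Q y''" by blast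
      have "(LEAST y. ?Q y) = y"
      proof (rule Least_equality)
        show "?Q y" by (rule y(2))
        fix z assume "?Q z"
        then show "y \<le> z" using y(3) not_less by blast
      qed
      then show ?thesis using y by (auto simp: first_feas_def Let_def)
    qed
  qed (use assms n e in \<open>auto simp: R1_def\<close>)
  then show ?thesis using assms by (simp add: Feas_search_def R1_def)
qed

definition pinst :: "(nat \<Rightarrow> nat) \<Rightarrow> (int \<Rightarrow> int) \<Rightarrow> bool" where
  "pinst P m \<longleftrightarrow> (\<forall>c\<le>k. m (adr tP (int c)) = int (P c))"

definition ctx :: "(nat \<Rightarrow> nat) \<Rightarrow> nat \<Rightarrow> (nat \<Rightarrow> int) \<Rightarrow> bool" where
  "ctx P c R \<longleftrightarrow> R rJ = int (par c) \<and> R rP = int (P (par c)) \<and> R rE = int (PS (Suc (par c))) \<and>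
     R rL = blev del (P (par c)) (par c) \<and> R rA = am (cl c) \<and>
     R rH = hi_of par cl del am ofs (P (par c)) c \<and>
     R rLo = max (hi_of par cl del am ofs (P (par c)) c - am (cl c)) (blev del (P (par c)) (par c))"

lemma ranged_le:
  assumes "ranged P" "c \<le> k"
  shows "P c \<le> PS (Suc c)" "P c \<le> PS k"
proof -
  have "P c \<le> PS (Suc c) \<and> P c \<le> PS k"
  proof (cases "c = k")
    case False
    then have "c < k" "P c \<le> PS (Suc c)" using assms by (auto simp: ranged_def)
    then show ?thesis using seg_bounds(2)[of c] by linarith
  qed (use assms PS_Suc_k in \<open>auto simp: ranged_def\<close>)
  then show "P c \<le> PS (Suc c)" "P c \<le> PS k" by auto
qed

lemma wp_High:
  assumes m: "minst m" and R: "R rK = int k" "R rB = int b" "R rC = int c" and c: "c < k"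
    and P: "pinst P m" "ranged P"
  shows "wp High n (\<lambda>\<tau>. ctx P c (fst \<tau>)) (R, m)"
proof -
  let ?j = "par c" and ?p = "P (par c)"
  have j: "?j \<le> k" "cl c \<le> k" using par_le cl_le c by auto
  have p: "?p \<le> PS (Suc ?j)" "?p \<le> PS k" using ranged_le[OF P(2)] j by auto
  have mp: "m (adr tP (int ?j)) = int ?p" using P(1) j by (simp add: pinst_def)
  define R1 where "R1 = R(rJ := int ?j, rR := int (cl c), rP := int ?p, rE := int (PS (Suc ?j)),
     rL := blev del ?p ?j, rA := am (cl c))"
  have "wp Feas_search n (\<lambda>\<tau>. fst \<tau> rHm = first_feas par cl del am ?p ?j (cl c)) (R1, m)"
    by (rule wp_Feas_search) (use m R j p in \<open>auto simp: R1_def\<close>)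
  then have "wp Feas_search n (wp (Block [Assign rH (Add (Reg rHm) (At tD (Five (Reg rR) 4))), Set_low]) n
      (\<lambda>\<tau>. ctx P c (fst \<tau>))) (R1, m)"
  proof (rule wp_conseq)
    fix R' m' assume hm: "fst (R', m') rHm = first_feas par cl del am ?p ?j (cl c)"
      and fr: "\<And>r. r \<notin> writes Feas_search \<Longrightarrow> R' r = R1 r" and m': "nostore Feas_search \<Longrightarrow> m' = m"
    have r: "R' rJ = int ?j" "R' rR = int (cl c)" "R' rP = int ?p" "R' rE = int (PS (Suc ?j))"
      "R' rL = blev del ?p ?j" "R' rA = am (cl c)" using fr by (simp_all add: R1_def)
    show "wp (Block [Assign rH (Add (Reg rHm) (At tD (Five (Reg rR) 4))), Set_low]) n (\<lambda>\<tau>. ctx P c (fst \<tau>)) (R', m')"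
      using hm r m' minstD(11)[OF m j(2)] by (simp add: ctx_def hi_of_def)
  qed
  then show ?thesis using R c j p mp minstD[OF m]
    by (simp add: High_def Load_ctx_def R1_def blev_def algebra_simps)
qed

lemma wp_New_pos:
  assumes m: "minst m" and R: "R rB = int b" "R rC = int c" and c: "c < k"
    and P: "ranged P" and x: "ctx P c R"
  shows "wp New_pos n (\<lambda>\<tau>. snd \<tau> = m(adr tP (int c) := int (newp par cl del am ofs (P (par c)) c))) (R, m)"
proof -
  let ?j = "par c" and ?p = "P (par c)"
  let ?hi = "hi_of par cl del am ofs ?p c" and ?B = "blev del ?p ?j" and ?a = "am (cl c)"
  let ?b = "boards par del ?a ?p c ?hi"
  let ?hit = "\<lambda>x z. HV z = TV x \<and> elev ?B ?a ?hi z + int z < LB x + del c"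
  have j: "?j \<le> k" using par_le c by auto
  have p: "?p \<le> PS (Suc ?j)" using ranged_le[OF P] j by auto
  have e: "PS (Suc ?j) \<le> Suc (PS k)" using PS_mono[of "Suc ?j" "Suc k"] PS_Suc_k j by simp
  let ?I = "\<lambda>x R m. (R rFn = 0 \<and> R rNp = int (PS (Suc c)) \<and> (\<forall>y<x. \<not> ?b y)) \<or>
     (R rFn = 1 \<and> (\<exists>y<x. R rNp = int y \<and> ?b y \<and> (\<forall>y'<y. \<not> ?b y')))"
  \<comment> \<open>While row \<open>x\<close> is being scanned the first boarding edge may be
    \<open>x\<close> itself, hence \<open>y \<le> x\<close> here as against \<open>y < x\<close>
    between rows.\<close>
  let ?I2 = "\<lambda>x z R m. (R rFn = 0 \<and> R rNp = int (PS (Suc c)) \<and> (\<forall>y<x. \<not> ?b y) \<and> (\<forall>z'\<in>{?p..<z}. \<not> ?hit x z')) \<or>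
     (R rFn = 1 \<and> (\<exists>y\<le>x. R rNp = int y \<and> ?b y \<and> (\<forall>y'<y. \<not> ?b y')))"
  define R1 where "R1 = R(rNp := int (PS (Suc c)), rXe := int (PS (Suc c)), rFn := 0)"
  have "wp (For rX (At tPS (Reg rC)) rXe (For rZ (Reg rP) rE Board_test)) n
     (\<lambda>\<tau>. fst \<tau> rNp = int (newp par cl del am ofs ?p c)) (R1, m)"
  proof (rule wp_For[where l = "PS c" and u = "PS (Suc c)" and I = ?I])
    show "ram_eval (At tPS (Reg rC)) (R1, m) = int (PS c)" using R c minstD[OF m] by (simp add: R1_def)
    show "PS c \<le> PS (Suc c)" "PS (Suc c) - PS c \<le> n" using seg_bounds[of c] c by auto
    fix x R' m' assume x: "PS c \<le> x" "x < PS (Suc c)" and I: "?I x R' m'" and rx: "R' rX = int x"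
      and fr: "\<And>r. r \<noteq> rX \<Longrightarrow> r \<notin> writes (For rZ (Reg rP) rE Board_test) \<Longrightarrow> R' r = R1 r"
      and m0: "nostore (For rZ (Reg rP) rE Board_test) \<Longrightarrow> m' = m"
    have m': "m' = m" using m0 by simp
    have xk: "x < PS k" using x seg_bounds(2)[OF c] by simp
    have regs: "R' rB = int b" "R' rC = int c" "R' rP = int ?p" "R' rE = int (PS (Suc ?j))" "R' rL = ?B"
      "R' rH = ?hi" "R' rLo = max (?hi - ?a) ?B" using fr R \<open>ctx P c R\<close> by (simp_all add: R1_def ctx_def)
    show "wp (For rZ (Reg rP) rE Board_test) n (\<lambda>\<tau>. ?I (Suc x) ((fst \<tau>)(rX := int (Suc x))) (snd \<tau>)) (R', m')"
    proof (rule wp_For[where l = ?p and u = "PS (Suc ?j)" and I = "?I2 x"])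
      show "?I2 x ?p (R'(rZ := int ?p)) m'" using I by (auto intro: less_imp_le)
      fix z R'' m'' assume z: "?p \<le> z" "z < PS (Suc ?j)" and I2: "?I2 x z R'' m''" and rz: "R'' rZ = int z"
        and fr': "\<And>r. r \<noteq> rZ \<Longrightarrow> r \<notin> writes Board_test \<Longrightarrow> R'' r = R' r" and m0': "nostore Board_test \<Longrightarrow> m'' = m'"
      have m'': "m'' = m" using m0' m' by simp
      have regs': "R'' rB = int b" "R'' rC = int c" "R'' rL = ?B" "R'' rX = int x"
        "R'' rH = ?hi" "R'' rLo = max (?hi - ?a) ?B" using fr' regs rx by simp_all
      have zk: "z \<le> PS k" using z e by simp
      have hb: "?b x" if "?hit x z" using that x z by (auto simp: boards_def)
      have hz: "(\<forall>z'\<in>{?p..<Suc z}. \<not> ?hit x z') \<longleftrightarrow> (\<forall>z'\<in>{?p..<z}. \<not> ?hit x z') \<and> \<not> ?hit x z"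
        using z by (auto simp: less_Suc_eq)
      have "wp Board_test n (\<lambda>\<tau>. fst \<tau> rFn = (if R'' rFn = 0 \<and> ?hit x z then 1 else R'' rFn) \<and>
          fst \<tau> rNp = (if R'' rFn = 0 \<and> ?hit x z then int x else R'' rNp)) (R'', m'')"
        unfolding m'' using regs' rz zk xk c minstD[OF m]
        by (auto simp: Board_test_def elev_def lvl_def max_def min_def)
      then show "wp Board_test n (\<lambda>\<tau>. ?I2 x (Suc z) ((fst \<tau>)(rZ := int (Suc z))) (snd \<tau>)) (R'', m'')"
      proof (rule wp_mono)
        fix \<tau> assume t: "fst \<tau> rFn = (if R'' rFn = 0 \<and> ?hit x z then 1 else R'' rFn) \<and>
          fst \<tau> rNp = (if R'' rFn = 0 \<and> ?hit x z then int x else R'' rNp)"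
        from I2 show "?I2 x (Suc z) ((fst \<tau>)(rZ := int (Suc z))) (snd \<tau>)"
        proof
          assume a: "R'' rFn = 0 \<and> R'' rNp = int (PS (Suc c)) \<and> (\<forall>y<x. \<not> ?b y) \<and> (\<forall>z'\<in>{?p..<z}. \<not> ?hit x z')"
          show ?thesis
          proof (cases "?hit x z")
            case True
            then have "fst \<tau> rFn = 1" "fst \<tau> rNp = int x" using t a by simp_all
            then show ?thesis using a hb[OF True] by auto
          next
            case False
            then have "fst \<tau> rFn = 0" "fst \<tau> rNp = int (PS (Suc c))" using t a by (metis, metis)
            then show ?thesis using a False hz by simp
          qed
        next
          assume a: "R'' rFn = 1 \<and> (\<exists>y\<le>x. R'' rNp = int y \<and> ?b y \<and> (\<forall>y'<y. \<not> ?b y'))"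
          then have "fst \<tau> rFn = 1" "fst \<tau> rNp = R'' rNp" using t by simp_all
          then show ?thesis using a by simp
        qed
      qed
    next
      fix R'' m'' assume I2: "?I2 x (PS (Suc ?j)) R'' m''"
      have bx: "?b x \<longleftrightarrow> \<not> (\<forall>z'\<in>{?p..<PS (Suc ?j)}. \<not> ?hit x z')" using x by (auto simp: boards_def)
      from I2 show "?I (Suc x) ((fst (R'', m''))(rX := int (Suc x))) (snd (R'', m''))"
      proof
        assume a: "R'' rFn = 0 \<and> R'' rNp = int (PS (Suc c)) \<and> (\<forall>y<x. \<not> ?b y) \<and> (\<forall>z'\<in>{?p..<PS (Suc ?j)}. \<not> ?hit x z')"
        then have "\<not> ?b x" using bx by blast
        then show ?thesis using a by (simp add: less_Suc_eq)
      next
        assume "R'' rFn = 1 \<and> (\<exists>y\<le>x. R'' rNp = int y \<and> ?b y \<and> (\<forall>y'<y. \<not> ?b y'))"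
        then show ?thesis by (simp add: less_Suc_eq_le)
      qed
    qed (use regs p e n in auto)
  next
    show "?I (PS c) (R1(rX := int (PS c))) m" by (auto simp: R1_def boards_def)
    fix R' :: "nat \<Rightarrow> int" and m' :: "int \<Rightarrow> int" assume I: "?I (PS (Suc c)) R' m'"
    from I show "fst (R', m') rNp = int (newp par cl del am ofs ?p c)"
    proof
      assume a: "R' rFn = 0 \<and> R' rNp = int (PS (Suc c)) \<and> (\<forall>y<PS (Suc c). \<not> ?b y)"
      then have "\<not> (\<exists>y. ?b y)" by (auto simp: boards_def)
      then show ?thesis using a by (simp add: newp_def entry_def)
    next
      assume "R' rFn = 1 \<and> (\<exists>y<PS (Suc c). R' rNp = int y \<and> ?b y \<and> (\<forall>y'<y. \<not> ?b y'))"
      then obtain y where y: "R' rNp = int y" "?b y" "\<forall>y'<y. \<not> ?b y'" by blast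
      have "(LEAST y. ?b y) = y"
      proof (rule Least_equality)
        show "?b y" by (rule y(2))
        fix z assume "?b z"
        then show "y \<le> z" using y(3) not_less by blast
      qed
      then show ?thesis using y by (auto simp: newp_def entry_def)
    qed
  qed (auto simp: R1_def)
  then have "wp (For rX (At tPS (Reg rC)) rXe (For rZ (Reg rP) rE Board_test)) n
     (wp (Block [SetAt tP (Reg rC) (Reg rNp)]) n
       (\<lambda>\<tau>. snd \<tau> = m(adr tP (int c) := int (newp par cl del am ofs ?p c)))) (R1, m)"
    by (rule wp_conseq) (use R in \<open>auto simp: R1_def\<close>)
  then show ?thesis using R c minstD[OF m] by (simp add: New_pos_def R1_def)
qed

lemma wp_Rounds:
  assumes m: "minst m" and R: "base R" and P: "pinst P0 m"
  shows "wp Rounds n (\<lambda>\<tau>. pinst (positions par cl del am ofs) (snd \<tau>) \<and> same {tP} m (snd \<tau>)) (R, m)"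
proof -
  let ?f = "proc par cl del am ofs"
  let ?P = "\<lambda>i. (round par cl del am ofs ^^ i) P0"
  let ?in = "For rC (Const 0) rK (Block [High, New_pos])"
  show ?thesis unfolding Rounds_def
  proof (rule wp_For[where l = 0 and u = k and I = "\<lambda>i R m'. pinst (?P i) m' \<and> same {tP} m m'"])
    fix i R' m' assume I: "pinst (?P i) m' \<and> same {tP} m m'"
      and fr: "\<And>r. r \<noteq> rRd \<Longrightarrow> r \<notin> writes ?in \<Longrightarrow> R' r = R r"
    have bR': "R' rK = int k" "R' rB = int b" using fr R by (auto simp: base_def)
    show "wp ?in n (\<lambda>\<tau>. pinst (?P (Suc i)) (snd \<tau>) \<and> same {tP} m (snd \<tau>)) (R', m')"
    proof (rule wp_For[where l = 0 and u = k and I = "\<lambda>c R m'. pinst (foldl ?f (?P i) [0..<c]) m' \<and> same {tP} m m'"])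
      fix c R'' m'' assume c: "c < k" and I: "pinst (foldl ?f (?P i) [0..<c]) m'' \<and> same {tP} m m''"
        and rc: "R'' rC = int c"
        and fr': "\<And>r. r \<noteq> rC \<Longrightarrow> r \<notin> writes (Block [High, New_pos]) \<Longrightarrow> R'' r = R' r"
      let ?Q = "foldl ?f (?P i) [0..<c]"
      have m'': "minst m''" using minst_same[OF m] I by auto
      have rg: "ranged ?Q" using ranged_fold ranged_rounds c by auto
      have bR: "R'' rK = int k" "R'' rB = int b" using fr' bR' by auto
      have "wp High n (\<lambda>\<tau>. ctx ?Q c (fst \<tau>)) (R'', m'')"
        by (rule wp_High) (use m'' bR rc c I rg in auto)
      then have "wp High n (wp New_pos n (\<lambda>\<tau>. pinst (foldl ?f (?P i) [0..<Suc c]) (snd \<tau>) \<and> same {tP} m (snd \<tau>))) (R'', m'')"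
      proof (rule wp_conseq)
        fix R3 m3 assume x: "ctx ?Q c (fst (R3, m3))" and fr3: "\<And>r. r \<notin> writes High \<Longrightarrow> R3 r = R'' r"
          and "nostore High \<Longrightarrow> m3 = m''"
        then have m3: "m3 = m''" by simp
        have "wp New_pos n (\<lambda>\<tau>. snd \<tau> = m''(adr tP (int c) := int (newp par cl del am ofs (?Q (par c)) c))) (R3, m'')"
          by (rule wp_New_pos) (use m'' bR rc c x fr3 rg in auto)
        then show "wp New_pos n (\<lambda>\<tau>. pinst (foldl ?f (?P i) [0..<Suc c]) (snd \<tau>) \<and> same {tP} m (snd \<tau>)) (R3, m3)"
          unfolding m3
        proof (rule wp_mono)
          fix \<tau> assume t: "snd \<tau> = m''(adr tP (int c) := int (newp par cl del am ofs (?Q (par c)) c))"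
          have "pinst (?f ?Q c) (snd \<tau>)" using I unfolding t pinst_def by (auto simp: proc_def[of _ _ _ _ _ ?Q])
          then show "pinst (foldl ?f (?P i) [0..<Suc c]) (snd \<tau>) \<and> same {tP} m (snd \<tau>)"
            using I same_upd[of "{tP}" m m'' tP] t by simp
        qed
      qed
      then show "wp (Block [High, New_pos]) n (\<lambda>\<tau>. pinst (foldl ?f (?P i) [0..<Suc c]) (snd \<tau>) \<and> same {tP} m (snd \<tau>)) (R'', m'')"
        by simp
    qed (use I bR' n in \<open>auto simp: round_def[of par cl del am ofs "?P i"]\<close>)
  qed (use R P n same_refl in \<open>auto simp: base_def positions_def\<close>)
qed

end

section \<open>Computing the shifts\<close>

abbreviation (input) "rNop \<equiv> 27 :: nat"
abbreviation (input) "rCost \<equiv> 28 :: nat"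
abbreviation (input) "rQ \<equiv> 29 :: nat"
abbreviation (input) "rQx \<equiv> 30 :: nat"
abbreviation (input) "rQv \<equiv> 31 :: nat"
abbreviation (input) "rDl \<equiv> 32 :: nat"
abbreviation (input) "rW \<equiv> 33 :: nat"
abbreviation (input) "rWe \<equiv> 34 :: nat"
abbreviation (input) "rT \<equiv> 35 :: nat"
abbreviation (input) "rCnt \<equiv> 39 :: nat"

abbreviation (input) "tWL \<equiv> 10 :: int"
abbreviation (input) "tOP \<equiv> 11 :: int"
abbreviation (input) "tMK \<equiv> 12 :: int"

definition Shift_edge :: ram_com where
  "Shift_edge = IfPos (Sub (Reg rW) (Reg rQx))
     (Block [Assign rT (Add (Reg rQv) (Sub (Reg rW) (Reg rQx))),
        IfLt (At tWL (Reg rW)) (Reg rT) (SetAt tWL (Reg rW) (Reg rT))])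
     (IfPos (Sub (Reg rQx) (Reg rW))
       (Block [Assign rT (Sub (Reg rQv) (Sub (Reg rQx) (Reg rW))),
          IfLt (Reg rT) (At tWL (Reg rW)) (SetAt tWL (Reg rW) (Reg rT))])
       (SetAt tWL (Reg rW) (Reg rQv)))"

definition Push :: ram_com where
  "Push = Block [Assign rDl (Sub (Reg rQv) (At tWL (Reg rQx))), SetAt tOP (Reg rNop) (Reg rQ),
     SetAt tOP (Add (Reg rNop) (Const 1)) (Sub (Reg rQx) (At tPS (Reg rQ))),
     SetAt tOP (Add (Reg rNop) (Const 2)) (Reg rDl), Assign rNop (Add (Reg rNop) (Const 3)),
     IfPos (Reg rDl) (Assign rCost (Add (Reg rCost) (Reg rDl))) (Assign rCost (Sub (Reg rCost) (Reg rDl))),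
     Assign rWe (At tPS (Add (Reg rQ) (Const 1))),
     For rW (At tPS (Reg rQ)) rWe Shift_edge]"

definition Delay_path :: ram_com where
  "Delay_path = Block [Assign rQx (At tP (Reg rC)), IfLt (Reg rQx) (At tPS (Add (Reg rC) (Const 1)))
     (Block [Assign rQv (Sub (Add (At tLB (Reg rQx)) (At tD (Five (Reg rC) 7))) (Reg rB)),
        IfLt (At tWL (Reg rQx)) (Reg rQv) (Block [Assign rQ (Reg rC), Push])])]"

definition Last_low :: ram_com where
  "Last_low = Block [Assign rFn (Const 0), Assign rQx (Const 0),
     For rY (Reg rP) rE (Block [Assign rV (level_exp rY), IfLt (Reg rV) (Reg rL) (Assign rV (Reg rL)),
       IfLe (Reg rV) (Reg rH) (Block [Assign rQx (Reg rY), Assign rFn (Const 1)])])]"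

text \<open>Top and base level are recomputed by \<open>High\<close> from the final positions, so
  nothing has to be stored per class.\<close>

definition Advance_path :: ram_com where
  "Advance_path = Block [High, IfLt (Reg rJ) (Reg rK) (Block [Last_low,
     IfEq (Reg rFn) (Const 1) (Block [Assign rQv (Add (Reg rLo) (Reg rQx)),
       IfLt (Reg rQv) (At tWL (Reg rQx)) (Block [Assign rQ (Reg rJ), Push])])])]"

definition Gen :: "mr_variant \<Rightarrow> ram_com" where
  "Gen X = Block [For rX (Const 0) rM (SetAt tWL (Reg rX) (At tLB (Reg rX))),
     Assign rNop (Const 0), Assign rCost (Const 0),
     if X = MR_AP then Skip else For rC (Const 0) rK Delay_path,
     if X = MR_DP then Skip else For rC (Const 0) rK Advance_path]"

lemma writes_gen [simp]:
  "writes Shift_edge = {rT}" "\<not> nostore Shift_edge"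
  "writes Push = {rDl, rNop, rCost, rWe, rW, rT}" "\<not> nostore Push"
  "writes Delay_path = {rQx, rQv, rQ, rDl, rNop, rCost, rWe, rW, rT}" "\<not> nostore Delay_path"
  "writes Last_low = {rFn, rQx, rY, rV}" "nostore Last_low"
  "writes Advance_path = writes High \<union> {rFn, rQx, rY, rV, rQv, rQ, rDl, rNop, rCost, rWe, rW, rT}"
  "\<not> nostore Advance_path"
  unfolding Shift_edge_def Push_def Delay_path_def Last_low_def Advance_path_def by auto

lemma enc_shifts_snoc: "enc_shifts (ops @ [(c, j, d)]) = enc_shifts ops @ [int c, int j, d]"
  by (simp add: enc_shifts_def)

lemma length_enc_shifts: "length (enc_shifts ops) = 3 * length ops"
  by (induction ops) (auto simp: enc_shifts_def)

context guess
begin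

section \<open>Correctness of the generation of shifts\<close>

definition winst :: "(nat \<Rightarrow> int) \<Rightarrow> (int \<Rightarrow> int) \<Rightarrow> bool" where
  "winst W m \<longleftrightarrow> (\<forall>x<PS k. m (adr tWL (int x)) = W x)"

definition oinst :: "shift_op list \<Rightarrow> (nat \<Rightarrow> int) \<Rightarrow> (int \<Rightarrow> int) \<Rightarrow> bool" where
  "oinst ops R m \<longleftrightarrow> R rNop = int (length (enc_shifts ops)) \<and> R rCost = int (shifts_cost ops) \<and>
     (\<forall>i<length (enc_shifts ops). m (adr tOP (int i)) = enc_shifts ops ! i)"

definition wstate :: "(nat \<Rightarrow> int) \<times> shift_op list \<Rightarrow> (nat \<Rightarrow> int) \<Rightarrow> (int \<Rightarrow> int) \<Rightarrow> bool" where
  "wstate st R m \<longleftrightarrow> winst (fst st) m \<and> oinst (snd st) R m"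

lemma wstate_cong: "wstate st R m \<Longrightarrow> R' rNop = R rNop \<Longrightarrow> R' rCost = R rCost \<Longrightarrow> wstate st R' m"
  by (simp add: wstate_def oinst_def)

lemma wp_Shift_edge:
  assumes "R rW = int y" "R rQx = int x" "R rQv = v" "y \<in> seg c"
    "m (adr tWL (int y)) = W y"
  shows "wp Shift_edge n (\<lambda>\<tau>. snd \<tau> = m(adr tWL (int y) := fshift c x v W y)) (R, m)"
  using assms by (cases x y rule: linorder_cases) (auto simp: Shift_edge_def fshift_def max_def min_def)

lemma wp_Push:
  assumes m: "minst m" and st: "wstate st R m" and c: "c < k" "x \<in> seg c"
    and R: "R rQ = int c" "R rQx = int x" "R rQv = v"
  shows "wp Push n (\<lambda>\<tau>. wstate (push c x v st) (fst \<tau>) (snd \<tau>) \<and> same {tWL, tOP} m (snd \<tau>)) (R, m)"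
proof -
  obtain W ops where sto: "st = (W, ops)" by (cases st)
  have W: "\<And>y. y < PS k \<Longrightarrow> m (adr tWL (int y)) = W y" using st by (auto simp: wstate_def winst_def sto)
  have o: "oinst ops R m" using st by (simp add: wstate_def sto)
  have xk: "x < PS k" using seg_le[OF c] .
  let ?d = "v - W x" and ?N = "length (enc_shifts ops)"
  let ?ops = "ops @ [(c, x - PS c, ?d)]"
  define m1 where "m1 = m(adr tOP (int ?N) := int c, adr tOP (int ?N + 1) := int x - int (PS c),
     adr tOP (int ?N + 2) := ?d)"
  define R1 where "R1 = R(rDl := ?d, rNop := int ?N + 3, rCost := int (shifts_cost ?ops),
     rWe := int (PS (Suc c)))"
  have m1s: "same {tOP} m m1" unfolding m1_def by (intro same_upd same_refl) auto
  have mi: "minst m1" using minst_same[OF m m1s] by simp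
  have W1: "m1 (adr tWL (int y)) = W y" if "y < PS k" for y using W[OF that] by (simp add: m1_def)
  have o1: "oinst ?ops R1 m1"
    unfolding oinst_def
  proof (intro conjI allI impI)
    show "R1 rNop = int (length (enc_shifts ?ops))" by (simp add: R1_def enc_shifts_snoc)
    show "R1 rCost = int (shifts_cost ?ops)" by (simp add: R1_def)
    fix i assume "i < length (enc_shifts ?ops)"
    then have "i < ?N \<or> i = ?N \<or> i = ?N + 1 \<or> i = ?N + 2" by (auto simp: enc_shifts_snoc)
    then show "m1 (adr tOP (int i)) = enc_shifts ?ops ! i"
      using o c(2) by (auto simp: enc_shifts_snoc m1_def oinst_def nth_append of_nat_diff)
  qed
  \<comment> \<open>Overwriting in place is safe: the new label of an edge depends on its own old
    label and on \<open>x\<close> and \<open>v\<close>, which are kept in registers.\<close>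
  have "wp (For rW (At tPS (Reg rQ)) rWe Shift_edge) n
     (\<lambda>\<tau>. wstate (push c x v st) (fst \<tau>) (snd \<tau>) \<and> same {tWL, tOP} m (snd \<tau>)) (R1, m1)"
  proof (rule wp_For[where l = "PS c" and u = "PS (Suc c)" and
        I = "\<lambda>y R' m'. (\<forall>z<PS k. m' (adr tWL (int z)) = (if PS c \<le> z \<and> z < y then fshift c x v W z else W z))
           \<and> same {tWL} m1 m'"])
    show "ram_eval (At tPS (Reg rQ)) (R1, m1) = int (PS c)"
      using R c minstD(1)[OF mi, of c] by (simp add: R1_def)
    show "PS c \<le> PS (Suc c)" "PS (Suc c) - PS c \<le> n" using seg_bounds[of c] c by auto
    show "(\<forall>z<PS k. m1 (adr tWL (int z)) = (if PS c \<le> z \<and> z < PS c then fshift c x v W z else W z))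
           \<and> same {tWL} m1 m1" using W1 same_refl by auto
    fix y R' m' assume y: "PS c \<le> y" "y < PS (Suc c)"
      and I: "(\<forall>z<PS k. m' (adr tWL (int z)) = (if PS c \<le> z \<and> z < y then fshift c x v W z else W z))
           \<and> same {tWL} m1 m'" and ry: "R' rW = int y"
      and fr: "\<And>r. r \<noteq> rW \<Longrightarrow> r \<notin> writes Shift_edge \<Longrightarrow> R' r = R1 r"
    have yk: "y < PS k" using seg_le[OF c(1)] y by auto
    have "wp Shift_edge n (\<lambda>\<tau>. snd \<tau> = m'(adr tWL (int y) := fshift c x v W y)) (R', m')"
      by (rule wp_Shift_edge) (use ry fr R y I yk in \<open>auto simp: R1_def\<close>)
    then show "wp Shift_edge n (\<lambda>\<tau>. (\<forall>z<PS k. snd \<tau> (adr tWL (int z)) =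
        (if PS c \<le> z \<and> z < Suc y then fshift c x v W z else W z)) \<and> same {tWL} m1 (snd \<tau>)) (R', m')"
    proof (rule wp_mono)
      fix \<tau> assume t: "snd \<tau> = m'(adr tWL (int y) := fshift c x v W y)"
      have "same {tWL} m1 (snd \<tau>)" unfolding t using I by (intro same_upd) auto
      moreover have "snd \<tau> (adr tWL (int z)) =
        (if PS c \<le> z \<and> z < Suc y then fshift c x v W z else W z)" if "z < PS k" for z
        unfolding t using I that y by (auto simp: less_Suc_eq)
      ultimately show "(\<forall>z<PS k. snd \<tau> (adr tWL (int z)) =
        (if PS c \<le> z \<and> z < Suc y then fshift c x v W z else W z)) \<and> same {tWL} m1 (snd \<tau>)" by blast
    qed
  next
    fix R' m' assume I: "(\<forall>z<PS k. m' (adr tWL (int z)) = (if PS c \<le> z \<and> z < PS (Suc c) then fshift c x v W z else W z))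
           \<and> same {tWL} m1 m'"
      and fr: "\<And>r. r \<noteq> rW \<Longrightarrow> r \<notin> writes Shift_edge \<Longrightarrow> R' r = R1 r"
    have "winst (fshift c x v W) m'" unfolding winst_def
    proof (intro allI impI)
      fix z assume "z < PS k"
      then show "m' (adr tWL (int z)) = fshift c x v W z"
        using I fshift_other[of z c x v W] by (cases "z \<in> seg c") auto
    qed
    moreover have "oinst ?ops R' m'"
    proof -
      have "m' (adr tOP i) = m1 (adr tOP i)" for i using sameD[of "{tWL}" m1 m' tOP i] I by simp
      then show ?thesis using o1 fr by (simp add: oinst_def)
    qed
    moreover have "same {tWL, tOP} m m'"
      using same_trans[of "{tWL, tOP}" m m1 m'] same_mono[OF m1s, of "{tWL, tOP}"]
        same_mono[of "{tWL}" m1 m' "{tWL, tOP}"] I by auto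
    ultimately show "wstate (push c x v st) (fst (R', m')) (snd (R', m')) \<and> same {tWL, tOP} m (snd (R', m'))"
      by (simp add: sto wstate_def)
  qed (auto simp: R1_def)
  moreover have "(if 0 < ?d then int (shifts_cost ops) + ?d else int (shifts_cost ops) - ?d) = int (shifts_cost ?ops)"
    by (simp add: shifts_cost_append shifts_cost_single)
  ultimately show ?thesis
    using R W[OF xk] o minstD(1,6)[OF m, of c] minstD(6)[OF mi, of c] c(1)
    by (simp add: Push_def R1_def m1_def oinst_def split: if_splits)
qed

lemma wp_Delay_path:
  assumes m: "minst m" and P: "pinst P m" "ranged P" and st: "wstate st R m" and c: "c < k"
    and R: "R rC = int c" "R rB = int b"
  shows "wp Delay_path n (\<lambda>\<tau>. wstate (dstep del P st c) (fst \<tau>) (snd \<tau>) \<and> same {tWL, tOP} m (snd \<tau>)) (R, m)"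
proof -
  have mp: "m (adr tP (int c)) = int (P c)" using P(1) c by (simp add: pinst_def)
  have pk: "P c \<le> PS k" "PS c \<le> P c" using ranged_le[OF P(2)] P(2) c by (auto simp: ranged_def)
  let ?v = "LB (P c) + del c"
  show ?thesis
  proof (cases "P c < PS (Suc c)")
    case True
    then have seg: "P c \<in> seg c" "P c < PS k" using pk seg_bounds(2)[OF c] by auto
    have w: "m (adr tWL (int (P c))) = fst st (P c)" using st seg by (simp add: wstate_def winst_def)
    show ?thesis
    proof (cases "fst st (P c) < ?v")
      case v: True
      have "wp Push n (\<lambda>\<tau>. wstate (push c (P c) ?v st) (fst \<tau>) (snd \<tau>) \<and> same {tWL, tOP} m (snd \<tau>))
         (R(rQx := int (P c), rQv := ?v, rQ := int c), m)"
        by (rule wp_Push) (use m wstate_cong[OF st] c seg in auto)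
      then show ?thesis using True v mp w R c pk minstD[OF m]
        by (simp add: Delay_path_def dstep_def Let_def)
    next
      case False
      have "wstate st (R(rQx := int (P c), rQv := ?v)) m" using wstate_cong[OF st] by simp
      then show ?thesis using True False mp w R c pk minstD[OF m] same_refl
        by (simp add: Delay_path_def dstep_def Let_def)
    qed
  next
    case False
    have "wstate st (R(rQx := int (P c))) m" using wstate_cong[OF st] by simp
    then show ?thesis using False mp R c pk minstD[OF m] same_refl
      by (simp add: Delay_path_def dstep_def Let_def)
  qed
qed

lemma wp_Last_low:
  assumes m: "minst m" and R: "R rP = int p" "R rE = int e" "p \<le> e" "e \<le> Suc (PS k)" "R rL = B" "R rH = hi"
  defines "S \<equiv> {y \<in> {p..<e}. lvl B y \<le> hi}"
  shows "wp Last_low n (\<lambda>\<tau>. if S = {} then fst \<tau> rFn = 0 else fst \<tau> rFn = 1 \<and> fst \<tau> rQx = int (Max S)) (R, m)"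
proof -
  let ?S = "\<lambda>y. {z \<in> {p..<y}. lvl B z \<le> hi}"
  let ?I = "\<lambda>y R m. if ?S y = {} then R rFn = 0 else R rFn = 1 \<and> R rQx = int (Max (?S y))"
  let ?body = "Block [Assign rV (level_exp rY), IfLt (Reg rV) (Reg rL) (Assign rV (Reg rL)),
       IfLe (Reg rV) (Reg rH) (Block [Assign rQx (Reg rY), Assign rFn (Const 1)])]"
  have "wp (For rY (Reg rP) rE ?body) n (\<lambda>\<tau>. ?I e (fst \<tau>) (snd \<tau>)) (R(rFn := 0, rQx := 0), m)"
  proof (rule wp_For[where l = p and u = e and I = ?I])
    fix y R' m' assume y: "p \<le> y" "y < e" and I: "?I y R' m'" and ry: "R' rY = int y"
      and fr: "\<And>r. r \<noteq> rY \<Longrightarrow> r \<notin> writes ?body \<Longrightarrow> R' r = (R(rFn := 0, rQx := 0)) r"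
      and m0: "nostore ?body \<Longrightarrow> m' = m"
    have m': "m' = m" using m0 by simp
    have yk: "y \<le> PS k" using y R by simp
    have regs: "R' rL = B" "R' rH = hi" using fr R by simp_all
    have body: "wp ?body n Q (R', m') = (if lvl B y \<le> hi then Q (R'(rV := lvl B y, rQx := int y, rFn := 1), m)
       else Q (R'(rV := lvl B y), m))" for Q
      using ry regs m' minstD(4)[OF m yk] by (auto simp: lvl_def max_def fun_upd_twist)
    show "wp ?body n (\<lambda>\<tau>. ?I (Suc y) ((fst \<tau>)(rY := int (Suc y))) (snd \<tau>)) (R', m')"
    proof (cases "lvl B y \<le> hi")
      case True
      have S: "?S (Suc y) = insert y (?S y)" using True y by (auto simp: less_Suc_eq)
      have "Max (?S (Suc y)) = y" unfolding S by (rule Max_eqI) auto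
      then show ?thesis unfolding body using True S by simp
    next
      case False
      have "?S (Suc y) = ?S y" using False by (auto simp: less_Suc_eq)
      then show ?thesis unfolding body using False I by simp
    qed
  qed (use R n in auto)
  moreover have "wp Last_low n Q (R, m) = wp (For rY (Reg rP) rE ?body) n Q (R(rFn := 0, rQx := 0), m)" for Q
    by (simp add: Last_low_def)
  ultimately show ?thesis unfolding S_def by simp
qed

lemma wp_Advance_path:
  assumes m: "minst m" and P: "pinst P m" "ranged P" and st: "wstate st R m" and c: "c < k"
    and R: "R rC = int c" "R rB = int b" "R rK = int k"
  shows "wp Advance_path n (\<lambda>\<tau>. wstate (astep par cl del am ofs P st c) (fst \<tau>) (snd \<tau>) \<and>
     same {tWL, tOP} m (snd \<tau>)) (R, m)"
proof -
  define j B hi S y v where "j = par c" and "B = blev del (P j) j"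
    and "hi = hi_of par cl del am ofs (P j) c" and "S = low_edges B hi (P j) j" and "y = Max S"
    and "v = max (hi - am (cl c)) B + int y"
  have eq: "astep par cl del am ofs P st c =
      (if j < k \<and> S \<noteq> {} \<and> v < fst st y then push j y v st else st)"
    by (simp add: astep_def Let_def j_def B_def hi_def S_def y_def v_def)
  let ?post = "\<lambda>\<tau>. wstate (astep par cl del am ofs P st c) (fst \<tau>) (snd \<tau>) \<and> same {tWL, tOP} m (snd \<tau>)"
  let ?tail = "IfEq (Reg rFn) (Const 1) (Block [Assign rQv (Add (Reg rLo) (Reg rQx)),
       IfLt (Reg rQv) (At tWL (Reg rQx)) (Block [Assign rQ (Reg rJ), Push])])"
  have jk: "j \<le> k" using par_le c by (simp add: j_def)
  have pj: "P j \<le> PS (Suc j)" using ranged_le[OF P(2) jk] by simp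
  have e: "PS (Suc j) \<le> Suc (PS k)" using PS_mono[of "Suc j" "Suc k"] PS_Suc_k jk by simp
  have "wp High n (\<lambda>\<tau>. ctx P c (fst \<tau>)) (R, m)"
    by (rule wp_High) (use m R c P in auto)
  then have "wp High n (wp (IfLt (Reg rJ) (Reg rK) (Block [Last_low, ?tail])) n ?post) (R, m)"
  proof (rule wp_conseq)
    fix R' m' assume x: "ctx P c (fst (R', m'))" and fr: "\<And>r. r \<notin> writes High \<Longrightarrow> R' r = R r"
      and "nostore High \<Longrightarrow> m' = m"
    then have m': "m' = m" by simp
    have regs: "R' rJ = int j" "R' rP = int (P j)" "R' rE = int (PS (Suc j))" "R' rL = B" "R' rH = hi"
      "R' rLo = max (hi - am (cl c)) B" "R' rK = int k"
      using x fr R by (auto simp: ctx_def j_def B_def hi_def)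
    have st': "wstate st R' m" using wstate_cong[OF st] fr by simp
    show "wp (IfLt (Reg rJ) (Reg rK) (Block [Last_low, ?tail])) n ?post (R', m')"
    proof (cases "j < k")
      case False
      then show ?thesis using regs st' same_refl m' eq by simp
    next
      case True
      have "wp Last_low n (\<lambda>\<tau>. if S = {} then fst \<tau> rFn = 0 else fst \<tau> rFn = 1 \<and> fst \<tau> rQx = int (Max S)) (R', m)"
        unfolding S_def low_edges_def by (rule wp_Last_low) (use m regs pj e in auto)
      then have "wp Last_low n (wp ?tail n ?post) (R', m)"
      proof (rule wp_conseq)
        fix R2 m2 assume a: "if S = {} then fst (R2, m2) rFn = 0 else fst (R2, m2) rFn = 1 \<and> fst (R2, m2) rQx = int (Max S)"
          and fr2: "\<And>r. r \<notin> writes Last_low \<Longrightarrow> R2 r = R' r" and "nostore Last_low \<Longrightarrow> m2 = m"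
        then have m2: "m2 = m" by simp
        have regs2: "R2 rJ = int j" "R2 rLo = max (hi - am (cl c)) B" using fr2 regs by simp_all
        have st2: "wstate st R2 m" using wstate_cong[OF st'] fr2 by simp
        show "wp ?tail n ?post (R2, m2)"
        proof (cases "S = {}")
          case True
          then show ?thesis using a m2 st2 same_refl eq by simp
        next
          case ne: False
          then have yS: "y \<in> S" unfolding y_def S_def by (rule low_edges_Max)
          then have ys: "y \<in> seg j" using P(2) True by (auto simp: S_def low_edges_def ranged_def)
          then have yk: "y < PS k" using seg_le[OF True] by simp
          have w: "m (adr tWL (int y)) = fst st y" using st yk by (simp add: wstate_def winst_def)
          have q: "R2 rFn = 1" "R2 rQx = int y" using a ne by (simp_all add: y_def)
          show ?thesis
          proof (cases "v < fst st y")
            case v: True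
            have "wp Push n (\<lambda>\<tau>. wstate (push j y v st) (fst \<tau>) (snd \<tau>) \<and> same {tWL, tOP} m (snd \<tau>))
               (R2(rQv := v, rQ := int j), m)"
              by (rule wp_Push) (use m wstate_cong[OF st2] True ys q in auto)
            then show ?thesis using v q w m2 regs2 True ne eq by (simp add: v_def)
          next
            case False
            have "wstate st (R2(rQv := v)) m" using wstate_cong[OF st2] by simp
            then show ?thesis using False q w m2 regs2 True ne eq same_refl by (simp add: v_def)
          qed
        qed
      qed
      then show ?thesis using True regs m' by simp
    qed
  qed
  then show ?thesis by (simp add: Advance_path_def)
qed

lemma wp_Gen:
  assumes m: "minst m" and P: "pinst (positions par cl del am ofs) m" and R: "base R"
  shows "wp (Gen X) n (\<lambda>\<tau>. wstate (gen X par cl del am ofs) (fst \<tau>) (snd \<tau>) \<and> same {tWL, tOP} m (snd \<tau>)) (R, m)"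
proof -
  let ?P = "positions par cl del am ofs"
  let ?T = "{tWL, tOP}"
  have rg: "ranged ?P" by (rule ranged_positions)
  let ?st1 = "if X = MR_AP then (LB, []) else dstage del ?P"
  let ?D = "if X = MR_AP then Skip else For rC (Const 0) rK Delay_path"
  let ?A = "if X = MR_DP then Skip else For rC (Const 0) rK Advance_path"
  have keep: "minst m'" "pinst ?P m'" if "same ?T m m'" for m'
    using minst_same[OF m that] P sameD[OF that, of tP] by (auto simp: pinst_def)
  have A: "wp ?A n (\<lambda>\<tau>. wstate (gen X par cl del am ofs) (fst \<tau>) (snd \<tau>) \<and> same ?T m (snd \<tau>)) (R', m')"
    if "wstate ?st1 R' m'" "same ?T m m'" "base R'" for R' m'
  proof (cases "X = MR_DP")
    case True
    then show ?thesis using that by (simp add: gen_def)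
  next
    case False
    have "wp (For rC (Const 0) rK Advance_path) n
       (\<lambda>\<tau>. wstate (foldl (astep par cl del am ofs ?P) ?st1 [0..<k]) (fst \<tau>) (snd \<tau>) \<and> same ?T m (snd \<tau>)) (R', m')"
    proof (rule wp_For[where l = 0 and u = k and
          I = "\<lambda>c R2 m2. wstate (foldl (astep par cl del am ofs ?P) ?st1 [0..<c]) R2 m2 \<and> same ?T m m2"])
      show "wstate (foldl (astep par cl del am ofs ?P) ?st1 [0..<0]) (R'(rC := int 0)) m' \<and> same ?T m m'"
        using that wstate_cong[OF that(1)] by simp
      fix c R2 m2 assume c: "c < k" and I: "wstate (foldl (astep par cl del am ofs ?P) ?st1 [0..<c]) R2 m2 \<and> same ?T m m2"
        and rc: "R2 rC = int c" and fr: "\<And>r. r \<noteq> rC \<Longrightarrow> r \<notin> writes Advance_path \<Longrightarrow> R2 r = R' r"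
      have "wp Advance_path n (\<lambda>\<tau>. wstate (astep par cl del am ofs ?P (foldl (astep par cl del am ofs ?P) ?st1 [0..<c]) c) (fst \<tau>) (snd \<tau>) \<and>
         same ?T m2 (snd \<tau>)) (R2, m2)"
        by (rule wp_Advance_path) (use keep I rg c rc fr that(3) in \<open>auto simp: base_def\<close>)
      then show "wp Advance_path n (\<lambda>\<tau>. wstate (foldl (astep par cl del am ofs ?P) ?st1 [0..<Suc c])
          ((fst \<tau>)(rC := int (Suc c))) (snd \<tau>) \<and> same ?T m (snd \<tau>)) (R2, m2)"
        by (rule wp_mono) (use I in \<open>auto intro: wstate_cong same_trans\<close>)
    qed (use that n in \<open>auto simp: base_def\<close>)
    then show ?thesis using False by (simp add: gen_def Let_def)
  qed
  have Dl: "wp ?D n (wp (Block [?A]) n (\<lambda>\<tau>. wstate (gen X par cl del am ofs) (fst \<tau>) (snd \<tau>) \<and> same ?T m (snd \<tau>))) (R', m')"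
    if "wstate (LB, []) R' m'" "same ?T m m'" "base R'" for R' m'
  proof (cases "X = MR_AP")
    case True
    then show ?thesis using that A by simp
  next
    case False
    have "wp (For rC (Const 0) rK Delay_path) n
       (\<lambda>\<tau>. wstate ?st1 (fst \<tau>) (snd \<tau>) \<and> same ?T m (snd \<tau>)) (R', m')"
    proof (rule wp_For[where l = 0 and u = k and
          I = "\<lambda>c R2 m2. wstate (foldl (dstep del ?P) (LB, []) [0..<c]) R2 m2 \<and> same ?T m m2"])
      show "wstate (foldl (dstep del ?P) (LB, []) [0..<0]) (R'(rC := int 0)) m' \<and> same ?T m m'"
        using that wstate_cong[OF that(1)] by simp
      fix c R2 m2 assume c: "c < k" and I: "wstate (foldl (dstep del ?P) (LB, []) [0..<c]) R2 m2 \<and> same ?T m m2"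
        and rc: "R2 rC = int c" and fr: "\<And>r. r \<noteq> rC \<Longrightarrow> r \<notin> writes Delay_path \<Longrightarrow> R2 r = R' r"
      have "wp Delay_path n (\<lambda>\<tau>. wstate (dstep del ?P (foldl (dstep del ?P) (LB, []) [0..<c]) c) (fst \<tau>) (snd \<tau>) \<and>
         same ?T m2 (snd \<tau>)) (R2, m2)"
        by (rule wp_Delay_path) (use keep I rg c rc fr that(3) in \<open>auto simp: base_def\<close>)
      then show "wp Delay_path n (\<lambda>\<tau>. wstate (foldl (dstep del ?P) (LB, []) [0..<Suc c])
          ((fst \<tau>)(rC := int (Suc c))) (snd \<tau>) \<and> same ?T m (snd \<tau>)) (R2, m2)"
        by (rule wp_mono) (use I in \<open>auto intro: wstate_cong same_trans\<close>)
    qed (use that n False in \<open>auto simp: base_def dstage_def\<close>)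
    then have "wp (For rC (Const 0) rK Delay_path) n
       (wp (Block [?A]) n (\<lambda>\<tau>. wstate (gen X par cl del am ofs) (fst \<tau>) (snd \<tau>) \<and> same ?T m (snd \<tau>))) (R', m')"
    proof (rule wp_conseq)
      fix R2 m2 assume "wstate ?st1 (fst (R2, m2)) (snd (R2, m2)) \<and> same ?T m (snd (R2, m2))"
        and fr: "\<And>r. r \<notin> writes (For rC (Const 0) rK Delay_path) \<Longrightarrow> R2 r = R' r"
      moreover have "base R2" using that(3) fr by (simp add: base_def)
      ultimately show "wp (Block [?A]) n (\<lambda>\<tau>. wstate (gen X par cl del am ofs) (fst \<tau>) (snd \<tau>) \<and> same ?T m (snd \<tau>)) (R2, m2)"
        using A by simp
    qed
    then show ?thesis using False by simp
  qed
  have "wp (For rX (Const 0) rM (SetAt tWL (Reg rX) (At tLB (Reg rX)))) n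
     (wp (Block [Assign rNop (Const 0), Assign rCost (Const 0), ?D, ?A]) n
       (\<lambda>\<tau>. wstate (gen X par cl del am ofs) (fst \<tau>) (snd \<tau>) \<and> same ?T m (snd \<tau>))) (R, m)"
  proof (rule wp_For[where l = 0 and u = "PS k" and
        I = "\<lambda>x R m'. (\<forall>y<x. m' (adr tWL (int y)) = LB y) \<and> same ?T m m'"])
    fix x R' m' assume x: "x < PS k" and I: "(\<forall>y<x. m' (adr tWL (int y)) = LB y) \<and> same ?T m m'" and rx: "R' rX = int x"
    have "m' (adr tLB (int x)) = LB x" using minstD(4)[OF keep(1)] I x by simp
    then show "wp (SetAt tWL (Reg rX) (At tLB (Reg rX))) n
      (\<lambda>\<tau>. (\<forall>y<Suc x. snd \<tau> (adr tWL (int y)) = LB y) \<and> same ?T m (snd \<tau>)) (R', m')"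
      using I rx same_upd[of ?T m m' tWL] by (auto simp: less_Suc_eq)
  next
    fix R' m' assume I: "(\<forall>y<PS k. m' (adr tWL (int y)) = LB y) \<and> same ?T m m'"
      and fr: "\<And>r. r \<noteq> rX \<Longrightarrow> r \<notin> writes (SetAt tWL (Reg rX) (At tLB (Reg rX))) \<Longrightarrow> R' r = R r"
    let ?R = "R'(rNop := 0, rCost := 0)"
    have "wstate (LB, []) ?R m'" using I
      by (simp add: wstate_def winst_def oinst_def enc_shifts_def shifts_cost_Nil)
    moreover have "base ?R" using R fr by (simp add: base_def)
    ultimately show "wp (Block [Assign rNop (Const 0), Assign rCost (Const 0), ?D, ?A]) n
       (\<lambda>\<tau>. wstate (gen X par cl del am ofs) (fst \<tau>) (snd \<tau>) \<and> same ?T m (snd \<tau>)) (R', m')"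
      using Dl I by simp
  qed (use R n same_refl in \<open>auto simp: base_def\<close>)
  then show ?thesis by (simp add: Gen_def)
qed

end

section \<open>Evaluating a guess\<close>

abbreviation (input) "rI \<equiv> 36 :: nat"
abbreviation (input) "rBest \<equiv> 37 :: nat"
abbreviation (input) "rNb \<equiv> 38 :: nat"
abbreviation (input) "rND \<equiv> 40 :: nat"
abbreviation (input) "rCy \<equiv> 41 :: nat"
abbreviation (input) "rRun \<equiv> 42 :: nat"

abbreviation (input) "tU \<equiv> 7 :: int"
abbreviation (input) "tBE \<equiv> 13 :: int"

definition Mark_edge :: ram_com where
  "Mark_edge = Block [IfEq (At tTV (Reg rX)) (Reg rS) (SetAt tMK (Reg rX) (Const 1)),
     For rZ (Const 0) rM (IfEq (At tMK (Reg rZ)) (Const 1) (IfEq (At tHV (Reg rZ)) (At tTV (Reg rX))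
       (IfLt (At tWL (Reg rZ)) (At tWL (Reg rX)) (SetAt tMK (Reg rX) (Const 1)))))]"

text \<open>A reached vertex is counted at the first marked edge that enters it; the source is
  covered beforehand by the initial 1 in \<open>Eval\<close>.\<close>

definition Count_edge :: ram_com where
  "Count_edge = IfEq (At tMK (Reg rX)) (Const 1) (Block [Assign rHit (Const 0),
     IfEq (At tHV (Reg rX)) (Reg rS) (Assign rHit (Const 1)),
     For rZ (Const 0) rX (IfEq (At tMK (Reg rZ)) (Const 1)
       (IfEq (At tHV (Reg rZ)) (At tHV (Reg rX)) (Assign rHit (Const 1)))),
     IfEq (Reg rHit) (Const 0) (Assign rCnt (Add (Reg rCnt) (Const 1)))])"

definition Eval :: ram_com where
  "Eval = Block [For rX (Const 0) rM (SetAt tMK (Reg rX) (Const 0)),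
     For rRd (Const 0) rM (For rX (Const 0) rM Mark_edge),
     Assign rCnt (Const 1), For rX (Const 0) rM Count_edge]"

definition Keep_best :: ram_com where
  "Keep_best = IfLe (Reg rCost) (Reg rB) (IfLt (Reg rBest) (Reg rCnt)
     (Block [Assign rBest (Reg rCnt), Assign rNb (Reg rNop),
       For rI (Const 0) rNop (SetAt tBE (Reg rI) (At tOP (Reg rI)))]))"

definition Init_pos :: ram_com where
  "Init_pos = Block [For rC (Const 0) rK (SetAt tP (Reg rC) (At tPS (Add (Reg rC) (Const 1)))),
     SetAt tP (Reg rK) (Reg rM)]"

definition Try_guess :: "mr_variant \<Rightarrow> ram_com" where
  "Try_guess X = Block [Init_pos, Rounds, Gen X, Eval, Keep_best]"

lemma writes_main [simp]:
  "writes Mark_edge = {rZ}" "\<not> nostore Mark_edge"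
  "writes Count_edge = {rHit, rZ, rCnt}" "nostore Count_edge"
  "writes Eval = {rX, rRd, rZ, rCnt, rHit}" "\<not> nostore Eval"
  "writes Keep_best = {rBest, rNb, rI}" "\<not> nostore Keep_best"
  "writes Init_pos = {rC}" "\<not> nostore Init_pos"
  "writes Rounds = insert rRd (insert rC (writes High \<union> {rNp, rXe, rFn, rX, rZ, rV}))" "\<not> nostore Rounds"
  "\<not> nostore (Gen X)"
  unfolding Mark_edge_def Count_edge_def Eval_def Keep_best_def Init_pos_def Rounds_def New_pos_def Gen_def by auto

lemma writes_Gen: "writes (Gen X) \<subseteq> {6..35}"
  by (auto simp: Gen_def)

lemma writes_Try_guess: "writes (Try_guess X) \<subseteq> {6..39}"
  using writes_Gen[of X] by (auto simp: Try_guess_def)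

lemma mem_image_less_Suc: "h \<in> insert s (f ` {y. Q y \<and> y < Suc z}) \<longleftrightarrow>
    h \<in> insert s (f ` {y. Q y \<and> y < z}) \<or> Q z \<and> f z = h"
proof -
  have "{y. Q y \<and> y < Suc z} = (if Q z then insert z {y. Q y \<and> y < z} else {y. Q y \<and> y < z})"
    by (auto simp: less_Suc_eq)
  then show ?thesis by (simp add: eq_commute disj_commute disj_left_commute)
qed

section \<open>Counting the reached vertices by rounds of marking\<close>

context flat_instance
begin

definition val :: "(nat \<Rightarrow> int) \<Rightarrow> nat" where
  "val W = card (insert s (HV ` {x. usable W x}))"

text \<open>A predecessor on a walk has smaller label and thus smaller rank. So \<open>PS k\<close>
  rounds mark every usable edge, whatever the order in which edges are scanned.\<close>

definition rank :: "(nat \<Rightarrow> int) \<Rightarrow> nat \<Rightarrow> nat" where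
  "rank W x = card {y. y < PS k \<and> W y < W x}"

lemma rank_mono: "y < PS k \<Longrightarrow> W y < W x \<Longrightarrow> rank W y < rank W x"
  unfolding rank_def by (rule psubset_card_mono) auto

lemma rank_less: "x < PS k \<Longrightarrow> rank W x < PS k"
proof -
  assume "x < PS k"
  then have "rank W x < card {..<PS k}" unfolding rank_def by (intro psubset_card_mono) auto
  then show ?thesis by simp
qed

definition sinst :: "(int \<Rightarrow> int) \<Rightarrow> bool" where
  "sinst m \<longleftrightarrow> (\<forall>c\<le>Suc k. m (adr tPS (int c)) = int (PS c)) \<and> (\<forall>x<PS k. m (adr tTV (int x)) = TV x) \<and>
     (\<forall>x\<le>PS k. m (adr tHV (int x)) = HV x \<and> m (adr tLB (int x)) = LB x)"

definition bstate :: "shift_op list \<times> int \<Rightarrow> (nat \<Rightarrow> int) \<Rightarrow> (int \<Rightarrow> int) \<Rightarrow> bool" where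
  "bstate bv R m \<longleftrightarrow> R rBest = snd bv \<and> R rNb = int (length (enc_shifts (fst bv))) \<and>
     (\<forall>i<length (enc_shifts (fst bv)). m (adr tBE (int i)) = enc_shifts (fst bv) ! i)"

definition better :: "(nat \<Rightarrow> int) \<times> shift_op list \<Rightarrow> shift_op list \<times> int \<Rightarrow> shift_op list \<times> int" where
  "better st bv = (if shifts_cost (snd st) \<le> b \<and> snd bv < int (val (fst st))
     then (snd st, int (val (fst st))) else bv)"

end

context guess
begin

definition kinst :: "nat set \<Rightarrow> (int \<Rightarrow> int) \<Rightarrow> bool" where
  "kinst A m \<longleftrightarrow> (\<forall>x<PS k. m (adr tMK (int x)) = (if x \<in> A then 1 else 0))"

lemma kinst_upd: "kinst A m \<Longrightarrow> kinst (insert x A) (m(adr tMK (int x) := 1))"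
  by (auto simp: kinst_def)

text \<open>Completeness is claimed only relative to the set \<open>A\<close> marked before this
  step. Marks that are set during the scan are correct and may help, but the argument does not rely
  on them.\<close>

lemma wp_Mark_edge:
  assumes m: "minst m" "winst W m" "kinst A m" and R: "R rX = int x" "R rS = s" "R rM = int (PS k)" and x: "x < PS k"
    and A: "\<And>y. y \<in> A \<Longrightarrow> usable W y"
  shows "wp Mark_edge n (\<lambda>\<tau>. same {tMK} m (snd \<tau>) \<and> (\<exists>A'. kinst A' (snd \<tau>) \<and> A \<subseteq> A' \<and>
     (\<forall>y\<in>A'. usable W y) \<and> (TV x = s \<or> (\<exists>y\<in>A. y < PS k \<and> HV y = TV x \<and> W y < W x) \<longrightarrow> x \<in> A'))) (R, m)"
proof -
  define A1 where "A1 = (if TV x = s then insert x A else A)"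
  define m1 where "m1 = (if TV x = s then m(adr tMK (int x) := 1) else m)"
  have s1: "same {tMK} m m1" unfolding m1_def using same_refl by (auto intro: same_upd)
  have k1: "kinst A1 m1" unfolding A1_def m1_def using kinst_upd[OF m(3)] m(3) by auto
  have u1: "\<And>y. y \<in> A1 \<Longrightarrow> usable W y" unfolding A1_def using A usable_start[OF x] by (auto split: if_splits)
  let ?body = "IfEq (At tMK (Reg rZ)) (Const 1) (IfEq (At tHV (Reg rZ)) (At tTV (Reg rX))
       (IfLt (At tWL (Reg rZ)) (At tWL (Reg rX)) (SetAt tMK (Reg rX) (Const 1))))"
  let ?J = "\<lambda>z A'. A1 \<subseteq> A' \<and> (\<forall>y\<in>A'. usable W y) \<and>
     ((\<exists>y\<in>A1. y < z \<and> HV y = TV x \<and> W y < W x) \<longrightarrow> x \<in> A')"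
  have "wp (For rZ (Const 0) rM ?body) n (\<lambda>\<tau>. same {tMK} m (snd \<tau>) \<and> (\<exists>A'. kinst A' (snd \<tau>) \<and> ?J (PS k) A')) (R, m1)"
  proof (rule wp_For[where l = 0 and u = "PS k" and I = "\<lambda>z R m'. same {tMK} m m' \<and> (\<exists>A'. kinst A' m' \<and> ?J z A')"])
    show "same {tMK} m m1 \<and> (\<exists>A'. kinst A' m1 \<and> ?J 0 A')" using s1 k1 u1 by blast
    fix z R' m' assume z: "z < PS k" and I: "same {tMK} m m' \<and> (\<exists>A'. kinst A' m' \<and> ?J z A')" and rz: "R' rZ = int z"
      and fr: "\<And>r. r \<noteq> rZ \<Longrightarrow> r \<notin> writes ?body \<Longrightarrow> R' r = R r"
    obtain A' where A': "kinst A' m'" "?J z A'" using I by blast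
    have m': "minst m'" using minst_same[OF m(1)] I by auto
    have w': "m' (adr tWL (int y)) = W y" if "y < PS k" for y
      using m(2) sameD[of "{tMK}" m m' tWL] I that by (simp add: winst_def)
    have rx: "R' rX = int x" using fr R by simp
    have mz: "m' (adr tMK (int z)) = (if z \<in> A' then 1 else 0)" using A' z by (simp add: kinst_def)
    show "wp ?body n (\<lambda>\<tau>. same {tMK} m (snd \<tau>) \<and> (\<exists>A'. kinst A' (snd \<tau>) \<and> ?J (Suc z) A')) (R', m')"
    proof (cases "z \<in> A' \<and> HV z = TV x \<and> W z < W x")
      case True
      then have "usable W x" using A' usable_step[of W z x] x by blast
      then have "?J (Suc z) (insert x A')" using A' by blast
      moreover have "kinst (insert x A') (m'(adr tMK (int x) := 1))" using kinst_upd[OF A'(1)] .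
      moreover have "same {tMK} m (m'(adr tMK (int x) := 1))" using I by (auto intro: same_upd)
      ultimately have "same {tMK} m (m'(adr tMK (int x) := 1)) \<and> (\<exists>A''. kinst A'' (m'(adr tMK (int x) := 1)) \<and> ?J (Suc z) A'')"
        by blast
      then show ?thesis using True rx rz mz w' z x minstD(2,3)[OF m'] by simp
    next
      case False
      have "?J (Suc z) A'" using A' False by (auto simp: less_Suc_eq)
      then have "same {tMK} m m' \<and> (\<exists>A'. kinst A' m' \<and> ?J (Suc z) A')" using I A' by blast
      then show ?thesis using False rx rz mz w' z x minstD(2,3)[OF m'] by auto
    qed
  qed (use R n in auto)
  then have "wp (For rZ (Const 0) rM ?body) n (\<lambda>\<tau>. same {tMK} m (snd \<tau>) \<and> (\<exists>A'. kinst A' (snd \<tau>) \<and> A \<subseteq> A' \<and>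
     (\<forall>y\<in>A'. usable W y) \<and> (TV x = s \<or> (\<exists>y\<in>A. y < PS k \<and> HV y = TV x \<and> W y < W x) \<longrightarrow> x \<in> A'))) (R, m1)"
  proof (rule wp_mono)
    fix \<tau> assume t: "same {tMK} m (snd \<tau>) \<and> (\<exists>A'. kinst A' (snd \<tau>) \<and> ?J (PS k) A')"
    then obtain A' where A': "kinst A' (snd \<tau>)" "?J (PS k) A'" by blast
    have sub: "A \<subseteq> A1" "TV x = s \<Longrightarrow> x \<in> A1" by (auto simp: A1_def)
    show "same {tMK} m (snd \<tau>) \<and> (\<exists>A'. kinst A' (snd \<tau>) \<and> A \<subseteq> A' \<and>
     (\<forall>y\<in>A'. usable W y) \<and> (TV x = s \<or> (\<exists>y\<in>A. y < PS k \<and> HV y = TV x \<and> W y < W x) \<longrightarrow> x \<in> A'))"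
      using t A' sub by blast
  qed
  moreover have "wp Mark_edge n Q (R, m) = wp (For rZ (Const 0) rM ?body) n Q (R, m1)" for Q
    using R x minstD(2)[OF m(1) x] by (simp add: Mark_edge_def m1_def)
  ultimately show ?thesis by simp
qed

lemma wp_Count_edge:
  assumes m: "minst m" "kinst {x. usable W x} m" and R: "R rX = int x" "R rS = s" and x: "x < PS k"
    and c: "R rCnt = int (card (insert s (HV ` {y. usable W y \<and> y < x})))"
  shows "wp Count_edge n (\<lambda>\<tau>. fst \<tau> rCnt = int (card (insert s (HV ` {y. usable W y \<and> y < Suc x})))) (R, m)"
proof -
  let ?V = "\<lambda>x. insert s (HV ` {y. usable W y \<and> y < x})"
  have mk: "m (adr tMK (int y)) = (if usable W y then 1 else 0)" if "y < PS k" for y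
    using m(2) that by (simp add: kinst_def)
  show ?thesis
  proof (cases "usable W x")
    case False
    then have "{y. usable W y \<and> y < Suc x} = {y. usable W y \<and> y < x}" by (auto simp: less_Suc_eq)
    then show ?thesis using False R c mk[OF x] by (simp add: Count_edge_def)
  next
    case True
    have V: "?V (Suc x) = insert (HV x) (?V x)" using True by (auto simp: less_Suc_eq)
    have finV: "finite (?V x)" by simp
    let ?b2 = "IfEq (At tMK (Reg rZ)) (Const 1) (IfEq (At tHV (Reg rZ)) (At tHV (Reg rX)) (Assign rHit (Const 1)))"
    define h0 where "h0 = (if HV x = s then 1 else 0 :: int)"
    define seen where "seen z \<longleftrightarrow> HV x \<in> ?V z" for z
    have seen0: "seen 0 \<longleftrightarrow> HV x = s" by (simp add: seen_def)
    have seenS: "seen (Suc z) \<longleftrightarrow> seen z \<or> usable W z \<and> HV z = HV x" for z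
      unfolding seen_def by (rule mem_image_less_Suc)
    have "wp (For rZ (Const 0) rX ?b2) n (\<lambda>\<tau>. fst \<tau> rHit = (if seen x then 1 else 0)) (R(rHit := h0), m)"
    proof (rule wp_For[where l = 0 and u = x and I = "\<lambda>z R m. R rHit = (if seen z then 1 else 0)"])
      fix z R' m' assume z: "z < x" and I: "R' rHit = (if seen z then 1 else 0)" and rz: "R' rZ = int z"
        and fr: "\<And>r. r \<noteq> rZ \<Longrightarrow> r \<notin> writes ?b2 \<Longrightarrow> R' r = (R(rHit := h0)) r" and "nostore ?b2 \<Longrightarrow> m' = m"
      then have m': "m' = m" by simp
      have rx: "R' rX = int x" using fr R by simp
      have e: "m (adr tMK (int z)) = (if usable W z then 1 else 0)" "m (adr tHV (int z)) = HV z"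
        "m (adr tHV (int x)) = HV x" using mk[of z] z x minstD(3)[OF m(1)] by simp_all
      show "wp ?b2 n (\<lambda>\<tau>. ((fst \<tau>)(rZ := int (Suc z))) rHit = (if seen (Suc z) then 1 else 0)) (R', m')"
        using I by (simp add: rz rx m' e seenS)
    qed (use R n x seen0 in \<open>auto simp: h0_def\<close>)
    then have "wp (For rZ (Const 0) rX ?b2) n (wp (Block [IfEq (Reg rHit) (Const 0) (Assign rCnt (Add (Reg rCnt) (Const 1)))]) n
      (\<lambda>\<tau>. fst \<tau> rCnt = int (card (?V (Suc x))))) (R(rHit := h0), m)"
    proof (rule wp_conseq)
      fix R' :: "nat \<Rightarrow> int" and m' :: "int \<Rightarrow> int" assume h: "fst (R', m') rHit = (if seen x then 1 else 0)"
        and fr: "\<And>r. r \<notin> writes (For rZ (Const 0) rX ?b2) \<Longrightarrow> R' r = (R(rHit := h0)) r"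
      have "R' rCnt = int (card (?V x))" using fr c by simp
      moreover have "card (?V (Suc x)) = (if seen x then card (?V x) else Suc (card (?V x)))"
        unfolding V seen_def using finV by (simp only: card_insert_if)
      ultimately show "wp (Block [IfEq (Reg rHit) (Const 0) (Assign rCnt (Add (Reg rCnt) (Const 1)))]) n
        (\<lambda>\<tau>. fst \<tau> rCnt = int (card (?V (Suc x)))) (R', m')" using h by simp
    qed
    moreover have "wp Count_edge n Q (R, m) = wp (For rZ (Const 0) rX ?b2) n
       (wp (Block [IfEq (Reg rHit) (Const 0) (Assign rCnt (Add (Reg rCnt) (Const 1)))]) n Q) (R(rHit := h0), m)" for Q
      using True R mk[OF x] x minstD(3)[OF m(1), of x] by (simp add: Count_edge_def h0_def)
    ultimately show ?thesis by simp
  qed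
qed

lemma wp_Eval:
  assumes m: "minst m" "winst W m" and R: "base R"
  shows "wp Eval n (\<lambda>\<tau>. fst \<tau> rCnt = int (val W) \<and> same {tMK} m (snd \<tau>)) (R, m)"
proof -
  let ?Q = "\<lambda>\<tau>. fst \<tau> rCnt = int (val W) \<and> same {tMK} m (snd \<tau>)"
  have keep: "minst m'" "winst W m'" if st: "same {tMK} m m'" for m'
  proof -
    show "minst m'" by (rule minst_same[OF m(1) st]) simp
    have "m' (adr tWL i) = m (adr tWL i)" for i using sameD[OF st, of tWL i] by simp
    then show "winst W m'" using m(2) unfolding winst_def by simp
  qed
  have C: "wp (Block [Assign rCnt (Const 1), For rX (Const 0) rM Count_edge]) n ?Q (R', m')"
    if b: "base R'" and k: "kinst {x. usable W x} m'" and s: "same {tMK} m m'" for R' m'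
  proof -
    have "wp (For rX (Const 0) rM Count_edge) n ?Q (R'(rCnt := 1), m')"
    proof (rule wp_For[where l = 0 and u = "PS k" and
          I = "\<lambda>x R m. R rCnt = int (card (insert s (HV ` {y. usable W y \<and> y < x})))"])
      fix x R2 m2 assume x: "x < PS k" and I: "R2 rCnt = int (card (insert s (HV ` {y. usable W y \<and> y < x})))"
        and rx: "R2 rX = int x" and fr: "\<And>r. r \<noteq> rX \<Longrightarrow> r \<notin> writes Count_edge \<Longrightarrow> R2 r = (R'(rCnt := 1)) r"
        and "nostore Count_edge \<Longrightarrow> m2 = m'"
      then have m2: "m2 = m'" by simp
      have "wp Count_edge n (\<lambda>\<tau>. fst \<tau> rCnt = int (card (insert s (HV ` {y. usable W y \<and> y < Suc x})))) (R2, m')"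
        by (rule wp_Count_edge) (use keep[OF s] k rx fr b x I in \<open>simp_all add: base_def\<close>)
      then show "wp Count_edge n (\<lambda>\<tau>. ((fst \<tau>)(rX := int (Suc x))) rCnt =
          int (card (insert s (HV ` {y. usable W y \<and> y < Suc x})))) (R2, m2)" unfolding m2 by simp
    next
      fix R2 :: "nat \<Rightarrow> int" and m2 :: "int \<Rightarrow> int" assume I: "R2 rCnt = int (card (insert s (HV ` {y. usable W y \<and> y < PS k})))"
        and "nostore Count_edge \<Longrightarrow> m2 = m'"
      then have m2: "m2 = m'" by simp
      have "{y. usable W y \<and> y < PS k} = {y. usable W y}" using usable_less by auto
      then show "?Q (R2, m2)" using I m2 s by (simp add: val_def)
    qed (use b n in \<open>auto simp: base_def\<close>)
    then show ?thesis by simp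
  qed
  \<comment> \<open>After \<open>r\<close> rounds all marks are correct, and complete for ranks
    below \<open>r\<close>.\<close>
  let ?J = "\<lambda>r A. (\<forall>y\<in>A. usable W y) \<and> (\<forall>y. usable W y \<longrightarrow> rank W y < r \<longrightarrow> y \<in> A)"
  have M: "wp (For rRd (Const 0) rM (For rX (Const 0) rM Mark_edge)) n
      (wp (Block [Assign rCnt (Const 1), For rX (Const 0) rM Count_edge]) n ?Q) (R', m')"
    if b: "base R'" and k: "kinst {} m'" and s: "same {tMK} m m'" for R' m'
  proof (rule wp_For[where l = 0 and u = "PS k" and
        I = "\<lambda>r R m'. same {tMK} m m' \<and> (\<exists>A. kinst A m' \<and> ?J r A)"])
    have "?J 0 {}" by simp
    then show "same {tMK} m m' \<and> (\<exists>A. kinst A m' \<and> ?J 0 A)" using k s by blast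
    show "R' rM = int (PS k)" using b by (simp add: base_def)
    fix r R2 m2 assume r: "r < PS k" and I: "same {tMK} m m2 \<and> (\<exists>A. kinst A m2 \<and> ?J r A)"
      and fr: "\<And>q. q \<noteq> rRd \<Longrightarrow> q \<notin> writes (For rX (Const 0) rM Mark_edge) \<Longrightarrow> R2 q = R' q"
    have b2: "R2 rM = int (PS k)" "R2 rS = s" using fr b by (auto simp: base_def)
    let ?J2 = "\<lambda>x A. ?J r A \<and> (\<forall>y<x. usable W y \<longrightarrow> rank W y < Suc r \<longrightarrow> y \<in> A)"
    show "wp (For rX (Const 0) rM Mark_edge) n (\<lambda>\<tau>. same {tMK} m (snd \<tau>) \<and> (\<exists>A. kinst A (snd \<tau>) \<and> ?J (Suc r) A)) (R2, m2)"
    proof (rule wp_For[where l = 0 and u = "PS k" and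
          I = "\<lambda>x R m'. same {tMK} m m' \<and> (\<exists>A. kinst A m' \<and> ?J2 x A)"])
      show "same {tMK} m m2 \<and> (\<exists>A. kinst A m2 \<and> ?J2 0 A)" using I by blast
      fix x R3 m3 assume x: "x < PS k" and I3: "same {tMK} m m3 \<and> (\<exists>A. kinst A m3 \<and> ?J2 x A)"
        and rx: "R3 rX = int x" and fr3: "\<And>q. q \<noteq> rX \<Longrightarrow> q \<notin> writes Mark_edge \<Longrightarrow> R3 q = R2 q"
      obtain A where A: "kinst A m3" "?J2 x A" using I3 by blast
      have "wp Mark_edge n (\<lambda>\<tau>. same {tMK} m3 (snd \<tau>) \<and> (\<exists>A'. kinst A' (snd \<tau>) \<and> A \<subseteq> A' \<and>
        (\<forall>y\<in>A'. usable W y) \<and> (TV x = s \<or> (\<exists>y\<in>A. y < PS k \<and> HV y = TV x \<and> W y < W x) \<longrightarrow> x \<in> A'))) (R3, m3)"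
      proof (rule wp_Mark_edge)
        show "minst m3" "winst W m3" using keep I3 by blast+
        show "kinst A m3" by (rule A(1))
        show "R3 rS = s" "R3 rM = int (PS k)" using fr3 b2 by simp_all
        show "usable W y" if "y \<in> A" for y using A(2) that by blast
      qed (use rx x in simp_all)
      then show "wp Mark_edge n (\<lambda>\<tau>. same {tMK} m (snd \<tau>) \<and> (\<exists>A. kinst A (snd \<tau>) \<and> ?J2 (Suc x) A)) (R3, m3)"
      proof (rule wp_mono)
        fix \<tau> assume t: "same {tMK} m3 (snd \<tau>) \<and> (\<exists>A'. kinst A' (snd \<tau>) \<and> A \<subseteq> A' \<and>
          (\<forall>y\<in>A'. usable W y) \<and> (TV x = s \<or> (\<exists>y\<in>A. y < PS k \<and> HV y = TV x \<and> W y < W x) \<longrightarrow> x \<in> A'))"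
        then obtain A' where A': "kinst A' (snd \<tau>)" "A \<subseteq> A'" "\<forall>y\<in>A'. usable W y"
          "TV x = s \<or> (\<exists>y\<in>A. y < PS k \<and> HV y = TV x \<and> W y < W x) \<Longrightarrow> x \<in> A'" by blast
        have "x \<in> A'" if u: "usable W x" and rk: "rank W x < Suc r"
          using u
        proof (cases rule: usable.cases)
          case usable_start
          then show ?thesis using A'(4) by simp
        next
          case (usable_step y)
          have yk: "y < PS k" using usable_less usable_step(1) by blast
          have "rank W y < r" using rank_mono[OF yk usable_step(4)] rk by simp
          then have "y \<in> A" using A(2) usable_step(1) by blast
          then show ?thesis using A'(4) usable_step yk by blast
        qed
        then have "?J2 (Suc x) A'" using A(2) A'(2,3) unfolding less_Suc_eq[of _ x] by blast
        moreover have "same {tMK} m (snd \<tau>)" using same_trans I3 t by blast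
        ultimately show "same {tMK} m (snd \<tau>) \<and> (\<exists>A. kinst A (snd \<tau>) \<and> ?J2 (Suc x) A)" using A'(1) by blast
      qed
    next
      fix R3 :: "nat \<Rightarrow> int" and m3 :: "int \<Rightarrow> int" assume a: "same {tMK} m m3 \<and> (\<exists>A. kinst A m3 \<and> ?J2 (PS k) A)"
      then obtain A where A: "kinst A m3" "?J2 (PS k) A" by blast
      then have "?J (Suc r) A" using usable_less by blast
      then show "same {tMK} m (snd (R3, m3)) \<and> (\<exists>A. kinst A (snd (R3, m3)) \<and> ?J (Suc r) A)"
        using a A(1) unfolding snd_conv by blast
    qed (use b2 n in auto)
  next
    fix R2 m2 assume I: "same {tMK} m m2 \<and> (\<exists>A. kinst A m2 \<and> ?J (PS k) A)"
      and fr: "\<And>q. q \<noteq> rRd \<Longrightarrow> q \<notin> writes (For rX (Const 0) rM Mark_edge) \<Longrightarrow> R2 q = R' q"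
    obtain A where A: "kinst A m2" "?J (PS k) A" using I by blast
    have Aeq: "A = {x. usable W x}"
    proof (intro set_eqI iffI)
      fix x assume "x \<in> {x. usable W x}"
      then have "usable W x" "rank W x < PS k" using rank_less usable_less by auto
      then show "x \<in> A" using A(2) by blast
    qed (use A(2) in blast)
    show "wp (Block [Assign rCnt (Const 1), For rX (Const 0) rM Count_edge]) n ?Q (R2, m2)"
    proof (rule C)
      show "base R2" using b fr by (simp add: base_def)
      show "kinst {x. usable W x} m2" using A(1) unfolding Aeq .
      show "same {tMK} m m2" using I by blast
    qed
  qed (use n in simp_all)
  have "wp (For rX (Const 0) rM (SetAt tMK (Reg rX) (Const 0))) n
      (wp (For rRd (Const 0) rM (For rX (Const 0) rM Mark_edge)) n
      (wp (Block [Assign rCnt (Const 1), For rX (Const 0) rM Count_edge]) n ?Q)) (R, m)"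
  proof (rule wp_For[where l = 0 and u = "PS k" and
        I = "\<lambda>x R m'. (\<forall>y<x. m' (adr tMK (int y)) = 0) \<and> same {tMK} m m'"])
    fix x R' m' assume "(\<forall>y<x. m' (adr tMK (int y)) = 0) \<and> same {tMK} m m'" "R' rX = int x"
    then show "wp (SetAt tMK (Reg rX) (Const 0)) n (\<lambda>\<tau>. (\<forall>y<Suc x. snd \<tau> (adr tMK (int y)) = 0) \<and> same {tMK} m (snd \<tau>)) (R', m')"
      using same_upd[of "{tMK}" m m' tMK] by (auto simp: less_Suc_eq)
  next
    fix R' m' assume I: "(\<forall>y<PS k. m' (adr tMK (int y)) = 0) \<and> same {tMK} m m'"
      and fr: "\<And>r. r \<noteq> rX \<Longrightarrow> r \<notin> writes (SetAt tMK (Reg rX) (Const 0)) \<Longrightarrow> R' r = R r"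
    show "wp (For rRd (Const 0) rM (For rX (Const 0) rM Mark_edge)) n
      (wp (Block [Assign rCnt (Const 1), For rX (Const 0) rM Count_edge]) n ?Q) (R', m')"
    proof (rule M)
      show "base R'" using R fr by (simp add: base_def)
      show "kinst {} m'" using I by (simp add: kinst_def)
      show "same {tMK} m m'" using I by blast
    qed
  qed (use R n same_refl in \<open>auto simp: base_def\<close>)
  then show ?thesis by (simp add: Eval_def)
qed

text \<open>Three cells per shift and at most \<open>2 * k\<close> shifts: this is why the iteration
  bound has to be at least \<open>6 * k\<close>.\<close>

lemma wp_Keep_best:
  assumes R: "R rCnt = int (val (fst st))" "R rB = int b" and o: "oinst (snd st) R m" and bv: "bstate bv R m"
    and n6: "length (snd st) \<le> 2 * k" "6 * k \<le> n"
  shows "wp Keep_best n (\<lambda>\<tau>. bstate (better st bv) (fst \<tau>) (snd \<tau>) \<and> same {tBE} m (snd \<tau>)) (R, m)"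
proof (cases "shifts_cost (snd st) \<le> b \<and> snd bv < int (val (fst st))")
  case False
  then show ?thesis using assms same_refl by (auto simp: Keep_best_def better_def oinst_def bstate_def)
next
  case True
  let ?e = "enc_shifts (snd st)"
  let ?b = "SetAt tBE (Reg rI) (At tOP (Reg rI))"
  let ?R = "R(rBest := int (val (fst st)), rNb := int (length ?e))"
  have len: "length ?e \<le> n" using n6 by (simp add: length_enc_shifts)
  have op: "m (adr tOP (int i)) = ?e ! i" if "i < length ?e" for i using o that by (simp add: oinst_def)
  have "wp (For rI (Const 0) rNop ?b) n (\<lambda>\<tau>. bstate (better st bv) (fst \<tau>) (snd \<tau>) \<and> same {tBE} m (snd \<tau>)) (?R, m)"
  proof (rule wp_For[where l = 0 and u = "length ?e" and
        I = "\<lambda>x R m'. (\<forall>i<x. m' (adr tBE (int i)) = ?e ! i) \<and> same {tBE} m m'"])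
    fix x R' m' assume x: "x < length ?e" and I: "(\<forall>i<x. m' (adr tBE (int i)) = ?e ! i) \<and> same {tBE} m m'" "R' rI = int x"
    have "m' (adr tOP (int x)) = ?e ! x" using op[OF x] sameD[of "{tBE}" m m' tOP] I by simp
    then show "wp ?b n (\<lambda>\<tau>. (\<forall>i<Suc x. snd \<tau> (adr tBE (int i)) = ?e ! i) \<and> same {tBE} m (snd \<tau>)) (R', m')"
      using I same_upd[of "{tBE}" m m' tBE] by (auto simp: less_Suc_eq)
  next
    fix R' m' assume "(\<forall>i<length ?e. m' (adr tBE (int i)) = ?e ! i) \<and> same {tBE} m m'"
      "\<And>r. r \<noteq> rI \<Longrightarrow> r \<notin> writes ?b \<Longrightarrow> R' r = ?R r"
    then show "bstate (better st bv) (fst (R', m')) (snd (R', m')) \<and> same {tBE} m (snd (R', m'))"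
      using True by (simp add: bstate_def better_def)
  qed (use o len same_refl in \<open>auto simp: oinst_def\<close>)
  then show ?thesis using True o R bv by (simp add: Keep_best_def oinst_def bstate_def)
qed

lemma wp_Init_pos:
  assumes m: "minst m" and R: "base R"
  shows "wp Init_pos n (\<lambda>\<tau>. pinst P0 (snd \<tau>) \<and> same {tP} m (snd \<tau>)) (R, m)"
proof -
  let ?b = "SetAt tP (Reg rC) (At tPS (Add (Reg rC) (Const 1)))"
  have "wp (For rC (Const 0) rK ?b) n (wp (Block [SetAt tP (Reg rK) (Reg rM)]) n
     (\<lambda>\<tau>. pinst P0 (snd \<tau>) \<and> same {tP} m (snd \<tau>))) (R, m)"
  proof (rule wp_For[where l = 0 and u = k and
        I = "\<lambda>x R m'. (\<forall>i<x. m' (adr tP (int i)) = int (PS (Suc i))) \<and> same {tP} m m'"])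
    fix x R' m' assume x: "x < k" and I: "(\<forall>i<x. m' (adr tP (int i)) = int (PS (Suc i))) \<and> same {tP} m m'" "R' rC = int x"
    have "m' (adr tPS (int x + 1)) = int (PS (Suc x))" using minstD(6)[OF m, of x] x sameD[of "{tP}" m m' tPS] I by simp
    then show "wp ?b n (\<lambda>\<tau>. (\<forall>i<Suc x. snd \<tau> (adr tP (int i)) = int (PS (Suc i))) \<and> same {tP} m (snd \<tau>)) (R', m')"
      using I same_upd[of "{tP}" m m' tP] by (auto simp: less_Suc_eq)
  next
    fix R' m' assume I: "(\<forall>i<k. m' (adr tP (int i)) = int (PS (Suc i))) \<and> same {tP} m m'"
      "\<And>r. r \<noteq> rC \<Longrightarrow> r \<notin> writes ?b \<Longrightarrow> R' r = R r"
    then show "wp (Block [SetAt tP (Reg rK) (Reg rM)]) n (\<lambda>\<tau>. pinst P0 (snd \<tau>) \<and> same {tP} m (snd \<tau>)) (R', m')"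
      using R same_upd[of "{tP}" m m' tP] by (auto simp: base_def pinst_def P0_def)
  qed (use R n same_refl in \<open>auto simp: base_def\<close>)
  then show ?thesis by (simp add: Init_pos_def)
qed

lemma bstate_cong: "bstate bv R m \<Longrightarrow> R' rBest = R rBest \<Longrightarrow> R' rNb = R rNb \<Longrightarrow> same T m m' \<Longrightarrow> tBE \<notin> T \<Longrightarrow> bstate bv R' m'"
  using sameD[of T m m' tBE] by (simp add: bstate_def)

lemma wp_Try_guess:
  assumes m: "minst m" and R: "base R" and bv: "bstate bv R m" and n6: "6 * k \<le> n"
  shows "wp (Try_guess X) n (\<lambda>\<tau>. bstate (better (gen X par cl del am ofs) bv) (fst \<tau>) (snd \<tau>) \<and>
     same {tP, tWL, tOP, tMK, tBE} m (snd \<tau>)) (R, m)"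
proof -
  let ?T = "{tP, tWL, tOP, tMK, tBE}" and ?P = "positions par cl del am ofs" and ?g = "gen X par cl del am ofs"
  let ?Q = "\<lambda>\<tau>. bstate (better ?g bv) (fst \<tau>) (snd \<tau>) \<and> same ?T m (snd \<tau>)"
  have tr: "same ?T m m''" if "same ?T m m'" "same T' m' m''" "T' \<subseteq> ?T" for m' m'' T'
    using same_trans[OF that(1) same_mono[OF that(2,3)]] .
  \<comment> \<open>The tag \<open>tBE\<close> is left out until the last command, so the best
    solution found so far survives the computation of the next one.\<close>
  let ?T4 = "{tP, tWL, tOP, tMK}"
  have tr4: "same ?T4 m m''" if "same ?T4 m m'" "same T' m' m''" "T' \<subseteq> ?T4" for m' m'' T'
    using same_trans[OF that(1) same_mono[OF that(2,3)]] .
  have s0: "same ?T4 m m" by (rule same_refl)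
  have 1: "wp Keep_best n ?Q (R', m')"
    if "fst (R', m') rCnt = int (val (fst ?g))" "base R'" "oinst (snd ?g) R' m'" "bstate bv R' m'" "same ?T4 m m'" for R' m'
  proof -
    have "wp Keep_best n (\<lambda>\<tau>. bstate (better ?g bv) (fst \<tau>) (snd \<tau>) \<and> same {tBE} m' (snd \<tau>)) (R', m')"
      by (rule wp_Keep_best) (use that gen_sound n6 in \<open>auto simp: base_def\<close>)
    moreover have "same ?T m m'" using same_mono[OF that(5)] by auto
    ultimately show ?thesis by (elim wp_mono) (use tr in blast)
  qed
  have 2: "wp Eval n (wp Keep_best n ?Q) (R', m')"
    if "base R'" "wstate ?g R' m'" "bstate bv R' m'" "same ?T4 m m'" for R' m'
  proof -
    have "wp Eval n (\<lambda>\<tau>. fst \<tau> rCnt = int (val (fst ?g)) \<and> same {tMK} m' (snd \<tau>)) (R', m')"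
      by (rule wp_Eval) (use minst_same[OF m that(4)] that in \<open>auto simp: wstate_def\<close>)
    then show ?thesis
    proof (rule wp_conseq)
      fix R2 m2 assume a: "fst (R2, m2) rCnt = int (val (fst ?g)) \<and> same {tMK} m' (snd (R2, m2))"
        and fr: "\<And>r. r \<notin> writes Eval \<Longrightarrow> R2 r = R' r"
      show "wp Keep_best n ?Q (R2, m2)"
      proof (rule 1)
        show "base R2" using that(1) fr by (simp add: base_def)
        show "oinst (snd ?g) R2 m2" using that(2) fr a sameD[of "{tMK}" m' m2 tOP]
          by (simp add: wstate_def oinst_def)
        show "bstate bv R2 m2" using bstate_cong[OF that(3)] fr a by auto
        show "same ?T4 m m2" using tr4[OF that(4)] a by auto
      qed (use a in simp)
    qed
  qed
  have 3: "wp (Gen X) n (wp Eval n (wp Keep_best n ?Q)) (R', m')"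
    if "base R'" "pinst ?P m'" "bstate bv R' m'" "same ?T4 m m'" for R' m'
  proof -
    have "wp (Gen X) n (\<lambda>\<tau>. wstate ?g (fst \<tau>) (snd \<tau>) \<and> same {tWL, tOP} m' (snd \<tau>)) (R', m')"
      by (rule wp_Gen) (use minst_same[OF m that(4)] that in auto)
    then show ?thesis
    proof (rule wp_conseq)
      fix R2 m2 assume a: "wstate ?g (fst (R2, m2)) (snd (R2, m2)) \<and> same {tWL, tOP} m' (snd (R2, m2))"
        and fr: "\<And>r. r \<notin> writes (Gen X) \<Longrightarrow> R2 r = R' r"
      have fr': "R2 r = R' r" if "r < 6 \<or> 35 < r" for r using fr writes_Gen[of X] that by force
      show "wp Eval n (wp Keep_best n ?Q) (R2, m2)"
      proof (rule 2)
        show "base R2" using that(1) fr' by (simp add: base_def)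
        show "bstate bv R2 m2" using bstate_cong[OF that(3)] fr' a by auto
        show "same ?T4 m m2" using tr4[OF that(4)] a by auto
      qed (use a in simp)
    qed
  qed
  have 4: "wp Rounds n (wp (Gen X) n (wp Eval n (wp Keep_best n ?Q))) (R', m')"
    if "base R'" "pinst P0 m'" "bstate bv R' m'" "same ?T4 m m'" for R' m'
  proof -
    have "wp Rounds n (\<lambda>\<tau>. pinst ?P (snd \<tau>) \<and> same {tP} m' (snd \<tau>)) (R', m')"
      by (rule wp_Rounds) (use minst_same[OF m that(4)] that in auto)
    then show ?thesis
    proof (rule wp_conseq)
      fix R2 m2 assume a: "pinst ?P (snd (R2, m2)) \<and> same {tP} m' (snd (R2, m2))"
        and fr: "\<And>r. r \<notin> writes Rounds \<Longrightarrow> R2 r = R' r"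
      show "wp (Gen X) n (wp Eval n (wp Keep_best n ?Q)) (R2, m2)"
      proof (rule 3)
        show "base R2" using that(1) fr by (simp add: base_def)
        show "bstate bv R2 m2" using bstate_cong[OF that(3)] fr a by auto
        show "same ?T4 m m2" using tr4[OF that(4)] a by auto
      qed (use a in simp)
    qed
  qed
  have "wp Init_pos n (\<lambda>\<tau>. pinst P0 (snd \<tau>) \<and> same {tP} m (snd \<tau>)) (R, m)"
    by (rule wp_Init_pos[OF m R])
  then have "wp Init_pos n (wp Rounds n (wp (Gen X) n (wp Eval n (wp Keep_best n ?Q)))) (R, m)"
  proof (rule wp_conseq)
    fix R2 m2 assume a: "pinst P0 (snd (R2, m2)) \<and> same {tP} m (snd (R2, m2))"
      and fr: "\<And>r. r \<notin> writes Init_pos \<Longrightarrow> R2 r = R r"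
    show "wp Rounds n (wp (Gen X) n (wp Eval n (wp Keep_best n ?Q))) (R2, m2)"
    proof (rule 4)
      show "base R2" using R fr by (simp add: base_def)
      show "bstate bv R2 m2" using bstate_cong[OF bv] fr a by auto
      show "same ?T4 m m2" using tr4[OF s0] a by auto
    qed (use a in simp)
  qed
  then show ?thesis by (simp add: Try_guess_def)
qed

end

section \<open>Enumerating the guesses\<close>

text \<open>The value of the digits \<open>d\<close> in mixed radix with bases \<open>u\<close>,
  least significant digit first.\<close>

definition ov :: "(nat \<Rightarrow> nat) \<Rightarrow> (nat \<Rightarrow> nat) \<Rightarrow> nat \<Rightarrow> nat" where
  "ov u d i = (\<Sum>j<i. d j * (\<Prod>l<j. u l))"

lemma ov_Suc: "ov u d (Suc i) = ov u d i + d i * (\<Prod>l<i. u l)"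
  by (simp add: ov_def)

lemma ov_less: "(\<And>j. j < i \<Longrightarrow> d j < u j) \<Longrightarrow> ov u d i < (\<Prod>l<i. u l)"
proof (induction i)
  case (Suc i)
  let ?p = "\<Prod>l<i. u l"
  have "ov u d i < ?p" using Suc by simp
  moreover have "Suc (d i) \<le> u i" using Suc.prems[of i] by simp
  then have "Suc (d i) * ?p \<le> u i * ?p" by (intro mult_right_mono) auto
  ultimately have "ov u d (Suc i) < u i * ?p" by (simp add: ov_Suc)
  then show ?case by (simp add: mult.commute)
qed (simp add: ov_def)

text \<open>The residue modulo the product of the lower bases recovers the lower digits. Hence a
  counter value determines the guess, and counting through all values tries all guesses.\<close>

lemma ov_inj:
  "(\<And>j. j < i \<Longrightarrow> d j < u j) \<Longrightarrow> (\<And>j. j < i \<Longrightarrow> e j < u j) \<Longrightarrow> ov u d i = ov u e i \<Longrightarrow> j < i \<Longrightarrow> d j = e j"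
proof (induction i arbitrary: j)
  case (Suc i)
  let ?p = "\<Prod>l<i. u l"
  have l: "ov u d i < ?p" "ov u e i < ?p" using ov_less[of i] Suc.prems(1,2) by auto
  have eq: "ov u d i + d i * ?p = ov u e i + e i * ?p" using Suc.prems(3) by (simp add: ov_Suc)
  have "(ov u d i + d i * ?p) mod ?p = ov u d i" "(ov u e i + e i * ?p) mod ?p = ov u e i" using l by simp_all
  then have 1: "ov u d i = ov u e i" using eq by simp
  then have "d i * ?p = e i * ?p" using eq by simp
  moreover have "?p \<noteq> 0" using l by linarith
  ultimately have "d i = e i" unfolding mult_cancel2 by blast
  then show ?case using Suc.IH[of j] Suc.prems 1 by (cases "j = i") auto
qed simp

section \<open>Increment of a mixed radix counter\<close>

definition Incr :: ram_com where
  "Incr = Block [Assign rCy (Const 1), For rI (Const 5) rND (IfEq (Reg rCy) (Const 1)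
     (IfPos (Sub (At tU (Reg rI)) (Add (At tD (Reg rI)) (Const 1)))
       (Block [SetAt tD (Reg rI) (Add (At tD (Reg rI)) (Const 1)), Assign rCy (Const 0)])
       (SetAt tD (Reg rI) (Const 0))))]"

lemma writes_Incr [simp]: "writes Incr = {rCy, rI}" "\<not> nostore Incr"
  by (auto simp: Incr_def)

text \<open>The cell \<open>N + 7\<close> represents \<open>del k = 0\<close> for the virtual path.\<close>

definition Dof :: "nat \<Rightarrow> nat \<Rightarrow> (nat \<Rightarrow> nat) \<Rightarrow> nat \<Rightarrow> int" where
  "Dof b N d i = (if 5 \<le> i \<and> i < N + 5 then int (d (i - 5)) else if i = N + 7 then int b else 0)"

lemma wp_Incr:
  assumes R: "R rND = int (N + 5)" and N: "N \<le> n"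
    and U: "\<And>i. i < N \<Longrightarrow> m (adr tU (int (i + 5))) = int (u i)"
    and D: "\<And>i. m (adr tD (int i)) = Dof b N d i"
    and d: "\<And>i. i < N \<Longrightarrow> d i < u i"
  shows "wp Incr n (\<lambda>\<tau>. same {tD} m (snd \<tau>) \<and> (\<exists>d'. (\<forall>i. snd \<tau> (adr tD (int i)) = Dof b N d' i) \<and>
     (\<forall>i<N. d' i < u i) \<and> (if Suc (ov u d N) < (\<Prod>l<N. u l) then fst \<tau> rCy = 0 \<and> ov u d' N = Suc (ov u d N)
        else fst \<tau> rCy = 1))) (R, m)"
proof -
  let ?b = "IfEq (Reg rCy) (Const 1)
     (IfPos (Sub (At tU (Reg rI)) (Add (At tD (Reg rI)) (Const 1)))
       (Block [SetAt tD (Reg rI) (Add (At tD (Reg rI)) (Const 1)), Assign rCy (Const 0)])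
       (SetAt tD (Reg rI) (Const 0)))"
  \<comment> \<open>Up to position \<open>i\<close>, digits and carry together represent the old
    value plus one; from \<open>i\<close> on the digits are still the old ones. Overflow is a carry
    behind the last digit.\<close>
  let ?J = "\<lambda>i cy d'. cy \<le> (1 :: nat) \<and> ov u d' i + cy * (\<Prod>l<i. u l) = ov u d i + 1 \<and>
     (\<forall>j<N. d' j < u j) \<and> (\<forall>j\<ge>i. d' j = d j)"
  let ?I = "\<lambda>x R m'. same {tD} m m' \<and> (\<exists>d' cy. R rCy = int cy \<and> (\<forall>i. m' (adr tD (int i)) = Dof b N d' i) \<and> ?J (x - 5) cy d')"
  have "wp (For rI (Const 5) rND ?b) n (\<lambda>\<tau>. same {tD} m (snd \<tau>) \<and> (\<exists>d'. (\<forall>i. snd \<tau> (adr tD (int i)) = Dof b N d' i) \<and>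
     (\<forall>i<N. d' i < u i) \<and> (if Suc (ov u d N) < (\<Prod>l<N. u l) then fst \<tau> rCy = 0 \<and> ov u d' N = Suc (ov u d N)
        else fst \<tau> rCy = 1))) (R(rCy := 1), m)"
  proof (rule wp_For[where l = 5 and u = "N + 5" and I = ?I])
    have "?J 0 1 d" using d by (simp add: ov_def)
    then have "(R(rCy := 1, rI := int 5)) rCy = int 1 \<and> (\<forall>i. m (adr tD (int i)) = Dof b N d i) \<and> ?J (5 - 5) 1 d"
      using D by simp
    then show "?I 5 (R(rCy := 1, rI := int 5)) m" using same_refl by blast
    fix x R' m' assume x: "5 \<le> x" "x < N + 5" and I: "?I x R' m'" and rx: "R' rI = int x"
    obtain d' cy where J: "R' rCy = int cy" "\<forall>i. m' (adr tD (int i)) = Dof b N d' i" "?J (x - 5) cy d'"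
      using I by blast
    define i where "i = x - 5"
    have i: "x = i + 5" "i < N" using x by (auto simp: i_def)
    let ?p = "\<Prod>l<i. u l"
    have mu: "m' (adr tU (int x)) = int (u i)" using U[OF i(2)] sameD[of "{tD}" m m' tU] I i by simp
    have Ji: "cy \<le> 1" "ov u d' i + cy * ?p = ov u d i + 1" "\<forall>j<N. d' j < u j" "\<forall>j\<ge>i. d' j = d j"
      using J(3) unfolding i_def[symmetric] by simp_all
    have "m' (adr tD (int x)) = Dof b N d' x" using J(2) by blast
    also have "\<dots> = int (d i)" using i Ji(4) by (simp add: Dof_def)
    finally have md: "m' (adr tD (int x)) = int (d i)" .
    have upd: "(m'(adr tD (int x) := int v)) (adr tD (int l)) = Dof b N (d'(i := v)) l" for v l
    proof (cases "l = x")
      case True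
      then show ?thesis using i by (simp add: Dof_def)
    next
      case False
      have "Dof b N (d'(i := v)) l = Dof b N d' l"
        using False i by (auto simp: Dof_def)
      then show ?thesis using J(2) False by simp
    qed
    have ovu: "ov u (d'(i := v)) i = ov u d' i" for v unfolding ov_def by (rule sum.cong) auto
    have sm: "same {tD} m (m'(adr tD (int x) := v))" for v using I by (auto intro: same_upd)
    have goal: "?I (Suc x) R2 m2" if "same {tD} m m2" "R2 rCy = int cy'"
      "\<And>i. m2 (adr tD (int i)) = Dof b N d2 i" "?J (Suc i) cy' d2" for R2 m2 cy' d2
    proof -
      have "Suc x - 5 = Suc i" using i by simp
      then show ?thesis using that by metis
    qed
    show "wp ?b n (\<lambda>\<tau>. ?I (Suc x) ((fst \<tau>)(rI := int (Suc x))) (snd \<tau>)) (R', m')"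
    proof (cases "cy = 1")
      case False
      then have c0: "cy = 0" using Ji(1) by simp
      have "?J (Suc i) 0 d'" using Ji c0 by (simp add: ov_Suc)
      then have "?I (Suc x) (R'(rI := int (Suc x))) m'" using goal[of m' "R'(rI := int (Suc x))" 0 d'] I J c0 by simp
      then show ?thesis using J(1) c0 by simp
    next
      case True
      have eq: "ov u d' i + ?p = ov u d i + 1" using Ji(2) True by simp
      show ?thesis
      proof (cases "Suc (d i) < u i")
        case lt: True
        have J2: "?J (Suc i) 0 (d'(i := Suc (d i)))" using Ji eq lt by (simp add: ov_Suc ovu)
        have "?I (Suc x) (R'(rCy := 0, rI := int (Suc x))) (m'(adr tD (int x) := int (Suc (d i))))"
          by (rule goal[OF sm _ upd J2]) simp
        then show ?thesis using J(1) True rx mu md lt by (simp add: add.commute)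
      next
        case ge: False
        then have ui: "u i = Suc (d i)" using d[OF i(2)] by simp
        have J2: "?J (Suc i) 1 (d'(i := 0))" using Ji eq ui by (simp add: ov_Suc ovu)
        have "?I (Suc x) (R'(rI := int (Suc x))) (m'(adr tD (int x) := int 0))"
          by (rule goal[OF sm _ upd J2]) (use J(1) True in simp)
        then show ?thesis using J(1) True rx mu md ui by simp
      qed
    qed
  next
    fix R' m' assume I: "?I (N + 5) R' m'"
    then obtain d' cy where J: "R' rCy = int cy" "\<forall>i. m' (adr tD (int i)) = Dof b N d' i" "?J N cy d'" by auto
    have lt: "ov u d N < (\<Prod>l<N. u l)" "ov u d' N < (\<Prod>l<N. u l)" using ov_less d J(3) by blast+
    have "if Suc (ov u d N) < (\<Prod>l<N. u l) then R' rCy = 0 \<and> ov u d' N = Suc (ov u d N) else R' rCy = 1"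
      using J lt by (cases cy) auto
    then show "same {tD} m (snd (R', m')) \<and> (\<exists>d'. (\<forall>i. snd (R', m') (adr tD (int i)) = Dof b N d' i) \<and>
     (\<forall>i<N. d' i < u i) \<and> (if Suc (ov u d N) < (\<Prod>l<N. u l) then fst (R', m') rCy = 0 \<and> ov u d' N = Suc (ov u d N)
        else fst (R', m') rCy = 1))"
      using I J unfolding fst_conv snd_conv by blast
  qed (use R N in auto)
  then show ?thesis by (simp add: Incr_def)
qed

text \<open>The enumeration makes exponentially many iterations, too many for the uniform bound
  \<open>n\<close> in \<open>wp\<close>. This one loop is therefore treated outside of it, while its
  body keeps a polynomial bound.\<close>

lemma while_count:
  assumes step: "\<And>v \<sigma>. v < N \<Longrightarrow> I v \<sigma> \<Longrightarrow> ram_eval a \<sigma> > 0 \<and> wp c n (I (Suc v)) \<sigma>"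
    and stop: "\<And>\<sigma>. I N \<sigma> \<Longrightarrow> \<not> ram_eval a \<sigma> > 0"
    and init: "I 0 \<sigma>"
  shows "\<exists>t \<tau>. ram_exec (WhilePos a c) \<sigma> t \<tau> \<and> I N \<tau> \<and> t \<le> (N + 1) * (1 + exp_cost a + tb n c)"
proof -
  let ?T = "1 + exp_cost a + tb n c"
  have "\<exists>t \<tau>. ram_exec (WhilePos a c) \<sigma> t \<tau> \<and> I N \<tau> \<and> t \<le> (j + 1) * ?T" if "I (N - j) \<sigma>" "j \<le> N" for j \<sigma>
    using that
  proof (induction j arbitrary: \<sigma>)
    case 0
    then have "I N \<sigma>" by simp
    moreover have "ram_exec (WhilePos a c) \<sigma> (1 + exp_cost a) \<sigma>"
      using ram_exec.WhileFalse stop[OF \<open>I N \<sigma>\<close>] by blast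
    ultimately show ?case by (intro exI[of _ "1 + exp_cost a"] exI[of _ \<sigma>]) simp
  next
    case (Suc j)
    have v: "N - Suc j < N" "Suc (N - Suc j) = N - j" using Suc.prems by auto
    have pos: "ram_eval a \<sigma> > 0" and "wp c n (I (N - j)) \<sigma>" using step[OF v(1) Suc.prems(1)] v(2) by auto
    from wp_exec[OF this(2)] obtain t \<rho> where 1: "ram_exec c \<sigma> t \<rho>" "t \<le> tb n c" "I (N - j) \<rho>" by blast
    from Suc.IH[OF 1(3)] Suc.prems(2) obtain u \<tau> where
      2: "ram_exec (WhilePos a c) \<rho> u \<tau>" "I N \<tau>" "u \<le> (j + 1) * ?T" by auto
    have "ram_exec (WhilePos a c) \<sigma> (1 + exp_cost a + t + u) \<tau>" using ram_exec.WhileTrue[OF pos 1(1) 2(1)] .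
    moreover have "1 + exp_cost a + t + u \<le> (Suc j + 1) * ?T" using 1 2 by simp
    ultimately show ?case using 2 by blast
  qed
  from this[of N \<sigma>] init show ?thesis by simp
qed

definition Main_loop :: "mr_variant \<Rightarrow> ram_com" where
  "Main_loop X = WhilePos (Reg rRun)
     (Block [Try_guess X, Incr, Assign rRun (Sub (Const 1) (Reg rCy))])"

section \<open>Guesses as digit strings and the enumeration loop\<close>

context flat_instance
begin

text \<open>Per path \<open>c\<close> there are five digits: parent, class, entry change moved up by
  \<open>b\<close>, and then amount and offset of class \<open>c + 1\<close>.\<close>

definition ub :: "nat \<Rightarrow> nat" where
  "ub i = (if i mod 5 = 0 then k + 1 else if i mod 5 = 1 then min b k + 1 else if i mod 5 = 2 then 2 * b + 1 else b + 1)"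

definition par_of :: "(nat \<Rightarrow> nat) \<Rightarrow> nat \<Rightarrow> nat" where
  "par_of d c = (if c < k then d (5 * c) else 0)"
definition cl_of :: "(nat \<Rightarrow> nat) \<Rightarrow> nat \<Rightarrow> nat" where
  "cl_of d c = (if c < k then d (5 * c + 1) else 0)"
definition del_of :: "(nat \<Rightarrow> nat) \<Rightarrow> nat \<Rightarrow> int" where
  "del_of d c = (if c < k then int (d (5 * c + 2)) - int b else 0)"
definition am_of :: "(nat \<Rightarrow> nat) \<Rightarrow> nat \<Rightarrow> int" where
  "am_of d r = (if 0 < r \<and> r \<le> k then int (d (5 * (r - 1) + 3)) else 0)"
definition ofs_of :: "(nat \<Rightarrow> nat) \<Rightarrow> nat \<Rightarrow> int" where
  "ofs_of d r = (if 0 < r \<and> r \<le> k then int (d (5 * (r - 1) + 4)) else 0)"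

definition gen_of where
  "gen_of X d = gen X (par_of d) (cl_of d) (del_of d) (am_of d) (ofs_of d)"

lemma guess_of:
  assumes "\<And>i. i < 5 * k \<Longrightarrow> d i < ub i" "k \<le> n" "Suc (PS k) \<le> n"
  shows "guess k b PS TV HV LB s (Dof b (5 * k) d) (par_of d) (cl_of d) (del_of d) (am_of d) (ofs_of d) n"
proof (unfold_locales)
  fix c assume c: "c < k"
  show "Dof b (5 * k) d (5 * c + 5) = int (par_of d c)" "Dof b (5 * k) d (5 * c + 6) = int (cl_of d c)"
    using c by (auto simp: Dof_def par_of_def cl_of_def)
  have "d (5 * c) < ub (5 * c)" "d (5 * c + 1) < ub (5 * c + 1)" using assms(1) c by auto
  then show "par_of d c \<le> k" "cl_of d c \<le> k" using c by (auto simp: par_of_def cl_of_def ub_def)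
next
  fix c assume "c \<le> k"
  then show "Dof b (5 * k) d (5 * c + 7) = del_of d c + int b"
    by (cases "c = k") (auto simp: Dof_def del_of_def)
next
  fix r assume r: "r \<le> k"
  show "Dof b (5 * k) d (5 * r + 3) = am_of d r"
  proof (cases r)
    case (Suc q)
    then show ?thesis using r by (simp add: Dof_def am_of_def add.commute)
  qed (auto simp: Dof_def am_of_def)
  show "Dof b (5 * k) d (5 * r + 4) = ofs_of d r"
  proof (cases r)
    case (Suc q)
    then show ?thesis using r by (simp add: Dof_def ofs_of_def add.commute)
  qed (auto simp: Dof_def ofs_of_def)
qed (use assms in auto)

text \<open>The recorded value is only a lower bound because the start \<open>([], 0)\<close>
  understates the empty solution. For optimality this direction is enough, as \<open>tried\<close>
  bounds all competitors by the recorded value.\<close>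

definition good :: "mr_variant \<Rightarrow> shift_op list \<times> int \<Rightarrow> bool" where
  "good X bv \<longleftrightarrow> ops_ok (fst bv) \<and> (\<forall>x\<in>set (fst bv). allowed_op X x) \<and> shifts_cost (fst bv) \<le> b \<and>
     snd bv \<le> int (val (fapply (fst bv))) \<and> length (fst bv) \<le> 2 * k"

lemma good_better: "good X bv \<Longrightarrow> good X (better (gen X par cl del am ofs) bv)"
  using gen_sound[of X par cl del am ofs] by (auto simp: good_def better_def sound_def)

lemma better_ge: "snd bv \<le> snd (better st bv)"
  "shifts_cost (snd st) \<le> b \<Longrightarrow> int (val (fst st)) \<le> snd (better st bv)"
  by (auto simp: better_def)

definition tried :: "mr_variant \<Rightarrow> nat \<Rightarrow> shift_op list \<times> int \<Rightarrow> bool" where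
  "tried X v bv \<longleftrightarrow> (\<forall>d. (\<forall>i<5 * k. d i < ub i) \<longrightarrow> ov ub d (5 * k) < v \<longrightarrow>
     shifts_cost (snd (gen_of X d)) \<le> b \<longrightarrow> int (val (fst (gen_of X d))) \<le> snd bv)"

lemma gen_of_cong:
  assumes "\<And>i. i < 5 * k \<Longrightarrow> d i = e i"
  shows "gen_of X d = gen_of X e"
proof -
  have i: "5 * (r - 1) + 3 < 5 * k" "5 * (r - 1) + 4 < 5 * k" if "0 < r" "r \<le> k" for r
    using that by auto
  have "par_of d = par_of e" "cl_of d = cl_of e" "del_of d = del_of e"
    using assms by (auto simp: par_of_def cl_of_def del_of_def)
  moreover have "am_of d = am_of e" "ofs_of d = ofs_of e"
    using assms[OF i(1)] assms[OF i(2)] by (auto simp: am_of_def ofs_of_def)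
  ultimately show ?thesis by (simp add: gen_of_def)
qed

text \<open>By \<open>ov_inj\<close> a guess with counter value \<open>v\<close> agrees with
  \<open>d\<close> on the first \<open>5 * k\<close> digits, and \<open>gen_of\<close> reads no
  others.\<close>

lemma tried_Suc:
  assumes "tried X v bv" "\<And>i. i < 5 * k \<Longrightarrow> d i < ub i" "ov ub d (5 * k) = v"
  shows "tried X (Suc v) (better (gen_of X d) bv)"
  unfolding tried_def
proof (intro allI impI)
  fix e assume e: "\<forall>i<5 * k. e i < ub i" "ov ub e (5 * k) < Suc v" "shifts_cost (snd (gen_of X e)) \<le> b"
  show "int (val (fst (gen_of X e))) \<le> snd (better (gen_of X d) bv)"
  proof (cases "ov ub e (5 * k) = v")
    case True
    have "\<And>i. i < 5 * k \<Longrightarrow> e i = d i"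
      using ov_inj[of "5 * k" e ub d] e(1) assms(2,3) True by simp
    then have "gen_of X e = gen_of X d" by (rule gen_of_cong)
    then show ?thesis using better_ge(2) e(3) by simp
  next
    case False
    then have "int (val (fst (gen_of X e))) \<le> snd bv" using e assms(1) by (simp add: tried_def)
    then show ?thesis using better_ge(1)[of bv "gen_of X d"] by linarith
  qed
qed

definition bregs :: "(nat \<Rightarrow> int) \<Rightarrow> bool" where
  "bregs R \<longleftrightarrow> R rK = int k \<and> R rM = int (PS k) \<and> R rB = int b \<and> R rS = s \<and> R rND = int (5 * k + 5)"

definition uinst :: "(int \<Rightarrow> int) \<Rightarrow> bool" where
  "uinst m \<longleftrightarrow> (\<forall>i<5 * k. m (adr tU (int (i + 5))) = int (ub i))"

text \<open>After the last guess the counter has overflowed, so the clause about the digits is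
  restricted to values below the number of guesses.\<close>

definition loop_inv :: "mr_variant \<Rightarrow> nat \<Rightarrow> ram_state \<Rightarrow> bool" where
  "loop_inv X v \<sigma> \<longleftrightarrow> bregs (fst \<sigma>) \<and> sinst (snd \<sigma>) \<and> uinst (snd \<sigma>) \<and>
     (\<exists>bv. bstate bv (fst \<sigma>) (snd \<sigma>) \<and> good X bv \<and> tried X v bv) \<and>
     fst \<sigma> rRun = (if v < (\<Prod>l<5*k. ub l) then 1 else 0) \<and>
     (v < (\<Prod>l<5*k. ub l) \<longrightarrow> (\<exists>d. (\<forall>i. snd \<sigma> (adr tD (int i)) = Dof b (5 * k) d i) \<and>
        (\<forall>i<5 * k. d i < ub i) \<and> ov ub d (5 * k) = v))"

lemma loop_step:
  assumes v: "v < (\<Prod>l<5*k. ub l)" and inv: "loop_inv X v (R, m)" and n: "6 * k \<le> n" "Suc (PS k) \<le> n"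
  shows "wp (Block [Try_guess X, Incr, Assign rRun (Sub (Const 1) (Reg rCy))]) n (loop_inv X (Suc v)) (R, m)"
proof -
  obtain bv where bv: "bstate bv R m" "good X bv" "tried X v bv" using inv by (auto simp: loop_inv_def)
  obtain d where d: "\<forall>i. m (adr tD (int i)) = Dof b (5 * k) d i" "\<forall>i<5 * k. d i < ub i" "ov ub d (5 * k) = v"
    using inv v by (auto simp: loop_inv_def)
  have st: "bregs R" "sinst m" "uinst m" using inv by (auto simp: loop_inv_def)
  interpret G: guess k b PS TV HV LB s "Dof b (5 * k) d" "par_of d" "cl_of d" "del_of d" "am_of d" "ofs_of d" n
    by (rule guess_of) (use d n in auto)
  have mi: "G.minst m" using st(2) d(1) by (simp add: G.minst_def sinst_def)
  have ba: "G.base R" using st(1) by (simp add: G.base_def bregs_def)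
  let ?T = "{tP, tWL, tOP, tMK, tBE}"
  let ?bv = "better (gen_of X d) bv"
  have "wp (Try_guess X) n (\<lambda>\<tau>. bstate ?bv (fst \<tau>) (snd \<tau>) \<and> same ?T m (snd \<tau>)) (R, m)"
    unfolding gen_of_def by (rule G.wp_Try_guess[OF mi ba bv(1) n(1)])
  then have "wp (Try_guess X) n (wp Incr n (wp (Block [Assign rRun (Sub (Const 1) (Reg rCy))]) n (loop_inv X (Suc v)))) (R, m)"
  proof (rule wp_conseq)
    fix R1 m1 assume a: "bstate ?bv (fst (R1, m1)) (snd (R1, m1)) \<and> same ?T m (snd (R1, m1))"
      and fr: "\<And>r. r \<notin> writes (Try_guess X) \<Longrightarrow> R1 r = R r"
    have fr': "R1 r = R r" if "r < 6 \<or> 39 < r" for r using fr writes_Try_guess[of X] that by force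
    have m1: "m1 (adr t i) = m (adr t i)" if "2 \<le> t" "t \<le> 7" for t i
      using sameD[of ?T m m1 t i] a that by simp
    have b1: "bregs R1" using st(1) fr' by (simp add: bregs_def)
    have s1: "sinst m1" using st(2) m1 by (simp add: sinst_def)
    have u1: "uinst m1" using st(3) m1 by (simp add: uinst_def)
    have "wp Incr n (\<lambda>\<tau>. same {tD} m1 (snd \<tau>) \<and> (\<exists>d'. (\<forall>i. snd \<tau> (adr tD (int i)) = Dof b (5 * k) d' i) \<and>
     (\<forall>i<5 * k. d' i < ub i) \<and> (if Suc (ov ub d (5 * k)) < (\<Prod>l<5 * k. ub l)
        then fst \<tau> rCy = 0 \<and> ov ub d' (5 * k) = Suc (ov ub d (5 * k)) else fst \<tau> rCy = 1))) (R1, m1)"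
      by (rule wp_Incr) (use b1 u1 n(1) d m1 in \<open>auto simp: bregs_def uinst_def\<close>)
    then show "wp Incr n (wp (Block [Assign rRun (Sub (Const 1) (Reg rCy))]) n (loop_inv X (Suc v))) (R1, m1)"
    proof (rule wp_conseq)
      fix R2 m2 assume b: "same {tD} m1 (snd (R2, m2)) \<and> (\<exists>d'. (\<forall>i. snd (R2, m2) (adr tD (int i)) = Dof b (5 * k) d' i) \<and>
     (\<forall>i<5 * k. d' i < ub i) \<and> (if Suc (ov ub d (5 * k)) < (\<Prod>l<5 * k. ub l)
        then fst (R2, m2) rCy = 0 \<and> ov ub d' (5 * k) = Suc (ov ub d (5 * k)) else fst (R2, m2) rCy = 1))"
        and fr2: "\<And>r. r \<notin> writes Incr \<Longrightarrow> R2 r = R1 r"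
      let ?R = "R2(rRun := 1 - R2 rCy)"
      have m2: "m2 (adr t i) = m1 (adr t i)" if "0 \<le> t" "t < 16" "t \<noteq> tD" for t i
        using sameD[of "{tD}" m1 m2 t i] b that by simp
      have "bregs ?R" using b1 fr2 by (simp add: bregs_def)
      moreover have "sinst m2" using s1 m2 by (simp add: sinst_def)
      moreover have "uinst m2" using u1 m2 by (simp add: uinst_def)
      moreover have "bstate ?bv ?R m2" using a fr2 m2 by (simp add: bstate_def)
      moreover have "good X ?bv" using good_better[OF bv(2)] by (simp add: gen_of_def)
      moreover have "tried X (Suc v) ?bv" using tried_Suc[OF bv(3) _ d(3)] d(2) by blast
      moreover have "?R rRun = (if Suc v < (\<Prod>l<5*k. ub l) then 1 else 0)"
        using b d(3) by (auto split: if_splits)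
      moreover have "Suc v < (\<Prod>l<5*k. ub l) \<longrightarrow> (\<exists>d. (\<forall>i. m2 (adr tD (int i)) = Dof b (5 * k) d i) \<and>
        (\<forall>i<5 * k. d i < ub i) \<and> ov ub d (5 * k) = Suc v)"
        using b d(3) by auto
      ultimately have "loop_inv X (Suc v) (?R, m2)" unfolding loop_inv_def fst_conv snd_conv by blast
      then show "wp (Block [Assign rRun (Sub (Const 1) (Reg rCy))]) n (loop_inv X (Suc v)) (R2, m2)" by simp
    qed
  qed
  then show ?thesis by simp
qed

lemma Main_loop_exec:
  assumes n: "6 * k \<le> n" "Suc (PS k) \<le> n" and init: "loop_inv X 0 \<sigma>"
  shows "\<exists>t \<tau>. ram_exec (Main_loop X) \<sigma> t \<tau> \<and> loop_inv X (\<Prod>l<5*k. ub l) \<tau> \<and>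
     t \<le> ((\<Prod>l<5*k. ub l) + 1) * (2 + tb n (Block [Try_guess X, Incr, Assign rRun (Sub (Const 1) (Reg rCy))]))"
proof -
  have "\<exists>t \<tau>. ram_exec (Main_loop X) \<sigma> t \<tau> \<and> loop_inv X (\<Prod>l<5*k. ub l) \<tau> \<and>
     t \<le> ((\<Prod>l<5*k. ub l) + 1) * (1 + exp_cost (Reg rRun) + tb n (Block [Try_guess X, Incr, Assign rRun (Sub (Const 1) (Reg rCy))]))"
    unfolding Main_loop_def
  proof (rule while_count[where I = "loop_inv X"])
    show "loop_inv X 0 \<sigma>" by (rule init)
  next
    fix v \<sigma> assume v: "v < (\<Prod>l<5*k. ub l)" and I: "loop_inv X v \<sigma>"
    obtain R m where s: "\<sigma> = (R, m)" by (cases \<sigma>)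
    show "ram_eval (Reg rRun) \<sigma> > 0 \<and> wp (Block [Try_guess X, Incr, Assign rRun (Sub (Const 1) (Reg rCy))]) n (loop_inv X (Suc v)) \<sigma>"
      using loop_step[OF v I[unfolded s] n] v I unfolding s by (simp add: loop_inv_def)
  next
    fix \<sigma> assume "loop_inv X (\<Prod>l<5*k. ub l) \<sigma>"
    then show "\<not> ram_eval (Reg rRun) \<sigma> > 0" by (simp add: loop_inv_def)
  qed
  then show ?thesis by simp
qed

lemma best_optimal:
  assumes t: "tried X (\<Prod>l<5*k. ub l) bv" and g: "good X bv"
    and ys: "ops_ok ys" "\<forall>x\<in>set ys. allowed_op X x" "shifts_cost ys \<le> b"
  shows "val (fapply ys) \<le> val (fapply (fst bv))"
proof -
  obtain par cl del am ofs where
    1: "\<forall>c<k. par c \<le> k \<and> cl c \<le> min b k \<and> \<bar>del c\<bar> \<le> int b"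
    and 2: "\<forall>c\<ge>k. par c = 0 \<and> cl c = 0 \<and> del c = 0"
    and 3: "\<forall>r. 0 \<le> am r \<and> am r \<le> int b \<and> 0 \<le> ofs r \<and> ofs r \<le> int b"
    and 4: "\<forall>r. r = 0 \<or> r > k \<longrightarrow> am r = 0 \<and> ofs r = 0"
    and 5: "shifts_cost (snd (gen X par cl del am ofs)) \<le> b"
    and 6: "\<forall>x. usable (fapply ys) x \<longrightarrow> usable (fst (gen X par cl del am ofs)) x"
    using ex_guess[OF ys] by (elim exE conjE) (rule that; assumption)
  \<comment> \<open>The last two digits of block \<open>c\<close> belong to class
    \<open>Suc c\<close>, because class 0 has no digits.\<close>
  define d where "d i = (let c = i div 5 in if i mod 5 = 0 then par c else if i mod 5 = 1 then cl c
      else if i mod 5 = 2 then nat (del c + int b) else if i mod 5 = 3 then nat (am (Suc c)) else nat (ofs (Suc c)))" for i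
  have dz: "d (5 * c + z) = (if z = 0 then par c else if z = 1 then cl c else if z = 2 then nat (del c + int b)
      else if z = 3 then nat (am (Suc c)) else nat (ofs (Suc c)))" if "z < 5" for c z
  proof -
    have "(5 * c + z) div 5 = c" "(5 * c + z) mod 5 = z" using that by simp_all
    then show ?thesis unfolding d_def Let_def by presburger
  qed
  have dm: "d (5 * c) = par c" "d (5 * c + 1) = cl c" "d (5 * c + 2) = nat (del c + int b)"
    "d (5 * c + 3) = nat (am (Suc c))" "d (5 * c + 4) = nat (ofs (Suc c))" for c
    using dz[of 0 c] dz[of 1 c] dz[of 2 c] dz[of 3 c] dz[of 4 c] by simp_all
  have "par_of d = par" using 2 dm(1) by (intro ext) (simp add: par_of_def)
  moreover have "cl_of d = cl" using 2 dm(2) by (intro ext) (simp add: cl_of_def)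
  moreover have "del_of d = del"
  proof
    fix c
    show "del_of d c = del c"
    proof (cases "c < k")
      case True
      then have "\<bar>del c\<bar> \<le> int b" using 1 by blast
      then show ?thesis using True dm(3)[of c] by (simp add: del_of_def)
    next
      case False
      then have "del c = 0" using 2 by simp
      then show ?thesis using False by (simp add: del_of_def)
    qed
  qed
  moreover have "am_of d = am"
  proof
    fix r
    show "am_of d r = am r"
    proof (cases "0 < r \<and> r \<le> k")
      case True
      then have "d (5 * (r - 1) + 3) = nat (am r)" using dm(4)[of "r - 1"] by simp
      moreover have "0 \<le> am r" using 3 by blast
      ultimately show ?thesis using True by (simp add: am_of_def)
    next
      case False
      then have "am r = 0" using 4 by (metis neq0_conv not_le)
      then show ?thesis using False by (auto simp: am_of_def)
    qed
  qed
  moreover have "ofs_of d = ofs"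
  proof
    fix r
    show "ofs_of d r = ofs r"
    proof (cases "0 < r \<and> r \<le> k")
      case True
      then have "d (5 * (r - 1) + 4) = nat (ofs r)" using dm(5)[of "r - 1"] by simp
      moreover have "0 \<le> ofs r" using 3 by blast
      ultimately show ?thesis using True by (simp add: ofs_of_def)
    next
      case False
      then have "ofs r = 0" using 4 by (metis neq0_conv not_le)
      then show ?thesis using False by (auto simp: ofs_of_def)
    qed
  qed
  ultimately have ge: "gen_of X d = gen X par cl del am ofs" by (simp add: gen_of_def)
  have db: "\<forall>i<5 * k. d i < ub i"
  proof (intro allI impI)
    fix i assume "i < 5 * k"
    then have c: "i div 5 < k" by auto
    have x: "par (i div 5) \<le> k" "cl (i div 5) \<le> min b k" "\<bar>del (i div 5)\<bar> \<le> int b" using 1 c by blast+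
    have y: "am (Suc (i div 5)) \<le> int b" "ofs (Suc (i div 5)) \<le> int b" using 3 by blast+
    have "par (i div 5) < k + 1" "cl (i div 5) < min b k + 1" "nat (del (i div 5) + int b) < 2 * b + 1"
      "nat (am (Suc (i div 5))) < b + 1" "nat (ofs (Suc (i div 5))) < b + 1"
      using x y by linarith+
    then show "d i < ub i" unfolding d_def ub_def Let_def by presburger
  qed
  then have "ov ub d (5 * k) < (\<Prod>l<5*k. ub l)" by (intro ov_less) auto
  then have "int (val (fst (gen_of X d))) \<le> snd bv" using t db 5 unfolding tried_def ge[symmetric] by blast
  moreover have "val (fapply ys) \<le> val (fst (gen_of X d))"
    unfolding val_def
  proof (rule card_mono)
    have "{x. usable W x} \<subseteq> {..<PS k}" for W using usable_less by auto
    then show "finite (insert s (HV ` {x. usable (fst (gen_of X d)) x}))"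
      using finite_subset by blast
    show "insert s (HV ` {x. usable (fapply ys) x}) \<subseteq> insert s (HV ` {x. usable (fst (gen_of X d)) x})"
      using 6 unfolding ge by blast
  qed
  ultimately show ?thesis using g by (simp add: good_def)
qed

end

section \<open>Temporal k-path graphs as flat instances\<close>

lemma concat_nth:
  "c < length L \<Longrightarrow> l < length (L ! c) \<Longrightarrow> concat L ! (length (concat (take c L)) + l) = L ! c ! l"
proof (induction L arbitrary: c)
  case (Cons x L)
  show ?case
  proof (cases c)
    case 0
    then show ?thesis using Cons.prems by (simp add: nth_append)
  next
    case (Suc c')
    then show ?thesis using Cons.prems Cons.IH[of c'] by (simp add: nth_append)
  qed
qed simp

lemma length_concat_take_Suc:
  "c < length L \<Longrightarrow> length (concat (take (Suc c) L)) = length (concat (take c L)) + length (L ! c)"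
  by (simp add: take_Suc_conv_app_nth)

text \<open>The extra value at \<open>Suc (length Ps)\<close> closes the one-element segment of the
  virtual source edge.\<close>

definition starts :: "'a list list \<Rightarrow> nat \<Rightarrow> nat" where
  "starts Ps c = (if c \<le> length Ps then length (concat (take c Ps)) else Suc (length (concat Ps)))"

lemma starts_Suc: "c < length Ps \<Longrightarrow> starts Ps (Suc c) = starts Ps c + length (Ps ! c)"
  by (simp add: starts_def length_concat_take_Suc)

lemma starts_simps: "starts Ps 0 = 0" "starts Ps (length Ps) = length (concat Ps)"
  "starts Ps (Suc (length Ps)) = Suc (length (concat Ps))"
  by (simp_all add: starts_def)

lemma starts_nth: "c < length Ps \<Longrightarrow> l < length (Ps ! c) \<Longrightarrow> concat Ps ! (starts Ps c + l) = Ps ! c ! l"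
  by (simp add: starts_def concat_nth)

lemma starts_le: "c < length Ps \<Longrightarrow> l < length (Ps ! c) \<Longrightarrow> starts Ps c + l < length (concat Ps)"
proof -
  assume c: "c < length Ps" "l < length (Ps ! c)"
  have "concat Ps = concat (take (Suc c) Ps) @ concat (drop (Suc c) Ps)" by (simp flip: concat_append)
  then have "length (concat (take (Suc c) Ps)) \<le> length (concat Ps)"
    by (metis le_add1 length_append)
  then show ?thesis using c starts_Suc[OF c(1)] by (simp add: starts_def)
qed

definition flatTV :: "(nat, nat) kpath_graph \<Rightarrow> nat \<Rightarrow> int" where
  "flatTV G x = int (tail G (fst (concat (bpaths G) ! x)))"

definition flatHV :: "(nat, nat) kpath_graph \<Rightarrow> nat \<Rightarrow> nat \<Rightarrow> int" where
  "flatHV G s x = (if x < length (concat (bpaths G)) then int (head G (fst (concat (bpaths G) ! x))) else int s)"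

text \<open>Starting the fold at 0 gives a lower bound of all labels that also exists for the empty
  list; it need not be attained.\<close>

definition min_label :: "('e \<times> int) list \<Rightarrow> int" where
  "min_label xs = fold (\<lambda>x a. min (snd x) a) xs 0"

definition flatLB :: "(nat, nat) kpath_graph \<Rightarrow> nat \<Rightarrow> nat \<Rightarrow> int" where
  "flatLB G b x = (if x < length (concat (bpaths G)) then snd (concat (bpaths G) ! x)
     else min_label (concat (bpaths G)) - int b - 1)"

lemma fold_min_le: "fold (\<lambda>x a. min (snd x) a) xs a \<le> (a :: int)"
proof (induction xs arbitrary: a)
  case (Cons x xs)
  have "fold (\<lambda>x a. min (snd x) a) xs (min (snd x) a) \<le> min (snd x) a" by (rule Cons)
  then show ?case by simp
qed simp

lemma fold_min_le_mem: "x \<in> set xs \<Longrightarrow> fold (\<lambda>x a. min (snd x) a) xs a \<le> (snd x :: int)"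
proof (induction xs arbitrary: a)
  case (Cons y xs)
  then show ?case using fold_min_le[of xs "min (snd y) a"] by auto
qed simp

locale mr_instance =
  fixes G :: "(nat, nat) kpath_graph" and b s :: nat
  assumes inp: "(G, b, s) \<in> mr_inputs"
begin

abbreviation "Ps \<equiv> bpaths G"
abbreviation "k \<equiv> length Ps"
abbreviation "PS \<equiv> starts Ps"
abbreviation "FL \<equiv> concat Ps"
abbreviation "TV \<equiv> flatTV G"
abbreviation "HV \<equiv> flatHV G s"
abbreviation "LB \<equiv> flatLB G b"

lemma graph: "temporal_kpath_graph k G" and wf: "wf_tmultigraph G" and s: "s \<in> verts G"
  using inp by (auto simp: mr_inputs_def temporal_kpath_graph_def)

lemma base_path: "c < k \<Longrightarrow> temporal_path G (Ps ! c)"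
  using graph by (auto simp: temporal_kpath_graph_def)

lemma path_facts:
  assumes "c < k"
  shows "Ps ! c \<noteq> []" "\<And>l. l < length (Ps ! c) \<Longrightarrow> fst (Ps ! c ! l) \<in> edges G"
    "\<And>l. Suc l < length (Ps ! c) \<Longrightarrow> head G (fst (Ps ! c ! l)) = tail G (fst (Ps ! c ! Suc l))"
    "\<And>l. Suc l < length (Ps ! c) \<Longrightarrow> snd (Ps ! c ! l) < snd (Ps ! c ! Suc l)"
proof -
  have tp: "directed_path G (map fst (Ps ! c))" "sorted_wrt (<) (map snd (Ps ! c))"
    using base_path[OF assms] by (auto simp: temporal_path_def)
  show "Ps ! c \<noteq> []" using tp by (auto simp: directed_path_def)
  show "fst (Ps ! c ! l) \<in> edges G" if "l < length (Ps ! c)" for l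
  proof -
    have "fst (Ps ! c ! l) \<in> set (map fst (Ps ! c))" using that by auto
    then show ?thesis using tp(1) unfolding directed_path_def by blast
  qed
  show "head G (fst (Ps ! c ! l)) = tail G (fst (Ps ! c ! Suc l))" if "Suc l < length (Ps ! c)" for l
    using tp(1) that by (auto simp: directed_path_def)
  show "snd (Ps ! c ! l) < snd (Ps ! c ! Suc l)" if "Suc l < length (Ps ! c)" for l
    using sorted_wrt_nth_less[OF tp(2), of l "Suc l"] that by simp
qed

lemma seg_split:
  assumes "c < k" "PS c \<le> x" "x < PS (Suc c)"
  obtains l where "x = PS c + l" "l < length (Ps ! c)" "FL ! x = Ps ! c ! l" "x < length FL"
proof
  let ?l = "x - PS c"
  show 1: "x = PS c + ?l" "?l < length (Ps ! c)" using assms starts_Suc[OF assms(1)] by auto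
  show "FL ! x = Ps ! c ! ?l" "x < length FL" using starts_nth[OF assms(1) 1(2)] starts_le[OF assms(1) 1(2)] 1(1) by simp_all
qed

sublocale flat_instance k b PS TV HV LB "int s"
proof
  show "PS c < PS (Suc c)" if "c < k" for c using starts_Suc[OF that] path_facts(1)[OF that] by simp
  show "PS (Suc k) = Suc (PS k)" by (simp add: starts_simps)
  show "PS 0 = 0" by (simp add: starts_simps)
  show "HV (PS k) = int s" by (simp add: flatHV_def starts_simps)
  show "HV x = TV (Suc x)" "LB x < LB (Suc x)" if a: "c < k" "PS c \<le> x" "Suc x < PS (Suc c)" for c x
  proof -
    have 1: "x < PS (Suc c)" "PS c \<le> Suc x" using that by auto
    obtain l where l: "x = PS c + l" "FL ! x = Ps ! c ! l" "x < length FL"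
      by (rule seg_split[OF a(1,2) 1(1)])
    obtain l' where l': "Suc x = PS c + l'" "l' < length (Ps ! c)" "FL ! Suc x = Ps ! c ! l'" "Suc x < length FL"
      by (rule seg_split[OF a(1) 1(2) a(3)])
    have "l' = Suc l" using l(1) l'(1) by simp
    then show "HV x = TV (Suc x)" "LB x < LB (Suc x)"
      using path_facts(3,4)[OF that(1), of l] l l' by (auto simp: flatHV_def flatTV_def flatLB_def)
  qed
  show "LB (PS k) + int b < LB x" if "x < PS k" for x
  proof -
    have "min_label FL \<le> snd (FL ! x)"
      unfolding min_label_def by (intro fold_min_le_mem nth_mem) (use that in \<open>simp add: starts_simps\<close>)
    then show ?thesis using that by (simp add: flatLB_def starts_simps)
  qed
qed

definition EE :: "nat \<Rightarrow> nat" where "EE x = fst (FL ! x)"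

lemma EE_edge: "x < length FL \<Longrightarrow> EE x \<in> edges G"
proof -
  assume "x < length FL"
  then obtain c where c: "c < k" "x \<in> seg c" using seg_ex[of x k] by (auto simp: starts_simps)
  obtain l where "l < length (Ps ! c)" "FL ! x = Ps ! c ! l" using seg_split[of c x] c by auto
  then show ?thesis using path_facts(2)[OF c(1)] by (simp add: EE_def)
qed

definition mk :: "(nat \<Rightarrow> int) \<Rightarrow> (nat \<times> int) list list" where
  "mk W = map (\<lambda>c. map (\<lambda>l. (EE (PS c + l), W (PS c + l))) [0..<length (Ps ! c)]) [0..<k]"

lemma mk_LB: "mk LB = Ps"
  by (rule nth_equalityI)
    (auto simp: mk_def EE_def flatLB_def starts_nth starts_le intro!: nth_equalityI)

lemma mk_set: "(\<Union>p\<in>set (mk W). set p) = {(EE x, W x) |x. x < length FL}"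
proof (intro set_eqI iffI)
  fix q assume "q \<in> (\<Union>p\<in>set (mk W). set p)"
  then obtain c l where "c < k" "l < length (Ps ! c)" "q = (EE (PS c + l), W (PS c + l))"
    by (auto simp: mk_def)
  then show "q \<in> {(EE x, W x) |x. x < length FL}" using starts_le[of c Ps l] by blast
next
  fix q assume "q \<in> {(EE x, W x) |x. x < length FL}"
  then obtain x where x: "x < length FL" "q = (EE x, W x)" by blast
  then obtain c where c: "c < k" "x \<in> seg c" using seg_ex[of x k] by (auto simp: starts_simps)
  obtain l where l: "x = PS c + l" "l < length (Ps ! c)" using seg_split[of c x] c by auto
  then have "q \<in> set (mk W ! c)" using c x by (simp add: mk_def)
  moreover have "mk W ! c \<in> set (mk W)" using c by (intro nth_mem) (simp add: mk_def)
  ultimately show "q \<in> (\<Union>p\<in>set (mk W). set p)" by blast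
qed

lemma mk_shift:
  assumes "c < k" "j < length (Ps ! c)"
  shows "(mk W)[c := shift_path j d (mk W ! c)] = mk (fop W (c, j, d))"
proof (rule nth_equalityI)
  show "length ((mk W)[c := shift_path j d (mk W ! c)]) = length (mk (fop W (c, j, d)))" by (simp add: mk_def)
  fix i assume "i < length ((mk W)[c := shift_path j d (mk W ! c)])"
  then have i: "i < k" by (simp add: mk_def)
  have segl: "PS i + l \<in> seg i" if "l < length (Ps ! i)" for l using that starts_Suc[OF i] by simp
  show "(mk W)[c := shift_path j d (mk W ! c)] ! i = mk (fop W (c, j, d)) ! i"
  proof (cases "i = c")
    case False
    have "fop W (c, j, d) (PS i + l) = W (PS i + l)" if "l < length (Ps ! i)" for l
    proof -
      have "PS i + l \<notin> seg c" using seg_unique[of "PS i + l" c i] segl[OF that] False i assms(1) by auto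
      then show ?thesis unfolding fop.simps by (rule fshift_other)
    qed
    then show ?thesis using False i by (simp add: mk_def)
  next
    case True
    have len: "length (mk W ! c) = length (Ps ! c)" using assms by (simp add: mk_def)
    have nth: "mk W ! c ! l = (EE (PS c + l), W (PS c + l))" if "l < length (Ps ! c)" for l
      using assms that by (simp add: mk_def)
    have "shift_path j d (mk W ! c) = map (\<lambda>l. (EE (PS c + l), fop W (c, j, d) (PS c + l))) [0..<length (Ps ! c)]"
      unfolding shift_path_def Let_def len
    proof (rule map_cong[OF refl])
      fix l assume "l \<in> set [0..<length (Ps ! c)]"
      then have l: "l < length (Ps ! c)" by simp
      show "(fst (mk W ! c ! l), if l = j then snd (mk W ! c ! j) + d
              else if j < l then max (snd (mk W ! c ! l)) (snd (mk W ! c ! j) + d + int (l - j))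
              else min (snd (mk W ! c ! l)) (snd (mk W ! c ! j) + d - int (j - l))) =
            (EE (PS c + l), fop W (c, j, d) (PS c + l))"
        using segl[of l] l True by (auto simp: nth[OF l] nth[OF assms(2)] fshift_def of_nat_diff)
    qed
    then show ?thesis using True i by (simp add: mk_def)
  qed
qed

text \<open>Multiplicities of temporal edges are dropped: reachability depends only on their set,
  whereas the base-paths are kept exactly because shifts act on them.\<close>

definition rep :: "(nat, nat) kpath_graph \<Rightarrow> (nat \<Rightarrow> int) \<Rightarrow> bool" where
  "rep H W \<longleftrightarrow> verts H = verts G \<and> edges H = edges G \<and> tail H = tail G \<and> head H = head G \<and>
     bpaths H = mk W \<and> set_mset (temporal_edges H) = {(EE x, W x) |x. x < length FL}"

lemma in_mset_sum_list: "x \<in># sum_list (map mset Qs) \<longleftrightarrow> (\<exists>q\<in>set Qs. x \<in> set q)"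
  by (induction Qs) auto

lemma rep_G: "rep G LB"
proof -
  have "temporal_edges G = sum_list (map mset Ps)" using graph by (simp add: temporal_kpath_graph_def)
  then have "set_mset (temporal_edges G) = (\<Union>p\<in>set Ps. set p)" using in_mset_sum_list by fastforce
  then show ?thesis using mk_set[of LB] by (simp add: rep_def mk_LB)
qed

lemma set_temporal_edges_labels:
  fixes H :: "(nat, nat) kpath_graph"
  assumes "finite (edges H)" "lab H = labels_of_paths Qs"
  shows "set_mset (temporal_edges H) = {q \<in> (\<Union>p\<in>set Qs. set p). fst q \<in> edges H}"
proof -
  have s: "set_mset (\<Sum>e\<in>A. f e) = (\<Union>e\<in>A. set_mset (f e))" if "finite A" for A :: "nat set" and f :: "nat \<Rightarrow> (nat \<times> int) multiset"
    using that by (induction A rule: finite_induct) auto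
  have "set_mset (temporal_edges H) = (\<Union>e\<in>edges H. set_mset (image_mset (Pair e) (labels_of_paths Qs e)))"
    unfolding temporal_edges_def assms(2) by (rule s[OF assms(1)])
  also have "\<dots> = {q \<in> (\<Union>p\<in>set Qs. set p). fst q \<in> edges H}"
    by (force simp: labels_of_paths_def in_mset_sum_list)
  finally show ?thesis .
qed

lemma rep_shift:
  assumes H: "rep H W" and c: "c < k" "j < length (Ps ! c)"
  shows "rep (apply_shift H (c, j, d)) (fop W (c, j, d))"
proof -
  let ?W = "fop W (c, j, d)"
  let ?H = "apply_shift H (c, j, d)"
  have bp: "bpaths ?H = mk ?W" using mk_shift[OF c] H by (simp add: rep_def Let_def)
  have l: "lab ?H = labels_of_paths (mk ?W)" using mk_shift[OF c] H by (simp add: rep_def Let_def)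
  have e: "edges ?H = edges G" using H by (simp add: rep_def Let_def)
  have f: "finite (edges ?H)" using wf e by (simp add: wf_tmultigraph_def)
  have "set_mset (temporal_edges ?H) = {q \<in> {(EE x, ?W x) |x. x < length FL}. fst q \<in> edges ?H}"
    using set_temporal_edges_labels[OF f l] unfolding mk_set by simp
  also have "\<dots> = {(EE x, ?W x) |x. x < length FL}" using EE_edge e by auto
  finally show ?thesis using H bp by (simp add: rep_def Let_def)
qed

lemma ops_ok_Cons: "ops_ok ((c, j, d) # ops) \<longleftrightarrow> c < k \<and> j < length (Ps ! c) \<and> ops_ok ops"
  using starts_Suc[of c Ps] by (auto simp: ops_ok_def)

lemma rep_shifts:
  assumes "rep H W"
  shows "(valid_shifts H ops \<longleftrightarrow> ops_ok ops) \<and> (ops_ok ops \<longrightarrow> rep (apply_shifts H ops) (foldl fop W ops))"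
  using assms
proof (induction ops arbitrary: H W)
  case Nil
  then show ?case by (simp add: ops_ok_def apply_shifts_def)
next
  case (Cons a ops)
  obtain c j d where a: "a = (c, j, d)" by (cases a)
  have v: "valid_shift H a \<longleftrightarrow> c < k \<and> j < length (Ps ! c)"
  proof -
    have "length (bpaths H) = k" "\<And>c. c < k \<Longrightarrow> length (bpaths H ! c) = length (Ps ! c)"
      using Cons.prems by (simp_all add: rep_def mk_def)
    then show ?thesis by (auto simp: a)
  qed
  show ?case
  proof (cases "c < k \<and> j < length (Ps ! c)")
    case True
    have "rep (apply_shift H a) (fop W a)" unfolding a using rep_shift[OF Cons.prems] True by simp
    then show ?thesis using Cons.IH[of "apply_shift H a" "fop W a"] v True
      by (simp add: a ops_ok_Cons apply_shifts_def del: apply_shift.simps fop.simps)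
  next
    case False
    then show ?thesis using v by (auto simp: a ops_ok_Cons)
  qed
qed

lemma feasible_iff: "mr_feasible X G b ops \<longleftrightarrow>
    ops_ok ops \<and> (\<forall>x\<in>set ops. allowed_op X x) \<and> shifts_cost ops \<le> b"
  using rep_shifts[OF rep_G] by (simp add: mr_feasible_def)

section \<open>Walks along usable edges and temporal paths\<close>

lemma path_usable:
  assumes H: "rep H W" and p: "temporal_path H p" "tail H (fst (hd p)) = s" and i: "i < length p"
  shows "\<exists>x. usable W x \<and> p ! i = (EE x, W x)"
  using i
proof (induction i)
  have te: "q \<in> set p \<Longrightarrow> \<exists>x<length FL. q = (EE x, W x)" for q
    using H p(1) by (auto simp: rep_def temporal_path_def)
  have dp: "directed_path G (map fst p)" using H p(1) by (auto simp: rep_def temporal_path_def directed_path_def)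
  {
    case 0
    then obtain x where x: "x < length FL" "p ! 0 = (EE x, W x)" using te[of "p ! 0"] by auto
    have "hd p = p ! 0" using 0 by (simp add: hd_conv_nth)
    then have "tail G (EE x) = s" using p(2) H x by (simp add: rep_def)
    then have "usable W x" using x by (intro usable_start) (auto simp: starts_simps flatTV_def EE_def)
    then show ?case using x by blast
  next
    case (Suc i)
    then obtain y where y: "usable W y" "p ! i = (EE y, W y)" by auto
    obtain x where x: "x < length FL" "p ! Suc i = (EE x, W x)" using te[of "p ! Suc i"] Suc.prems by auto
    have yl: "y < length FL" using usable_less[OF y(1)] by (simp add: starts_simps)
    have "head G (map fst p ! i) = tail G (map fst p ! Suc i)"
      using dp Suc.prems unfolding directed_path_def by simp
    then have "head G (EE y) = tail G (EE x)" using Suc.prems x y by simp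
    then have "HV y = TV x" using yl by (simp add: flatHV_def flatTV_def EE_def)
    moreover have "W y < W x"
      using sorted_wrt_nth_less[of "(<)" "map snd p" i "Suc i"] p(1) Suc.prems x y by (simp add: temporal_path_def)
    ultimately have "usable W x" using usable_step[OF y(1)] x by (simp add: starts_simps)
    then show ?case using x by blast
  }
qed

lemma temporal_path_take:
  assumes "temporal_path H p" "0 < i" "i \<le> length p"
  shows "temporal_path H (take i p)"
proof -
  have d: "directed_path H (map fst p)" "sorted_wrt (<) (map snd p)" "set p \<subseteq> set_mset (temporal_edges H)"
    using assms(1) by (auto simp: temporal_path_def)
  have ne: "take i p \<noteq> []" using assms by auto
  have hd: "hd (map fst (take i p)) = hd (map fst p)" using assms by (simp add: take_map[symmetric] hd_take)
  have "distinct (tail H (hd (map fst p)) # map (head H) (map fst p))" using d(1) by (simp add: directed_path_def)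
  then have "distinct (take (Suc i) (tail H (hd (map fst p)) # map (head H) (map fst p)))" by (rule distinct_take)
  then have "distinct (tail H (hd (map fst (take i p))) # map (head H) (map fst (take i p)))"
    unfolding hd by (simp add: take_map)
  moreover have "set (map fst (take i p)) \<subseteq> edges H"
    using d(1) set_take_subset[of i p] unfolding directed_path_def by auto
  moreover have "\<forall>l. Suc l < length (map fst (take i p)) \<longrightarrow>
      head H (map fst (take i p) ! l) = tail H (map fst (take i p) ! Suc l)"
    using d(1) by (simp add: directed_path_def)
  ultimately have "directed_path H (map fst (take i p))" using ne unfolding directed_path_def by simp
  moreover have "sorted_wrt (<) (map snd (take i p))" using d(2) sorted_wrt_take[of "(<)" "map snd p" i] by (simp add: take_map)
  ultimately show ?thesis using d(3) set_take_subset[of i p] by (auto simp: temporal_path_def)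
qed

text \<open>Temporal paths are simple, walks are not. If the next head already lies on the path, a
  prefix reaches it with a label of at most \<open>W x\<close>; claiming this inequality instead of
  equality lets the induction continue from the prefix. A return to the source is served by the
  empty path.\<close>

lemma usable_path:
  assumes H: "rep H W"
  shows "usable W x \<Longrightarrow> head G (EE x) = s \<or> (\<exists>p. temporal_path H p \<and> tail H (fst (hd p)) = s \<and>
     head H (fst (last p)) = head G (EE x) \<and> snd (last p) \<le> W x)"
proof (induction rule: usable.induct)
  \<comment> \<open>An edge leaving the source starts afresh. This covers both the start of a walk
    and a walk that has come back to the source.\<close>
  have single: "head G (EE x) = s \<or> (\<exists>p. temporal_path H p \<and> tail H (fst (hd p)) = s \<and>
     head H (fst (last p)) = head G (EE x) \<and> snd (last p) \<le> W x)" if x: "x < PS k" "tail G (EE x) = s" for x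
  proof (cases "head G (EE x) = s")
    case False
    have "(EE x, W x) \<in> {(EE x, W x) |x. x < length FL}" using x by (auto simp: starts_simps)
    then have "temporal_path H [(EE x, W x)]"
      using H x False EE_edge[of x] by (auto simp: temporal_path_def directed_path_def rep_def starts_simps)
    then show ?thesis using x H by (intro disjI2 exI[of _ "[(EE x, W x)]"]) (auto simp: rep_def)
  qed simp
  {
    case (usable_start x)
    then show ?case using single by (simp add: flatTV_def EE_def)
  next
    case (usable_step y x)
    have yl: "y < length FL" "x < length FL" using usable_less[OF usable_step(1)] usable_step(2) by (simp_all add: starts_simps)
    have yx: "head G (EE y) = tail G (EE x)" using usable_step(3) yl by (simp add: flatHV_def flatTV_def EE_def)
    show ?case
    proof (cases "tail G (EE x) = s")
      case True
      then show ?thesis using single usable_step(2) by blast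
    next
      case False
      then obtain p where p: "temporal_path H p" "tail H (fst (hd p)) = s" "head H (fst (last p)) = tail G (EE x)"
        "snd (last p) \<le> W y" using usable_step.IH yx by auto
      have th: "tail H = tail G" "head H = head G" "edges H = edges G" using H by (auto simp: rep_def)
      have ne: "p \<noteq> []" using p(1) by (auto simp: temporal_path_def directed_path_def)
      have srt: "sorted_wrt (<) (map snd p)" using p(1) by (simp add: temporal_path_def)
      have last_ge: "snd (p ! i) \<le> snd (last p)" if "i < length p" for i
      proof (cases "i = length p - 1")
        case True
        then show ?thesis using ne by (simp add: last_conv_nth)
      next
        case False
        then have "map snd p ! i < map snd p ! (length p - 1)"
          using sorted_wrt_nth_less[OF srt, of i "length p - 1"] that by simp
        then show ?thesis using that ne by (simp add: last_conv_nth)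
      qed
      have le: "snd (last p) < W x" using p(4) usable_step(4) by simp
      consider "head G (EE x) = s" | i where "i < length p" "head G (fst (p ! i)) = head G (EE x)"
        | "head G (EE x) \<noteq> s" "head G (EE x) \<notin> set (map (head G) (map fst p))"
      proof (cases "head G (EE x) \<in> set (map (head G) (map fst p))")
        case True
        then obtain i where "i < length (map (head G) (map fst p))" "map (head G) (map fst p) ! i = head G (EE x)"
          unfolding in_set_conv_nth by blast
        then show ?thesis using that(2)[of i] by simp
      qed (use that in blast)
      then show ?thesis
      proof cases
        case 1
        then show ?thesis by simp
      next
        case (2 i)
        have "temporal_path H (take (Suc i) p)" using temporal_path_take[OF p(1), of "Suc i"] 2 by simp
        moreover have "last (take (Suc i) p) = p ! i" using 2 by (simp add: take_Suc_conv_app_nth)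
        moreover have "hd (take (Suc i) p) = hd p" using ne by (simp add: hd_take)
        ultimately show ?thesis using 2 p(2) th last_ge[of i] le
          by (intro disjI2 exI[of _ "take (Suc i) p"]) auto
      next
        case 3
        let ?p = "p @ [(EE x, W x)]"
        have d: "directed_path H (map fst p)" "set p \<subseteq> set_mset (temporal_edges H)"
          using p(1) by (auto simp: temporal_path_def)
        have hd: "hd (map fst ?p) = hd (map fst p)" using ne by simp
        have tl: "tail G (hd (map fst p)) = s" using p(2) th ne by (simp add: hd_map)
        have dist: "distinct (tail G (hd (map fst ?p)) # map (head G) (map fst ?p))"
          using d(1) 3 unfolding hd tl directed_path_def by (auto simp: th tl)
        have cons: "head G (map fst ?p ! i) = tail G (map fst ?p ! Suc i)" if "Suc i < length (map fst ?p)" for i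
        proof (cases "Suc i < length p")
          case True
          then show ?thesis using d(1) by (simp add: directed_path_def th nth_append)
        next
          case False
          then have "i = length p - 1" "Suc i = length p" using that ne by auto
          then show ?thesis using p(3) ne th by (simp add: nth_append last_conv_nth)
        qed
        have sub: "set (map fst ?p) \<subseteq> edges G" using d(1) EE_edge[OF yl(2)] by (auto simp: directed_path_def th)
        have dpp: "directed_path H (map fst ?p)"
          unfolding directed_path_def th using sub cons dist by blast
        have s2: "sorted_wrt (<) (map snd ?p)"
        proof -
          have "\<forall>q\<in>set p. snd q < W x"
          proof
            fix q assume "q \<in> set p"
            then obtain i where "i < length p" "q = p ! i" by (auto simp: in_set_conv_nth)
            then show "snd q < W x" using last_ge[of i] le by simp
          qed
          then show ?thesis using srt by (auto simp: sorted_wrt_append)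
        qed
        have "(EE x, W x) \<in> set_mset (temporal_edges H)" using H yl(2) by (auto simp: rep_def)
        then have "temporal_path H ?p" unfolding temporal_path_def using dpp s2 d(2) by auto
        moreover have "tail H (fst (hd ?p)) = s" "head H (fst (last ?p)) = head G (EE x)" "snd (last ?p) \<le> W x"
          using p(2) ne th by simp_all
        ultimately show ?thesis by blast
      qed
    qed
  }
qed

lemma reach_val:
  assumes H: "rep H W"
  shows "card (reach_set H s) = val W"
proof -
  have th: "tail H = tail G" "head H = head G" "verts H = verts G" using H by (auto simp: rep_def)
  have hv: "HV x = int (head G (EE x))" if "usable W x" for x
    using usable_less[OF that] by (simp add: flatHV_def EE_def starts_simps)
  have "int ` reach_set H s = insert (int s) (HV ` {x. usable W x})"
  proof (intro set_eqI iffI)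
    fix q assume "q \<in> int ` reach_set H s"
    then obtain v where v: "q = int v" "reaches H s v" by (auto simp: reach_set_def)
    show "q \<in> insert (int s) (HV ` {x. usable W x})"
    proof (cases "v = s")
      case False
      then obtain p where p: "temporal_path H p" "tail H (fst (hd p)) = s" "head H (fst (last p)) = v"
        using v(2) by (auto simp: reaches_def)
      have ne: "p \<noteq> []" using p(1) by (auto simp: temporal_path_def directed_path_def)
      obtain x where x: "usable W x" "p ! (length p - 1) = (EE x, W x)"
        using path_usable[OF H p(1,2), of "length p - 1"] ne by auto
      then have "v = head G (EE x)" using p(3) ne th by (simp add: last_conv_nth)
      then have "q = HV x" using v(1) hv[OF x(1)] by simp
      then show ?thesis using x(1) by blast
    qed (use v in simp)
  next
    fix q assume "q \<in> insert (int s) (HV ` {x. usable W x})"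
    then consider "q = int s" | x where "usable W x" "q = HV x" by blast
    then show "q \<in> int ` reach_set H s"
    proof cases
      case 1
      then show ?thesis using s th by (auto simp: reach_set_def reaches_def)
    next
      case (2 x)
      have "x < length FL" using usable_less[OF 2(1)] by (simp add: starts_simps)
      then have "head G (EE x) \<in> verts H" using EE_edge wf th by (auto simp: wf_tmultigraph_def)
      moreover have "reaches H s (head G (EE x))" using usable_path[OF H 2(1)] by (auto simp: reaches_def)
      ultimately show ?thesis using hv[OF 2(1)] 2(2) by (auto simp: reach_set_def)
    qed
  qed
  then have "val W = card (int ` reach_set H s)" by (simp add: val_def)
  also have "\<dots> = card (reach_set H s)" by (rule card_image) simp
  finally show ?thesis by simp
qed

lemma best_is_optimal:
  assumes "tried X (\<Prod>l<5*k. ub l) bv" "good X bv"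
  shows "mr_optimal X G b s (fst bv)"
proof -
  have val: "card (reach_set (apply_shifts G ops) s) = val (fapply ops)" if "ops_ok ops" for ops
    using rep_shifts[OF rep_G, of ops] that reach_val by (simp add: fapply_def)
  have f: "mr_feasible X G b (fst bv)" using assms(2) by (simp add: feasible_iff good_def)
  show ?thesis unfolding mr_optimal_def
  proof (intro conjI f allI impI)
    fix ys assume "mr_feasible X G b ys"
    then have ys: "ops_ok ys" "\<forall>x\<in>set ys. allowed_op X x" "shifts_cost ys \<le> b" by (auto simp: feasible_iff)
    have "ops_ok (fst bv)" using assms(2) by (simp add: good_def)
    then show "card (reach_set (apply_shifts G ys) s) \<le> card (reach_set (apply_shifts G (fst bv)) s)"
      using best_optimal[OF assms ys] val ys(1) by simp
  qed
qed

end

section \<open>Parsing, output and running time\<close>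

abbreviation (input) "rCur \<equiv> 43 :: nat"
abbreviation (input) "rLen \<equiv> 44 :: nat"
abbreviation (input) "rMin \<equiv> 46 :: nat"

definition Parse_edge :: ram_com where
  "Parse_edge = Block [Assign rJ (Load (Reg rCur)),
     SetAt tTV (Reg rM) (Load (Add (Const 5) (Add (Reg rJ) (Reg rJ)))),
     SetAt tHV (Reg rM) (Load (Add (Const 6) (Add (Reg rJ) (Reg rJ)))),
     Assign rV (Load (Add (Reg rCur) (Const 1))),
     SetAt tLB (Reg rM) (Reg rV), IfLt (Reg rV) (Reg rMin) (Assign rMin (Reg rV)),
     Assign rCur (Add (Reg rCur) (Const 2)), Assign rM (Add (Reg rM) (Const 1))]"

definition Parse_path :: ram_com where
  "Parse_path = Block [SetAt tPS (Reg rC) (Reg rM), Assign rLen (Load (Reg rCur)),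
     Assign rCur (Add (Reg rCur) (Const 1)), For rX (Const 0) rLen Parse_edge]"

definition Set_bounds :: ram_com where
  "Set_bounds = Block [SetAt tU (Five (Reg rC) 5) (Add (Reg rK) (Const 1)),
     SetAt tU (Five (Reg rC) 6) (Add (Reg rV) (Const 1)),
     SetAt tU (Five (Reg rC) 7) (Add (Add (Reg rB) (Reg rB)) (Const 1)),
     SetAt tU (Five (Reg rC) 8) (Add (Reg rB) (Const 1)),
     SetAt tU (Five (Reg rC) 9) (Add (Reg rB) (Const 1))]"

definition Setup :: ram_com where
  "Setup = Block [SetAt tPS (Reg rK) (Reg rM), SetAt tPS (Add (Reg rK) (Const 1)) (Add (Reg rM) (Const 1)),
     SetAt tHV (Reg rM) (Reg rS), SetAt tLB (Reg rM) (Sub (Sub (Reg rMin) (Reg rB)) (Const 1)),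
     SetAt tD (Five (Reg rK) 7) (Reg rB),
     Assign rND (Five (Reg rK) 5), Assign rRun (Const 1), Assign rBest (Const 0), Assign rNb (Const 0),
     Assign rV (Reg rK), IfLt (Reg rB) (Reg rK) (Assign rV (Reg rB)),
     For rC (Const 0) rK Set_bounds]"

definition Parse :: ram_com where
  "Parse = Block [Assign rB (Load (Const 0)), Assign rS (Load (Const 1)), Assign rK (Load (Const 4)),
     Assign rCur (Add (Const 5) (Add (Load (Const 3)) (Load (Const 3)))), Assign rM (Const 0), Assign rMin (Const 0),
     For rC (Const 0) rK Parse_path, Setup]"

definition Output :: ram_com where
  "Output = Block [For rI (Const 0) rNb (Store (Reg rI) (At tBE (Reg rI))), Assign 0 (Reg rNb)]"

lemma writes_parse [simp]:
  "writes Parse_edge = {rJ, rV, rMin, rCur, rM}" "\<not> nostore Parse_edge"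
  "writes Parse_path = {rLen, rCur, rX, rJ, rV, rMin, rM}" "\<not> nostore Parse_path"
  "writes Set_bounds = {}" "\<not> nostore Set_bounds"
  unfolding Parse_edge_def Parse_path_def Set_bounds_def by auto

text \<open>Stated for plain integers, which keeps address arithmetic out of the symbolic execution.
  The three inequations say that the stores do not hit the input cells that are read
  afterwards.\<close>

lemma wp_Parse_edge_raw:
  assumes "R rCur = u" "R rM = x" "m u = e" "m (u + 1) = t" "m (5 + (e + e)) = a" "m (6 + (e + e)) = h"
    "adr tTV x \<noteq> 6 + (e + e)" "adr tTV x \<noteq> u + 1" "adr tHV x \<noteq> u + 1"
  shows "wp Parse_edge n (\<lambda>\<tau>. fst \<tau> rCur = u + 2 \<and> fst \<tau> rM = x + 1 \<and> fst \<tau> rMin = min t (R rMin) \<and>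
     snd \<tau> = m(adr tTV x := a, adr tHV x := h, adr tLB x := t)) (R, m)"
  unfolding Parse_edge_def using assms assms(7-9)[symmetric] by (cases "t < R rMin") simp_all

lemma concat_pairs:
  "length (concat (map (\<lambda>x. [f x, g x]) xs)) = 2 * length xs"
  "i < length xs \<Longrightarrow> concat (map (\<lambda>x. [f x, g x]) xs) ! (2 * i) = f (xs ! i)"
  "i < length xs \<Longrightarrow> concat (map (\<lambda>x. [f x, g x]) xs) ! Suc (2 * i) = g (xs ! i)"
proof -
  show "length (concat (map (\<lambda>x. [f x, g x]) xs)) = 2 * length xs" by (induction xs) auto
  show "i < length xs \<Longrightarrow> concat (map (\<lambda>x. [f x, g x]) xs) ! (2 * i) = f (xs ! i)"
    by (induction xs arbitrary: i) (auto simp: nth_Cons' less_Suc_eq_0_disj)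
  show "i < length xs \<Longrightarrow> concat (map (\<lambda>x. [f x, g x]) xs) ! Suc (2 * i) = g (xs ! i)"
    by (induction xs arbitrary: i) (auto simp: nth_Cons' less_Suc_eq_0_disj)
qed

definition enc_path :: "(nat \<times> int) list \<Rightarrow> int list" where
  "enc_path p = int (length p) # concat (map (\<lambda>x. [int (fst x), snd x]) p)"

lemma length_enc_path: "length (enc_path p) = Suc (2 * length p)"
  by (simp add: enc_path_def concat_pairs)

lemma enc_path_nth: "l < length p \<Longrightarrow> enc_path p ! Suc (2 * l) = int (fst (p ! l))"
  "l < length p \<Longrightarrow> enc_path p ! Suc (Suc (2 * l)) = snd (p ! l)"
  by (simp_all add: enc_path_def concat_pairs)

lemma length_concat_take_enc:
  "c \<le> length Ps \<Longrightarrow> length (concat (take c (map enc_path Ps))) = c + 2 * length (concat (take c Ps))"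
proof (induction c)
  case (Suc c)
  then have "c < length Ps" by simp
  then show ?case using Suc.IH length_concat_take_Suc[of c Ps] length_concat_take_Suc[of c "map enc_path Ps"]
    by (simp add: length_enc_path)
qed simp

declare enc_input.simps [simp del]

section \<open>Reading the input and writing the output\<close>

context mr_instance
begin

abbreviation "ne \<equiv> card (edges G)"
abbreviation "len \<equiv> length (enc_input (G, b, s))"

lemma enc_eq: "enc_input (G, b, s) = [int b, int s, int (card (verts G)), int ne, int k]
    @ concat (map (\<lambda>e. [int (tail G e), int (head G e)]) [0..<ne]) @ concat (map enc_path Ps)"
proof -
  have h: "(\<lambda>(e, t). [int e, t]) = (\<lambda>x :: nat \<times> int. [int (fst x), snd x])" by auto
  then have "enc_path = (\<lambda>p. int (length p) # concat (map (\<lambda>(e, t). [int e, t]) p))"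
    by (intro ext) (simp only: enc_path_def h)
  then show ?thesis by (simp add: enc_input.simps)
qed

lemma len_eq: "len = 5 + 2 * ne + k + 2 * PS k"
  using length_concat_take_enc[of k Ps] unfolding enc_eq by (simp add: concat_pairs starts_def)

definition cells :: "(int \<Rightarrow> int) \<Rightarrow> bool" where
  "cells m \<longleftrightarrow> (\<forall>a<len. m (int a) = enc_input (G, b, s) ! a)"

lemma cellD: "cells m \<Longrightarrow> a < len \<Longrightarrow> m (int a) = enc_input (G, b, s) ! a"
  by (simp add: cells_def)

text \<open>The address of the block of path \<open>c\<close>: five header cells, two cells per edge
  of the graph, one length cell per earlier path and two cells per earlier temporal edge.\<close>

definition off :: "nat \<Rightarrow> nat" where
  "off c = 5 + 2 * ne + c + 2 * PS c"

lemma edges_eq: "e \<in> edges G \<Longrightarrow> e < ne"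
  using inp by (auto simp: mr_inputs_def)

lemma cells_hdr:
  assumes "cells m"
  shows "m 0 = int b" "m 1 = int s" "m 3 = int ne" "m 4 = int k"
proof -
  have "m (int a) = enc_input (G, b, s) ! a" if "a < 5" for a
    using cellD[OF assms, of a] that len_eq by linarith
  from this[of 0] this[of 1] this[of 3] this[of 4]
  show "m 0 = int b" "m 1 = int s" "m 3 = int ne" "m 4 = int k" unfolding enc_eq by simp_all
qed

lemma cells_edge:
  assumes "cells m" "e < ne"
  shows "m (5 + (int e + int e)) = int (tail G e)" "m (6 + (int e + int e)) = int (head G e)"
proof -
  let ?E = "concat (map (\<lambda>e. [int (tail G e), int (head G e)]) [0..<ne])"
  have c: "m (int (5 + y)) = ?E ! y" if "y < 2 * ne" for y
  proof -
    have "enc_input (G, b, s) ! (5 + y) = ?E ! y"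
      unfolding enc_eq using that by (simp add: nth_append concat_pairs)
    moreover have "5 + y < len" using that len_eq by linarith
    ultimately show ?thesis using cellD[OF assms(1)] by metis
  qed
  have "int (5 + 2 * e) = 5 + (int e + int e)" "int (5 + Suc (2 * e)) = 6 + (int e + int e)" by auto
  then show "m (5 + (int e + int e)) = int (tail G e)" "m (6 + (int e + int e)) = int (head G e)"
    using c[of "2 * e"] c[of "Suc (2 * e)"] assms(2) concat_pairs(2,3)[of e "[0..<ne]" "\<lambda>e. int (tail G e)" "\<lambda>e. int (head G e)"]
    by simp_all
qed

lemma cells_path:
  assumes "cells m" "c < k"
  shows "m (int (off c)) = int (length (Ps ! c))"
    "l < length (Ps ! c) \<Longrightarrow> m (int (off c) + 1 + 2 * int l) = int (EE (PS c + l))"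
    "l < length (Ps ! c) \<Longrightarrow> m (int (off c) + 2 + 2 * int l) = LB (PS c + l)"
proof -
  let ?L = "map enc_path Ps"
  have st: "length (concat (take c ?L)) = c + 2 * PS c"
    using length_concat_take_enc[of c Ps] assms(2) by (simp add: starts_def)
  have c: "m (int (off c + y)) = enc_path (Ps ! c) ! y" if y: "y < length (enc_path (Ps ! c))" for y
  proof -
    have "enc_input (G, b, s) ! (off c + y) = concat ?L ! (c + 2 * PS c + y)"
      unfolding enc_eq off_def by (simp add: nth_append concat_pairs add_ac)
    also have "\<dots> = enc_path (Ps ! c) ! y"
      using concat_nth[of c ?L y] y assms(2) st by simp
    finally have e: "enc_input (G, b, s) ! (off c + y) = enc_path (Ps ! c) ! y" .
    have "PS (Suc c) \<le> PS k" using PS_mono[of "Suc c" k] assms(2) by simp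
    then have "off c + y < len" using y starts_Suc[OF assms(2)] assms(2) by (simp add: off_def len_eq length_enc_path)
    then show ?thesis using cellD[OF assms(1)] e by metis
  qed
  show "m (int (off c)) = int (length (Ps ! c))" using c[of 0] by (simp add: enc_path_def)
  assume l: "l < length (Ps ! c)"
  have i: "int (off c + Suc (2 * l)) = int (off c) + 1 + 2 * int l" "int (off c + Suc (Suc (2 * l))) = int (off c) + 2 + 2 * int l"
    by auto
  show "m (int (off c) + 1 + 2 * int l) = int (EE (PS c + l))"
    using c[of "Suc (2 * l)"] l unfolding i by (simp add: length_enc_path enc_path_nth EE_def starts_nth[OF assms(2) l])
  show "m (int (off c) + 2 + 2 * int l) = LB (PS c + l)"
    using c[of "Suc (Suc (2 * l))"] l starts_le[OF assms(2) l] unfolding i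
    by (simp add: length_enc_path enc_path_nth flatLB_def starts_nth[OF assms(2) l])
qed

definition mn :: "nat \<Rightarrow> int" where
  "mn x = fold (\<lambda>x a. min (snd x) a) (take x FL) 0"

lemma mn_Suc: "x < length FL \<Longrightarrow> mn (Suc x) = min (LB x) (mn x)"
  by (simp add: mn_def take_Suc_conv_app_nth flatLB_def)

definition stored :: "nat \<Rightarrow> (int \<Rightarrow> int) \<Rightarrow> (int \<Rightarrow> int) \<Rightarrow> bool" where
  "stored x m0 m \<longleftrightarrow> (\<forall>y<x. m (adr tTV (int y)) = TV y \<and> m (adr tHV (int y)) = HV y \<and> m (adr tLB (int y)) = LB y) \<and>
     (\<forall>a\<ge>0. m a = m0 a) \<and> same {tPS, tTV, tHV, tLB} m0 m"

lemma wp_Parse_edge: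
  assumes c: "c < k" "l < length (Ps ! c)" and m: "cells m" "stored (PS c + l) m0 m"
    and R: "R rCur = int (off c) + 1 + 2 * int l" "R rM = int (PS c + l)" "R rMin = mn (PS c + l)"
  shows "wp Parse_edge n (\<lambda>\<tau>. fst \<tau> rCur = int (off c) + 1 + 2 * int (Suc l) \<and> fst \<tau> rM = int (PS c + Suc l) \<and>
     fst \<tau> rMin = mn (PS c + Suc l) \<and> stored (PS c + Suc l) m0 (snd \<tau>) \<and>
     (\<forall>i. snd \<tau> (adr tPS i) = m (adr tPS i))) (R, m)"
proof -
  let ?x = "PS c + l"
  have xl: "?x < length FL" using starts_le[OF c] .
  note cp = cells_path(2,3)[OF m(1) c]
  have e: "EE ?x < ne" using EE_edge[OF xl] edges_eq by simp
  note ce = cells_edge[OF m(1) e]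
  have tv: "int (tail G (EE ?x)) = TV ?x" "int (head G (EE ?x)) = HV ?x"
    using xl by (simp_all add: flatTV_def flatHV_def EE_def)
  let ?m = "m(adr tTV (int ?x) := TV ?x, adr tHV (int ?x) := HV ?x, adr tLB (int ?x) := LB ?x)"
  have neg: "adr t (int ?x) \<noteq> a" if "0 \<le> a" "0 \<le> t" for t a using adr_neg[of t "int ?x"] that by linarith
  have neg2: "adr t (int ?x) < 0" if "0 \<le> t" for t using adr_neg[of t "int ?x"] that by simp
  have st: "stored (PS c + Suc l) m0 ?m"
    unfolding stored_def
  proof (intro conjI allI impI)
    fix y assume "y < PS c + Suc l"
    then have "y < ?x \<or> y = ?x" by auto
    then show "?m (adr tTV (int y)) = TV y" "?m (adr tHV (int y)) = HV y" "?m (adr tLB (int y)) = LB y"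
      using m(2) unfolding stored_def by auto
  next
    fix a :: int assume "0 \<le> a"
    then have "a \<noteq> adr tTV (int ?x)" "a \<noteq> adr tHV (int ?x)" "a \<noteq> adr tLB (int ?x)"
      using neg2[of tTV] neg2[of tHV] neg2[of tLB] by linarith+
    then show "?m a = m0 a" using m(2) \<open>0 \<le> a\<close> unfolding stored_def by simp
  next
    show "same {tPS, tTV, tHV, tLB} m0 ?m" using m(2) unfolding stored_def by (intro same_upd) auto
  qed
  have mi: "mn (PS c + Suc l) = min (LB ?x) (mn ?x)" using mn_Suc[OF xl] by simp
  let ?u = "int (off c) + 1 + 2 * int l"
  have rd: "m (?u + 1) = LB ?x" using cp(2) by (simp add: algebra_simps)
  have "wp Parse_edge n (\<lambda>\<tau>. fst \<tau> rCur = ?u + 2 \<and> fst \<tau> rM = int ?x + 1 \<and>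
     fst \<tau> rMin = min (LB ?x) (R rMin) \<and> snd \<tau> = ?m) (R, m)"
    by (rule wp_Parse_edge_raw[where e = "int (EE ?x)"])
      (use R cp(1) rd ce tv neg[of "6 + (int (EE ?x) + int (EE ?x))" tTV] neg[of "?u + 1" tTV] neg[of "?u + 1" tHV] in auto)
  then show ?thesis
  proof (rule wp_mono)
    fix \<tau> assume "fst \<tau> rCur = ?u + 2 \<and> fst \<tau> rM = int ?x + 1 \<and>
     fst \<tau> rMin = min (LB ?x) (R rMin) \<and> snd \<tau> = ?m"
    then show "fst \<tau> rCur = int (off c) + 1 + 2 * int (Suc l) \<and> fst \<tau> rM = int (PS c + Suc l) \<and>
     fst \<tau> rMin = mn (PS c + Suc l) \<and> stored (PS c + Suc l) m0 (snd \<tau>) \<and>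
     (\<forall>i. snd \<tau> (adr tPS i) = m (adr tPS i))" using st mi R(3) by simp
  qed
qed

lemma cells_stored: "cells m0 \<Longrightarrow> stored x m0 m \<Longrightarrow> cells m"
  by (simp add: cells_def stored_def)

lemma wp_Parse_path:
  assumes c: "c < k" and m0: "cells m0" and m: "stored (PS c) m0 m" "\<forall>c'<c. m (adr tPS (int c')) = int (PS c')"
    and R: "R rC = int c" "R rCur = int (off c)" "R rM = int (PS c)" "R rMin = mn (PS c)" and n: "len \<le> n"
  shows "wp Parse_path n (\<lambda>\<tau>. fst \<tau> rCur = int (off (Suc c)) \<and> fst \<tau> rM = int (PS (Suc c)) \<and>
     fst \<tau> rMin = mn (PS (Suc c)) \<and> stored (PS (Suc c)) m0 (snd \<tau>) \<and>
     (\<forall>c'<Suc c. snd \<tau> (adr tPS (int c')) = int (PS c'))) (R, m)"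
proof -
  let ?m = "m(adr tPS (int c) := int (PS c))"
  let ?R = "R(rLen := int (length (Ps ! c)), rCur := int (off c) + 1)"
  have neg: "a \<noteq> adr tPS (int c)" if "0 \<le> a" for a using adr_neg[of tPS "int c"] that by linarith
  have st: "stored (PS c) m0 ?m" unfolding stored_def
  proof (intro conjI allI impI)
    fix a :: int assume "0 \<le> a"
    then show "?m a = m0 a" using m(1) neg unfolding stored_def by simp
  next
    show "same {tPS, tTV, tHV, tLB} m0 ?m" using m(1) unfolding stored_def by (intro same_upd) auto
  qed (use m(1) in \<open>simp_all add: stored_def\<close>)
  have ps: "\<forall>c'<Suc c. ?m (adr tPS (int c')) = int (PS c')" using m(2) by (auto simp: less_Suc_eq)
  have Sc: "PS (Suc c) = PS c + length (Ps ! c)" using starts_Suc[OF c] .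
  have ln: "length (Ps ! c) \<le> n"
    using n PS_mono[of "Suc c" k] c Sc unfolding len_eq by simp
  have "wp (For rX (Const 0) rLen Parse_edge) n (\<lambda>\<tau>. fst \<tau> rCur = int (off (Suc c)) \<and> fst \<tau> rM = int (PS (Suc c)) \<and>
     fst \<tau> rMin = mn (PS (Suc c)) \<and> stored (PS (Suc c)) m0 (snd \<tau>) \<and>
     (\<forall>c'<Suc c. snd \<tau> (adr tPS (int c')) = int (PS c'))) (?R, ?m)"
  proof (rule wp_For[where l = 0 and u = "length (Ps ! c)" and
        I = "\<lambda>l R m. R rCur = int (off c) + 1 + 2 * int l \<and> R rM = int (PS c + l) \<and> R rMin = mn (PS c + l) \<and>
           stored (PS c + l) m0 m \<and> (\<forall>c'<Suc c. m (adr tPS (int c')) = int (PS c'))"])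
    show "(?R(rX := int 0)) rCur = int (off c) + 1 + 2 * int 0 \<and> (?R(rX := int 0)) rM = int (PS c + 0) \<and>
      (?R(rX := int 0)) rMin = mn (PS c + 0) \<and> stored (PS c + 0) m0 ?m \<and> (\<forall>c'<Suc c. ?m (adr tPS (int c')) = int (PS c'))"
      using R st ps by simp
    fix l R' m' assume l: "l < length (Ps ! c)"
      and I: "R' rCur = int (off c) + 1 + 2 * int l \<and> R' rM = int (PS c + l) \<and> R' rMin = mn (PS c + l) \<and>
           stored (PS c + l) m0 m' \<and> (\<forall>c'<Suc c. m' (adr tPS (int c')) = int (PS c'))"
    have "wp Parse_edge n (\<lambda>\<tau>. fst \<tau> rCur = int (off c) + 1 + 2 * int (Suc l) \<and> fst \<tau> rM = int (PS c + Suc l) \<and>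
      fst \<tau> rMin = mn (PS c + Suc l) \<and> stored (PS c + Suc l) m0 (snd \<tau>) \<and>
      (\<forall>i. snd \<tau> (adr tPS i) = m' (adr tPS i))) (R', m')"
      by (rule wp_Parse_edge[OF c l]) (use I cells_stored[OF m0] in blast)+
    then show "wp Parse_edge n (\<lambda>\<tau>. ((fst \<tau>)(rX := int (Suc l))) rCur = int (off c) + 1 + 2 * int (Suc l) \<and>
       ((fst \<tau>)(rX := int (Suc l))) rM = int (PS c + Suc l) \<and> ((fst \<tau>)(rX := int (Suc l))) rMin = mn (PS c + Suc l) \<and>
           stored (PS c + Suc l) m0 (snd \<tau>) \<and> (\<forall>c'<Suc c. snd \<tau> (adr tPS (int c')) = int (PS c'))) (R', m')"
      by (rule wp_mono) (use I in simp)
  next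
    fix R' m' assume I: "R' rCur = int (off c) + 1 + 2 * int (length (Ps ! c)) \<and> R' rM = int (PS c + length (Ps ! c)) \<and>
      R' rMin = mn (PS c + length (Ps ! c)) \<and>
           stored (PS c + length (Ps ! c)) m0 m' \<and> (\<forall>c'<Suc c. m' (adr tPS (int c')) = int (PS c'))"
    then show "fst (R', m') rCur = int (off (Suc c)) \<and> fst (R', m') rM = int (PS (Suc c)) \<and>
     fst (R', m') rMin = mn (PS (Suc c)) \<and> stored (PS (Suc c)) m0 (snd (R', m')) \<and>
     (\<forall>c'<Suc c. snd (R', m') (adr tPS (int c')) = int (PS c'))"
      unfolding Sc by (simp add: off_def Sc)
  qed (use ln in auto)
  moreover have "?m (int (off c)) = int (length (Ps ! c))"
    using cells_path(1)[OF cells_stored[OF m0 st] c] .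
  ultimately show ?thesis using R by (simp add: Parse_path_def)
qed

lemma ub_digit: "ub (5 * c) = k + 1" "ub (Suc (5 * c)) = min b k + 1" "ub (Suc (Suc (5 * c))) = 2 * b + 1"
  "ub (Suc (Suc (Suc (5 * c)))) = b + 1" "ub (Suc (Suc (Suc (Suc (5 * c))))) = b + 1"
proof -
  have "5 * c mod 5 = 0" "Suc (5 * c) mod 5 = 1" "Suc (Suc (5 * c)) mod 5 = 2"
    "Suc (Suc (Suc (5 * c))) mod 5 = 3" "Suc (Suc (Suc (Suc (5 * c)))) mod 5 = 4"
    by presburger+
  then show "ub (5 * c) = k + 1" "ub (Suc (5 * c)) = min b k + 1" "ub (Suc (Suc (5 * c))) = 2 * b + 1"
    "ub (Suc (Suc (Suc (5 * c)))) = b + 1" "ub (Suc (Suc (Suc (Suc (5 * c))))) = b + 1"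
    unfolding ub_def by simp_all
qed

lemma wp_Setup:
  assumes m0: "\<forall>i. m0 (adr tD (int i)) = 0" and m: "stored (PS k) m0 m" "\<forall>c<k. m (adr tPS (int c)) = int (PS c)"
    and R: "R rK = int k" "R rB = int b" "R rS = int s" "R rM = int (PS k)" "R rMin = mn (PS k)" and n: "k \<le> n"
  shows "wp Setup n (loop_inv X 0) (R, m)"
proof -
  define R1 where "R1 = R(rND := 5 * int k + 5, rRun := 1, rBest := 0, rNb := 0, rV := int (min b k))"
  define m1 where "m1 = m(adr tPS (int k) := int (PS k), adr tPS (int k + 1) := int (PS k) + 1,
     adr tHV (int (PS k)) := int s, adr tLB (int (PS k)) := mn (PS k) - int b - 1, adr tD (5 * int k + 7) := int b)"
  have lb: "mn (PS k) - int b - 1 = LB (PS k)" by (simp add: mn_def flatLB_def starts_simps min_label_def)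
  have si: "sinst m1"
    unfolding sinst_def
  proof (intro conjI allI impI)
    fix c assume "c \<le> Suc k"
    then consider "c < k" | "c = k" | "c = Suc k" by linarith
    then show "m1 (adr tPS (int c)) = int (PS c)"
    proof cases
      case 1 then show ?thesis using m(2) by (simp add: m1_def)
    next
      case 2 then show ?thesis by (simp add: m1_def)
    next
      case 3 then show ?thesis by (simp add: m1_def PS_Suc_k add.commute)
    qed
  next
    fix x assume "x < PS k"
    then show "m1 (adr tTV (int x)) = TV x" using m(1) by (simp add: m1_def stored_def)
  next
    fix x assume "x \<le> PS k"
    then consider "x < PS k" | "x = PS k" by linarith
    then have "m1 (adr tHV (int x)) = HV x \<and> m1 (adr tLB (int x)) = LB x"
    proof cases
      case 1
      then show ?thesis using m(1) by (simp add: m1_def stored_def)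
    next
      case 2
      then show ?thesis using HV_src lb by (simp add: m1_def)
    qed
    then show "m1 (adr tHV (int x)) = HV x" "m1 (adr tLB (int x)) = LB x" by auto
  qed
  \<comment> \<open>All cells of this array are initially 0, which is the first guess; only the cell
    for the virtual path has been written.\<close>
  have di: "m1 (adr tD (int i)) = Dof b (5 * k) (\<lambda>_. 0) i" for i
  proof -
    have "m (adr tD (int i)) = 0" using m0 m(1) sameD[of "{tPS, tTV, tHV, tLB}" m0 m tD] by (simp add: stored_def)
    moreover have "int i = 5 * int k + 7 \<longleftrightarrow> i = 5 * k + 7" by linarith
    ultimately show ?thesis by (simp add: m1_def Dof_def)
  qed
  let ?J = "\<lambda>c m'. (\<forall>i<5 * c. m' (adr tU (int (i + 5))) = int (ub i)) \<and> same {tU} m1 m'"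
  have "wp (For rC (Const 0) rK Set_bounds) n (loop_inv X 0) (R1, m1)"
  proof (rule wp_For[where l = 0 and u = k and I = "\<lambda>c R m'. ?J c m'"])
    show "?J 0 m1" using same_refl by simp
    fix c R' m' assume c: "c < k" and J: "?J c m'" and rc: "R' rC = int c"
      and fr: "\<And>r. r \<noteq> rC \<Longrightarrow> r \<notin> writes Set_bounds \<Longrightarrow> R' r = R1 r"
    have rg: "R' rK = int k" "R' rV = int (min b k)" "R' rB = int b" using fr R by (simp_all add: R1_def)
    let ?m = "m'(adr tU (5 * int c + 5) := int k + 1, adr tU (5 * int c + 6) := int (min b k) + 1,
       adr tU (5 * int c + 7) := int b + int b + 1, adr tU (5 * int c + 8) := int b + 1, adr tU (5 * int c + 9) := int b + 1)"
    have sm: "same {tU} m1 ?m" using J by (intro same_upd) auto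
    have "?m (adr tU (int (i + 5))) = int (ub i)" if i: "i < 5 * Suc c" for i
    proof -
      consider "i < 5 * c" | "i = 5 * c" | "i = Suc (5 * c)" | "i = Suc (Suc (5 * c))" | "i = Suc (Suc (Suc (5 * c)))"
        | "i = Suc (Suc (Suc (Suc (5 * c))))"
      proof -
        have "i < 5 * c \<or> i = 5 * c \<or> i = Suc (5 * c) \<or> i = Suc (Suc (5 * c)) \<or> i = Suc (Suc (Suc (5 * c)))
          \<or> i = Suc (Suc (Suc (Suc (5 * c))))" using i by presburger
        then show ?thesis using that by blast
      qed
      then show ?thesis
      proof cases
        case 1
        then have "int (i + 5) \<noteq> 5 * int c + 5" "int (i + 5) \<noteq> 5 * int c + 6" "int (i + 5) \<noteq> 5 * int c + 7"
          "int (i + 5) \<noteq> 5 * int c + 8" "int (i + 5) \<noteq> 5 * int c + 9" by linarith+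
        then have "?m (adr tU (int (i + 5))) = m' (adr tU (int (i + 5)))" by simp
        then show ?thesis using J 1 by simp
      qed (simp_all add: ub_digit)
    qed
    then have "?J (Suc c) ?m" using sm by blast
    then show "wp Set_bounds n (\<lambda>\<tau>. ?J (Suc c) (snd \<tau>)) (R', m')"
      unfolding Set_bounds_def using rc rg by simp
  next
    fix R' m' assume J: "?J k m'" and fr: "\<And>r. r \<noteq> rC \<Longrightarrow> r \<notin> writes Set_bounds \<Longrightarrow> R' r = R1 r"
    have mm: "m' (adr t i) = m1 (adr t i)" if "0 \<le> t" "t < 16" "t \<noteq> tU" for t i
      using sameD[of "{tU}" m1 m' t i] J that by simp
    have pos: "0 < (\<Prod>l<5*k. ub l)" by (intro prod_pos) (simp add: ub_def)
    have "bregs R'" using fr R by (simp add: bregs_def R1_def)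
    moreover have "sinst m'" using si mm by (simp add: sinst_def)
    moreover have "uinst m'" using J by (simp add: uinst_def)
    moreover have "bstate ([], 0) R' m'" using fr by (simp add: bstate_def enc_shifts_def R1_def)
    moreover have "good X ([], 0)" by (simp add: good_def ops_ok_def shifts_cost_Nil)
    moreover have "tried X 0 ([], 0)" by (simp add: tried_def)
    moreover have "R' rRun = (if 0 < (\<Prod>l<5*k. ub l) then 1 else 0)" using fr pos by (simp add: R1_def)
    moreover have "(\<forall>i. m' (adr tD (int i)) = Dof b (5 * k) (\<lambda>_. 0) i) \<and> (\<forall>i<5 * k. 0 < ub i) \<and> ov ub (\<lambda>_. 0) (5 * k) = 0"
      using di mm by (simp add: ub_def ov_def)
    ultimately show "loop_inv X 0 (R', m')" unfolding loop_inv_def fst_conv snd_conv by blast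
  qed (use R n in \<open>auto simp: R1_def\<close>)
  moreover have "wp Setup n Q (R, m) = wp (For rC (Const 0) rK Set_bounds) n Q (R1, m1)" for Q
    using R by (cases "b < k") (simp_all add: Setup_def R1_def m1_def)
  ultimately show ?thesis by simp
qed

lemma wp_Parse:
  assumes n: "len \<le> n"
  shows "wp Parse n (loop_inv X 0) (ram_init (enc_input (G, b, s)))"
proof -
  obtain R0 m0 where i: "ram_init (enc_input (G, b, s)) = (R0, m0)" by fastforce
  have m0: "cells m0" using i by (auto simp: ram_init_def cells_def)
  have mD: "\<forall>i. m0 (adr tD (int i)) = 0"
  proof
    fix j
    have "adr tD (int j) < 0" by (rule adr_neg) auto
    then show "m0 (adr tD (int j)) = 0" using i by (auto simp: ram_init_def)
  qed
  note h = cells_hdr[OF m0]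
  define R1 where "R1 = R0(rB := int b, rS := int s, rK := int k, rCur := 5 + (int ne + int ne), rM := 0, rMin := 0)"
  have "wp (For rC (Const 0) rK Parse_path) n (wp Setup n (loop_inv X 0)) (R1, m0)"
  proof (rule wp_For[where l = 0 and u = k and
        I = "\<lambda>c R m. R rCur = int (off c) \<and> R rM = int (PS c) \<and> R rMin = mn (PS c) \<and> stored (PS c) m0 m \<and>
          (\<forall>c'<c. m (adr tPS (int c')) = int (PS c'))"])
    show "(R1(rC := int 0)) rCur = int (off 0) \<and> (R1(rC := int 0)) rM = int (PS 0) \<and> (R1(rC := int 0)) rMin = mn (PS 0) \<and>
      stored (PS 0) m0 m0 \<and> (\<forall>c'<0. m0 (adr tPS (int c')) = int (PS c'))"
      using same_refl by (simp add: R1_def off_def PS_0 mn_def stored_def)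
    fix c R m assume c: "c < k" and I: "R rCur = int (off c) \<and> R rM = int (PS c) \<and> R rMin = mn (PS c) \<and> stored (PS c) m0 m \<and>
          (\<forall>c'<c. m (adr tPS (int c')) = int (PS c'))" and rc: "R rC = int c"
    have "wp Parse_path n (\<lambda>\<tau>. fst \<tau> rCur = int (off (Suc c)) \<and> fst \<tau> rM = int (PS (Suc c)) \<and>
     fst \<tau> rMin = mn (PS (Suc c)) \<and> stored (PS (Suc c)) m0 (snd \<tau>) \<and>
     (\<forall>c'<Suc c. snd \<tau> (adr tPS (int c')) = int (PS c'))) (R, m)"
      by (rule wp_Parse_path) (use I c m0 rc n in blast)+
    then show "wp Parse_path n (\<lambda>\<tau>. ((fst \<tau>)(rC := int (Suc c))) rCur = int (off (Suc c)) \<and>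
      ((fst \<tau>)(rC := int (Suc c))) rM = int (PS (Suc c)) \<and> ((fst \<tau>)(rC := int (Suc c))) rMin = mn (PS (Suc c)) \<and>
      stored (PS (Suc c)) m0 (snd \<tau>) \<and> (\<forall>c'<Suc c. snd \<tau> (adr tPS (int c')) = int (PS c'))) (R, m)"
      by (rule wp_mono) simp
  next
    fix R m assume I: "R rCur = int (off k) \<and> R rM = int (PS k) \<and> R rMin = mn (PS k) \<and> stored (PS k) m0 m \<and>
          (\<forall>c'<k. m (adr tPS (int c')) = int (PS c'))"
      and fr: "\<And>r. r \<noteq> rC \<Longrightarrow> r \<notin> writes Parse_path \<Longrightarrow> R r = R1 r"
    have rg: "R rK = int k" "R rB = int b" "R rS = int s" using fr by (simp_all add: R1_def)
    have kn: "k \<le> n" using n len_eq by simp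
    show "wp Setup n (loop_inv X 0) (R, m)"
    proof (rule wp_Setup)
      show "stored (PS k) m0 m" using I by blast
      show "\<forall>i. m0 (adr tD (int i)) = 0" by (rule mD)
    qed (use I rg kn in simp_all)
  qed (use n len_eq in \<open>auto simp: R1_def\<close>)
  then show ?thesis unfolding i using h by (simp add: Parse_def R1_def)
qed

text \<open>The solution lies at negative addresses and is copied to nonnegative ones, so
  overwriting the input destroys nothing that is still to be read.\<close>

lemma wp_Output:
  assumes "bstate bv R m" "length (fst bv) \<le> 2 * k" "6 * k \<le> n"
  shows "wp Output n (\<lambda>\<tau>. ram_output \<tau> = enc_shifts (fst bv)) (R, m)"
proof -
  let ?e = "enc_shifts (fst bv)"
  have b: "R rNb = int (length ?e)" "\<And>i. i < length ?e \<Longrightarrow> m (adr tBE (int i)) = ?e ! i"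
    using assms(1) by (auto simp: bstate_def)
  have len: "length ?e \<le> n" using assms(2,3) by (simp add: length_enc_shifts)
  have neg: "adr tBE (int i) \<noteq> int j" for i j :: nat using adr_neg[of tBE "int i"] by linarith
  let ?b = "Store (Reg rI) (At tBE (Reg rI))"
  have "wp (For rI (Const 0) rNb ?b) n (wp (Block [Assign 0 (Reg rNb)]) n (\<lambda>\<tau>. ram_output \<tau> = ?e)) (R, m)"
  proof (rule wp_For[where l = 0 and u = "length ?e" and
        I = "\<lambda>x R m'. (\<forall>i<x. m' (int i) = ?e ! i) \<and> (\<forall>i. m' (adr tBE (int i)) = m (adr tBE (int i)))"])
    fix x R' m' assume x: "x < length ?e" and I: "(\<forall>i<x. m' (int i) = ?e ! i) \<and> (\<forall>i. m' (adr tBE (int i)) = m (adr tBE (int i)))"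
      and rx: "R' rI = int x"
    have v: "m' (adr tBE (int x)) = ?e ! x" using I b(2)[OF x] by simp
    show "wp ?b n (\<lambda>\<tau>. (\<forall>i<Suc x. snd \<tau> (int i) = ?e ! i) \<and> (\<forall>i. snd \<tau> (adr tBE (int i)) = m (adr tBE (int i)))) (R', m')"
      using I v rx neg by (simp add: less_Suc_eq)
  next
    fix R' m' assume I: "(\<forall>i<length ?e. m' (int i) = ?e ! i) \<and> (\<forall>i. m' (adr tBE (int i)) = m (adr tBE (int i)))"
      and fr: "\<And>r. r \<noteq> rI \<Longrightarrow> r \<notin> writes ?b \<Longrightarrow> R' r = R r"
    have "R' rNb = int (length ?e)" using fr b by simp
    moreover have "map (\<lambda>l. m' (int l)) [0..<length ?e] = ?e"
      using I by (intro nth_equalityI) auto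
    ultimately show "wp (Block [Assign 0 (Reg rNb)]) n (\<lambda>\<tau>. ram_output \<tau> = ?e) (R', m')"
      by (simp add: ram_output_def)
  qed (use b len in auto)
  then show ?thesis by (simp add: Output_def)
qed

end

definition Solve :: "mr_variant \<Rightarrow> ram_com" where
  "Solve X = Seq Parse (Seq (Main_loop X) Output)"

text \<open>A device for the analysis: its polynomial bound \<open>tb\<close> covers parsing, one
  body of the main loop and output at once.\<close>

definition Once :: "mr_variant \<Rightarrow> ram_com" where
  "Once X = Seq Parse (Seq (Block [Try_guess X, Incr, Assign rRun (Sub (Const 1) (Reg rCy))]) Output)"

context mr_instance
begin

lemma Solve_run:
  "\<exists>t ys. ram_run (Solve X) (enc_input (G, b, s)) t ys \<and> mr_solution X (G, b, s) ys \<and>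
     t \<le> ((\<Prod>l<5*k. ub l) + 1) * (2 + tb (6 * len) (Once X))"
proof -
  \<comment> \<open>The factor 6 comes from the output: at most two shifts per path with three cells
    each.\<close>
  let ?n = "6 * len" and ?N = "\<Prod>l<5*k. ub l"
  let ?B = "Block [Try_guess X, Incr, Assign rRun (Sub (Const 1) (Reg rCy))]"
  have n: "len \<le> ?n" "6 * k \<le> ?n" "Suc (PS k) \<le> ?n" using len_eq by linarith+
  from wp_exec[OF wp_Parse[OF n(1)]] obtain t1 \<sigma>1 where
    1: "ram_exec Parse (ram_init (enc_input (G, b, s))) t1 \<sigma>1" "t1 \<le> tb ?n Parse" "loop_inv X 0 \<sigma>1" by blast
  from Main_loop_exec[OF n(2,3) 1(3)] obtain t2 \<sigma>2 where
    2: "ram_exec (Main_loop X) \<sigma>1 t2 \<sigma>2" "loop_inv X ?N \<sigma>2" "t2 \<le> (?N + 1) * (2 + tb ?n ?B)" by blast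
  obtain R m where s2: "\<sigma>2 = (R, m)" by (cases \<sigma>2)
  obtain bv where bv: "bstate bv R m" "good X bv" "tried X ?N bv"
    using 2(2) unfolding loop_inv_def s2 fst_conv snd_conv by blast
  have "wp Output ?n (\<lambda>\<tau>. ram_output \<tau> = enc_shifts (fst bv)) (R, m)"
    by (rule wp_Output[OF bv(1) _ n(2)]) (use bv(2) in \<open>simp add: good_def\<close>)
  from wp_exec[OF this] obtain t3 \<sigma>3 where
    3: "ram_exec Output \<sigma>2 t3 \<sigma>3" "t3 \<le> tb ?n Output" "ram_output \<sigma>3 = enc_shifts (fst bv)" unfolding s2 by blast
  have "ram_exec (Solve X) (ram_init (enc_input (G, b, s))) (t1 + (t2 + t3)) \<sigma>3"
    unfolding Solve_def using ram_exec.Seq[OF 1(1) ram_exec.Seq[OF 2(1) 3(1)]] .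
  then have "ram_run (Solve X) (enc_input (G, b, s)) (t1 + (t2 + t3)) (enc_shifts (fst bv))"
    unfolding ram_run_def using 3(3) by metis
  moreover have "mr_solution X (G, b, s) (enc_shifts (fst bv))"
    using best_is_optimal[OF bv(3,2)] by auto
  moreover have "t1 + (t2 + t3) \<le> (?N + 1) * (2 + tb ?n (Once X))"
  proof -
    have "t1 + (t2 + t3) \<le> tb ?n Parse + (?N + 1) * (2 + tb ?n ?B) + tb ?n Output" using 1(2) 2(3) 3(2) by linarith
    also have "\<dots> \<le> (?N + 1) * tb ?n Parse + (?N + 1) * (2 + tb ?n ?B) + (?N + 1) * tb ?n Output" by simp
    also have "\<dots> = (?N + 1) * (2 + tb ?n (Once X))" by (simp add: Once_def algebra_simps)
    finally show ?thesis .
  qed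
  ultimately show ?thesis by blast
qed

section \<open>Number of guesses and length of the input\<close>

lemma prod_ub: "(\<Prod>l<5*j. ub l) = ((k + 1) * (min b k + 1) * (2 * b + 1) * (b + 1) * (b + 1)) ^ j"
proof (induction j)
  case (Suc j)
  have "5 * Suc j = Suc (Suc (Suc (Suc (Suc (5 * j)))))" by simp
  then have "(\<Prod>l<5 * Suc j. ub l) = (\<Prod>l<5*j. ub l) * (ub (5*j) * ub (Suc (5*j)) * ub (Suc (Suc (5*j))) *
     ub (Suc (Suc (Suc (5*j)))) * ub (Suc (Suc (Suc (Suc (5*j))))))"
    by (simp only: prod.lessThan_Suc mult.assoc)
  then show ?case unfolding ub_digit Suc.IH power_Suc by (simp only: mult.commute)
qed simp

text \<open>With \<open>x = b + k\<close> every factor is at most \<open>2 * x + 1\<close>, hence at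
  most \<open>2 ^ (x + 1)\<close>. A power of two is chosen because the machine can compute it by
  doublings.\<close>

lemma prod_ub_fpt: "(\<Prod>l<5*k. ub l) \<le> 2 ^ ((5 * (b + k) + 5) * (b + k))"
proof -
  let ?x = "b + k"
  have le: "y + 1 \<le> 2 ^ (?x + 1)" if "y \<le> 2 * ?x" for y
  proof -
    have "Suc ?x \<le> 2 ^ ?x" by (rule Suc_leI) (rule less_exp)
    then show ?thesis using that by simp
  qed
  let ?p = "(2 :: nat) ^ (?x + 1)"
  have "(k + 1) * (min b k + 1) * (2 * b + 1) * (b + 1) * (b + 1) \<le> ?p * ?p * ?p * ?p * ?p"
    by (intro mult_mono le) auto
  also have "\<dots> = ?p ^ 5" by (simp add: numeral_eq_Suc)
  also have "\<dots> = 2 ^ (5 * ?x + 5)" by (simp only: power_mult[symmetric]) (simp add: algebra_simps)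
  finally have "(\<Prod>l<5*k. ub l) \<le> (2 ^ (5 * ?x + 5)) ^ k" unfolding prod_ub by (intro power_mono) auto
  also have "\<dots> \<le> (2 ^ (5 * ?x + 5)) ^ ?x" by (intro power_increasing) auto
  finally show ?thesis by (simp add: power_mult)
qed

text \<open>For \<open>k\<close> at least 1 the factor per path is at most
  \<open>48 * k * max 1 b ^ 4\<close>, where 48 is the product of the constants 2, 2, 3, 2, 2 of the
  five digit bounds. The \<open>k\<close>-th power leaves a factor \<open>k ^ k\<close> of the
  claimed bound; it absorbs \<open>48 ^ k\<close> as soon as \<open>k\<close> exceeds 48, and for
  smaller \<open>k\<close> the constant \<open>48 ^ 48\<close> does.\<close>

lemma prod_ub_bound: "(\<Prod>l<5*k. ub l) \<le> 48 ^ 48 * (max 1 b ^ (6 * k) * k ^ (2 * k))"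
proof (cases "k = 0")
  case False
  then have k1: "1 \<le> k" by (simp add: Suc_le_eq)
  let ?b = "max 1 b"
  have "(k + 1) * (min b k + 1) * (2 * b + 1) * (b + 1) * (b + 1) \<le> (2 * k) * (2 * ?b) * (3 * ?b) * (2 * ?b) * (2 * ?b)"
    by (intro mult_mono) (use k1 in simp_all)
  also have "\<dots> = 48 * k * ?b ^ 4" by (simp add: numeral_eq_Suc algebra_simps)
  also have "\<dots> \<le> 48 * k * ?b ^ 6" by (intro mult_left_mono power_increasing) auto
  finally have "(\<Prod>l<5*k. ub l) \<le> (48 * k * ?b ^ 6) ^ k" unfolding prod_ub by (intro power_mono) auto
  also have "\<dots> = 48 ^ k * (k ^ k * ?b ^ (6 * k))" by (simp add: power_mult_distrib power_mult)
  also have "\<dots> \<le> (48 ^ 48 * k ^ k) * (k ^ k * ?b ^ (6 * k))"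
  proof (rule mult_right_mono)
    show "(48 :: nat) ^ k \<le> 48 ^ 48 * k ^ k"
    proof (cases "k \<le> 48")
      case True
      have "(48 :: nat) ^ k * 1 \<le> 48 ^ 48 * k ^ k"
      proof (intro mult_mono power_increasing)
        show "1 \<le> k ^ k" using k1 by (rule one_le_power)
      qed (use True in auto)
      then show ?thesis by (simp only: mult_1_right)
    next
      case ge: False
      then have "(48 :: nat) ^ k \<le> k ^ k" by (intro power_mono) auto
      also have "k ^ k \<le> 48 ^ 48 * k ^ k" by simp
      finally show ?thesis .
    qed
  qed simp
  also have "\<dots> = 48 ^ 48 * (?b ^ (6 * k) * (k ^ k * k ^ k))" by (simp only: mult_ac)
  also have "k ^ k * k ^ k = k ^ (2 * k)" by (simp only: mult_2 power_add)
  finally show ?thesis .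
qed simp

text \<open>Every base-path has an edge, so there are at most as many paths as temporal edges. The
  source is a vertex, which pays for the five header cells.\<close>

lemma len_le: "len \<le> 8 * graph_size G"
proof -
  have te: "temporal_edges G = sum_list (map mset Ps)" using graph by (simp add: temporal_kpath_graph_def)
  have "size (sum_list (map mset Qs)) = length (concat Qs)" for Qs :: "(nat \<times> int) list list"
    by (induction Qs) auto
  then have M: "size (temporal_edges G) = PS k" using te by (simp add: starts_simps)
  have kM: "c \<le> k \<Longrightarrow> c \<le> PS c" for c
  proof (induction c)
    case (Suc c)
    then show ?case using PS_less[of c] by simp
  qed simp
  have "card (verts G) > 0" using s wf by (auto simp: card_gt_0_iff wf_tmultigraph_def)
  then show ?thesis using kM[of k] M by (simp add: len_eq graph_size_def)
qed

end

lemma solve_time: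
  "\<exists>K d. \<forall>G b s. (G, b, s) \<in> mr_inputs \<longrightarrow> (\<exists>t ys. ram_run (Solve X) (enc_input (G, b, s)) t ys \<and>
     mr_solution X (G, b, s) ys \<and>
     t \<le> K * (\<Prod>l<5 * length (bpaths G). flat_instance.ub (length (bpaths G)) b l) * length (enc_input (G, b, s)) ^ d)"
proof -
  obtain C d where tb: "\<And>n. tb n (Once X) \<le> C * (n + 1) ^ d" using tb_poly by blast
  \<comment> \<open>The factor 2 comes from replacing the number of guesses plus one by its double,
    and \<open>7 ^ d\<close> from bounding \<open>6 * len + 1\<close> by
    \<open>7 * len\<close>.\<close>
  let ?K = "2 * (2 + C * 7 ^ d)"
  have "\<exists>t ys. ram_run (Solve X) (enc_input (G, b, s)) t ys \<and> mr_solution X (G, b, s) ys \<and>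
     t \<le> ?K * (\<Prod>l<5 * length (bpaths G). flat_instance.ub (length (bpaths G)) b l) * length (enc_input (G, b, s)) ^ d"
    if "(G, b, s) \<in> mr_inputs" for G b s
  proof -
    interpret mr_instance G b s using that by unfold_locales
    let ?N = "\<Prod>l<5*k. ub l"
    obtain t ys where t: "ram_run (Solve X) (enc_input (G, b, s)) t ys" "mr_solution X (G, b, s) ys"
      "t \<le> (?N + 1) * (2 + tb (6 * len) (Once X))" using Solve_run by blast
    have l1: "1 \<le> len" using len_eq by linarith
    have "tb (6 * len) (Once X) \<le> C * (6 * len + 1) ^ d" by (rule tb)
    also have "\<dots> \<le> C * (7 * len) ^ d" using l1 by (intro mult_left_mono power_mono) auto
    also have "\<dots> = C * 7 ^ d * len ^ d" by (simp only: power_mult_distrib mult.assoc)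
    finally have "2 + tb (6 * len) (Once X) \<le> 2 * 1 + C * 7 ^ d * len ^ d" by simp
    also have "\<dots> \<le> 2 * len ^ d + C * 7 ^ d * len ^ d" using l1 by (intro add_mono mult_left_mono) auto
    also have "\<dots> = (2 + C * 7 ^ d) * len ^ d" by (simp only: add_mult_distrib)
    finally have a: "2 + tb (6 * len) (Once X) \<le> (2 + C * 7 ^ d) * len ^ d" .
    have "1 \<le> ?N" unfolding Suc_le_eq One_nat_def by (intro prod_pos) (simp add: ub_def)
    then have "(?N + 1) * (2 + tb (6 * len) (Once X)) \<le> (2 * ?N) * ((2 + C * 7 ^ d) * len ^ d)"
      by (intro mult_mono a) auto
    also have "\<dots> = ?K * ?N * len ^ d" by (simp only: mult_ac)
    finally have "t \<le> ?K * ?N * len ^ d" using t(3) by linarith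
    then show ?thesis using t(1,2) by blast
  qed
  then show ?thesis by blast
qed

text \<open>The exponent is a product, so two nested loops of doublings compute the power without
  multiplication.\<close>

definition Fpt_fun :: "nat \<Rightarrow> ram_com" where
  "Fpt_fun K = Block [Assign 2 (Load (Const 0)), Assign 3 (Const (int K)), Assign 4 (Five (Reg 2) 5),
     For 5 (Const 0) 2 (For 6 (Const 0) 4 (Assign 3 (Add (Reg 3) (Reg 3)))), Store (Const 0) (Reg 3)]"

lemma computable_fpt: "computable_fun (\<lambda>x. K * 2 ^ ((5 * x + 5) * x))"
  unfolding computable_fun_def
proof (rule exI[of _ "Fpt_fun K"], rule allI)
  fix x :: nat
  let ?w = "5 * x + 5"
  obtain R0 m0 where i: "ram_init [int x] = (R0, m0)" by fastforce
  have h: "R0 0 = 1" "m0 0 = int x" using i by (auto simp: ram_init_def)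
  let ?in = "For 6 (Const 0) 4 (Assign 3 (Add (Reg 3) (Reg 3)))"
  let ?R = "R0(2 := int x, 3 := int K, 4 := int ?w)"
  let ?Q = "\<lambda>\<tau>. ram_output \<tau> = [int (K * 2 ^ (?w * x))]"
  have "wp (For 5 (Const 0) 2 ?in) ?w (wp (Block [Store (Const 0) (Reg 3)]) ?w ?Q) (?R, m0)"
  proof (rule wp_For[where l = 0 and u = x and I = "\<lambda>a R m. R 3 = int (K * 2 ^ (?w * a))"])
    fix a R m assume I: "R 3 = int (K * 2 ^ (?w * a))" and fr: "\<And>r. r \<noteq> 5 \<Longrightarrow> r \<notin> writes ?in \<Longrightarrow> R r = ?R r"
    show "wp ?in ?w (\<lambda>\<tau>. ((fst \<tau>)(5 := int (Suc a))) 3 = int (K * 2 ^ (?w * Suc a))) (R, m)"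
    proof (rule wp_For[where l = 0 and u = ?w and I = "\<lambda>c R m. R 3 = int (K * 2 ^ (?w * a + c))"])
      show "R 4 = int ?w" using fr by simp
      fix R' :: "nat \<Rightarrow> int" and m' :: "int \<Rightarrow> int" assume "R' 3 = int (K * 2 ^ (?w * a + ?w))"
      then show "((fst (R', m'))(5 := int (Suc a))) 3 = int (K * 2 ^ (?w * Suc a))"
        by (simp add: algebra_simps)
    qed (use I in auto)
  next
    fix R m assume I: "R 3 = int (K * 2 ^ (?w * x))" and fr: "\<And>r. r \<noteq> 5 \<Longrightarrow> r \<notin> writes ?in \<Longrightarrow> R r = ?R r"
    \<comment> \<open>The length register of the one-element input already holds the length of the
      output.\<close>
    have "R 0 = 1" using fr h by simp
    then show "wp (Block [Store (Const 0) (Reg 3)]) ?w ?Q (R, m)" using I by (simp add: ram_output_def)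
  qed auto
  then have "wp (Fpt_fun K) ?w ?Q (R0, m0)" using h by (simp add: Fpt_fun_def)
  from wp_exec[OF this] show "\<exists>t. ram_run (Fpt_fun K) [int x] t [int (K * 2 ^ (?w * x))]"
    unfolding ram_run_def i by metis
qed

theorem theorem32:
  fixes X :: mr_variant
  shows "fixed_parameter_tractable mr_inputs enc_input (mr_solution X)
           (\<lambda>x. mr_budget x + mr_paths x) \<and>
         (\<exists>c C d. solves_in_time c mr_inputs enc_input (mr_solution X) (mr_time_bound C d))"
proof -
  \<comment> \<open>Both claims rest on the same program and the same bound for its run; they differ
    only in the estimate for the number of guesses.\<close>
  obtain K d where run: "\<And>G b s. (G, b, s) \<in> mr_inputs \<Longrightarrow> \<exists>t ys. ram_run (Solve X) (enc_input (G, b, s)) t ys \<and>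
     mr_solution X (G, b, s) ys \<and>
     t \<le> K * (\<Prod>l<5 * length (bpaths G). flat_instance.ub (length (bpaths G)) b l) * length (enc_input (G, b, s)) ^ d"
    using solve_time[of X] by blast
  let ?f = "\<lambda>x. K * 2 ^ ((5 * x + 5) * x) :: nat"
  have "solves_in_time (Solve X) mr_inputs enc_input (mr_solution X)
      (\<lambda>x. ?f (mr_budget x + mr_paths x) * length (enc_input x) ^ d)"
    unfolding solves_in_time_def
  proof
    fix x assume x: "x \<in> mr_inputs"
    obtain G b s where xe: "x = (G, b, s)" by (cases x)
    interpret mr_instance G b s using x xe by unfold_locales simp
    obtain t ys where t: "ram_run (Solve X) (enc_input x) t ys" "mr_solution X x ys"
      "t \<le> K * (\<Prod>l<5*k. ub l) * len ^ d" using run x unfolding xe by blast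
    have "K * (\<Prod>l<5*k. ub l) * len ^ d \<le> ?f (b + k) * len ^ d"
      by (intro mult_right_mono mult_left_mono prod_ub_fpt) auto
    then have "t \<le> ?f (mr_budget x + mr_paths x) * length (enc_input x) ^ d" 
      using t(3) unfolding xe mr_budget.simps mr_paths.simps by linarith
    then show "\<exists>t ys. ram_run (Solve X) (enc_input x) t ys \<and> mr_solution X x ys \<and>
       t \<le> ?f (mr_budget x + mr_paths x) * length (enc_input x) ^ d" using t(1,2) by blast
  qed
  then have 1: "fixed_parameter_tractable mr_inputs enc_input (mr_solution X) (\<lambda>x. mr_budget x + mr_paths x)"
    unfolding fixed_parameter_tractable_def using computable_fpt[of K] by blast
  have "solves_in_time (Solve X) mr_inputs enc_input (mr_solution X) (mr_time_bound (K * 48 ^ 48 * 8 ^ d) d)"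
    unfolding solves_in_time_def
  proof
    fix x assume x: "x \<in> mr_inputs"
    obtain G b s where xe: "x = (G, b, s)" by (cases x)
    interpret mr_instance G b s using x xe by unfold_locales simp
    obtain t ys where t: "ram_run (Solve X) (enc_input x) t ys" "mr_solution X x ys"
      "t \<le> K * (\<Prod>l<5*k. ub l) * len ^ d" using run x unfolding xe by blast
    have "K * (\<Prod>l<5*k. ub l) * len ^ d \<le>
       K * (48 ^ 48 * (max 1 b ^ (6 * k) * k ^ (2 * k))) * (8 * graph_size G) ^ d"
      by (intro mult_mono power_mono prod_ub_bound len_le) auto
    also have "\<dots> = mr_time_bound (K * 48 ^ 48 * 8 ^ d) d x"
      unfolding mr_time_bound_def xe mr_budget.simps mr_paths.simps mr_graph_size.simps power_mult_distrib
      by (simp only: mult_ac)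
    finally show "\<exists>t ys. ram_run (Solve X) (enc_input x) t ys \<and> mr_solution X x ys \<and>
       t \<le> mr_time_bound (K * 48 ^ 48 * 8 ^ d) d x" using t le_trans by blast
  qed
  then show ?thesis using 1 by blast
qed

end
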